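(* Let $\mathbf{X}=X_1\times\cdots\times X_N$ be an $N$-tuple of Banach spaces each of which has separable dual with the approximation property, and let $Y$ be a Banach space. Then for each $u\in(\tilde\otimes_{\pi,\,j=1,\dots,N}X_j)\tilde\otimes_\pi Y$ there exists a regular Borel measure $\mu_u$ on $(B_{X_1''},w^* )\times\cdots\times(B_{X_N''},w^* )\times(B_{Y''},w^* )$ such that $\|\mu_u\|\le\|u\|_\pi$ and $$\langle u,\Psi\rangle=\int_{B_{X_1''}\times\cdots\times B_{X_N''}\times B_{Y''}}\overline{\Psi}(x_1'',\dots,x_N'')(y'')\,d\mu_u(x_1'',\dots,x_N'',y'')$$ for all $\Psi\in\mathcal{L}(^N\mathbf{X};Y')$, where $\pi$ is the projective tensor norm.
   Context: $X'$ is the topological dual of $X$ and $B_X$ the closed unit ball. $\mathcal{L}(^N\mathbf{X};Y')$ is the space of continuous $N$-linear mappings $X_1\times\cdots\times X_N\to Y'$ with the supremum norm. $\tilde\otimes_{\pi,\,j=1,\dots,N}X_j$ is the completed projective tensor product of $X_1,\dots,X_N$. The measure is scalar-valued (signed or complex according to the scalar field) and $\|\mu_u\|$ is its total variation. The duality $\langle u,\Psi\rangle$ is the canonical isometric identification $\big((\tilde\otimes_{\pi}X_j)\tilde\otimes_\pi Y\big)'=\mathcal{L}(^N\mathbf{X};Y')$, determined by $\langle x_1\otimes\cdots\otimes x_N\otimes y,\Psi\rangle=\Psi(x_1,\dots,x_N)(y)$. $\overline{\Psi}:X_1''\times\cdots\times X_N''\to Y'''$ is the Arens extension given by $$\overline{\Psi}(x_1'',\dots,x_N'')=w^*\text{-}\lim_{\alpha_1}\cdots\lim_{\alpha_N}\Psi(x_{1,\alpha_1},\dots,x_{N,\alpha_N}),$$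 where $(x_{j,\alpha_j})_{\alpha_j}\subset X_j$ is a bounded net $w^*$-convergent to $x_j''$, $j=1,\dots,N$. *)

theory Defs
  imports "HOL-Analysis.Analysis"
begin

section \<open>The scalar field\<close>

text \<open>
  The real and the complex case are treated together: a type of this class is an isometric copy
  of the real field or of the complex field.
\<close>

class real_or_complex = real_normed_field + banach + second_countable_topology +
  assumes ex_isometry_into_complex:
    "\<exists>\<phi> :: 'a \<Rightarrow> complex.
       (\<forall>a b. \<phi> (a + b) = \<phi> a + \<phi> b) \<and> (\<forall>a b. \<phi> (a * b) = \<phi> a * \<phi> b) \<and>
       (\<forall>a. norm (\<phi> a) = norm a) \<and> (range \<phi> = \<real> \<or> range \<phi> = UNIV)"

instance real :: real_or_complex
proof
  show "\<exists>\<phi> :: real \<Rightarrow> complex.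
       (\<forall>a b. \<phi> (a + b) = \<phi> a + \<phi> b) \<and> (\<forall>a b. \<phi> (a * b) = \<phi> a * \<phi> b) \<and>
       (\<forall>a. norm (\<phi> a) = norm a) \<and> (range \<phi> = \<real> \<or> range \<phi> = UNIV)"
    by (rule exI[of _ complex_of_real]) (auto simp: Reals_def)
qed

instance complex :: real_or_complex
proof
  show "\<exists>\<phi> :: complex \<Rightarrow> complex.
       (\<forall>a b. \<phi> (a + b) = \<phi> a + \<phi> b) \<and> (\<forall>a b. \<phi> (a * b) = \<phi> a * \<phi> b) \<and>
       (\<forall>a. norm (\<phi> a) = norm a) \<and> (range \<phi> = \<real> \<or> range \<phi> = UNIV)"
    by (rule exI[of _ id]) auto
qed

section \<open>Normed spaces with explicit carriers\<close>

text \<open>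
  Spaces are records rather than types, so that the tuple \<open>X\<^sub>1, \<dots>, X\<^sub>N\<close> may consist of different
  spaces (with carriers inside one type, each with its own operations) for a variable \<open>N\<close>, and so
  that duals and tensor products are again spaces of the same kind.
\<close>

record ('k, 'a) nspace =
  vcarrier :: "'a set"
  vadd :: "'a \<Rightarrow> 'a \<Rightarrow> 'a"
  vzero :: "'a"
  vscale :: "'k \<Rightarrow> 'a \<Rightarrow> 'a"
  vnorm :: "'a \<Rightarrow> real"

locale normed_vspace =
  fixes X :: "('k::real_or_complex, 'a) nspace"
  assumes zero_closed: "vzero X \<in> vcarrier X"
    and add_closed: "\<lbrakk>x \<in> vcarrier X; y \<in> vcarrier X\<rbrakk> \<Longrightarrow> vadd X x y \<in> vcarrier X"
    and scale_closed: "x \<in> vcarrier X \<Longrightarrow> vscale X c x \<in> vcarrier X"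
    and add_assoc: "\<lbrakk>x \<in> vcarrier X; y \<in> vcarrier X; z \<in> vcarrier X\<rbrakk> \<Longrightarrow>
          vadd X (vadd X x y) z = vadd X x (vadd X y z)"
    and add_commute: "\<lbrakk>x \<in> vcarrier X; y \<in> vcarrier X\<rbrakk> \<Longrightarrow> vadd X x y = vadd X y x"
    and add_zero: "x \<in> vcarrier X \<Longrightarrow> vadd X x (vzero X) = x"
    and add_minus: "x \<in> vcarrier X \<Longrightarrow> vadd X x (vscale X (- 1) x) = vzero X"
    and scale_add_right: "\<lbrakk>x \<in> vcarrier X; y \<in> vcarrier X\<rbrakk> \<Longrightarrow>
          vscale X c (vadd X x y) = vadd X (vscale X c x) (vscale X c y)"
    and scale_add_left: "x \<in> vcarrier X \<Longrightarrow>
          vscale X (c + d) x = vadd X (vscale X c x) (vscale X d x)"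
    and scale_scale: "x \<in> vcarrier X \<Longrightarrow> vscale X c (vscale X d x) = vscale X (c * d) x"
    and scale_one: "x \<in> vcarrier X \<Longrightarrow> vscale X 1 x = x"
    and norm_nonneg: "x \<in> vcarrier X \<Longrightarrow> 0 \<le> vnorm X x"
    and norm_eq_zero: "x \<in> vcarrier X \<Longrightarrow> vnorm X x = 0 \<longleftrightarrow> x = vzero X"
    and norm_triangle: "\<lbrakk>x \<in> vcarrier X; y \<in> vcarrier X\<rbrakk> \<Longrightarrow>
          vnorm X (vadd X x y) \<le> vnorm X x + vnorm X y"
    and norm_scale: "x \<in> vcarrier X \<Longrightarrow> vnorm X (vscale X c x) = norm c * vnorm X x"

text \<open>
  The value 0 off the carrier is there because the locale \<^locale>\<open>Metric_space\<close> requires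
  nonnegativity and symmetry on the whole type.
\<close>

definition vdist :: "('k::real_or_complex, 'a) nspace \<Rightarrow> 'a \<Rightarrow> 'a \<Rightarrow> real" where
  "vdist X x y = (if x \<in> vcarrier X \<and> y \<in> vcarrier X
                  then vnorm X (vadd X x (vscale X (- 1) y)) else 0)"

definition norm_topology :: "('k::real_or_complex, 'a) nspace \<Rightarrow> 'a topology" where
  "norm_topology X = Metric_space.mtopology (vcarrier X) (vdist X)"

locale banach_vspace = normed_vspace X for X :: "('k::real_or_complex, 'a) nspace" +
  assumes complete: "Metric_space.mcomplete (vcarrier X) (vdist X)"

definition unit_ball :: "('k::real_or_complex, 'a) nspace \<Rightarrow> 'a set" where
  "unit_ball X = {x \<in> vcarrier X. vnorm X x \<le> 1}"

definition linear_between ::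
    "('k::real_or_complex, 'a) nspace \<Rightarrow> ('k, 'b) nspace \<Rightarrow> ('a \<Rightarrow> 'b) \<Rightarrow> bool" where
  "linear_between X Z f \<longleftrightarrow>
     (\<forall>x \<in> vcarrier X. f x \<in> vcarrier Z) \<and>
     (\<forall>x \<in> vcarrier X. \<forall>y \<in> vcarrier X. f (vadd X x y) = vadd Z (f x) (f y)) \<and>
     (\<forall>c. \<forall>x \<in> vcarrier X. f (vscale X c x) = vscale Z c (f x))"

definition scalars :: "('k::real_or_complex, 'k) nspace" where
  "scalars = \<lparr>vcarrier = UNIV, vadd = (+), vzero = 0, vscale = (*), vnorm = norm\<rparr>"

text \<open>
  Spaces of scalar functions on a set \<open>D\<close> with pointwise operations; functions on \<open>D\<close> are
  represented by their extensional version, with value \<^const>\<open>undefined\<close> outside \<open>D\<close>.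
\<close>

definition function_space ::
    "'a set \<Rightarrow> ('a \<Rightarrow> 'k::real_or_complex) set \<Rightarrow> (('a \<Rightarrow> 'k) \<Rightarrow> real) \<Rightarrow> ('k, 'a \<Rightarrow> 'k) nspace" where
  "function_space D C n =
     \<lparr>vcarrier = C,
      vadd = (\<lambda>f g. \<lambda>x\<in>D. f x + g x),
      vzero = (\<lambda>x\<in>D. 0),
      vscale = (\<lambda>c f. \<lambda>x\<in>D. c * f x),
      vnorm = n\<rparr>"

section \<open>Duals, weak* topologies, completion, approximation property\<close>

definition dual :: "('k::real_or_complex, 'a) nspace \<Rightarrow> ('k, 'a \<Rightarrow> 'k) nspace" where
  "dual X = function_space (vcarrier X)
     {f \<in> extensional (vcarrier X).
        linear_between X scalars f \<and> continuous_map (norm_topology X) (norm_topology scalars) f}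
     (\<lambda>f. SUP x \<in> unit_ball X. norm (f x))"

abbreviation bidual :: "('k::real_or_complex, 'a) nspace \<Rightarrow> ('k, ('a \<Rightarrow> 'k) \<Rightarrow> 'k) nspace" where
  "bidual X \<equiv> dual (dual X)"

definition canonical :: "('k::real_or_complex, 'a) nspace \<Rightarrow> 'a \<Rightarrow> ('a \<Rightarrow> 'k) \<Rightarrow> 'k" where
  "canonical X x = (\<lambda>f \<in> vcarrier (dual X). f x)"

text \<open>The weak* topology on the dual of \<open>X\<close>, i.e. pointwise convergence on \<open>X\<close>.\<close>

definition weak_star :: "('k::real_or_complex, 'a) nspace \<Rightarrow> ('a \<Rightarrow> 'k) topology" where
  "weak_star X =
     subtopology (product_topology (\<lambda>_. euclidean) (vcarrier X)) (vcarrier (dual X))"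

text \<open>The completion of a normed space, realised as its norm closure in the bidual.\<close>

definition completion ::
    "('k::real_or_complex, 'a) nspace \<Rightarrow> ('k, ('a \<Rightarrow> 'k) \<Rightarrow> 'k) nspace" where
  "completion X = (bidual X)
     \<lparr>vcarrier := norm_topology (bidual X) closure_of (canonical X ` vcarrier X)\<rparr>"

primrec linear_combination ::
    "('k::real_or_complex, 'a) nspace \<Rightarrow> (nat \<Rightarrow> 'k) \<Rightarrow> (nat \<Rightarrow> 'a) \<Rightarrow> nat \<Rightarrow> 'a" where
  "linear_combination X c b 0 = vzero X"
| "linear_combination X c b (Suc n) =
     vadd X (linear_combination X c b n) (vscale X (c n) (b n))"

definition finite_rank :: "('k::real_or_complex, 'a) nspace \<Rightarrow> ('a \<Rightarrow> 'a) \<Rightarrow> bool" where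
  "finite_rank X T \<longleftrightarrow>
     (\<exists>n b. (\<forall>i<n. b i \<in> vcarrier X) \<and>
            (\<forall>x \<in> vcarrier X. \<exists>c. T x = linear_combination X c b n))"

definition approximation_property :: "('k::real_or_complex, 'a) nspace \<Rightarrow> bool" where
  "approximation_property X \<longleftrightarrow>
     (\<forall>K \<epsilon>. compactin (norm_topology X) K \<and> 0 < \<epsilon> \<longrightarrow>
        (\<exists>T. linear_between X X T \<and> continuous_map (norm_topology X) (norm_topology X) T \<and>
             finite_rank X T \<and> (\<forall>x \<in> K. vdist X (T x) x \<le> \<epsilon>)))"

section \<open>Multilinear mappings and projective tensor products\<close>

definition multilinear ::
    "'i set \<Rightarrow> ('i \<Rightarrow> ('k::real_or_complex, 'a) nspace) \<Rightarrow> ('k, 'b) nspace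
       \<Rightarrow> (('i \<Rightarrow> 'a) \<Rightarrow> 'b) \<Rightarrow> bool" where
  "multilinear I X Z A \<longleftrightarrow>
     A \<in> extensional (\<Pi>\<^sub>E j\<in>I. vcarrier (X j)) \<and>
     (\<forall>x \<in> (\<Pi>\<^sub>E j\<in>I. vcarrier (X j)). \<forall>j\<in>I. linear_between (X j) Z (\<lambda>t. A (x(j := t))))"

definition continuous_multilinear_maps ::
    "'i set \<Rightarrow> ('i \<Rightarrow> ('k::real_or_complex, 'a) nspace) \<Rightarrow> ('k, 'b) nspace
       \<Rightarrow> (('i \<Rightarrow> 'a) \<Rightarrow> 'b) set" where
  "continuous_multilinear_maps I X Z =
     {A. multilinear I X Z A \<and>
         continuous_map (product_topology (\<lambda>j. norm_topology (X j)) I) (norm_topology Z) A}"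

definition bilinear_form ::
    "('k::real_or_complex, 'a) nspace \<Rightarrow> ('k, 'b) nspace \<Rightarrow> ('a \<times> 'b \<Rightarrow> 'k) \<Rightarrow> bool" where
  "bilinear_form S Y B \<longleftrightarrow>
     B \<in> extensional (vcarrier S \<times> vcarrier Y) \<and>
     (\<forall>y \<in> vcarrier Y. linear_between S scalars (\<lambda>s. B (s, y))) \<and>
     (\<forall>s \<in> vcarrier S. linear_between Y scalars (\<lambda>y. B (s, y)))"

text \<open>
  The algebraic tensor product, with tensors regarded as linear functionals on the space \<open>M\<close> of
  all (not necessarily continuous) multilinear forms: the elementary tensor of a tuple \<open>p\<close> is
  evaluation at \<open>p\<close>.  \<open>P\<close> is the set of tuples and \<open>w p\<close> the product of the norms of the entries
  of \<open>p\<close>.  The norm is the infimum of \<open>\<Sum> w (p i)\<close> over all finite representations of the tensor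
  as a sum of elementary tensors; scalar coefficients can be absorbed into the entries.
\<close>

definition elementary_tensor :: "('p \<Rightarrow> 'k::real_or_complex) set \<Rightarrow> 'p \<Rightarrow> ('p \<Rightarrow> 'k) \<Rightarrow> 'k" where
  "elementary_tensor M p = (\<lambda>A\<in>M. A p)"

definition represents ::
    "'p set \<Rightarrow> ('p \<Rightarrow> 'k::real_or_complex) set \<Rightarrow> nat \<Rightarrow> (nat \<Rightarrow> 'p) \<Rightarrow> (('p \<Rightarrow> 'k) \<Rightarrow> 'k) \<Rightarrow> bool"
  where
  "represents P M n p v \<longleftrightarrow>
     (\<forall>i<n. p i \<in> P) \<and> v = (\<lambda>A\<in>M. \<Sum>i<n. elementary_tensor M (p i) A)"

definition alg_tensor ::
    "'p set \<Rightarrow> ('p \<Rightarrow> 'k::real_or_complex) set \<Rightarrow> ('p \<Rightarrow> real) \<Rightarrow> ('k, ('p \<Rightarrow> 'k) \<Rightarrow> 'k) nspace" where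
  "alg_tensor P M w = function_space M
     {v. \<exists>n p. represents P M n p v}
     (\<lambda>v. Inf {\<Sum>i<n. w (p i) | n p. represents P M n p v})"

definition alg_tensor_family ::
    "'i set \<Rightarrow> ('i \<Rightarrow> ('k::real_or_complex, 'a) nspace)
       \<Rightarrow> ('k, (('i \<Rightarrow> 'a) \<Rightarrow> 'k) \<Rightarrow> 'k) nspace" where
  "alg_tensor_family I X =
     alg_tensor (\<Pi>\<^sub>E j\<in>I. vcarrier (X j)) {A. multilinear I X scalars A}
       (\<lambda>x. \<Prod>j\<in>I. vnorm (X j) (x j))"

definition alg_tensor_pair ::
    "('k::real_or_complex, 'a) nspace \<Rightarrow> ('k, 'b) nspace
       \<Rightarrow> ('k, ('a \<times> 'b \<Rightarrow> 'k) \<Rightarrow> 'k) nspace" where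
  "alg_tensor_pair S Y =
     alg_tensor (vcarrier S \<times> vcarrier Y) {B. bilinear_form S Y B}
       (\<lambda>(s, y). vnorm S s * vnorm Y y)"

definition proj_tensor_family where
  "proj_tensor_family I X = completion (alg_tensor_family I X)"

definition proj_tensor_pair where
  "proj_tensor_pair S Y = completion (alg_tensor_pair S Y)"

definition tensor_family where
  "tensor_family I X x =
     canonical (alg_tensor_family I X) (elementary_tensor {A. multilinear I X scalars A} x)"

definition tensor_pair where
  "tensor_pair S Y s y =
     canonical (alg_tensor_pair S Y) (elementary_tensor {B. bilinear_form S Y B} (s, y))"

text \<open>
  The duality between the projective tensor product of \<open>X\<^sub>1 \<otimes> \<dots> \<otimes> X\<^sub>N\<close> and \<open>Y\<close>, and the
  \<open>N\<close>-linear mappings into the dual of \<open>Y\<close>: the mapping \<open>\<Psi>\<close> is identified with the unique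
  continuous linear functional having the prescribed values on elementary tensors.
\<close>

definition duality ::
    "nat \<Rightarrow> (nat \<Rightarrow> ('k::real_or_complex, 'a) nspace) \<Rightarrow> ('k, 'b) nspace \<Rightarrow> _
       \<Rightarrow> ((nat \<Rightarrow> 'a) \<Rightarrow> 'b \<Rightarrow> 'k) \<Rightarrow> 'k" where
  "duality N X Y u \<Psi> =
     (THE \<phi>. \<phi> \<in> vcarrier (dual (proj_tensor_pair (proj_tensor_family {..<N} X) Y)) \<and>
        (\<forall>x \<in> (\<Pi>\<^sub>E j\<in>{..<N}. vcarrier (X j)). \<forall>y \<in> vcarrier Y.
           \<phi> (tensor_pair (proj_tensor_family {..<N} X) Y (tensor_family {..<N} X x) y)
             = \<Psi> x y)) u"

section \<open>Arens extension\<close>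

text \<open>
  Nets are represented by proper filters: \<open>F\<close> plays the role of a bounded net in \<open>X\<close> that
  converges weak* to \<open>x''\<close>.
\<close>

definition bounded_net_to ::
    "('k::real_or_complex, 'a) nspace \<Rightarrow> 'a filter \<Rightarrow> (('a \<Rightarrow> 'k) \<Rightarrow> 'k) \<Rightarrow> bool" where
  "bounded_net_to X F x'' \<longleftrightarrow>
     F \<noteq> bot \<and> (\<exists>r. \<forall>\<^sub>F x in F. x \<in> vcarrier X \<and> vnorm X x \<le> r) \<and>
     limitin (weak_star (dual X)) (canonical X) x'' F"

text \<open>
  \<open>iterated_limit T F f js x l\<close>: with the remaining coordinates taken from \<open>x\<close>, the iterated limit
  of \<open>f\<close> in \<open>T\<close> over the coordinates in \<open>js\<close>, the head of \<open>js\<close> being the outermost limit, exists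
  and equals \<open>l\<close>.
\<close>

primrec iterated_limit ::
    "'b topology \<Rightarrow> ('i \<Rightarrow> 'a filter) \<Rightarrow> (('i \<Rightarrow> 'a) \<Rightarrow> 'b) \<Rightarrow> 'i list \<Rightarrow> ('i \<Rightarrow> 'a) \<Rightarrow> 'b \<Rightarrow> bool"
  where
  "iterated_limit T F f [] x l \<longleftrightarrow> f x = l"
| "iterated_limit T F f (j # js) x l \<longleftrightarrow>
     (\<exists>g. (\<forall>\<^sub>F t in F j. iterated_limit T F f js (x(j := t)) (g t)) \<and> limitin T g l (F j))"

text \<open>
  The limits are taken in the third dual of \<open>Y\<close>, with its weak* topology as the dual of the bidual.
\<close>

definition arens ::
    "nat \<Rightarrow> (nat \<Rightarrow> ('k::real_or_complex, 'a) nspace) \<Rightarrow> ('k, 'b) nspace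
       \<Rightarrow> ((nat \<Rightarrow> 'a) \<Rightarrow> 'b \<Rightarrow> 'k) \<Rightarrow> (nat \<Rightarrow> ('a \<Rightarrow> 'k) \<Rightarrow> 'k) \<Rightarrow> (('b \<Rightarrow> 'k) \<Rightarrow> 'k) \<Rightarrow> 'k" where
  "arens N X Y \<Psi> x'' =
     (THE z. \<forall>F. (\<forall>j<N. bounded_net_to (X j) (F j) (x'' j)) \<longrightarrow>
        iterated_limit (weak_star (bidual Y)) F (\<lambda>x. canonical (dual Y) (\<Psi> x))
          [0..<N] (\<lambda>_. undefined) z)"

section \<open>Regular scalar measures on a topological space\<close>

definition borel_sets :: "'p topology \<Rightarrow> 'p set set" where
  "borel_sets T = sigma_sets (topspace T) {U. openin T U}"

definition scalar_borel_measure :: "'p topology \<Rightarrow> ('p set \<Rightarrow> 'k::real_or_complex) \<Rightarrow> bool" where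
  "scalar_borel_measure T \<mu> \<longleftrightarrow>
     \<mu> {} = 0 \<and>
     (\<forall>A :: nat \<Rightarrow> 'p set. range A \<subseteq> borel_sets T \<and> disjoint_family A \<longrightarrow>
        (\<lambda>i. \<mu> (A i)) sums \<mu> (\<Union>i. A i))"

definition total_variation ::
    "'p topology \<Rightarrow> ('p set \<Rightarrow> 'k::real_or_complex) \<Rightarrow> 'p set \<Rightarrow> ennreal" where
  "total_variation T \<mu> E =
     (SUP A \<in> {A :: nat \<Rightarrow> 'p set. range A \<subseteq> borel_sets T \<and> disjoint_family A \<and> (\<Union>i. A i) = E}.
        \<Sum>i. ennreal (norm (\<mu> (A i))))"

definition variation_measure ::
    "'p topology \<Rightarrow> ('p set \<Rightarrow> 'k::real_or_complex) \<Rightarrow> 'p measure" where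
  "variation_measure T \<mu> = measure_of (topspace T) (borel_sets T) (total_variation T \<mu>)"

definition regular_borel_measure :: "'p topology \<Rightarrow> ('p set \<Rightarrow> 'k::real_or_complex) \<Rightarrow> bool" where
  "regular_borel_measure T \<mu> \<longleftrightarrow>
     scalar_borel_measure T \<mu> \<and>
     (\<forall>E \<in> borel_sets T.
        total_variation T \<mu> E = (INF U \<in> {U. openin T U \<and> E \<subseteq> U}. total_variation T \<mu> U) \<and>
        total_variation T \<mu> E = (SUP C \<in> {C. compactin T C \<and> C \<subseteq> E}. total_variation T \<mu> C))"

text \<open>
  The integral against a scalar measure, defined as usual through the polar decomposition
  \<open>d\<mu> = h d|\<mu>|\<close>; the density \<open>h\<close> is unique up to \<open>|\<mu>|\<close>-null sets.
\<close>

definition variation_density ::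
    "'p topology \<Rightarrow> ('p set \<Rightarrow> 'k::real_or_complex) \<Rightarrow> 'p \<Rightarrow> 'k" where
  "variation_density T \<mu> =
     (SOME h. integrable (variation_measure T \<mu>) h \<and> (\<forall>p. norm (h p) = 1) \<and>
        (\<forall>E \<in> borel_sets T. \<mu> E = set_lebesgue_integral (variation_measure T \<mu>) E h))"

definition scalar_integral ::
    "'p topology \<Rightarrow> ('p set \<Rightarrow> 'k::real_or_complex) \<Rightarrow> ('p \<Rightarrow> 'k) \<Rightarrow> 'k" where
  "scalar_integral T \<mu> f =
     integral\<^sup>L (variation_measure T \<mu>) (\<lambda>p. f p * variation_density T \<mu> p)"

section \<open>The product of the bidual balls\<close>

definition bidual_ball ::
    "('k::real_or_complex, 'a) nspace \<Rightarrow> (('a \<Rightarrow> 'k) \<Rightarrow> 'k) topology" where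
  "bidual_ball X = subtopology (weak_star (dual X)) (unit_ball (bidual X))"

definition bidual_balls ::
    "nat \<Rightarrow> (nat \<Rightarrow> ('k::real_or_complex, 'a) nspace) \<Rightarrow> ('k, 'b) nspace
       \<Rightarrow> ((nat \<Rightarrow> ('a \<Rightarrow> 'k) \<Rightarrow> 'k) \<times> (('b \<Rightarrow> 'k) \<Rightarrow> 'k)) topology" where
  "bidual_balls N X Y =
     prod_topology (product_topology (\<lambda>j. bidual_ball (X j)) {..<N}) (bidual_ball Y)"

end

theory Submission
  imports Defs
begin

text \<open>
  Write \<open>u = \<Sum>i a\<^sub>i x\<^sub>1\<^sub>i \<otimes> \<dots> \<otimes> x\<^sub>N\<^sub>i \<otimes> y\<^sub>i\<close> with entries in the unit balls, \<open>a\<^sub>i \<ge> 0\<close> and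
  \<open>\<Sum>i a\<^sub>i\<close> arbitrarily close to the norm of \<open>u\<close>.  Such a series is a positive discrete measure on the
  compact space of the bidual balls, carried by canonical images, and its integral of an Arens
  extension is the duality pairing.  A regular Borel measure \<open>\<mu>\<close> obtained in the limit from such
  measures has mass at most the norm of \<open>u\<close> and, by continuity, the right integral for
  the forms of finite type \<open>\<phi>\<^sub>1 \<otimes> \<dots> \<otimes> \<phi>\<^sub>N \<otimes> \<psi>\<close>; in particular \<open>\<mu>\<close> may be chosen positive.

  An Arens extension is not continuous, so the passage to a general \<open>\<Psi>\<close> is made one coordinate at a
  time, comparing \<open>\<mu>\<close> with one of the discrete measures.  With all other coordinates fixed, the
  integrand is \<open>x\<^sub>k''(\<Phi>(p))\<close> for a weak* measurable bounded \<open>\<Phi>\<close> with values in the separable dual of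
  \<open>X\<^sub>k\<close>.  Expanding \<open>\<Phi>\<close> in a countably valued series turns the difference of the two integrals into
  the trace of a nuclear operator on that dual.  The induction hypothesis says that the
  operator is zero, and by the approximation property its trace is zero.
\<close>

section \<open>Normed spaces and their duals\<close>

text \<open>Convergence of the discrete measures controls only continuous integrands. The induction
  therefore works with integrands whose first coordinates carry a product of functionals
  \<open>\<phi> j\<close> and whose later coordinates are already extended by \<open>V\<close>. At
  coordinate k such an integrand is \<open>\<xi> p (\<Phi> p)\<close>: \<open>\<xi> p\<close> is the
  k-th point weighted by the product, and \<open>\<Phi> p\<close> is the section in the k-th
  argument. Testing on \<open>\<xi> p \<psi> * \<Phi> p t\<close> gives the previous integrand with
  \<open>\<phi> k = \<psi>\<close> and \<open>x k = t\<close>, so the operator whose trace is sought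
  vanishes. The countable expansion of \<open>\<Phi>\<close>, which rests on separability, also
  yields measurability of the next integrand. The point in the bidual of \<open>Y\<close> enters
  only through evaluation at functionals, which is continuous.

  All discrete measures give a finite-type form the same integral, since it depends on u alone. The
  limit thus reproduces it exactly and can be compared with any one of them, while the vanishing
  excess of the masses gives the norm bound.

  Algebraic tensors act on all forms, so definiteness of the projective norm rests on bounded forms
  separating them.\<close>

context normed_vspace
begin

lemma scale_zero: "x \<in> vcarrier X \<Longrightarrow> vscale X 0 x = vzero X"
  using scale_add_left[of x 1 "-1"] by (simp add: scale_one add_minus)

lemma scale_vzero: "vscale X c (vzero X) = vzero X"
  using scale_zero[OF zero_closed] scale_scale[OF zero_closed, of c 0] by simp

lemma norm_vzero: "vnorm X (vzero X) = 0"
  using norm_eq_zero[OF zero_closed] by simp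

lemma zero_add: "x \<in> vcarrier X \<Longrightarrow> vadd X (vzero X) x = x"
  using add_commute[OF zero_closed] add_zero by simp

lemma norm_minus: "x \<in> vcarrier X \<Longrightarrow> vnorm X (vscale X (-1) x) = vnorm X x"
  by (simp add: norm_scale)

abbreviation vdiff where "vdiff x y \<equiv> vadd X x (vscale X (-1) y)"

lemma diff_closed: "x \<in> vcarrier X \<Longrightarrow> y \<in> vcarrier X \<Longrightarrow> vdiff x y \<in> vcarrier X"
  by (simp add: add_closed scale_closed)

lemma diff_add: "x \<in> vcarrier X \<Longrightarrow> y \<in> vcarrier X \<Longrightarrow> vadd X (vdiff x y) y = x"
proof -
  assume x: "x \<in> vcarrier X" and y: "y \<in> vcarrier X"
  have "vadd X (vdiff x y) y = vadd X x (vadd X (vscale X (-1) y) y)"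
    by (simp add: add_assoc x y scale_closed)
  also have "vadd X (vscale X (-1) y) y = vzero X"
    by (simp add: add_commute[OF scale_closed[OF y] y] add_minus y)
  finally show ?thesis by (simp add: add_zero x)
qed

lemma add_swap:
  assumes "a \<in> vcarrier X" "b \<in> vcarrier X" "c \<in> vcarrier X" "d \<in> vcarrier X"
  shows "vadd X (vadd X a b) (vadd X c d) = vadd X (vadd X a c) (vadd X b d)"
proof -
  have "vadd X (vadd X a b) (vadd X c d) = vadd X a (vadd X (vadd X b c) d)"
    using assms by (simp add: add_assoc add_closed)
  also have "\<dots> = vadd X a (vadd X (vadd X c b) d)" using assms by (simp add: add_commute)
  also have "\<dots> = vadd X (vadd X a c) (vadd X b d)"
    using assms by (simp add: add_assoc add_closed)
  finally show ?thesis .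
qed

lemma diff_triangle:
  assumes "x \<in> vcarrier X" "y \<in> vcarrier X" "z \<in> vcarrier X"
  shows "vadd X (vdiff x y) (vdiff y z) = vdiff x z"
proof -
  have "vadd X (vdiff x y) (vdiff y z) = vadd X (vadd X (vdiff x y) y) (vscale X (-1) z)"
    using assms by (simp add: add_assoc add_closed scale_closed)
  then show ?thesis using assms by (simp add: diff_add)
qed

lemma diff_swap:
  assumes "x \<in> vcarrier X" "y \<in> vcarrier X"
  shows "vdiff x y = vscale X (-1) (vdiff y x)"
  using assms by (simp add: scale_add_right scale_closed scale_scale scale_one add_commute)

lemma Metric: "Metric_space (vcarrier X) (vdist X)"
proof
  show "0 \<le> vdist X x y" for x y
    by (auto simp: vdist_def intro!: norm_nonneg diff_closed)
  show "vdist X x y = vdist X y x" for x y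
    using diff_swap[of x y] norm_minus[OF diff_closed[of y x]] by (simp add: vdist_def)
  show "(vdist X x y = 0) = (x = y)" if "x \<in> vcarrier X" "y \<in> vcarrier X" for x y
  proof
    assume "vdist X x y = 0"
    then have "vdiff x y = vzero X" using that norm_eq_zero[OF diff_closed] by (auto simp: vdist_def)
    then show "x = y" using diff_add[OF that] zero_add that by simp
  qed (auto simp: vdist_def add_minus norm_vzero that)
  show "vdist X x z \<le> vdist X x y + vdist X y z"
    if "x \<in> vcarrier X" "y \<in> vcarrier X" "z \<in> vcarrier X" for x y z
    using that norm_triangle[OF diff_closed[of x y] diff_closed[of y z]]
    by (simp add: vdist_def diff_triangle)
qed

sublocale M: Metric_space "vcarrier X" "vdist X" by (rule Metric)

lemma topspace_norm [simp]: "topspace (norm_topology X) = vcarrier X"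
  by (simp add: norm_topology_def)

lemma openin_norm:
  "openin (norm_topology X) U \<longleftrightarrow> U \<subseteq> vcarrier X \<and>
     (\<forall>x\<in>U. \<exists>r>0. \<forall>y\<in>vcarrier X. vnorm X (vdiff x y) < r \<longrightarrow> y \<in> U)"
proof -
  have "M.mball x r \<subseteq> U \<longleftrightarrow> (\<forall>y\<in>vcarrier X. vnorm X (vdiff x y) < r \<longrightarrow> y \<in> U)"
    if "x \<in> vcarrier X" for x r
    using that by (auto simp: M.mball_def vdist_def)
  then show ?thesis unfolding norm_topology_def M.openin_mtopology by (meson subsetD)
qed

lemma closure_of_norm:
  assumes "S \<subseteq> vcarrier X"
  shows "x \<in> norm_topology X closure_of S \<longleftrightarrow>
    x \<in> vcarrier X \<and> (\<forall>r>0. \<exists>y\<in>S. vnorm X (vdiff x y) < r)"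
  unfolding norm_topology_def M.metric_closure_of using assms
  by (auto simp: M.mball_def vdist_def subset_iff)

lemma normed_vspace_subspace:
  assumes "C \<subseteq> vcarrier X" "vzero X \<in> C" "\<And>x y. x \<in> C \<Longrightarrow> y \<in> C \<Longrightarrow> vadd X x y \<in> C"
    "\<And>c x. x \<in> C \<Longrightarrow> vscale X c x \<in> C"
  shows "normed_vspace (X\<lparr>vcarrier := C\<rparr>)"
proof -
  have c: "x \<in> C \<Longrightarrow> x \<in> vcarrier X" for x using assms by auto
  show ?thesis
    by unfold_locales (use assms in \<open>auto simp: c add_assoc add_zero add_minus scale_add_right
        scale_add_left scale_scale scale_one norm_nonneg norm_eq_zero norm_triangle norm_scale
        intro!: add_commute c\<close>)
qed

end

lemma normed_scalars: "normed_vspace (scalars :: ('k::real_or_complex, 'k) nspace)"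
  by unfold_locales (auto simp: scalars_def algebra_simps norm_triangle_ineq norm_mult)

lemma scalars_simps [simp]:
  "vcarrier scalars = UNIV" "vadd scalars = (+)" "vzero scalars = 0"
  "vscale scalars = (*)" "vnorm scalars = norm"
  by (auto simp: scalars_def)

definition linear_functional :: "('k::real_or_complex, 'a) nspace \<Rightarrow> ('a \<Rightarrow> 'k) \<Rightarrow> bool" where
  "linear_functional X f \<longleftrightarrow>
     (\<forall>x\<in>vcarrier X. \<forall>y\<in>vcarrier X. f (vadd X x y) = f x + f y) \<and>
     (\<forall>c. \<forall>x\<in>vcarrier X. f (vscale X c x) = c * f x)"

lemma linear_between_scalars: "linear_between X scalars f \<longleftrightarrow> linear_functional X f"
  by (auto simp: linear_between_def linear_functional_def)

context normed_vspace
begin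

lemma lf_zero: "linear_functional X f \<Longrightarrow> f (vzero X) = 0"
  using scale_zero[OF zero_closed] zero_closed unfolding linear_functional_def
  by (metis mult_zero_left)

lemma lf_diff: "linear_functional X f \<Longrightarrow> x \<in> vcarrier X \<Longrightarrow> y \<in> vcarrier X \<Longrightarrow>
   f (vdiff x y) = f x - f y"
  by (simp add: linear_functional_def scale_closed)

lemma unit_zero: "vzero X \<in> unit_ball X"
  by (simp add: unit_ball_def zero_closed norm_vzero)

text \<open>At the zero vector \<open>inverse 0 = 0\<close> makes both claims hold, so the later
  normalizations of tensors need no case distinction.\<close>

lemma unit_normalize:
  assumes x: "x \<in> vcarrier X"
  shows "vscale X (of_real (inverse (vnorm X x))) x \<in> unit_ball X"
    and "vscale X (of_real (vnorm X x)) (vscale X (of_real (inverse (vnorm X x))) x) = x"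
proof -
  show "vscale X (of_real (inverse (vnorm X x))) x \<in> unit_ball X"
    using x norm_nonneg[OF x] by (cases "vnorm X x = 0")
      (auto simp: unit_ball_def scale_closed norm_scale norm_inverse)
  show "vscale X (of_real (vnorm X x)) (vscale X (of_real (inverse (vnorm X x))) x) = x"
    using x norm_eq_zero[OF x] by (cases "vnorm X x = 0")
     (auto simp: scale_scale scale_vzero scale_one simp flip: of_real_mult)
qed

lemma bounded_from_unit:
  assumes "linear_functional X f" "\<And>x. x \<in> unit_ball X \<Longrightarrow> norm (f x) \<le> C" "x \<in> vcarrier X"
  shows "norm (f x) \<le> C * vnorm X x"
proof -
  let ?y = "vscale X (of_real (inverse (vnorm X x))) x"
  have y: "?y \<in> vcarrier X" using assms by (simp add: scale_closed)
  have "f x = of_real (vnorm X x) * f ?y"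
    using assms(1) y unit_normalize(2)[OF assms(3)] unfolding linear_functional_def by metis
  then have "norm (f x) = vnorm X x * norm (f ?y)"
    using norm_nonneg[OF assms(3)] by (simp add: norm_mult)
  also have "\<dots> \<le> vnorm X x * C"
    using assms unit_normalize(1) norm_nonneg by (intro mult_left_mono) auto
  finally show ?thesis by (simp add: mult.commute)
qed

lemma continuous_functional_iff:
  assumes f: "linear_functional X f"
  shows "continuous_map (norm_topology X) (norm_topology scalars) f \<longleftrightarrow>
    (\<exists>C. \<forall>x\<in>vcarrier X. norm (f x) \<le> C * vnorm X x)"
proof
  interpret s: normed_vspace "scalars :: ('k,'k) nspace" by (rule normed_scalars)
  assume c: "continuous_map (norm_topology X) (norm_topology scalars) f"
  have "openin (norm_topology scalars) (ball (0::'k) 1)"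
    unfolding s.openin_norm
  proof (auto, goal_cases)
    case (1 x)
    show ?case
    proof (intro exI[of _ "1 - norm x"] conjI allI impI)
      fix y assume "norm (x - y) < 1 - norm x"
      then show "norm y < 1" using norm_triangle_ineq2[of y x] by (simp add: norm_minus_commute)
    qed (use 1 in auto)
  qed
  then have "openin (norm_topology X) {x \<in> vcarrier X. f x \<in> ball 0 1}"
    using c unfolding continuous_map_def by auto
  moreover have "vzero X \<in> {x \<in> vcarrier X. f x \<in> ball 0 1}"
    using lf_zero[OF f] zero_closed by simp
  ultimately obtain r where r: "r > 0"
    "\<forall>y\<in>vcarrier X. vnorm X (vdiff (vzero X) y) < r \<longrightarrow> norm (f y) < 1"
    unfolding openin_norm by force
  \<comment> \<open>Scaling by \<open>r/2\<close> moves the unit ball strictly inside the ball of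
    radius r, where f is bounded by 1; this gives the constant \<open>2/r\<close>.\<close>
  have "norm (f x) \<le> (2/r) * vnorm X x" if x: "x \<in> vcarrier X" for x
  proof (rule bounded_from_unit[OF f _ x])
    fix x assume x: "x \<in> unit_ball X"
    then have xc: "x \<in> vcarrier X" "vnorm X x \<le> 1" by (auto simp: unit_ball_def)
    let ?y = "vscale X (of_real (r/2)) x"
    have "vnorm X (vdiff (vzero X) ?y) = norm (of_real (r/2) :: 'k) * vnorm X x"
      using xc by (simp add: zero_add scale_closed norm_minus norm_scale)
    also have "\<dots> \<le> (r/2) * 1" unfolding norm_of_real using xc r by (intro mult_mono norm_nonneg) auto
    finally have "vnorm X (vdiff (vzero X) ?y) < r" using r by simp
    then have "norm (f ?y) < 1" using r xc by (simp add: scale_closed)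
    moreover have "f ?y = of_real (r/2) * f x" using f xc unfolding linear_functional_def by blast
    moreover have "norm (of_real (r/2) * f x) = r/2 * norm (f x)"
      using r unfolding norm_mult norm_of_real by simp
    ultimately have "(r/2) * norm (f x) < 1" by metis
    then show "norm (f x) \<le> 2/r" using r by (simp add: field_simps)
  qed
  then show "\<exists>C. \<forall>x\<in>vcarrier X. norm (f x) \<le> C * vnorm X x" by blast
next
  interpret s: normed_vspace "scalars :: ('k,'k) nspace" by (rule normed_scalars)
  assume "\<exists>C. \<forall>x\<in>vcarrier X. norm (f x) \<le> C * vnorm X x"
  then obtain C where C: "\<And>x. x \<in> vcarrier X \<Longrightarrow> norm (f x) \<le> C * vnorm X x" by blast
  \<comment> \<open>\<open>C\<close> may be zero or negative, but the radius \<open>r / D\<close>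
    below needs a positive constant.\<close>
  define D where "D = max C 1"
  have D: "norm (f x) \<le> D * vnorm X x" "D > 0" if "x \<in> vcarrier X" for x
    using C[OF that] mult_right_mono[OF max.cobounded1[of C 1] norm_nonneg[OF that]]
    by (auto simp: D_def)
  show "continuous_map (norm_topology X) (norm_topology scalars) f"
    unfolding continuous_map_def
  proof (intro conjI allI impI)
    show "f \<in> topspace (norm_topology X) \<rightarrow> topspace (norm_topology scalars)" by auto
    fix U :: "'k set" assume U: "openin (norm_topology scalars) U"
    show "openin (norm_topology X) {x \<in> topspace (norm_topology X). f x \<in> U}"
      unfolding openin_norm
    proof (intro conjI ballI)
      fix x assume "x \<in> {x \<in> topspace (norm_topology X). f x \<in> U}"
      then have x: "x \<in> vcarrier X" "f x \<in> U" by auto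
      obtain r where r: "r > 0" "\<And>y. norm (f x - y) < r \<Longrightarrow> y \<in> U"
        using U x(2) unfolding s.openin_norm by auto
      show "\<exists>r>0. \<forall>y\<in>vcarrier X. vnorm X (vdiff x y) < r \<longrightarrow>
            y \<in> {x \<in> topspace (norm_topology X). f x \<in> U}"
      proof (intro exI[of _ "r / D"] conjI ballI impI)
        show "0 < r / D" using r D[OF x(1)] by simp
        fix y assume y: "y \<in> vcarrier X" "vnorm X (vdiff x y) < r / D"
        have "norm (f x - f y) \<le> D * vnorm X (vdiff x y)"
          using D(1)[OF diff_closed[OF x(1) y(1)]] lf_diff[OF f x(1) y(1)] by simp
        also have "\<dots> < r" using y D[OF x(1)] by (simp add: field_simps)
        finally show "y \<in> {x \<in> topspace (norm_topology X). f x \<in> U}" using r y by simp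
      qed
    qed auto
  qed
qed

lemma dual_iff: "f \<in> vcarrier (dual X) \<longleftrightarrow> f \<in> extensional (vcarrier X) \<and> linear_functional X f \<and>
    (\<exists>C. \<forall>x\<in>vcarrier X. norm (f x) \<le> C * vnorm X x)"
  unfolding dual_def function_space_def using continuous_functional_iff
  by (auto simp: linear_between_scalars)

lemma dual_norm_def: "vnorm (dual X) f = (SUP x \<in> unit_ball X. norm (f x))"
  by (simp add: dual_def function_space_def)

lemma dual_bdd: "f \<in> vcarrier (dual X) \<Longrightarrow> bdd_above ((\<lambda>x. norm (f x)) ` unit_ball X)"
proof -
  assume "f \<in> vcarrier (dual X)"
  then obtain C where C: "\<And>x. x\<in>vcarrier X \<Longrightarrow> norm (f x) \<le> C * vnorm X x"
    unfolding dual_iff by blast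
  \<comment> \<open>The constant obtained from \<open>dual_iff\<close> carries no sign, so its
    absolute value is taken as the bound on the ball.\<close>
  have "norm (f x) \<le> \<bar>C\<bar>" if "x \<in> unit_ball X" for x
  proof -
    have x: "x \<in> vcarrier X" "vnorm X x \<le> 1" using that by (auto simp: unit_ball_def)
    have "C * vnorm X x \<le> \<bar>C\<bar> * 1"
      using x norm_nonneg by (intro mult_mono) auto
    then show ?thesis using C[OF x(1)] by simp
  qed
  then show ?thesis by (meson bdd_aboveI2)
qed

lemma dual_lf: "f \<in> vcarrier (dual X) \<Longrightarrow> linear_functional X f" by (simp add: dual_iff)
lemma dual_add: "f \<in> vcarrier (dual X) \<Longrightarrow> x \<in> vcarrier X \<Longrightarrow> y \<in> vcarrier X \<Longrightarrow> f (vadd X x y) = f x + f y"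
  and dual_scale: "f \<in> vcarrier (dual X) \<Longrightarrow> x \<in> vcarrier X \<Longrightarrow> f (vscale X c x) = c * f x"
  and dual_ext: "f \<in> vcarrier (dual X) \<Longrightarrow> f \<in> extensional (vcarrier X)"
  by (simp_all add: dual_iff linear_functional_def)

lemma dual_unit_bound: "f \<in> vcarrier (dual X) \<Longrightarrow> x \<in> unit_ball X \<Longrightarrow> norm (f x) \<le> vnorm (dual X) f"
  unfolding dual_norm_def by (rule cSUP_upper[OF _ dual_bdd])

lemma dual_bound: "f \<in> vcarrier (dual X) \<Longrightarrow> x \<in> vcarrier X \<Longrightarrow>
   norm (f x) \<le> vnorm (dual X) f * vnorm X x"
  by (rule bounded_from_unit) (auto simp: dual_lf dual_unit_bound)

lemma dual_norm_le: "(\<And>x. x \<in> unit_ball X \<Longrightarrow> norm (f x) \<le> C) \<Longrightarrow> vnorm (dual X) f \<le> C"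
  unfolding dual_norm_def using unit_zero by (intro cSUP_least) auto

lemma dual_norm_le': "0 \<le> C \<Longrightarrow> (\<And>x. x \<in> vcarrier X \<Longrightarrow> norm (f x) \<le> C * vnorm X x) \<Longrightarrow>
   vnorm (dual X) f \<le> C"
proof (rule dual_norm_le)
  fix x assume C: "0 \<le> C" "\<And>x. x \<in> vcarrier X \<Longrightarrow> norm (f x) \<le> C * vnorm X x" and x: "x \<in> unit_ball X"
  have "norm (f x) \<le> C * vnorm X x" using C x by (auto simp: unit_ball_def)
  also have "\<dots> \<le> C * 1" using C x by (intro mult_left_mono) (auto simp: unit_ball_def)
  finally show "norm (f x) \<le> C" by simp
qed

lemma dual_norm_nonneg: "f \<in> vcarrier (dual X) \<Longrightarrow> 0 \<le> vnorm (dual X) f"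
  using dual_unit_bound[OF _ unit_zero] norm_ge_zero order_trans by blast

lemma dualI:
  "f \<in> extensional (vcarrier X) \<Longrightarrow> linear_functional X f \<Longrightarrow>
   (\<And>x. x \<in> vcarrier X \<Longrightarrow> norm (f x) \<le> C * vnorm X x) \<Longrightarrow> f \<in> vcarrier (dual X)"
  unfolding dual_iff by blast

lemma dual_ops:
  "vadd (dual X) f g = (\<lambda>x\<in>vcarrier X. f x + g x)"
  "vzero (dual X) = (\<lambda>x\<in>vcarrier X. 0)"
  "vscale (dual X) c f = (\<lambda>x\<in>vcarrier X. c * f x)"
  by (simp_all add: dual_def function_space_def)

lemma dual_eqI: "f \<in> vcarrier (dual X) \<Longrightarrow> g \<in> vcarrier (dual X) \<Longrightarrow>
   (\<And>x. x \<in> vcarrier X \<Longrightarrow> f x = g x) \<Longrightarrow> f = g"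
  by (meson dual_ext extensionalityI)

lemma normed_dual: "normed_vspace (dual X)"
proof
  note lf = linear_functional_def
  show z: "vzero (dual X) \<in> vcarrier (dual X)"
    unfolding dual_ops by (rule dualI[of _ 0]) (auto simp: lf add_closed scale_closed)
  show ac: "vadd (dual X) f g \<in> vcarrier (dual X)"
    if f: "f \<in> vcarrier (dual X)" and g: "g \<in> vcarrier (dual X)" for f g
    unfolding dual_ops
  proof (rule dualI[of _ "vnorm (dual X) f + vnorm (dual X) g"])
    fix x assume x: "x \<in> vcarrier X"
    have "norm (f x + g x) \<le> norm (f x) + norm (g x)" by (rule norm_triangle_ineq)
    then show "norm ((\<lambda>x\<in>vcarrier X. f x + g x) x) \<le> (vnorm (dual X) f + vnorm (dual X) g) * vnorm X x"
      using dual_bound[OF f x] dual_bound[OF g x] x by (simp add: distrib_right)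
  qed (use f g in \<open>auto simp: lf add_closed scale_closed dual_add dual_scale algebra_simps\<close>)
  show sc: "vscale (dual X) c f \<in> vcarrier (dual X)" if f: "f \<in> vcarrier (dual X)" for c f
    unfolding dual_ops
  proof (rule dualI[of _ "norm c * vnorm (dual X) f"])
    fix x assume x: "x \<in> vcarrier X"
    show "norm ((\<lambda>x\<in>vcarrier X. c * f x) x) \<le> (norm c * vnorm (dual X) f) * vnorm X x"
      using dual_bound[OF f x] x by (simp add: norm_mult mult.assoc mult_left_mono)
  qed (use f in \<open>auto simp: lf add_closed scale_closed dual_add dual_scale algebra_simps\<close>)
  show "vadd (dual X) (vadd (dual X) f g) h = vadd (dual X) f (vadd (dual X) g h)"
    "vadd (dual X) f g = vadd (dual X) g f"
    "vscale (dual X) c (vadd (dual X) f g) = vadd (dual X) (vscale (dual X) c f) (vscale (dual X) c g)"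
    "vscale (dual X) (c + d) f = vadd (dual X) (vscale (dual X) c f) (vscale (dual X) d f)"
    "vscale (dual X) c (vscale (dual X) d f) = vscale (dual X) (c * d) f" for f g h c d
    by (auto simp: dual_ops fun_eq_iff restrict_def algebra_simps)
  fix f assume f: "f \<in> vcarrier (dual X)"
  show "vadd (dual X) f (vzero (dual X)) = f" "vscale (dual X) 1 f = f"
    using dual_ext[OF f] by (auto simp: dual_ops fun_eq_iff restrict_def extensional_def)
  show "vadd (dual X) f (vscale (dual X) (- 1) f) = vzero (dual X)"
    by (auto simp: dual_ops fun_eq_iff restrict_def)
  show nn: "0 \<le> vnorm (dual X) f" by (rule dual_norm_nonneg[OF f])
  show "(vnorm (dual X) f = 0) = (f = vzero (dual X))"
  proof
    assume "vnorm (dual X) f = 0"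
    then have "f x = 0" if "x \<in> vcarrier X" for x using dual_bound[OF f that] by simp
    then show "f = vzero (dual X)" using f z by (intro dual_eqI) (auto simp: dual_ops)
  next
    assume "f = vzero (dual X)"
    then have "vnorm (dual X) f \<le> 0" by (intro dual_norm_le) (auto simp: dual_ops unit_ball_def)
    then show "vnorm (dual X) f = 0" using nn by simp
  qed
  show "vnorm (dual X) (vadd (dual X) f g) \<le> vnorm (dual X) f + vnorm (dual X) g"
    if g: "g \<in> vcarrier (dual X)" for g
  proof (rule dual_norm_le)
    fix x assume x: "x \<in> unit_ball X"
    have "norm (f x + g x) \<le> norm (f x) + norm (g x)" by (rule norm_triangle_ineq)
    then show "norm (vadd (dual X) f g x) \<le> vnorm (dual X) f + vnorm (dual X) g"
      using dual_unit_bound[OF f x] dual_unit_bound[OF g x] x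
      by (simp add: dual_ops unit_ball_def)
  qed
  have le: "vnorm (dual X) (vscale (dual X) c f) \<le> norm c * vnorm (dual X) f"
    if f: "f \<in> vcarrier (dual X)" for c f
  proof (rule dual_norm_le)
    fix x assume x: "x \<in> unit_ball X"
    show "norm (vscale (dual X) c f x) \<le> norm c * vnorm (dual X) f"
      using dual_unit_bound[OF f x] x by (simp add: dual_ops unit_ball_def norm_mult mult_left_mono)
  qed
  show "vnorm (dual X) (vscale (dual X) c f) = norm c * vnorm (dual X) f" for c
  proof (cases "c = 0")
    case True
    then show ?thesis using le[OF f, of 0] dual_norm_nonneg[OF sc[OF f, of 0]] by simp
  next
    case False
    \<comment> \<open>Equality in the scaling law comes from using the inequality \<open>le\<close>
      both for c and for its inverse.\<close>
    have "vscale (dual X) (inverse c) (vscale (dual X) c f) = f"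
      using dual_ext[OF f] False by (auto simp: dual_ops fun_eq_iff restrict_def extensional_def)
    then have "vnorm (dual X) f \<le> norm (inverse c) * vnorm (dual X) (vscale (dual X) c f)"
      using le[OF sc[OF f], of "inverse c" c] by simp
    from mult_left_mono[OF this, of "norm c"]
    have "norm c * vnorm (dual X) f \<le> vnorm (dual X) (vscale (dual X) c f)"
      using False by (simp add: norm_inverse mult.assoc[symmetric])
    then show ?thesis using le[OF f, of c] by simp
  qed
qed

lemma canonical_apply: "f \<in> vcarrier (dual X) \<Longrightarrow> canonical X x f = f x"
  by (simp add: canonical_def)

lemma canonical_bidual:
  assumes x: "x \<in> vcarrier X"
  shows "canonical X x \<in> vcarrier (bidual X)" "vnorm (bidual X) (canonical X x) \<le> vnorm X x"
proof -
  interpret d: normed_vspace "dual X" by (rule normed_dual)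
  have b: "norm (canonical X x f) \<le> vnorm X x * vnorm (dual X) f" if "f \<in> vcarrier (dual X)" for f
    using dual_bound[OF that x] by (simp add: canonical_apply that mult.commute)
  have "canonical X x (vadd (dual X) f g) = canonical X x f + canonical X x g"
    "canonical X x (vscale (dual X) c f) = c * canonical X x f"
    if "f \<in> vcarrier (dual X)" "g \<in> vcarrier (dual X)" for f g c
    using d.add_closed[OF that] d.scale_closed[OF that(1)] that x
    by (simp_all add: canonical_apply) (simp_all add: dual_ops)
  then show "canonical X x \<in> vcarrier (bidual X)"
    by (intro d.dualI[OF _ _ b]) (simp_all add: linear_functional_def, simp add: canonical_def extensional_def)
  show "vnorm (bidual X) (canonical X x) \<le> vnorm X x"
    by (rule d.dual_norm_le'[OF norm_nonneg[OF x] b])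
qed

lemma canonical_add: "x \<in> vcarrier X \<Longrightarrow> y \<in> vcarrier X \<Longrightarrow>
    canonical X (vadd X x y) = vadd (bidual X) (canonical X x) (canonical X y)"
  and canonical_scale: "x \<in> vcarrier X \<Longrightarrow>
    canonical X (vscale X c x) = vscale (bidual X) c (canonical X x)"
  by (auto simp: canonical_def normed_vspace.dual_ops[OF normed_dual] fun_eq_iff restrict_def
      dual_add dual_scale)

end

section \<open>The scalar field inside the complex numbers\<close>

text \<open>The class only asserts that an embedding exists; one is fixed so that real parts and
  conjugates of scalars make sense.\<close>

definition kc :: "'k::real_or_complex \<Rightarrow> complex" where
  "kc = (SOME \<phi>. (\<forall>a b. \<phi> (a + b) = \<phi> a + \<phi> b) \<and> (\<forall>a b. \<phi> (a * b) = \<phi> a * \<phi> b) \<and>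
       (\<forall>a. norm (\<phi> a) = norm a) \<and> (range \<phi> = \<real> \<or> range \<phi> = UNIV))"

lemma kc_props:
  "kc (a + b) = kc a + kc b" "kc (a * b) = kc a * kc b" "norm (kc a) = norm a"
  "range (kc :: 'k::real_or_complex \<Rightarrow> complex) = \<real> \<or> range (kc :: 'k \<Rightarrow> complex) = UNIV"
  for a b :: "'k::real_or_complex"
  using someI_ex[OF ex_isometry_into_complex[where 'a = 'k]] unfolding kc_def[symmetric] by auto

lemma kc_diff: "kc (a - b) = kc a - kc b" for a b :: "'k::real_or_complex"
  using kc_props(1)[of "a - b" b] by simp

lemma kc_inj: "kc a = kc b \<longleftrightarrow> a = b" for a b :: "'k::real_or_complex"
  using kc_diff[of a b] kc_props(3)[of "a - b"] by auto

lemma kc_one: "kc (1::'k::real_or_complex) = 1"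
proof -
  have "kc (1::'k) * kc (1::'k) = kc (1::'k)" unfolding kc_props(2)[symmetric] by simp
  moreover have "kc (1::'k) \<noteq> 0" using kc_props(3)[of "1::'k"] by auto
  ultimately show ?thesis by simp
qed

text \<open>Additivity alone would settle only rational scalars. Here isometry does it: a complex
  number at distance \<open>\<bar>r\<bar>\<close> from 0 and \<open>\<bar>r - 1\<bar>\<close> from 1
  must be r.\<close>

lemma kc_of_real: "kc (of_real r :: 'k::real_or_complex) = of_real r"
proof -
  let ?z = "kc (of_real r :: 'k)"
  have 1: "(norm ?z)\<^sup>2 = r\<^sup>2" by (simp add: kc_props(3))
  have "norm (?z - 1) = \<bar>r - 1\<bar>"
    unfolding kc_one[where 'k='k, symmetric] kc_diff[symmetric] kc_props(3)
    by (metis norm_of_real of_real_1 of_real_diff)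
  then have "(norm (?z - 1))\<^sup>2 = (r - 1)\<^sup>2" by simp
  then have "(Re ?z - 1)\<^sup>2 + (Im ?z)\<^sup>2 = (r - 1)\<^sup>2" "(Re ?z)\<^sup>2 + (Im ?z)\<^sup>2 = r\<^sup>2"
    using 1 by (simp_all add: cmod_power2)
  then have R: "Re ?z = r" unfolding power2_diff by simp
  have "Im ?z = 0" using 1(1) unfolding cmod_power2 R by simp
  then show ?thesis using R by (intro complex_eqI) (simp_all only: Re_complex_of_real Im_complex_of_real)
qed

definition re :: "'k::real_or_complex \<Rightarrow> real" where "re a = Re (kc a)"

lemma re_add: "re (a + b) = re a + re b" and re_diff: "re (a - b) = re a - re b"
  for a b :: "'k::real_or_complex"
  by (simp_all add: re_def kc_props kc_diff)

lemma re_of_real_mult: "re (of_real r * a) = r * re a" for a :: "'k::real_or_complex"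
  by (simp add: re_def kc_props kc_of_real)

lemma re_of_real: "re (of_real r :: 'k::real_or_complex) = r"
  by (simp add: re_def kc_of_real)

lemma abs_re_le: "\<bar>re a\<bar> \<le> norm a" for a :: "'k::real_or_complex"
  using abs_Re_le_cmod[of "kc a"] by (simp add: re_def kc_props)

lemma re_sum: "re (\<Sum>i\<in>A. f i) = (\<Sum>i\<in>A. re (f i :: 'k::real_or_complex))"
  using re_of_real[where 'k='k, of 0] by (induction A rule: infinite_finite_induct) (simp_all add: re_add)

lemma re_eq_norm: "norm a \<le> re a \<Longrightarrow> a = of_real (re a)" for a :: "'k::real_or_complex"
proof -
  assume "norm a \<le> re a"
  then have "norm (kc a) = Re (kc a)" using abs_re_le[of a] by (simp add: re_def kc_props)
  then have "kc a = of_real (Re (kc a))"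
    using cmod_eq_Re[of "kc a"] by (smt (verit) cmod_power2 complex_eq_iff complex_of_real_def
      Im_complex_of_real Re_complex_of_real power2_eq_iff zero_eq_power2)
  then have "kc a = kc (of_real (re a) :: 'k)" by (simp add: kc_of_real re_def)
  then show ?thesis by (simp add: kc_inj)
qed

text \<open>Complex conjugation, written as squared modulus over a so that it stays in the scalar
  field without inverting \<open>kc\<close>; at 0 the division yields 0.\<close>

definition cj :: "'k::real_or_complex \<Rightarrow> 'k" where "cj a = of_real ((norm a)\<^sup>2) / a"

lemma kc_cj: "kc (cj a) = cnj (kc a)"
proof (cases "a = 0")
  case True then show ?thesis using kc_of_real[where 'k='a, of 0] by (simp add: cj_def)
next
  case False
  then have nz: "kc a \<noteq> 0" using kc_props(3)[of a] by auto
  have "cj a * a = of_real ((norm a)\<^sup>2)" using False by (simp add: cj_def)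
  then have "kc (cj a) * kc a = of_real ((norm (kc a))\<^sup>2)"
    by (metis kc_props(2,3) kc_of_real)
  also have "\<dots> = cnj (kc a) * kc a" by (metis complex_norm_square mult.commute)
  finally show ?thesis using nz by simp
qed

lemma norm_diff_square: "(norm (a - b))\<^sup>2 = (norm a)\<^sup>2 - 2 * re (cj a * b) + (norm b)\<^sup>2"
  for a b :: "'k::real_or_complex"
proof -
  have "(norm (kc a - kc b))\<^sup>2 = (norm (kc a))\<^sup>2 - 2 * Re (cnj (kc a) * kc b) + (norm (kc b))\<^sup>2"
    unfolding cmod_power2 by (simp add: power2_eq_square algebra_simps)
  then show ?thesis by (simp add: kc_props(3) re_def kc_props(2) kc_cj flip: kc_diff)
qed

text \<open>The range of \<open>kc\<close> is the real line or the whole plane, hence closed, and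
  the inverse of \<open>kc\<close> carries compactness back from the complex disc.\<close>

lemma compact_cball_scalar: "compact (cball (0::'k::real_or_complex) r)"
proof -
  have kc0: "dist (kc a) (kc b) = dist a b" for a b :: 'k
    by (simp add: dist_norm kc_props(3) flip: kc_diff)
  have inj: "inj (kc :: 'k \<Rightarrow> complex)" using kc_inj by (auto simp: inj_def)
  have cl: "closed (range (kc :: 'k \<Rightarrow> complex))"
    using kc_props(4)[where 'k='k] closed_complex_Reals by auto
  have "continuous_on (range (kc :: 'k \<Rightarrow> complex)) (inv (kc :: 'k \<Rightarrow> complex))"
    unfolding continuous_on_iff by (auto simp: inv_f_f[OF inj] kc0 intro!: exI)
  then have "compact (inv (kc :: 'k \<Rightarrow> complex) ` (cball 0 r \<inter> range (kc :: 'k \<Rightarrow> complex)))"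
    by (intro compact_continuous_image compact_Int_closed cl) (auto intro: continuous_on_subset)
  moreover have "inv (kc :: 'k \<Rightarrow> complex) ` (cball 0 r \<inter> range (kc :: 'k \<Rightarrow> complex)) = cball 0 r"
    by (force simp: inv_f_f[OF inj] kc_props(3) image_iff)
  ultimately show ?thesis by simp
qed

lemma phase: "\<exists>s. norm s = 1 \<and> s * a = of_real (norm a)" for a :: "'k::real_or_complex"
  by (cases "a = 0") (auto intro: exI[of _ 1] exI[of _ "of_real (norm a) / a"] simp: norm_divide)

lemma scalar_cases:
  obtains (real) "\<And>a::'k::real_or_complex. a = of_real (re a)"
  | (complex) j :: "'k::real_or_complex" where "j * j = -1" "\<And>a. \<exists>s t. a = of_real s + of_real t * j"
proof (cases "range (kc :: 'k \<Rightarrow> complex) = \<real>")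
  case True
  have "a = of_real (re a)" for a :: 'k
  proof -
    have "kc a \<in> \<real>" using True by blast
    then have "kc a = kc (of_real (re a) :: 'k)" by (simp add: re_def kc_of_real)
    then show ?thesis by (simp add: kc_inj)
  qed
  then show ?thesis by (rule real)
next
  case False
  then have u: "range (kc :: 'k \<Rightarrow> complex) = UNIV" using kc_props(4) by blast
  then obtain j :: 'k where j: "kc j = \<i>" by (metis UNIV_I imageE)
  have "kc (j * j) = kc (of_real (-1) :: 'k)" by (simp only: kc_props(2) kc_of_real j) simp
  then have "j * j = -1" by (simp add: kc_inj)
  moreover have "\<exists>s t. a = of_real s + of_real t * j" for a :: 'k
  proof (intro exI)
    have "kc a = kc (of_real (Re (kc a)) + of_real (Im (kc a)) * j :: 'k)"
      by (simp add: kc_props kc_of_real j complex_eq_iff)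
    then show "a = of_real (Re (kc a)) + of_real (Im (kc a)) * j" by (simp add: kc_inj)
  qed
  ultimately show ?thesis by (rule complex)
qed

section \<open>The Hahn-Banach theorem\<close>

context normed_vspace
begin

abbreviation rs :: "real \<Rightarrow> 'a \<Rightarrow> 'a" where "rs t x \<equiv> vscale X (of_real t) x"

text \<open>Homogeneity is asked only as an inequality for positive t, the form that passes directly
  to infima; equality, also at 0, is recovered in \<open>sublinear_scale\<close>.\<close>

definition sublinear :: "('a \<Rightarrow> real) \<Rightarrow> bool" where
  "sublinear q \<longleftrightarrow> (\<forall>x\<in>vcarrier X. \<forall>y\<in>vcarrier X. q (vadd X x y) \<le> q x + q y) \<and>
     (\<forall>t>0. \<forall>x\<in>vcarrier X. q (rs t x) \<le> t * q x)"

lemma sublinear_add: "sublinear q \<Longrightarrow> x \<in> vcarrier X \<Longrightarrow> y \<in> vcarrier X \<Longrightarrow> q (vadd X x y) \<le> q x + q y"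
  and sublinear_scale_le: "sublinear q \<Longrightarrow> x \<in> vcarrier X \<Longrightarrow> t > 0 \<Longrightarrow> q (rs t x) \<le> t * q x"
  by (auto simp: sublinear_def)

lemma sublinear_zero: assumes "sublinear q" shows "q (vzero X) = 0"
  using sublinear_scale_le[OF assms zero_closed, of "1/2"] sublinear_scale_le[OF assms zero_closed, of 2]
  by (simp add: scale_vzero)

lemma sublinear_scale:
  assumes "sublinear q" "x \<in> vcarrier X" "t \<ge> 0" shows "q (rs t x) = t * q x"
proof (cases "t = 0")
  case True then show ?thesis using assms by (simp add: scale_zero sublinear_zero)
next
  case False
  then have t: "t > 0" using assms by simp
  have "q (rs (1/t) (rs t x)) \<le> (1/t) * q (rs t x)"
    using t assms by (intro sublinear_scale_le) (auto simp: scale_closed)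
  moreover have "rs (1/t) (rs t x) = x" using t assms by (simp add: scale_scale scale_one)
  ultimately have "t * q x \<le> q (rs t x)" using t by (simp add: field_simps)
  then show ?thesis using sublinear_scale_le[OF assms(1,2) t] by simp
qed

lemma sublinear_lower:
  assumes "sublinear q" "x \<in> vcarrier X" shows "- q (vscale X (-1) x) \<le> q x"
  using sublinear_add[OF assms(1,2) scale_closed[OF assms(2), of "-1"]] sublinear_zero[OF assms(1)]
  by (simp add: add_minus assms)

text \<open>The greatest sublinear function below \<open>q\<close> that is linear along \<open>y\<close>.\<close>

definition lower :: "('a \<Rightarrow> real) \<Rightarrow> 'a \<Rightarrow> 'a \<Rightarrow> real" where
  "lower q y x = (INF t\<in>{0..}. q (vadd X x (rs t y)) - t * q y)"

text \<open>Subadditivity applied to \<open>t y = - x + (x + t y)\<close> gives the lower bound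
  \<open>- q (- x)\<close>, uniformly in t.\<close>

lemma lower_bdd:
  assumes q: "sublinear q" and x: "x \<in> vcarrier X" and y: "y \<in> vcarrier X"
  shows "bdd_below ((\<lambda>t. q (vadd X x (rs t y)) - t * q y) ` {0..})"
proof (rule bdd_belowI2)
  fix t :: real assume t: "t \<in> {0..}"
  have m: "vscale X (-1) x \<in> vcarrier X" "rs t y \<in> vcarrier X" using x y by (auto simp: scale_closed)
  have "vadd X (vscale X (-1) x) (vadd X x (rs t y)) = rs t y"
    using m x by (simp add: add_assoc[symmetric] add_commute[of "vscale X (-1) x" x] add_minus zero_add)
  then have "t * q y \<le> q (vscale X (-1) x) + q (vadd X x (rs t y))"
    using sublinear_add[OF q m(1) add_closed[OF x m(2)]] sublinear_scale[OF q y, of t] t by simp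
  then show "- q (vscale X (-1) x) \<le> q (vadd X x (rs t y)) - t * q y" by simp
qed

lemma lower_le:
  assumes "sublinear q" "x \<in> vcarrier X" "y \<in> vcarrier X" "t \<ge> 0"
  shows "lower q y x \<le> q (vadd X x (rs t y)) - t * q y"
  unfolding lower_def by (rule cINF_lower[OF lower_bdd]) (use assms in auto)

lemma lower_sublinear:
  assumes q: "sublinear q" and y: "y \<in> vcarrier X" shows "sublinear (lower q y)"
  unfolding sublinear_def
proof (intro conjI ballI allI impI)
  fix a b assume a: "a \<in> vcarrier X" and b: "b \<in> vcarrier X"
  \<comment> \<open>Parameters s and t for the two summands combine into \<open>s + t\<close>; the
    two infima are then taken one after the other.\<close>
  have le: "lower q y (vadd X a b) \<le> (q (vadd X a (rs s y)) - s * q y) + (q (vadd X b (rs t y)) - t * q y)"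
    if "s \<ge> 0" "t \<ge> 0" for s t
  proof -
    have "vadd X (vadd X a (rs s y)) (vadd X b (rs t y)) = vadd X (vadd X a b) (rs (s + t) y)"
      using a b y by (simp add: add_swap scale_closed scale_add_left)
    then have "q (vadd X (vadd X a b) (rs (s+t) y)) \<le> q (vadd X a (rs s y)) + q (vadd X b (rs t y))"
      using sublinear_add[OF q add_closed[OF a scale_closed[OF y]] add_closed[OF b scale_closed[OF y]],
          of "of_real s" "of_real t"] by simp
    then show ?thesis using lower_le[OF q add_closed[OF a b] y, of "s + t"] that
      by (simp add: algebra_simps)
  qed
  have "lower q y (vadd X a b) - (q (vadd X b (rs t y)) - t * q y) \<le> lower q y a" if "t \<ge> 0" for t
    unfolding lower_def[of q y a] by (rule cINF_greatest) (use le that in \<open>auto simp: algebra_simps\<close>)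
  then have "lower q y (vadd X a b) - lower q y a \<le> q (vadd X b (rs t y)) - t * q y" if "t \<ge> 0" for t
    using that by (force simp: algebra_simps)
  then have "lower q y (vadd X a b) - lower q y a \<le> lower q y b"
    unfolding lower_def[of q y b] by (intro cINF_greatest) auto
  then show "lower q y (vadd X a b) \<le> lower q y a + lower q y b" by simp
next
  fix s :: real and a assume s: "s > 0" and a: "a \<in> vcarrier X"
  have "lower q y (rs s a) / s \<le> lower q y a"
    unfolding lower_def[of q y a]
  proof (rule cINF_greatest)
    fix t :: real assume t: "t \<in> {0..}"
    have e: "vadd X (rs s a) (rs (s * t) y) = rs s (vadd X a (rs t y))"
      using a y by (simp add: scale_add_right scale_closed scale_scale)
    have "lower q y (rs s a) \<le> q (rs s (vadd X a (rs t y))) - (s * t) * q y"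
      using lower_le[OF q scale_closed[OF a] y, of "s * t" "of_real s"] s t unfolding e by simp
    also have "\<dots> \<le> s * q (vadd X a (rs t y)) - (s * t) * q y"
      using sublinear_scale_le[OF q add_closed[OF a scale_closed[OF y]] s] by simp
    finally show "lower q y (rs s a) / s \<le> q (vadd X a (rs t y)) - t * q y"
      using s by (simp add: field_simps)
  qed simp
  then show "lower q y (rs s a) \<le> s * lower q y a" using s by (simp add: field_simps)
qed

lemma lower_le_self:
  "sublinear q \<Longrightarrow> x \<in> vcarrier X \<Longrightarrow> y \<in> vcarrier X \<Longrightarrow> lower q y x \<le> q x"
  using lower_le[of q x y 0] by (simp add: scale_zero add_zero)

text \<open>The parameter \<open>t = 1\<close> cancels y. For a minimal q this will force
  \<open>q (- y) \<le> - q y\<close>, that is, oddness.\<close>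

lemma lower_minus:
  assumes "sublinear q" "y \<in> vcarrier X" shows "lower q y (vscale X (-1) y) \<le> - q y"
proof -
  have "vadd X (vscale X (-1) y) (rs 1 y) = vzero X"
    using assms by (simp add: scale_one add_commute[OF scale_closed] add_minus)
  then show ?thesis using lower_le[OF assms(1) scale_closed[OF assms(2)] assms(2), of 1 "-1"] assms
    by (simp add: sublinear_zero)
qed

lemma sublinear_norm: "sublinear (vnorm X)"
  by (simp add: sublinear_def norm_triangle norm_scale)

text \<open>Zorn's lemma below the norm. The condition at \<open>- x0\<close> ensures that the
  eventual functional attains the norm at x0; it is inherited by smaller functions, and the starting
  point \<open>lower\<close> of the norm at x0 satisfies it by \<open>lower_minus\<close>.\<close>

lemma ex_minimal_sublinear:
  assumes x0: "x0 \<in> vcarrier X"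
  obtains m where "sublinear m" "\<And>x. x \<in> vcarrier X \<Longrightarrow> m x \<le> vnorm X x"
    "m (vscale X (-1) x0) \<le> - vnorm X x0"
    "\<forall>q. sublinear q \<and> (\<forall>x\<in>vcarrier X. q x \<le> m x) \<longrightarrow> (\<forall>x\<in>vcarrier X. q x = m x)"
proof -
  define A where "A = {q. sublinear q \<and> (\<forall>x\<in>vcarrier X. q x \<le> vnorm X x) \<and>
     q (vscale X (-1) x0) \<le> - vnorm X x0 \<and> (\<forall>x. x \<notin> vcarrier X \<longrightarrow> q x = 0)}"
  define P where "P = (\<lambda>q q' :: 'a \<Rightarrow> real. \<forall>x. q' x \<le> q x)"
  \<comment> \<open>The order compares values on the whole type, so members of \<open>A\<close> are
    required to be 0 off the carrier; \<open>cut\<close> arranges this.\<close>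
  define cut where "cut = (\<lambda>(q::'a\<Rightarrow>real) x. if x \<in> vcarrier X then q x else 0)"
  have cut: "sublinear (cut q)" if "sublinear q" for q
    using that by (auto simp: sublinear_def cut_def add_closed scale_closed)
  have mx0: "vscale X (-1) x0 \<in> vcarrier X" using x0 by (simp add: scale_closed)
  have base: "cut (lower (vnorm X) x0) \<in> A"
    unfolding A_def using cut[OF lower_sublinear[OF sublinear_norm x0]]
      lower_le_self[OF sublinear_norm _ x0] lower_minus[OF sublinear_norm x0] mx0
    by (auto simp: cut_def)
  have "\<exists>m\<in>A. \<forall>a\<in>A. P m a \<longrightarrow> a = m"
  proof (rule predicate_Zorn)
    show "partial_order_on A (relation_of P A)"
      by (rule partial_order_on_relation_ofI) (auto simp: P_def fun_eq_iff intro: order_trans antisym)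
    fix C assume C: "C \<in> Chains (relation_of P A)"
    then have CA: "C \<subseteq> A" and comp: "\<And>p q. p \<in> C \<Longrightarrow> q \<in> C \<Longrightarrow> P p q \<or> P q p"
      by (auto simp: Chains_def relation_of_def)
    show "\<exists>u\<in>A. \<forall>a\<in>C. P a u"
    proof (cases "C = {}")
      case True then show ?thesis using base by auto
    next
      case False
      define u where "u = (\<lambda>x. INF q\<in>C. q x)"
      have sub: "sublinear q" "x \<in> vcarrier X \<Longrightarrow> q x \<le> vnorm X x" "x \<notin> vcarrier X \<Longrightarrow> q x = 0"
        "q (vscale X (-1) x0) \<le> - vnorm X x0" if "q \<in> C" for q x
        using that CA by (auto simp: A_def)
      have bdd: "bdd_below ((\<lambda>q. q x) ` C)" for x
      proof (cases "x \<in> vcarrier X")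
        case True
        show ?thesis
        proof (rule bdd_belowI2)
          fix q assume q: "q \<in> C"
          show "- vnorm X x \<le> q x"
            using sublinear_lower[OF sub(1)[OF q] True] sub(2)[OF q scale_closed[OF True]] norm_minus[OF True]
            by (smt (verit))
        qed
      next
        case False
        then show ?thesis by (intro bdd_belowI2[of _ 0]) (auto simp: sub(3))
      qed
      have ule: "u x \<le> q x" if "q \<in> C" for q x
        unfolding u_def by (rule cINF_lower[OF bdd that])
      have ug: "c \<le> u x" if "\<And>q. q \<in> C \<Longrightarrow> c \<le> q x" for c x
        unfolding u_def by (rule cINF_greatest[OF False that])
      obtain q0 where q0: "q0 \<in> C" using False by auto
      have "sublinear u"
        unfolding sublinear_def
      proof (intro conjI ballI allI impI)
        fix a b assume ab: "a \<in> vcarrier X" "b \<in> vcarrier X"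
        have le: "u (vadd X a b) \<le> p a + q b" if p: "p \<in> C" and q: "q \<in> C" for p q
        proof -
          \<comment> \<open>In a chain the smaller of two members serves for both summands, which
            makes the infimum subadditive.\<close>
          have "\<exists>r\<in>C. r a \<le> p a \<and> r b \<le> q b" using comp[OF p q] p q by (auto simp: P_def)
          then obtain r where r: "r \<in> C" "r a \<le> p a" "r b \<le> q b" by auto
          then show ?thesis using ule[OF r(1), of "vadd X a b"] sublinear_add[OF sub(1)[OF r(1)] ab] by linarith
        qed
        have "u (vadd X a b) - q b \<le> u a" if "q \<in> C" for q
          by (rule ug) (use le[OF _ that] in \<open>force simp: algebra_simps\<close>)
        then have "u (vadd X a b) - u a \<le> u b" by (intro ug) (force simp: algebra_simps)
        then show "u (vadd X a b) \<le> u a + u b" by simp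
      next
        fix t :: real and a assume t: "t > 0" and a: "a \<in> vcarrier X"
        have "u (rs t a) / t \<le> u a"
        proof (rule ug)
          fix q assume q: "q \<in> C"
          show "u (rs t a) / t \<le> q a"
            using ule[OF q, of "rs t a"] sublinear_scale_le[OF sub(1)[OF q] a t] t by (simp add: field_simps)
        qed
        then show "u (rs t a) \<le> t * u a" using t by (simp add: field_simps)
      qed
      moreover have "u x = 0" if "x \<notin> vcarrier X" for x
        using ule[OF q0, of x] ug[of 0 x] sub(3)[OF _ that] q0 by fastforce
      moreover have "u x \<le> vnorm X x" if "x \<in> vcarrier X" for x
        using ule[OF q0, of x] sub(2)[OF q0 that] by linarith
      moreover have "u (vscale X (-1) x0) \<le> - vnorm X x0"
        using ule[OF q0] sub(4)[OF q0] order_trans by blast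
      ultimately have "u \<in> A" by (auto simp: A_def)
      then show ?thesis using ule by (auto simp: P_def)
    qed
  qed
  then obtain m where m: "m \<in> A" "\<And>a. a \<in> A \<Longrightarrow> P m a \<Longrightarrow> a = m" by blast
  show ?thesis
  proof (rule that)
    show "sublinear m" "x \<in> vcarrier X \<Longrightarrow> m x \<le> vnorm X x" "m (vscale X (-1) x0) \<le> - vnorm X x0" for x
      using m(1) by (auto simp: A_def)
    have "q x = m x" if q: "sublinear q" "\<And>x. x \<in> vcarrier X \<Longrightarrow> q x \<le> m x" "x \<in> vcarrier X" for q x
    proof -
    have "cut q \<in> A" using cut[OF q(1)] q(2) m(1) mx0 unfolding A_def by (fastforce simp: cut_def)
    moreover have "P m (cut q)" using q(2) m(1) by (auto simp: P_def A_def cut_def)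
    ultimately have "cut q = m" by (rule m(2))
    then show "q x = m x" using q(3) by (auto simp: cut_def)
    qed
    then show "\<forall>q. sublinear q \<and> (\<forall>x\<in>vcarrier X. q x \<le> m x) \<longrightarrow> (\<forall>x\<in>vcarrier X. q x = m x)" by blast
  qed
qed

text \<open>A minimal \<open>m\<close> equals \<open>lower m y\<close> for every y, so
  \<open>m (- y) \<le> - m y\<close> by \<open>lower_minus\<close>. With
  \<open>sublinear_lower\<close> this makes \<open>m\<close> odd, and an odd subadditive function is
  additive.\<close>

lemma real_hahn_banach:
  assumes x0: "x0 \<in> vcarrier X"
  obtains m where "\<And>x y. x \<in> vcarrier X \<Longrightarrow> y \<in> vcarrier X \<Longrightarrow> m (vadd X x y) = m x + m y"
    "\<And>t x. x \<in> vcarrier X \<Longrightarrow> m (rs t x) = t * m x"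
    "\<And>x. x \<in> vcarrier X \<Longrightarrow> m x \<le> vnorm X x" "m x0 = vnorm X x0"
proof -
  obtain m where m: "sublinear m" "\<And>x. x \<in> vcarrier X \<Longrightarrow> m x \<le> vnorm X x"
    "m (vscale X (-1) x0) \<le> - vnorm X x0"
    "\<forall>q. sublinear q \<and> (\<forall>x\<in>vcarrier X. q x \<le> m x) \<longrightarrow> (\<forall>x\<in>vcarrier X. q x = m x)"
    by (rule ex_minimal_sublinear[OF x0]) (rule that; assumption)
  have "m (vscale X (-1) y) \<le> - m y" if y: "y \<in> vcarrier X" for y
    using lower_minus[OF m(1) y] m(4) lower_sublinear[OF m(1) y] lower_le_self[OF m(1) _ y] scale_closed[OF y]
    by metis
  then have neg: "m (vscale X (-1) y) = - m y" if y: "y \<in> vcarrier X" for y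
    using sublinear_lower[OF m(1) y] y by (smt (verit))
  show ?thesis
  proof (rule that)
    fix x y assume x: "x \<in> vcarrier X" and y: "y \<in> vcarrier X"
    have "vadd X (vadd X x y) (vscale X (-1) y) = x"
      using x y by (simp add: add_assoc scale_closed add_minus add_zero)
    then have "m x \<le> m (vadd X x y) - m y"
      using sublinear_add[OF m(1) add_closed[OF x y] scale_closed[OF y, of "-1"]] neg[OF y] by simp
    then show "m (vadd X x y) = m x + m y" using sublinear_add[OF m(1) x y] by simp
  next
    fix t x assume x: "x \<in> vcarrier X"
    show "m (rs t x) = t * m x"
    proof (cases "t \<ge> 0")
      case True then show ?thesis by (rule sublinear_scale[OF m(1) x])
    next
      case False
      have "rs t x = vscale X (-1) (rs (-t) x)" using x by (simp add: scale_scale)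
      then show ?thesis using neg[OF scale_closed[OF x]] sublinear_scale[OF m(1) x, of "-t"] False by simp
    qed
  next
    have "m x0 \<ge> vnorm X x0" using m(3) neg[OF x0] by simp
    then show "m x0 = vnorm X x0" using m(2)[OF x0] by simp
  qed (rule m(2))
qed

lemma hahn_banach:
  assumes x0: "x0 \<in> vcarrier X"
  obtains f where "f \<in> vcarrier (dual X)" "vnorm (dual X) f \<le> 1" "f x0 = of_real (vnorm X x0)"
proof -
  obtain m where m: "\<And>x y. x \<in> vcarrier X \<Longrightarrow> y \<in> vcarrier X \<Longrightarrow> m (vadd X x y) = m x + m y"
    "\<And>t x. x \<in> vcarrier X \<Longrightarrow> m (rs t x) = t * m x"
    "\<And>x. x \<in> vcarrier X \<Longrightarrow> m x \<le> vnorm X x" "m x0 = vnorm X x0"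
    by (rule real_hahn_banach[OF x0]) (rule that; assumption)
  have "\<exists>g :: 'a \<Rightarrow> 'k. linear_functional X g \<and> (\<forall>x\<in>vcarrier X. re (g x) = m x)"
  proof (cases rule: scalar_cases[where 'k='k])
    case real
    have "m (vscale X c x) = re c * m x" if "x \<in> vcarrier X" for c x
      using m(2)[OF that, of "re c"] by (subst real[of c]) simp
    then have "of_real (m (vscale X c x)) = c * (of_real (m x) :: 'k)" if "x \<in> vcarrier X" for c x
      using that by (subst (2) real[of c]) simp
    then show ?thesis using m(1)
      by (intro exI[of _ "\<lambda>x. of_real (m x)"])
        (auto simp: linear_functional_def re_of_real)
  next
    case (complex j)
    \<comment> \<open>The complex-linear functional with real part \<open>m\<close>: the second term
      contributes nothing to the real part because \<open>kc j\<close> is purely imaginary.\<close>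
    define g where "g = (\<lambda>x. of_real (m x) - j * of_real (m (vscale X j x)))"
    have g_add: "g (vadd X x y) = g x + g y" if "x \<in> vcarrier X" "y \<in> vcarrier X" for x y
      using that by (simp add: g_def m(1) scale_add_right scale_closed algebra_simps)
    have g_real: "g (rs t x) = of_real t * g x" if "x \<in> vcarrier X" for x t
      using that m(2)[OF scale_closed[OF that], of t j] m(2)[OF that, of t]
      by (simp add: g_def scale_scale algebra_simps)
    have g_j: "g (vscale X j x) = j * g x" if "x \<in> vcarrier X" for x
    proof -
      have "m (vscale X (-1) x) = - m x" using m(2)[OF that, of "-1"] by simp
      then have "g (vscale X j x) = of_real (m (vscale X j x)) - j * of_real (- m x)"
        using that by (simp add: g_def scale_scale complex(1))
      also have "\<dots> = - (j * j) * of_real (m (vscale X j x)) + j * of_real (m x)"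
        unfolding complex(1) by simp
      finally show ?thesis by (simp add: g_def algebra_simps)
    qed
    have "g (vscale X c x) = c * g x" if x: "x \<in> vcarrier X" for c x
    proof -
      obtain s t where c: "c = of_real s + of_real t * j" using complex(2) by blast
      have "g (vscale X c x) = g (rs s x) + g (rs t (vscale X j x))"
        using x by (simp add: c scale_add_left g_add[symmetric] scale_closed scale_scale)
      then show ?thesis using x by (simp add: g_real g_j scale_closed c algebra_simps)
    qed
    moreover have "re (g x) = m x" for x
    proof -
      have "kc j * kc j = -1"
        using kc_props(2)[of j j] complex(1) kc_of_real[where 'k='k, of "-1"] by simp
      from arg_cong[OF this, of Re] arg_cong[OF this, of Im]
      have "Re (kc j) * Re (kc j) - Im (kc j) * Im (kc j) = -1" "Re (kc j) = 0 \<or> Im (kc j) = 0"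
        by auto
      then have "Re (kc j) = 0" using zero_le_square[of "Re (kc j)"] by fastforce
      then show ?thesis
        by (simp add: g_def re_def kc_diff kc_props kc_of_real)
    qed
    ultimately show ?thesis using g_add unfolding linear_functional_def
      by (intro exI[of _ g]) blast
  qed
  then obtain g :: "'a \<Rightarrow> 'k" where g: "linear_functional X g" "\<And>x. x \<in> vcarrier X \<Longrightarrow> re (g x) = m x"
    by blast
  \<comment> \<open>Rotating x by a unimodular scalar makes \<open>g x\<close> real and nonnegative,
    so the bound on the real part becomes one on the modulus.\<close>
  have bound: "norm (g x) \<le> 1 * vnorm X x" if x: "x \<in> vcarrier X" for x
  proof -
    obtain s where s: "norm s = 1" "s * g x = of_real (norm (g x))" using phase by blast
    have "norm (g x) = re (g (vscale X s x))"
      using s g(1) x by (simp add: linear_functional_def re_of_real)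
    also have "\<dots> \<le> vnorm X (vscale X s x)" using g(2) m(3) scale_closed[OF x] by simp
    finally show ?thesis using s x by (simp add: norm_scale)
  qed
  define f where "f = (\<lambda>x\<in>vcarrier X. g x)"
  have fd: "f \<in> vcarrier (dual X)"
    by (rule dualI[of _ 1]) (use g bound in \<open>auto simp: f_def linear_functional_def add_closed scale_closed\<close>)
  moreover have "vnorm (dual X) f \<le> 1" by (rule dual_norm_le') (use bound in \<open>auto simp: f_def\<close>)
  \<comment> \<open>The real part already exhausts the largest possible modulus, so nothing is left
    for an imaginary part.\<close>
  moreover have "f x0 = of_real (vnorm X x0)"
    using re_eq_norm[of "g x0"] bound[OF x0] g(2)[OF x0] m(4) x0 by (simp add: f_def)
  ultimately show ?thesis by (rule that)
qed

lemma canonical_isometric: "x \<in> vcarrier X \<Longrightarrow> vnorm (bidual X) (canonical X x) = vnorm X x"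
proof -
  assume x: "x \<in> vcarrier X"
  interpret d: normed_vspace "dual X" by (rule normed_dual)
  obtain f where f: "f \<in> vcarrier (dual X)" "vnorm (dual X) f \<le> 1" "f x = of_real (vnorm X x)"
    using hahn_banach[OF x] .
  have "norm (canonical X x f) \<le> vnorm (bidual X) (canonical X x)"
    using canonical_bidual[OF x] f by (intro d.dual_unit_bound) (auto simp: unit_ball_def)
  then show ?thesis using canonical_bidual[OF x] f norm_nonneg[OF x] by (simp add: canonical_apply)
qed

section \<open>Linear combinations and interpolation by continuous functionals\<close>

lemma lc_closed: "(\<And>i. i < n \<Longrightarrow> b i \<in> vcarrier X) \<Longrightarrow> linear_combination X c b n \<in> vcarrier X"
  by (induction n) (auto simp: zero_closed add_closed scale_closed)

lemma lc_functional:
  "linear_functional X f \<Longrightarrow> (\<And>i. i < n \<Longrightarrow> b i \<in> vcarrier X) \<Longrightarrow>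
   f (linear_combination X c b n) = (\<Sum>i<n. c i * f (b i))"
  by (induction n) (auto simp: lf_zero linear_functional_def lc_closed scale_closed)

lemma lc_cong:
  "(\<And>i. i < n \<Longrightarrow> c i = c' i) \<Longrightarrow> (\<And>i. i < n \<Longrightarrow> b i = b' i) \<Longrightarrow>
   linear_combination X c b n = linear_combination X c' b' n"
  by (induction n) auto

text \<open>A continuous finite-rank operator \<open>P\<close> is corrected one vector at a time: if
  the new vector leaves a residue r different from zero, Hahn-Banach gives a functional with
  \<open>g r = 1\<close>, and r is added with coefficient g composed with identity minus
  \<open>P\<close>.\<close>

lemma finite_interpolation:
  assumes "\<And>i. i < n \<Longrightarrow> b i \<in> vcarrier X"
  shows "\<exists>m c e. (\<forall>k<m. c k \<in> vcarrier (dual X) \<and> e k \<in> vcarrier X) \<and>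
    (\<forall>i<(n::nat). b i = linear_combination X (\<lambda>k. c k (b i)) e m)"
  using assms
proof (induction n)
  case 0 then show ?case by (intro exI[of _ 0]) auto
next
  case (Suc n)
  then obtain m c e where ce: "\<And>k. k < m \<Longrightarrow> c k \<in> vcarrier (dual X)" "\<And>k. k < m \<Longrightarrow> e k \<in> vcarrier X"
    and P: "\<And>i. i < n \<Longrightarrow> b i = linear_combination X (\<lambda>k. c k (b i)) e m"
    by (metis less_Suc_eq)
  define P where "P = (\<lambda>x. linear_combination X (\<lambda>k. c k x) e m)"
  have bn: "b n \<in> vcarrier X" and bi: "\<And>i. i < n \<Longrightarrow> b i \<in> vcarrier X" using Suc by auto
  have Pc: "P x \<in> vcarrier X" for x unfolding P_def using ce by (intro lc_closed)
  define r where "r = vdiff (b n) (P (b n))"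
  have r: "r \<in> vcarrier X" unfolding r_def using bn Pc by (rule diff_closed)
  show ?case
  proof (cases "r = vzero X")
    case True
    then have "b n = P (b n)" using diff_add[OF bn Pc[of "b n"]] zero_add[OF Pc] by (simp add: r_def)
    then show ?thesis using P ce unfolding P_def less_Suc_eq by (intro exI[of _ m] exI[of _ c] exI[of _ e]) auto
  next
    case False
    obtain f where f: "f \<in> vcarrier (dual X)" "f r = of_real (vnorm X r)" using hahn_banach[OF r] by metis
    have nr: "vnorm X r \<noteq> 0" using False norm_eq_zero[OF r] by simp
    define g where "g = vscale (dual X) (of_real (inverse (vnorm X r))) f"
    have g: "g \<in> vcarrier (dual X)" unfolding g_def
      using normed_vspace.scale_closed[OF normed_dual f(1)] .
    have gr: "g r = 1" using nr r f(2) by (simp add: g_def dual_ops)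
    \<comment> \<open>This coefficient vanishes on the vectors already fixed by \<open>P\<close>,
      and on \<open>b n\<close> it equals \<open>g r = 1\<close>.\<close>
    define c' where "c' = (\<lambda>x\<in>vcarrier X. g x - (\<Sum>k<m. c k x * g (e k)))"
    have c'P: "c' x = g x - g (P x)" if "x \<in> vcarrier X" for x
      using that unfolding P_def by (simp add: c'_def lc_functional[OF dual_lf[OF g]] ce)
    have c'd: "c' \<in> vcarrier (dual X)"
    proof (rule dualI[of _ "vnorm (dual X) g + (\<Sum>k<m. vnorm (dual X) (c k) * norm (g (e k)))"])
      show "linear_functional X c'"
        using ce by (auto simp: c'_def linear_functional_def add_closed scale_closed dual_add[OF g] dual_scale[OF g]
          dual_add[OF ce(1)] dual_scale[OF ce(1)] algebra_simps sum.distrib sum_distrib_left)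
      fix x assume x: "x \<in> vcarrier X"
      have "norm (c' x) \<le> norm (g x) + (\<Sum>k<m. norm (c k x * g (e k)))"
        using x by (auto simp: c'_def intro!: norm_triangle_le_diff add_left_mono norm_sum)
      also have "\<dots> \<le> vnorm (dual X) g * vnorm X x +
           (\<Sum>k<m. (vnorm (dual X) (c k) * vnorm X x) * norm (g (e k)))"
        unfolding norm_mult using dual_bound[OF g x] dual_bound[OF ce(1) x]
        by (intro add_mono sum_mono mult_right_mono) auto
      finally show "norm (c' x) \<le> (vnorm (dual X) g + (\<Sum>k<m. vnorm (dual X) (c k) * norm (g (e k)))) * vnorm X x"
        by (simp add: algebra_simps sum_distrib_left)
    qed (simp add: c'_def)
    define C where "C = c(m := c')"
    define E where "E = e(m := r)"
    have PE: "linear_combination X (\<lambda>k. C k x) E (Suc m) = vadd X (P x) (vscale X (c' x) r)" for x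
      unfolding P_def by (simp add: C_def E_def cong: lc_cong)
    have "b i = linear_combination X (\<lambda>k. C k (b i)) E (Suc m)" if "i < Suc n" for i
    proof (cases "i = n")
      case True
      have "c' (b n) = 1" using c'P[OF bn] gr lf_diff[OF dual_lf[OF g] bn Pc[of "b n"]] by (simp add: r_def)
      then show ?thesis unfolding PE True r_def[symmetric]
        using diff_add[OF bn Pc[of "b n"]] by (simp add: scale_one r add_commute[OF Pc r] flip: r_def)
    next
      case False
      then have i: "i < n" using that by simp
      have "P (b i) = b i" using P[OF i] by (simp add: P_def)
      then show ?thesis unfolding PE using c'P[OF bi[OF i]] r bi[OF i] by (simp add: scale_zero add_zero)
    qed
    moreover have "C k \<in> vcarrier (dual X) \<and> E k \<in> vcarrier X" if "k < Suc m" for k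
      using that ce c'd r by (auto simp: C_def E_def less_Suc_eq)
    ultimately show ?thesis by blast
  qed
qed

end

section \<open>Weak* topologies\<close>

context normed_vspace
begin

lemma vcarrier_dual_PiE: "vcarrier (dual X) \<subseteq> topspace (product_topology (\<lambda>_. euclidean) (vcarrier X))"
  using dual_ext by (auto simp: PiE_def)

lemma topspace_weak_star: "topspace (weak_star X) = vcarrier (dual X)"
  unfolding weak_star_def using vcarrier_dual_PiE by (auto simp: topspace_subtopology)

lemma limitin_weak_star:
  "limitin (weak_star X) g l F \<longleftrightarrow> l \<in> vcarrier (dual X) \<and> (\<forall>\<^sub>F t in F. g t \<in> vcarrier (dual X)) \<and>
    (\<forall>x\<in>vcarrier X. ((\<lambda>t. g t x) \<longlongrightarrow> l x) F)"
proof -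
  have *: "\<forall>\<^sub>F t in F. g t \<in> vcarrier (dual X) \<Longrightarrow>
     \<forall>\<^sub>F t in F. g t \<in> topspace (product_topology (\<lambda>_. euclidean :: 'k topology) (vcarrier X))"
    by (erule eventually_mono) (use vcarrier_dual_PiE in auto)
  show ?thesis
    unfolding weak_star_def limitin_subtopology limitin_componentwise limitin_canonical_iff
    using * dual_ext by auto
qed

lemma continuous_weak_star_eval:
  assumes "x \<in> vcarrier X"
  shows "continuous_map (weak_star X) euclidean (\<lambda>f. f x)"
  unfolding weak_star_def
  by (intro continuous_map_from_subtopology continuous_map_product_projection) (use assms in auto)

lemma Hausdorff_weak_star: "Hausdorff_space (weak_star X)"
  unfolding weak_star_def
  by (intro Hausdorff_space_subtopology) (simp add: Hausdorff_space_product_topology)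

lemma unit_ball_dual_iff:
  "f \<in> unit_ball (dual X) \<longleftrightarrow> f \<in> extensional (vcarrier X) \<and> linear_functional X f \<and>
     (\<forall>x\<in>vcarrier X. norm (f x) \<le> vnorm X x)"
proof
  assume f: "f \<in> unit_ball (dual X)"
  then have fd: "f \<in> vcarrier (dual X)" "vnorm (dual X) f \<le> 1" by (auto simp: unit_ball_def)
  have "norm (f x) \<le> vnorm X x" if "x \<in> vcarrier X" for x
    using dual_bound[OF fd(1) that] mult_right_mono[OF fd(2) norm_nonneg[OF that]] by simp
  then show "f \<in> extensional (vcarrier X) \<and> linear_functional X f \<and>
     (\<forall>x\<in>vcarrier X. norm (f x) \<le> vnorm X x)" using fd by (auto simp: dual_ext dual_lf)
next
  assume f: "f \<in> extensional (vcarrier X) \<and> linear_functional X f \<and>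
     (\<forall>x\<in>vcarrier X. norm (f x) \<le> vnorm X x)"
  then have "f \<in> vcarrier (dual X)" by (intro dualI[of _ 1]) auto
  moreover have "vnorm (dual X) f \<le> 1" using f by (intro dual_norm_le') auto
  ultimately show "f \<in> unit_ball (dual X)" by (simp add: unit_ball_def)
qed

text \<open>Banach-Alaoglu: in the product of discs of radius \<open>vnorm X x\<close>, compact by
  Tychonoff, linearity is an intersection of closed conditions on finitely many coordinates
  each.\<close>

lemma compact_dual_ball: "compact_space (subtopology (weak_star X) (unit_ball (dual X)))"
proof -
  let ?P = "product_topology (\<lambda>_. euclidean :: 'k topology) (vcarrier X)"
  let ?B = "\<Pi>\<^sub>E x\<in>vcarrier X. cball (0::'k) (vnorm X x)"
  have ev: "continuous_map ?P euclidean (\<lambda>f. f x)" if "x \<in> vcarrier X" for x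
    using that by (intro continuous_map_product_projection) auto
  have cl1: "closedin ?P {f \<in> topspace ?P. f (vadd X x y) - (f x + f y) \<in> {0}}"
    if "x \<in> vcarrier X" "y \<in> vcarrier X" for x y
    using that add_closed[OF that]
    by (intro closedin_continuous_map_preimage[where Y = euclidean] continuous_intros ev) auto
  have evc: "continuous_map ?P euclidean (\<lambda>f. c * f x)" if "x \<in> vcarrier X" for x c
    using continuous_map_compose[OF ev[OF that], of euclidean "(*) c"]
    by (simp add: comp_def continuous_map_iff_continuous2 continuous_intros)
  have cl2: "closedin ?P {f \<in> topspace ?P. f (vscale X c x) - c * f x \<in> {0}}"
    if "x \<in> vcarrier X" for x c
    using that scale_closed[OF that]
    by (intro closedin_continuous_map_preimage[where Y = euclidean] continuous_map_diff evc ev) auto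
  have "compactin ?P ?B" by (simp add: compactin_PiE compact_cball_scalar)
  moreover have "closedin ?P (\<Inter>x\<in>vcarrier X. \<Inter>y\<in>vcarrier X. \<Inter>c.
     {f \<in> topspace ?P. f (vadd X x y) - (f x + f y) \<in> {0}} \<inter>
     {f \<in> topspace ?P. f (vscale X c x) - c * f x \<in> {0}})" (is "closedin _ ?C")
    by (intro closedin_INT closedin_Int cl1 cl2) (use zero_closed in auto)
  ultimately have "compactin ?P (?C \<inter> ?B)" by (rule closed_Int_compactin[rotated])
  also have "?C \<inter> ?B = unit_ball (dual X)"
    unfolding set_eq_iff unit_ball_dual_iff using zero_closed
    by (auto simp: linear_functional_def PiE_def Pi_def)
  finally have "compact_space (subtopology ?P (unit_ball (dual X)))" by (rule compact_space_subtopology)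
  moreover have "vcarrier (dual X) \<inter> unit_ball (dual X) = unit_ball (dual X)" by (auto simp: unit_ball_def)
  ultimately show ?thesis by (simp add: weak_star_def subtopology_subtopology)
qed

lemma topspace_bidual_ball: "topspace (bidual_ball X) = unit_ball (bidual X)"
proof -
  interpret d: normed_vspace "dual X" by (rule normed_dual)
  show ?thesis unfolding bidual_ball_def topspace_subtopology d.topspace_weak_star by (auto simp: unit_ball_def)
qed

lemma compact_bidual_ball: "compact_space (bidual_ball X)"
  unfolding bidual_ball_def by (rule normed_vspace.compact_dual_ball[OF normed_dual])

lemma Hausdorff_bidual_ball: "Hausdorff_space (bidual_ball X)"
  unfolding bidual_ball_def
  by (intro Hausdorff_space_subtopology normed_vspace.Hausdorff_weak_star[OF normed_dual])

lemma continuous_bidual_eval: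
  "\<phi> \<in> vcarrier (dual X) \<Longrightarrow> continuous_map (bidual_ball X) euclidean (\<lambda>z. z \<phi>)"
  unfolding bidual_ball_def
  by (intro continuous_map_from_subtopology normed_vspace.continuous_weak_star_eval[OF normed_dual])

lemma canonical_unit_ball: "x \<in> unit_ball X \<Longrightarrow> canonical X x \<in> unit_ball (bidual X)"
  using canonical_bidual[of x] by (auto simp: unit_ball_def)

section \<open>Helly's and Goldstine's theorems\<close>

lemma re_cj_self: "re (cj a * a) = (norm a)\<^sup>2" for a :: "'k"
  using norm_diff_square[of a a] by simp

text \<open>Helly's theorem, by minimising the Euclidean distance to \<open>(x'' (\<phi> i))\<^sub>i\<close> over the image of the
  unit ball: at an almost minimiser the functional \<open>\<Sum>i. cj (e i) * \<phi> i\<close>, with \<open>e\<close> the error, almost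
  attains its norm.\<close>

lemma helly:
  fixes n :: nat
  assumes z: "z \<in> unit_ball (bidual X)" and \<phi>: "\<And>i. i < n \<Longrightarrow> \<phi> i \<in> vcarrier (dual X)" and \<epsilon>: "\<epsilon> > 0"
  shows "\<exists>x\<in>unit_ball X. \<forall>i<n. norm (\<phi> i x - z (\<phi> i)) < \<epsilon>"
proof (rule ccontr)
  assume neg: "\<not> ?thesis"
  interpret d: normed_vspace "dual X" by (rule normed_dual)
  have zd: "z \<in> vcarrier (bidual X)" "vnorm (bidual X) z \<le> 1" using z by (auto simp: unit_ball_def)
  define S where "S = (\<lambda>x. \<Sum>i<n. (norm (z (\<phi> i) - \<phi> i x))\<^sup>2)"
  define d where "d = (INF x\<in>unit_ball X. S x)"
  define B where "B = (\<Sum>i<n. (2 * vnorm (dual X) (\<phi> i))\<^sup>2)"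
  have S0: "S x \<ge> 0" for x by (simp add: S_def sum_nonneg)
  have bdd: "bdd_below (S ` unit_ball X)" using S0 by (intro bdd_belowI2[of _ 0]) auto
  have B0: "B \<ge> 0" by (simp add: B_def sum_nonneg)
  have Se: "S x \<ge> \<epsilon>\<^sup>2" if x: "x \<in> unit_ball X" for x
  proof -
    obtain i where i: "i < n" "norm (\<phi> i x - z (\<phi> i)) \<ge> \<epsilon>" using neg x by (auto simp: not_less)
    have "\<epsilon>\<^sup>2 \<le> (norm (z (\<phi> i) - \<phi> i x))\<^sup>2" using i \<epsilon> by (simp add: norm_minus_commute power_mono)
    also have "\<dots> \<le> S x" unfolding S_def using i(1) by (intro member_le_sum) auto
    finally show ?thesis .
  qed
  have d\<epsilon>: "d \<ge> \<epsilon>\<^sup>2" unfolding d_def using Se unit_zero by (intro cINF_greatest) auto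
  \<comment> \<open>The length of the step from x towards y: at most 1 so as to stay in the ball,
    and so small that \<open>\<eta> * (1 + B) / 2\<close> lies below \<open>\<epsilon>^2\<close>.
    \<open>B\<close> bounds the second order term of the squared distance along the step.\<close>
  define \<eta> where "\<eta> = min 1 (\<epsilon>\<^sup>2 / (1 + B))"
  have "\<eta> \<le> \<epsilon>\<^sup>2 / (1 + B)" by (simp add: \<eta>_def)
  then have \<eta>: "\<eta> > 0" "\<eta> \<le> 1" "\<eta> * (1 + B) \<le> \<epsilon>\<^sup>2"
    using \<epsilon> B0 by (simp add: \<eta>_def, simp add: \<eta>_def) (use \<open>\<eta> \<le> _\<close> B0 in \<open>simp add: pos_le_divide_eq\<close>)
  \<comment> \<open>An excess of only \<open>\<eta>^2\<close> over the infimum is still of order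
    \<open>\<eta>\<close> after the division by \<open>\<eta>\<close> in
    \<open>main\<close>.\<close>
  have "\<exists>x\<in>unit_ball X. S x < d + \<eta>\<^sup>2"
    using cINF_less_iff[OF _ bdd, of "d + \<eta>\<^sup>2"] \<eta>(1) unit_zero unfolding d_def by auto
  then obtain x where x: "x \<in> unit_ball X" "S x < d + \<eta>\<^sup>2" by auto
  define e where "e = (\<lambda>i. z (\<phi> i) - \<phi> i x)"
  have Sx: "S x = (\<Sum>i<n. (norm (e i))\<^sup>2)" by (simp add: S_def e_def)
  define f where "f = linear_combination (dual X) (\<lambda>i. cj (e i)) \<phi> n"
  have f: "f \<in> vcarrier (dual X)" unfolding f_def using \<phi> by (rule d.lc_closed)
  have fy: "f y = (\<Sum>i<n. cj (e i) * \<phi> i y)" if y: "y \<in> vcarrier X" for y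
  proof -
    have "canonical X y f = (\<Sum>i<n. cj (e i) * canonical X y (\<phi> i))"
      unfolding f_def by (rule d.lc_functional[OF d.dual_lf[OF canonical_bidual(1)[OF y]]]) (use \<phi> in auto)
    then show ?thesis using f by (simp add: canonical_apply \<phi>)
  qed
  have zf: "z f = (\<Sum>i<n. cj (e i) * z (\<phi> i))"
    unfolding f_def using d.lc_functional[OF d.dual_lf[OF zd(1)] \<phi>] .
  have xc: "x \<in> vcarrier X" "vnorm X x \<le> 1" using x by (auto simp: unit_ball_def)
  have main: "re (f y) - re (f x) \<le> \<eta> * (1 + B) / 2" if y: "y \<in> unit_ball X" for y
  proof -
    have yc: "y \<in> vcarrier X" "vnorm X y \<le> 1" using y by (auto simp: unit_ball_def)
    define w where "w = vadd X (rs (1 - \<eta>) x) (rs \<eta> y)"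
    have "vnorm X w \<le> \<bar>1 - \<eta>\<bar> * vnorm X x + \<bar>\<eta>\<bar> * vnorm X y"
      unfolding w_def using norm_triangle[OF scale_closed[OF xc(1)] scale_closed[OF yc(1)]]
        norm_scale[OF xc(1)] norm_scale[OF yc(1)] by (metis norm_of_real)
    also have "\<dots> \<le> \<bar>1 - \<eta>\<bar> * 1 + \<bar>\<eta>\<bar> * 1" using xc yc by (intro add_mono mult_left_mono) auto
    finally have w: "w \<in> unit_ball X" using \<eta> xc yc by (simp add: unit_ball_def w_def add_closed scale_closed)
    have \<phi>w: "\<phi> i w = \<phi> i x + of_real \<eta> * (\<phi> i y - \<phi> i x)" if "i < n" for i
      unfolding w_def using dual_add[OF \<phi>[OF that] scale_closed[OF xc(1)] scale_closed[OF yc(1)]]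
        dual_scale[OF \<phi>[OF that] xc(1)] dual_scale[OF \<phi>[OF that] yc(1)]
      by (simp add: algebra_simps)
    have term_le: "(norm (z (\<phi> i) - \<phi> i w))\<^sup>2 \<le> (norm (e i))\<^sup>2 - 2 * \<eta> * re (cj (e i) * (\<phi> i y - \<phi> i x))
        + \<eta>\<^sup>2 * (2 * vnorm (dual X) (\<phi> i))\<^sup>2" if i: "i < n" for i
    proof -
      have "z (\<phi> i) - \<phi> i w = e i - of_real \<eta> * (\<phi> i y - \<phi> i x)" by (simp add: \<phi>w i e_def)
      then have "(norm (z (\<phi> i) - \<phi> i w))\<^sup>2 = (norm (e i))\<^sup>2 - 2 * re (of_real \<eta> * (cj (e i) * (\<phi> i y - \<phi> i x)))
         + (\<eta> * norm (\<phi> i y - \<phi> i x))\<^sup>2"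
        by (simp add: norm_diff_square norm_mult power_mult_distrib mult.left_commute)
      moreover have "norm (\<phi> i y - \<phi> i x) \<le> 2 * vnorm (dual X) (\<phi> i)"
        using norm_triangle_ineq4[of "\<phi> i y" "\<phi> i x"] dual_unit_bound[OF \<phi>[OF i] y] dual_unit_bound[OF \<phi>[OF i] x(1)]
        by simp
      then have "(norm (\<phi> i y - \<phi> i x))\<^sup>2 \<le> (2 * vnorm (dual X) (\<phi> i))\<^sup>2" by (intro power_mono) auto
      then have "(\<eta> * norm (\<phi> i y - \<phi> i x))\<^sup>2 \<le> \<eta>\<^sup>2 * (2 * vnorm (dual X) (\<phi> i))\<^sup>2"
        unfolding power_mult_distrib by (intro mult_left_mono) auto
      ultimately show ?thesis by (simp add: re_of_real_mult)
    qed
    have "d \<le> S w" unfolding d_def using bdd w by (rule cINF_lower)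
    also have "\<dots> \<le> (\<Sum>i<n. (norm (e i))\<^sup>2 - 2 * \<eta> * re (cj (e i) * (\<phi> i y - \<phi> i x))
        + \<eta>\<^sup>2 * (2 * vnorm (dual X) (\<phi> i))\<^sup>2)"
      unfolding S_def using term_le by (intro sum_mono) auto
    also have "\<dots> = S x - 2 * \<eta> * (re (f y) - re (f x)) + \<eta>\<^sup>2 * B"
      unfolding fy[OF yc(1)] fy[OF xc(1)] Sx B_def re_sum
      by (simp add: sum.distrib sum_subtractf sum_distrib_left right_diff_distrib re_diff)
    also have "\<dots> \<le> d + \<eta>\<^sup>2 - 2 * \<eta> * (re (f y) - re (f x)) + \<eta>\<^sup>2 * B" using x by simp
    finally have "\<eta> * (2 * (re (f y) - re (f x))) \<le> \<eta> * (\<eta> * (1 + B))"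
      by (simp add: power2_eq_square algebra_simps)
    then show ?thesis using \<eta>(1) by simp
  qed
  have "vnorm (dual X) f \<le> re (f x) + \<eta> * (1 + B) / 2"
  proof (rule dual_norm_le)
    fix y assume y: "y \<in> unit_ball X"
    then have yc: "y \<in> vcarrier X" "vnorm X y \<le> 1" by (auto simp: unit_ball_def)
    obtain s where s: "norm s = 1" "s * f y = of_real (norm (f y))" using phase by blast
    have "vscale X s y \<in> unit_ball X" using yc s by (simp add: unit_ball_def scale_closed norm_scale)
    from main[OF this] show "norm (f y) \<le> re (f x) + \<eta> * (1 + B) / 2"
      using dual_scale[OF f yc(1), of s] s by (simp add: re_of_real)
  qed
  moreover have "re (z f) \<le> vnorm (dual X) f"
    using abs_re_le[of "z f"] d.dual_bound[OF zd(1) f] mult_right_mono[OF zd(2) dual_norm_nonneg[OF f]]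
    by simp
  \<comment> \<open>The gap is exactly the squared distance, while norm at most 1 of z and the
    almost attained norm of f bound it by half of \<open>\<epsilon>^2\<close>: the
    contradiction.\<close>
  moreover have "re (z f) - re (f x) = S x"
  proof -
    have "re (z f) - re (f x) = (\<Sum>i<n. re (cj (e i) * e i))"
      unfolding zf fy[OF xc(1)] re_sum by (simp add: e_def right_diff_distrib re_diff sum_subtractf)
    then show ?thesis by (simp add: re_cj_self S_def e_def)
  qed
  ultimately have "\<epsilon>\<^sup>2 \<le> \<eta> * (1 + B) / 2" using Se[OF x(1)] by simp
  moreover have "\<epsilon>\<^sup>2 > 0" using \<epsilon> by simp
  ultimately show False using \<eta>(3) by linarith
qed

text \<open>The sets \<open>V (A, \<epsilon>)\<close> of ball vectors close to z on finitely many
  functionals form a filter base. Helly's theorem makes each of them nonempty, so the filter they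
  generate is proper and serves as the net.\<close>

lemma goldstine:
  assumes z: "z \<in> unit_ball (bidual X)"
  shows "\<exists>F. bounded_net_to X F z"
proof -
  interpret d: normed_vspace "dual X" by (rule normed_dual)
  define V where "V = (\<lambda>(A, \<epsilon>). {x \<in> unit_ball X. \<forall>\<phi>\<in>A. norm (\<phi> x - z \<phi>) < \<epsilon>})"
  define I where "I = {(A, \<epsilon>::real). finite A \<and> A \<subseteq> vcarrier (dual X) \<and> \<epsilon> > 0}"
  define F where "F = (INF p\<in>I. principal (V p))"
  have ne: "V p \<noteq> {}" if pI: "p \<in> I" for p
  proof -
    obtain A \<epsilon> where p: "p = (A, \<epsilon>)" "finite A" "A \<subseteq> vcarrier (dual X)" "\<epsilon> > 0"
      using pI by (auto simp: I_def)
    obtain n :: nat and \<phi> where A: "A = \<phi> ` {i. i < n}" using finite_imp_nat_seg_image_inj_on[OF p(2)] by auto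
    obtain x where "x \<in> unit_ball X" "\<forall>i<n. norm (\<phi> i x - z (\<phi> i)) < \<epsilon>"
      using helly[OF z, of n \<phi> \<epsilon>] p A by auto
    then show ?thesis by (auto simp: V_def p(1) A)
  qed
  have I0: "({}, 1) \<in> I" by (simp add: I_def)
  have ev: "eventually P F \<longleftrightarrow> (\<exists>p\<in>I. eventually P (principal (V p)))" for P
    unfolding F_def
  proof (rule eventually_INF_base)
    fix a b assume "a \<in> I" "b \<in> I"
    then show "\<exists>x\<in>I. principal (V x) \<le> inf (principal (V a)) (principal (V b))"
      by (intro bexI[of _ "(fst a \<union> fst b, min (snd a) (snd b))"]) (auto simp: I_def V_def)
  qed (use I0 in auto)
  have "F \<noteq> bot"
    unfolding trivial_limit_def ev using ne by (auto simp: eventually_principal)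
  moreover have ub: "\<forall>\<^sub>F x in F. x \<in> vcarrier X \<and> vnorm X x \<le> 1"
    unfolding ev using I0 by (intro bexI[of _ "({}, 1)"]) (auto simp: eventually_principal V_def unit_ball_def)
  moreover have "limitin (weak_star (dual X)) (canonical X) z F"
    unfolding d.limitin_weak_star
  proof (intro conjI ballI)
    show "z \<in> vcarrier (bidual X)" using z by (simp add: unit_ball_def)
    show "\<forall>\<^sub>F t in F. canonical X t \<in> vcarrier (bidual X)"
      using ub by (rule eventually_mono) (simp add: canonical_bidual)
    fix \<phi> assume \<phi>: "\<phi> \<in> vcarrier (dual X)"
    show "((\<lambda>t. canonical X t \<phi>) \<longlongrightarrow> z \<phi>) F"
      unfolding tendsto_iff dist_norm
    proof (intro allI impI)
      fix e :: real assume "e > 0"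
      then show "\<forall>\<^sub>F x in F. norm (canonical X x \<phi> - z \<phi>) < e"
        unfolding ev using \<phi> by (intro bexI[of _ "({\<phi>}, e)"])
          (auto simp: eventually_principal V_def canonical_apply I_def)
    qed
  qed
  ultimately show ?thesis unfolding bounded_net_to_def by blast
qed

end

section \<open>Regular Borel measures as limits of discrete measures\<close>

text \<open>The indices with \<open>i / m \<le> t\<close> run from 1 to the floor of
  \<open>m t\<close>. Applied pointwise to a function, this replaces its integral by measures of
  superlevel sets, up to \<open>1 / m\<close>.\<close>

lemma step_sum:
  fixes t :: real and m :: nat
  assumes "0 \<le> t" "t \<le> 1" "m > 0"
  shows "(\<Sum>i=1..m. of_bool (real i / m \<le> t)) / m \<le> t"
    and "t \<le> 1 / m + (\<Sum>i=1..m. of_bool (real i / m \<le> t)) / m"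
proof -
  have "{i\<in>{1..m}. real i / m \<le> t} = {1..nat \<lfloor>m * t\<rfloor>}"
  proof (intro set_eqI iffI)
    fix i assume "i \<in> {i\<in>{1..m}. real i / m \<le> t}"
    then have "1 \<le> i" "real i \<le> m * t" using assms by (auto simp: field_simps)
    then show "i \<in> {1..nat \<lfloor>m * t\<rfloor>}" by (simp add: le_nat_floor)
  next
    fix i assume i: "i \<in> {1..nat \<lfloor>m * t\<rfloor>}"
    have "real (nat \<lfloor>m * t\<rfloor>) \<le> m * t" using assms by (simp add: of_nat_floor)
    then have "real i \<le> m * t" using i by (meson atLeastAtMost_iff of_nat_mono order_trans)
    moreover have "m * t \<le> m" using assms by (simp add: mult_left_le)
    moreover from calculation have "i \<le> m" by linarith
    ultimately show "i \<in> {i\<in>{1..m}. real i / m \<le> t}" using i assms by (auto simp: field_simps)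
  qed
  then have "(\<Sum>i=1..m. of_bool (real i / m \<le> t)) = real (nat \<lfloor>m * t\<rfloor>)"
    by (simp add: of_bool_def sum.If_cases Int_def)
  moreover have "real (nat \<lfloor>m * t\<rfloor>) \<le> m * t" "m * t \<le> real (nat \<lfloor>m * t\<rfloor>) + 1"
    using assms by (auto simp: of_nat_floor)
  ultimately show "(\<Sum>i=1..m. of_bool (real i / m \<le> t)) / m \<le> t"
    "t \<le> 1 / m + (\<Sum>i=1..m. of_bool (real i / m \<le> t)) / m"
    using assms by (auto simp: field_simps)
qed

text \<open>The measures live on all subsets of the space, so that a limit can be taken set by set
  before a sigma-algebra is chosen.\<close>

locale measure_sequence =
  fixes T :: "'p topology" and D :: "nat \<Rightarrow> 'p measure" and B :: real
  assumes compact: "compact_space T" and Hausdorff: "Hausdorff_space T"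
    and sets_D: "\<And>n. sets (D n) = Pow (topspace T)"
    and finite_D: "\<And>n. finite_measure (D n)"
    and D_le: "\<And>n. measure (D n) (topspace T) \<le> B"
begin

abbreviation "K \<equiv> topspace T"

lemma space_D: "space (D n) = K"
  using sets_eq_imp_space_eq[of "D n" "count_space K"] sets_D[of n] by simp

text \<open>A cluster point in the product of copies of \<open>{0..B}\<close> over all subsets,
  compact by Tychonoff. It need not be the limit of a subsequence, hence the form with finitely many
  sets at a time and indices beyond any k.\<close>

lemma ex_limit_content:
  "\<exists>\<nu> :: 'p set \<Rightarrow> real. \<forall>\<A> \<epsilon> k. finite \<A> \<and> \<A> \<subseteq> Pow K \<and> \<epsilon> > 0 \<longrightarrow>
     (\<exists>n\<ge>k. \<forall>E\<in>\<A>. \<bar>\<nu> E - measure (D n) E\<bar> < \<epsilon>)"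
proof -
  let ?P = "product_topology (\<lambda>_. top_of_set {0..B}) (Pow K)"
  define d where "d = (\<lambda>n. \<lambda>E\<in>Pow K. measure (D n) E)"
  define C where "C = (\<lambda>k. ?P closure_of (d ` {k..}))"
  have dP: "d n \<in> topspace ?P" for n
  proof -
    have "measure (D n) E \<le> B" if "E \<subseteq> K" for E
      using finite_measure.finite_measure_mono[OF finite_D[of n], of E K] D_le[of n] sets_D that
      by fastforce
    then show ?thesis by (auto simp: d_def)
  qed
  have cs: "compact_space ?P" by (simp add: compact_space_product_topology compact_space_subtopology)
  have "\<Inter> (range C) \<noteq> {}"
  proof (rule compact_space_imp_nest[OF cs])
    show "closedin ?P (C n)" for n by (simp add: C_def)
    show "C n \<noteq> {}" for n
      using closure_of_subset[of "d ` {n..}" ?P] dP by (force simp: C_def)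
    show "antimono C" unfolding C_def by (intro antimonoI closure_of_mono) auto
  qed
  then obtain \<nu> where \<nu>: "\<And>k. \<nu> \<in> ?P closure_of (d ` {k..})" by (auto simp: C_def)
  have "\<exists>n\<ge>k. \<forall>E\<in>\<A>. \<bar>\<nu> E - measure (D n) E\<bar> < \<epsilon>"
    if \<A>: "finite \<A>" "\<A> \<subseteq> Pow K" and \<epsilon>: "\<epsilon> > 0" for \<A> k \<epsilon>
  proof -
    define S where "S = (\<lambda>E. if E \<in> \<A> then {0..B} \<inter> ball (\<nu> E) \<epsilon> else {0..B})"
    have "{E \<in> Pow K. S E \<noteq> topspace (top_of_set {0..B})} \<subseteq> \<A>" by (auto simp: S_def)
    then have "openin ?P (Pi\<^sub>E (Pow K) S)"
      unfolding openin_PiE_gen using finite_subset[OF _ \<A>(1)]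
      by (auto simp: S_def intro!: openin_open_Int)
    moreover have "\<nu> \<in> Pi\<^sub>E (Pow K) S"
      using \<nu>[of k] \<epsilon> unfolding in_closure_of by (auto simp: S_def)
    ultimately obtain y where "y \<in> d ` {k..}" "y \<in> Pi\<^sub>E (Pow K) S"
      using \<nu>[of k] unfolding in_closure_of by blast
    then obtain n where n: "n \<ge> k" "d n \<in> Pi\<^sub>E (Pow K) S" by auto
    have "\<bar>\<nu> E - measure (D n) E\<bar> < \<epsilon>" if E: "E \<in> \<A>" for E
    proof -
      have "E \<in> Pow K" using E \<A> by auto
      then have "d n E \<in> S E" using n(2) by (rule PiE_mem[rotated])
      then show ?thesis using E \<open>E \<in> Pow K\<close> by (auto simp: S_def d_def dist_real_def)
    qed
    then show ?thesis using n by auto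
  qed
  then show ?thesis by blast
qed

definition \<nu> :: "'p set \<Rightarrow> real" where
  "\<nu> = (SOME \<nu>. \<forall>\<A> \<epsilon> k. finite \<A> \<and> \<A> \<subseteq> Pow K \<and> \<epsilon> > 0 \<longrightarrow>
     (\<exists>n\<ge>k. \<forall>E\<in>\<A>. \<bar>\<nu> E - measure (D n) E\<bar> < \<epsilon>))"

lemma \<nu>_approx:
  "finite \<A> \<Longrightarrow> \<A> \<subseteq> Pow K \<Longrightarrow> \<epsilon> > 0 \<Longrightarrow> \<exists>n\<ge>k. \<forall>E\<in>\<A>. \<bar>\<nu> E - measure (D n) E\<bar> < \<epsilon>"
  using someI_ex[OF ex_limit_content] unfolding \<nu>_def[symmetric] by blast

text \<open>Finite additivity involves three sets at a time, so it passes to a cluster point.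
  Countable additivity need not, which is why \<open>\<mu>\<close> is built below.\<close>

lemma \<nu>_Un: assumes "E \<subseteq> K" "F \<subseteq> K" "E \<inter> F = {}" shows "\<nu> (E \<union> F) = \<nu> E + \<nu> F"
proof -
  have "\<bar>\<nu> (E \<union> F) - (\<nu> E + \<nu> F)\<bar> \<le> e" if e: "e > 0" for e
  proof -
    obtain n where n: "\<bar>\<nu> (E \<union> F) - measure (D n) (E \<union> F)\<bar> < e/3" "\<bar>\<nu> E - measure (D n) E\<bar> < e/3"
      "\<bar>\<nu> F - measure (D n) F\<bar> < e/3"
      using \<nu>_approx[of "{E \<union> F, E, F}" "e/3" 0] assms e by auto
    have "measure (D n) (E \<union> F) = measure (D n) E + measure (D n) F"
      using assms by (intro finite_measure.finite_measure_Union[OF finite_D]) (auto simp: sets_D)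
    then show ?thesis using n by linarith
  qed
  then have "\<bar>\<nu> (E \<union> F) - (\<nu> E + \<nu> F)\<bar> \<le> 0" by (rule field_le_epsilon) auto
  then show ?thesis by simp
qed

lemma \<nu>_nonneg: assumes "E \<subseteq> K" shows "\<nu> E \<ge> 0"
proof -
  have le: "- \<nu> E \<le> e" if e: "e > 0" for e
  proof -
    obtain n where "\<bar>\<nu> E - measure (D n) E\<bar> < e"
      using \<nu>_approx[of "{E}" e 0] assms e by auto
    then show ?thesis using measure_nonneg[of "D n" E] by linarith
  qed
  show ?thesis using le[of "- \<nu> E / 2"] by linarith
qed

lemma \<nu>_mono: assumes "E \<subseteq> F" "F \<subseteq> K" shows "\<nu> E \<le> \<nu> F"
proof -
  have "F - E \<subseteq> K" "E \<union> (F - E) = F" using assms by auto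
  then show ?thesis using \<nu>_Un[of E "F - E"] \<nu>_nonneg[of "F - E"] assms by (simp add: Diff_disjoint)
qed

lemma \<nu>_empty: "\<nu> {} = 0"
  using \<nu>_Un[of "{}" "{}"] by simp

lemma \<nu>_subadd: assumes "E \<subseteq> K" "F \<subseteq> K" shows "\<nu> (E \<union> F) \<le> \<nu> E + \<nu> F"
proof -
  have "F - E \<subseteq> K" "E \<union> (F - E) = E \<union> F" "F - E \<subseteq> F" using assms by auto
  then show ?thesis using \<nu>_Un[of E "F - E"] \<nu>_mono[of "F - E" F] assms by (simp add: Diff_disjoint)
qed

section \<open>Regularisation of the limit content to a Borel measure\<close>

definition \<tau> :: "'p set \<Rightarrow> ennreal" where
  "\<tau> U = (SUP C\<in>{C. closedin T C \<and> C \<subseteq> U}. ennreal (\<nu> C))"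

text \<open>As in the proof of the Riesz representation theorem, \<open>\<tau>\<close> is an inner
  content on open sets and \<open>\<mu>\<close> its outer extension; \<open>\<nu>\<close> enters
  only through closed sets.\<close>

definition \<mu> :: "'p set \<Rightarrow> ennreal" where
  "\<mu> E = (INF U\<in>{U. openin T U \<and> E \<subseteq> U}. \<tau> U)"

lemma \<tau>_upper: "closedin T C \<Longrightarrow> C \<subseteq> U \<Longrightarrow> ennreal (\<nu> C) \<le> \<tau> U"
  unfolding \<tau>_def by (rule SUP_upper) auto

lemma \<tau>_mono: "U \<subseteq> V \<Longrightarrow> \<tau> U \<le> \<tau> V"
  unfolding \<tau>_def by (rule SUP_subset_mono) auto

lemma \<mu>_le: "openin T U \<Longrightarrow> E \<subseteq> U \<Longrightarrow> \<mu> E \<le> \<tau> U"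
  unfolding \<mu>_def by (rule INF_lower) auto

lemma \<mu>_open: "openin T U \<Longrightarrow> \<mu> U = \<tau> U"
  by (intro antisym \<mu>_le order_refl) (auto simp: \<mu>_def intro!: INF_greatest \<tau>_mono)

lemma \<tau>_space: "\<tau> K = ennreal (\<nu> K)"
proof (rule antisym)
  show "\<tau> K \<le> ennreal (\<nu> K)"
    unfolding \<tau>_def using \<nu>_mono closedin_subset by (intro SUP_least) (auto intro!: ennreal_leI)
qed (intro \<tau>_upper, auto)

text \<open>Equality can fail: mass approaching C from outside is counted by \<open>\<mu>\<close>
  but not by \<open>\<nu>\<close>. The one-sided bound suffices, since it will be used for the
  superlevel sets of both f and \<open>1 - f\<close>.\<close>

lemma \<mu>_closed_ge: "closedin T C \<Longrightarrow> ennreal (\<nu> C) \<le> \<mu> C"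
  unfolding \<mu>_def by (intro INF_greatest \<tau>_upper) auto

lemma \<mu>_finite: "\<mu> E < \<infinity>" if "E \<subseteq> K"
  using \<mu>_le[of K E] that \<tau>_space by (simp add: order_le_less_trans)

text \<open>Normality separates the part of C outside the first n sets from the part outside
  \<open>U n\<close>. Removing the separating open sets writes C as a union of two closed sets, one
  covered by the first n sets and one inside \<open>U n\<close>.\<close>

lemma \<tau>_finite_subadd:
  "closedin T C \<Longrightarrow> (\<And>i. i < n \<Longrightarrow> openin T (U i)) \<Longrightarrow> C \<subseteq> (\<Union>i<n. U i) \<Longrightarrow>
     ennreal (\<nu> C) \<le> (\<Sum>i<(n::nat). \<tau> (U i))"
proof (induction n arbitrary: C)
  case 0 then show ?case by (simp add: \<nu>_empty)
next
  case (Suc n)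
  have "normal_space T" using compact Hausdorff by (simp add: compact_Hausdorff_or_regular_imp_normal_space)
  moreover have "closedin T (C - (\<Union>i<n. U i))" "closedin T (C - U n)"
    using Suc.prems by (auto intro!: closedin_diff)
  moreover have "disjnt (C - (\<Union>i<n. U i)) (C - U n)"
    using Suc.prems(3) by (auto simp: disjnt_def lessThan_Suc)
  ultimately obtain V W where VW: "openin T V" "openin T W" "C - (\<Union>i<n. U i) \<subseteq> V" "C - U n \<subseteq> W" "disjnt V W"
    unfolding normal_space_def by meson
  have cl: "closedin T (C - V)" "closedin T (C - W)" using Suc.prems VW by (auto intro!: closedin_diff)
  have "C = (C - V) \<union> (C - W)" using VW by (auto simp: disjnt_def)
  then have "ennreal (\<nu> C) \<le> ennreal (\<nu> (C - V) + \<nu> (C - W))"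
    using \<nu>_subadd[of "C - V" "C - W"] cl[THEN closedin_subset] by (simp add: ennreal_leI)
  also have "\<dots> = ennreal (\<nu> (C - V)) + ennreal (\<nu> (C - W))"
    using cl[THEN closedin_subset] by (intro ennreal_plus \<nu>_nonneg)
  also have "\<dots> \<le> (\<Sum>i<n. \<tau> (U i)) + \<tau> (U n)"
    using Suc.prems VW cl by (intro add_mono Suc.IH \<tau>_upper) auto
  finally show ?case by simp
qed

text \<open>A closed subset of the union is compact and therefore covered by finitely many of the
  \<open>U i\<close>.\<close>

lemma \<tau>_countable_subadd:
  assumes U: "\<And>i::nat. openin T (U i)" shows "\<tau> (\<Union>i. U i) \<le> (\<Sum>i. \<tau> (U i))"
  unfolding \<tau>_def[of "\<Union>i. U i"]
proof (rule SUP_least)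
  fix C assume "C \<in> {C. closedin T C \<and> C \<subseteq> (\<Union>i. U i)}"
  then have C: "closedin T C" "C \<subseteq> (\<Union>i. U i)" by auto
  have "compactin T C" using C compact by (simp add: closedin_compact_space)
  then obtain \<F> where \<F>: "finite \<F>" "\<F> \<subseteq> range U" "C \<subseteq> \<Union>\<F>"
    using compactinD[of T C "range U"] C U by auto
  obtain J where J: "finite J" "\<F> = U ` J" using finite_subset_image[OF \<F>(1,2)] by auto
  obtain n where n: "J \<subseteq> {..<n}" using J(1) finite_nat_iff_bounded by auto
  have "C \<subseteq> (\<Union>i<n. U i)" using \<F>(3) n unfolding J(2) by blast
  then have "ennreal (\<nu> C) \<le> (\<Sum>i<n. \<tau> (U i))" using C U by (intro \<tau>_finite_subadd) auto
  also have "\<dots> \<le> (\<Sum>i. \<tau> (U i))" by (rule sum_le_suminf) auto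
  finally show "ennreal (\<nu> C) \<le> (\<Sum>i. \<tau> (U i))" .
qed

lemma outer_measure_\<mu>: "outer_measure_space (Pow K) \<mu>"
  unfolding outer_measure_space_def positive_def increasing_def countably_subadditive_def
proof (intro conjI allI impI ballI)
  show "\<mu> {} = 0" unfolding \<mu>_open[OF openin_empty] by (simp add: \<tau>_def \<nu>_empty)
  show "\<mu> x \<le> \<mu> y" if "x \<subseteq> y" for x y
    unfolding \<mu>_def using that by (intro INF_superset_mono) auto
  fix A :: "nat \<Rightarrow> 'p set" assume A: "range A \<subseteq> Pow K"
  show "\<mu> (\<Union> (range A)) \<le> (\<Sum>i. \<mu> (A i))"
  proof (rule ennreal_le_epsilon)
    fix e :: real assume e: "e > 0"
    have "\<exists>U. openin T U \<and> A i \<subseteq> U \<and> \<tau> U \<le> \<mu> (A i) + ennreal (e * (1/2)^Suc i)" for i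
    proof -
      have "ennreal (e * (1/2)^Suc i) > 0" using e by simp
      then have "\<mu> (A i) < \<mu> (A i) + ennreal (e * (1/2)^Suc i)"
        using \<mu>_finite[of "A i"] A by (auto simp: ennreal_add_left_cancel_less less_top)
      from this[unfolded \<mu>_def[of "A i"] INF_less_iff] show ?thesis
        unfolding \<mu>_def[of "A i", symmetric] by (auto intro: less_imp_le)
    qed
    then obtain U where U: "\<And>i. openin T (U i)" "\<And>i. A i \<subseteq> U i"
      "\<And>i. \<tau> (U i) \<le> \<mu> (A i) + ennreal (e * (1/2)^Suc i)" by metis
    have "\<mu> (\<Union> (range A)) \<le> \<tau> (\<Union>i. U i)" using U by (intro \<mu>_le) auto
    also have "\<dots> \<le> (\<Sum>i. \<tau> (U i))" by (rule \<tau>_countable_subadd[OF U(1)])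
    also have "\<dots> \<le> (\<Sum>i. \<mu> (A i) + ennreal (e * (1/2)^Suc i))" by (intro suminf_le U) auto
    also have "\<dots> = (\<Sum>i. \<mu> (A i)) + (\<Sum>i. ennreal (e * (1/2)^Suc i))" by (rule suminf_add[symmetric]) auto
    also have "(\<Sum>i. ennreal (e * (1/2)^Suc i)) = ennreal e"
      using sums_mult[OF power_half_series, of e] e by (intro suminf_ennreal_eq) auto
    finally show "\<mu> (\<Union> (range A)) \<le> (\<Sum>i. \<mu> (A i)) + ennreal e" .
  qed
qed

lemma \<mu>_subadd: assumes "E \<subseteq> K" "F \<subseteq> K" shows "\<mu> (E \<union> F) \<le> \<mu> E + \<mu> F"
proof -
  interpret sigma_algebra K "Pow K" by (rule sigma_algebra_Pow)
  have "subadditive (Pow K) \<mu>"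
    using outer_measure_\<mu> unfolding outer_measure_space_def
    by (intro countably_subadditive_subadditive) auto
  then have "\<mu> (E \<union> (F - E)) \<le> \<mu> E + \<mu> (F - E)"
    using assms unfolding subadditive_def by blast
  moreover have "\<mu> (F - E) \<le> \<mu> F"
    using outer_measure_\<mu> assms unfolding outer_measure_space_def increasing_def by blast
  ultimately show ?thesis by (metis Un_Diff_cancel add_left_mono order_trans)
qed

text \<open>For an open V above x, take a closed C in \<open>V \<inter> U\<close> and then a closed
  C' in the open set \<open>V - C\<close>, which contains the part of x outside U. The two are
  disjoint, so \<open>\<nu>\<close> adds on them and stays below \<open>\<tau> V\<close>.\<close>

lemma open_lambda:
  assumes U: "openin T U" shows "U \<in> lambda_system K (Pow K) \<mu>"
  unfolding lambda_system_def
proof (intro CollectI conjI ballI)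
  have UK: "U \<subseteq> K" using U by (rule openin_subset)
  then show "U \<in> Pow K" by simp
  fix x assume "x \<in> Pow K"
  then have x: "x \<subseteq> K" by simp
  show "\<mu> (U \<inter> x) + \<mu> ((K - U) \<inter> x) = \<mu> x"
  proof (rule antisym)
    have "x = (U \<inter> x) \<union> ((K - U) \<inter> x)" using x by auto
    then show "\<mu> x \<le> \<mu> (U \<inter> x) + \<mu> ((K - U) \<inter> x)" using \<mu>_subadd[of "U \<inter> x" "(K - U) \<inter> x"] x by auto
    show "\<mu> (U \<inter> x) + \<mu> ((K - U) \<inter> x) \<le> \<mu> x"
      unfolding \<mu>_def[of x]
    proof (rule INF_greatest)
      fix V assume "V \<in> {V. openin T V \<and> x \<subseteq> V}"
      then have V: "openin T V" "x \<subseteq> V" by auto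
      have le: "ennreal (\<nu> C) + \<mu> ((K - U) \<inter> x) \<le> \<tau> V" if C: "closedin T C" "C \<subseteq> V \<inter> U" for C
      proof -
        have "\<mu> ((K - U) \<inter> x) \<le> \<tau> (V - C)" using C V by (intro \<mu>_le openin_diff) auto
        moreover have "ennreal (\<nu> C) + \<tau> (V - C) \<le> \<tau> V"
          unfolding \<tau>_def[of "V - C"]
        proof (subst ennreal_SUP_add_right)
          show "{Ca. closedin T Ca \<and> Ca \<subseteq> V - C} \<noteq> {}" using closedin_empty by blast
          show "(SUP C'\<in>{Ca. closedin T Ca \<and> Ca \<subseteq> V - C}. ennreal (\<nu> C) + ennreal (\<nu> C')) \<le> \<tau> V"
          proof (rule SUP_least)
            fix C' assume C': "C' \<in> {Ca. closedin T Ca \<and> Ca \<subseteq> V - C}"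
            have "ennreal (\<nu> C) + ennreal (\<nu> C') = ennreal (\<nu> (C \<union> C'))"
              using C C' closedin_subset by (subst \<nu>_Un) (auto simp: ennreal_plus \<nu>_nonneg)
            also have "\<dots> \<le> \<tau> V" using C C' by (intro \<tau>_upper) auto
            finally show "ennreal (\<nu> C) + ennreal (\<nu> C') \<le> \<tau> V" .
          qed
        qed
        ultimately show ?thesis using add_left_mono order_trans by blast
      qed
      have "\<mu> (U \<inter> x) + \<mu> ((K - U) \<inter> x) \<le> \<tau> (V \<inter> U) + \<mu> ((K - U) \<inter> x)"
        using V U by (intro add_right_mono \<mu>_le) auto
      also have "\<dots> \<le> \<tau> V"
        unfolding \<tau>_def[of "V \<inter> U"]
      proof (subst ennreal_SUP_add_left[symmetric])
        show "{C. closedin T C \<and> C \<subseteq> V \<inter> U} \<noteq> {}" using closedin_empty by blast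
      qed (auto intro!: SUP_least le)
      finally show "\<mu> (U \<inter> x) + \<mu> ((K - U) \<inter> x) \<le> \<tau> V" .
    qed
  qed
qed

definition M :: "'p measure" where "M = measure_of K (borel_sets T) \<mu>"

lemma borel_sets_Pow: "borel_sets T \<subseteq> Pow K"
proof -
  have "{U. openin T U} \<subseteq> Pow K" using openin_subset by auto
  from sigma_sets_into_sp[OF this] show ?thesis by (auto simp: borel_sets_def)
qed

lemma sigma_algebra_borel: "sigma_algebra K (borel_sets T)"
  unfolding borel_sets_def by (rule sigma_algebra_sigma_sets) (auto dest: openin_subset)

lemma borel_open: "openin T U \<Longrightarrow> U \<in> borel_sets T"
  unfolding borel_sets_def by auto

lemma borel_closed: "closedin T C \<Longrightarrow> C \<in> borel_sets T"
proof -
  assume C: "closedin T C"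
  then have "K - C \<in> borel_sets T" by (intro borel_open) auto
  then have "K - (K - C) \<in> borel_sets T"
    by (metis borel_sets_def sigma_sets.Compl)
  then show ?thesis using closedin_subset[OF C] by (simp add: double_diff)
qed

lemma sets_M: "sets M = borel_sets T" and space_M: "space M = K"
  unfolding M_def using borel_sets_Pow sigma_algebra.sigma_sets_eq[OF sigma_algebra_borel]
  by (simp_all add: sets_measure_of)

lemma emeasure_M: assumes "E \<in> borel_sets T" shows "emeasure M E = \<mu> E"
proof -
  interpret P: sigma_algebra K "Pow K" by (rule sigma_algebra_Pow)
  have ms: "measure_space K (lambda_system K (Pow K) \<mu>) \<mu>"
    by (rule P.caratheodory_lemma[OF outer_measure_\<mu>])
  then have sa: "sigma_algebra K (lambda_system K (Pow K) \<mu>)" by (simp add: measure_space_def)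
  have "borel_sets T \<subseteq> lambda_system K (Pow K) \<mu>"
    unfolding borel_sets_def by (rule sigma_algebra.sigma_sets_subset[OF sa]) (use open_lambda in auto)
  from measure_down[OF ms sigma_algebra_borel this]
  show ?thesis
    unfolding M_def using assms borel_sets_Pow sigma_algebra.sigma_sets_eq[OF sigma_algebra_borel]
    by (intro emeasure_measure_of[where \<Omega> = K and A = "borel_sets T"])
      (auto simp: measure_space_def sets_measure_of)
qed

lemma finite_M: "finite_measure M"
  by (rule finite_measureI) (use \<mu>_finite[of K] in \<open>auto simp: space_M emeasure_M borel_open\<close>)

lemma measure_M_space: "measure M K = \<nu> K"
  by (simp add: measure_def emeasure_M borel_open \<mu>_open \<tau>_space \<nu>_nonneg)

lemma measure_M_closed: "closedin T C \<Longrightarrow> \<nu> C \<le> measure M C"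
  using \<mu>_closed_ge[of C] \<nu>_nonneg[OF closedin_subset[of T C]]
  by (simp add: emeasure_M[OF borel_closed, symmetric] finite_measure.emeasure_eq_measure[OF finite_M])

lemma outer_regular:
  "E \<in> borel_sets T \<Longrightarrow> emeasure M E = (INF U\<in>{U. openin T U \<and> E \<subseteq> U}. emeasure M U)"
  by (subst emeasure_M, assumption, unfold \<mu>_def, intro INF_cong) (auto simp: emeasure_M borel_open \<mu>_open)

text \<open>Outer regularity of the complement: an open superset of \<open>K - E\<close> of almost
  the same measure has a closed, hence compact, complement inside E.\<close>

lemma inner_regular:
  assumes E: "E \<in> borel_sets T"
  shows "emeasure M E = (SUP C\<in>{C. compactin T C \<and> C \<subseteq> E}. emeasure M C)"
proof (rule antisym)
  interpret finite_measure M by (rule finite_M)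
  have EK: "E \<subseteq> K" using E borel_sets_Pow by auto
  have KE: "K - E \<in> borel_sets T" using E unfolding borel_sets_def by (rule sigma_sets.Compl)
  show "(SUP C\<in>{C. compactin T C \<and> C \<subseteq> E}. emeasure M C) \<le> emeasure M E"
    by (rule SUP_least) (use E in \<open>auto intro!: emeasure_mono simp: sets_M\<close>)
  show "emeasure M E \<le> (SUP C\<in>{C. compactin T C \<and> C \<subseteq> E}. emeasure M C)"
  proof (rule ennreal_le_epsilon)
    fix e :: real assume e: "e > 0"
    have "emeasure M (K - E) < emeasure M (K - E) + ennreal e"
      using e by (simp add: emeasure_eq_measure ennreal_less_iff flip: ennreal_plus)
    from this[unfolded outer_regular[OF KE] INF_less_iff]
    obtain U where U: "openin T U" "K - E \<subseteq> U" "emeasure M U < emeasure M (K - E) + ennreal e"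
      unfolding outer_regular[OF KE, symmetric] by blast
    have UK: "U \<subseteq> K" using U openin_subset by auto
    have "compactin T (K - U)" using U compact by (intro closedin_compact_space) auto
    moreover have "K - U \<subseteq> E" using U by auto
    ultimately have "emeasure M (K - U) \<le> (SUP C\<in>{C. compactin T C \<and> C \<subseteq> E}. emeasure M C)"
      by (intro SUP_upper) auto
    moreover have "emeasure M E \<le> emeasure M (K - U) + ennreal e"
    proof -
      have "measure M U < measure M (K - E) + e"
        using U(3) e by (simp add: emeasure_eq_measure ennreal_less_iff flip: ennreal_plus)
      moreover have "measure M (K - E) = measure M K - measure M E" "measure M (K - U) = measure M K - measure M U"
        using E U(1) EK UK finite_measure_compl[of E] finite_measure_compl[of U]
        by (auto simp: sets_M space_M borel_open)
      ultimately have "measure M E \<le> measure M (K - U) + e" by simp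
      then show ?thesis using e by (simp add: emeasure_eq_measure flip: ennreal_plus)
    qed
    ultimately show "emeasure M E \<le> (SUP C\<in>{C. compactin T C \<and> C \<subseteq> E}. emeasure M C) + ennreal e"
      by (meson add_right_mono order_trans)
  qed
qed

section \<open>Integrals of continuous functions under the limit measure\<close>

lemma continuous_measurable:
  fixes f :: "'p \<Rightarrow> 'c::topological_space"
  assumes "continuous_map T euclidean f" shows "f \<in> borel_measurable M"
proof (rule borel_measurableI)
  fix S :: "'c set" assume "open S"
  then have "openin T {x \<in> K. f x \<in> S}" using assms by (auto simp: continuous_map_def)
  moreover have "f -` S \<inter> space M = {x \<in> K. f x \<in> S}" by (auto simp: space_M)
  ultimately show "f -` S \<inter> space M \<in> sets M" by (simp add: sets_M borel_open)
qed

lemma measurable_D: "(f :: 'p \<Rightarrow> 'c::topological_space) \<in> borel_measurable (D n)"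
  by (rule borel_measurableI) (auto simp: sets_D space_D)

text \<open>The superlevel sets of a continuous f are closed, and there \<open>\<nu>\<close> lies
  below the limit measure. The finite family is fixed before n, so that \<open>\<nu>_approx\<close>
  can supply n afterwards; \<open>B / m\<close> bounds the discretisation error under
  \<open>D n\<close>.\<close>

lemma integral_lower:
  assumes f: "continuous_map T euclideanreal f" "\<And>x. x \<in> K \<Longrightarrow> 0 \<le> f x \<and> f x \<le> 1" and m: "(m::nat) > 0"
  obtains \<A> where "finite \<A>" "\<A> \<subseteq> Pow K"
    "\<And>n \<epsilon>. (\<And>E. E \<in> \<A> \<Longrightarrow> \<bar>\<nu> E - measure (D n) E\<bar> < \<epsilon>) \<Longrightarrow>
       (\<integral>x. f x \<partial>D n) - B / m - \<epsilon> \<le> (\<integral>x. f x \<partial>M)"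
proof
  define C where "C = (\<lambda>i::nat. {x\<in>K. f x \<in> {real i / m..}})"
  have C: "closedin T (C i)" for i
    unfolding C_def by (rule closedin_continuous_map_preimage[OF f(1)]) auto
  have CK: "C i \<subseteq> K" for i by (auto simp: C_def)
  show "finite (C ` {1..m})" "C ` {1..m} \<subseteq> Pow K" using CK by auto
  fix n :: nat and \<epsilon> :: real
  assume "\<And>E. E \<in> C ` {1..m} \<Longrightarrow> \<bar>\<nu> E - measure (D n) E\<bar> < \<epsilon>"
  then have \<epsilon>: "measure (D n) (C i) \<le> measure M (C i) + \<epsilon>" if "i \<in> {1..m}" for i
    using that measure_M_closed[OF C[of i]] by fastforce
  interpret M: finite_measure M by (rule finite_M)
  interpret D: finite_measure "D n" by (rule finite_D)
  have sum_eq: "(\<Sum>i=1..m. of_bool (real i / m \<le> f x)) = (\<Sum>i=1..m. indicator (C i) x :: real)" if "x \<in> K" for x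
    using that by (intro sum.cong) (auto simp: C_def indicator_def)
  have step: "(\<Sum>i=1..m. indicator (C i) x) / m \<le> f x" "f x \<le> 1 / m + (\<Sum>i=1..m. indicator (C i) x) / m"
    if "x \<in> K" for x
    unfolding sum_eq[OF that, symmetric] using step_sum[of "f x" m] f(2)[OF that] m by auto
  have intC: "integrable N (\<lambda>x. \<Sum>i=1..m. indicator (C i) x :: real)"
    "(\<integral>x. (\<Sum>i=1..m. indicator (C i) x) \<partial>N) = (\<Sum>i=1..m. measure N (C i))"
    if "finite_measure N" "\<And>i. C i \<in> sets N" "space N = K" for N
  proof -
    interpret finite_measure N by fact
    have "C i \<inter> space N = C i" for i using that CK by auto
    then show "integrable N (\<lambda>x. \<Sum>i=1..m. indicator (C i) x :: real)"
      "(\<integral>x. (\<Sum>i=1..m. indicator (C i) x) \<partial>N) = (\<Sum>i=1..m. measure N (C i))"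
      using that by (auto simp: integrable_indicator_iff emeasure_finite less_top[symmetric])
  qed
  have CM: "C i \<in> sets M" "C i \<in> sets (D n)" for i using borel_closed[OF C] CK by (auto simp: sets_M sets_D)
  note iM = intC[OF finite_M CM(1) space_M] and iD = intC[OF finite_D CM(2) space_D]
  have fM: "integrable M f"
    by (rule M.integrable_const_bound[of _ 1]) (use f continuous_measurable[OF f(1)] in \<open>auto simp: space_M intro!: AE_I2\<close>)
  have fD: "integrable (D n) f"
    by (rule D.integrable_const_bound[of _ 1]) (use f measurable_D in \<open>auto simp: space_D intro!: AE_I2\<close>)
  have "(\<integral>x. f x \<partial>D n) \<le> (\<integral>x. 1 / m + (\<Sum>i=1..m. indicator (C i) x) / m \<partial>D n)"
    using iD(1) by (intro integral_mono fD) (use step in \<open>auto simp: space_D\<close>)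
  also have "\<dots> = measure (D n) K / m + (\<Sum>i=1..m. measure (D n) (C i)) / m"
    using iD by (simp add: space_D)
  also have "\<dots> \<le> B / m + (\<Sum>i=1..m. measure M (C i) + \<epsilon>) / m"
    using \<epsilon> D_le m by (intro add_mono divide_right_mono sum_mono) auto
  also have "\<dots> = B / m + \<epsilon> + (\<Sum>i=1..m. measure M (C i)) / m" using m by (simp add: sum.distrib add_divide_distrib)
  also have "(\<Sum>i=1..m. measure M (C i)) / m = (\<integral>x. (\<Sum>i=1..m. indicator (C i) x) / m \<partial>M)"
    using iM by simp
  also have "\<dots> \<le> (\<integral>x. f x \<partial>M)"
    using iM(1) by (intro integral_mono fM) (use step in \<open>auto simp: space_M\<close>)
  finally show "(\<integral>x. f x \<partial>D n) - B / m - \<epsilon> \<le> (\<integral>x. f x \<partial>M)" by simp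
qed

text \<open>Using \<open>integral_lower\<close> for both f and \<open>1 - f\<close> turns the
  one-sided estimate into a two-sided one; the total masses needed for this are compared through
  \<open>measure_M_space\<close>.\<close>

lemma integral_approx01:
  assumes f: "continuous_map T euclideanreal f" "\<And>x. x \<in> K \<Longrightarrow> 0 \<le> f x \<and> f x \<le> 1" and e: "e > 0"
  shows "\<exists>n\<ge>k. \<bar>(\<integral>x. f x \<partial>M) - (\<integral>x. f x \<partial>D n)\<bar> \<le> e \<and> \<bar>measure M K - measure (D n) K\<bar> \<le> e"
proof -
  \<comment> \<open>\<open>m0\<close> is large enough for a discretisation error of at most
    \<open>e / 3\<close>; passing to its successor keeps the number of levels positive.\<close>
  obtain m0 :: nat where "\<bar>B\<bar> / (e/3) < m0" using reals_Archimedean2 by blast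
  then have "\<bar>B\<bar> \<le> (e/3) * m0" using e by (simp add: field_simps)
  also have "\<dots> \<le> (e/3) * Suc m0" using e by simp
  finally have "\<bar>B\<bar> / Suc m0 \<le> e / 3" by (simp add: pos_divide_le_eq)
  then obtain m :: nat where m: "m > 0" "\<bar>B\<bar> / m \<le> e / 3" by blast
  have g: "continuous_map T euclideanreal (\<lambda>x. 1 - f x)" "\<And>x. x \<in> K \<Longrightarrow> 0 \<le> 1 - f x \<and> 1 - f x \<le> 1"
    using f by (auto intro!: continuous_intros)
  obtain \<A> where A: "finite \<A>" "\<A> \<subseteq> Pow K"
    "\<And>n \<epsilon>. (\<And>E. E \<in> \<A> \<Longrightarrow> \<bar>\<nu> E - measure (D n) E\<bar> < \<epsilon>) \<Longrightarrow>
       (\<integral>x. f x \<partial>D n) - B / m - \<epsilon> \<le> (\<integral>x. f x \<partial>M)" using integral_lower[OF f m(1)] by blast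
  obtain \<A>' where A': "finite \<A>'" "\<A>' \<subseteq> Pow K"
    "\<And>n \<epsilon>. (\<And>E. E \<in> \<A>' \<Longrightarrow> \<bar>\<nu> E - measure (D n) E\<bar> < \<epsilon>) \<Longrightarrow>
       (\<integral>x. 1 - f x \<partial>D n) - B / m - \<epsilon> \<le> (\<integral>x. 1 - f x \<partial>M)" using integral_lower[OF g m(1)] by blast
  obtain n where n: "n \<ge> k" "\<forall>E\<in>insert K (\<A> \<union> \<A>'). \<bar>\<nu> E - measure (D n) E\<bar> < e / 3"
    using \<nu>_approx[of "insert K (\<A> \<union> \<A>')" "e/3" k] A A' e by auto
  interpret M: finite_measure M by (rule finite_M)
  interpret D: finite_measure "D n" by (rule finite_D)
  have fM: "integrable M f"
    by (rule M.integrable_const_bound[of _ 1]) (use f continuous_measurable[OF f(1)] in \<open>auto simp: space_M intro!: AE_I2\<close>)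
  have fD: "integrable (D n) f"
    by (rule D.integrable_const_bound[of _ 1]) (use f measurable_D in \<open>auto simp: space_D intro!: AE_I2\<close>)
  have "(\<integral>x. 1 - f x \<partial>M) = measure M K - (\<integral>x. f x \<partial>M)" "(\<integral>x. 1 - f x \<partial>D n) = measure (D n) K - (\<integral>x. f x \<partial>D n)"
    using fM fD by (auto simp: space_M space_D)
  moreover have "\<bar>measure M K - measure (D n) K\<bar> < e / 3" using n(2) by (simp add: measure_M_space)
  moreover have "B / m \<le> e / 3" using m abs_ge_self[of B] by (meson divide_right_mono of_nat_0_le_iff order_trans)
  moreover have "(\<integral>x. f x \<partial>D n) - B / m - e / 3 \<le> (\<integral>x. f x \<partial>M)" using n(2) by (intro A(3)) auto
  moreover have "(\<integral>x. 1 - f x \<partial>D n) - B / m - e / 3 \<le> (\<integral>x. 1 - f x \<partial>M)" using n(2) by (intro A'(3)) auto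
  ultimately show ?thesis using n(1) e unfolding abs_le_iff by (intro exI[of _ n] conjI) linarith+
qed

lemma continuous_bounded:
  fixes f :: "'p \<Rightarrow> real" assumes "continuous_map T euclideanreal f"
  obtains c where "c > 0" "\<forall>x\<in>K. \<bar>f x\<bar> \<le> c"
proof -
  have "compactin euclideanreal (f ` K)"
    using image_compactin[OF _ assms, of K] compact by (simp add: compact_space_def)
  then have "bounded (f ` K)" by (auto intro: compact_imp_bounded)
  then obtain c where "c > 0" "\<forall>x\<in>f ` K. norm x \<le> c" unfolding bounded_pos by blast
  then show ?thesis using that by auto
qed

lemma integral_limit:
  assumes f: "continuous_map T euclideanreal f" and L: "\<And>n. (\<integral>x. f x \<partial>D n) = L"
  shows "integrable M f" "(\<integral>x. f x \<partial>M) = L"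
proof -
  obtain c where c: "c > 0" "\<forall>x\<in>K. \<bar>f x\<bar> \<le> c" using continuous_bounded[OF f] .
  define g where "g = (\<lambda>x. (f x + c) / (2 * c))"
  have g: "continuous_map T euclideanreal g" "\<And>x. x \<in> K \<Longrightarrow> 0 \<le> g x \<and> g x \<le> 1"
  proof -
    show "continuous_map T euclideanreal g" unfolding g_def using c(1) f by (intro continuous_intros) auto
    show "0 \<le> g x \<and> g x \<le> 1" if "x \<in> K" for x using c(1) bspec[OF c(2) that] by (auto simp: g_def abs_le_iff field_simps)
  qed
  have fg: "f x = 2 * c * g x - c" for x using c(1) by (simp add: g_def)
  interpret M: finite_measure M by (rule finite_M)
  have gM: "integrable M g"
    by (rule M.integrable_const_bound[of _ 1]) (use g continuous_measurable[OF g(1)] in \<open>auto simp: space_M intro!: AE_I2\<close>)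
  then show "integrable M f" unfolding fg by auto
  have fM: "(\<integral>x. f x \<partial>M) = 2 * c * (\<integral>x. g x \<partial>M) - c * measure M K"
    unfolding fg using gM by (simp add: space_M)
  have "\<bar>(\<integral>x. f x \<partial>M) - L\<bar> \<le> e" if e: "e > 0" for e
  proof -
    \<comment> \<open>As f is \<open>2 * c * g - c\<close>, the two errors get multiplied by
      \<open>2 * c\<close> and by c and add up to e.\<close>
    obtain n where n: "\<bar>(\<integral>x. g x \<partial>M) - (\<integral>x. g x \<partial>D n)\<bar> \<le> e / (3 * c)" "\<bar>measure M K - measure (D n) K\<bar> \<le> e / (3 * c)"
      using integral_approx01[OF g, of "e / (3 * c)" 0] e c by auto
    interpret D: finite_measure "D n" by (rule finite_D)
    have gD: "integrable (D n) g"
      by (rule D.integrable_const_bound[of _ 1]) (use g measurable_D in \<open>auto simp: space_D intro!: AE_I2\<close>)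
    have fD: "L = 2 * c * (\<integral>x. g x \<partial>D n) - c * measure (D n) K"
      unfolding L[of n, symmetric] unfolding fg using gD by (simp add: space_D)
    have c3: "c * a \<le> e / 3" if "a \<le> e / (3 * c)" for a
      using mult_left_mono[OF that, of c] c(1) by simp
    have "\<bar>(\<integral>x. f x \<partial>M) - L\<bar> = \<bar>2 * c * ((\<integral>x. g x \<partial>M) - (\<integral>x. g x \<partial>D n)) - c * (measure M K - measure (D n) K)\<bar>"
      unfolding fM fD by (simp add: algebra_simps)
    also have "\<dots> \<le> 2 * (c * \<bar>(\<integral>x. g x \<partial>M) - (\<integral>x. g x \<partial>D n)\<bar>) + c * \<bar>measure M K - measure (D n) K\<bar>"
      using c(1) by (intro order_trans[OF abs_triangle_ineq4]) (auto simp: abs_mult)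
    also have "\<dots> \<le> e" using c3[OF n(1)] c3[OF n(2)] by linarith
    finally show ?thesis .
  qed
  then have "\<bar>(\<integral>x. f x \<partial>M) - L\<bar> \<le> 0" by (rule field_le_epsilon) auto
  then show "(\<integral>x. f x \<partial>M) = L" by simp
qed

text \<open>The indices in \<open>\<nu>_approx\<close> can be taken arbitrarily late, so only the
  eventual masses count.\<close>

lemma measure_M_le:
  assumes "\<And>e. e > 0 \<Longrightarrow> \<exists>k. \<forall>n\<ge>k. measure (D n) K \<le> b + e"
  shows "measure M K \<le> b"
proof (rule field_le_epsilon)
  fix e :: real assume e: "e > 0"
  obtain k where k: "\<forall>n\<ge>k. measure (D n) K \<le> b + e/2" using assms[of "e/2"] e by auto
  obtain n where "n \<ge> k" "\<bar>\<nu> K - measure (D n) K\<bar> < e/2" using \<nu>_approx[of "{K}" "e/2" k] e by auto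
  moreover from this have "measure (D n) K \<le> b + e/2" using k by blast
  ultimately show "measure M K \<le> b + e" unfolding measure_M_space by linarith
qed

end

lemma bounded_linear_kc: "bounded_linear (kc :: 'k::real_or_complex \<Rightarrow> complex)"
proof
  show "kc (r *\<^sub>R b) = r *\<^sub>R kc b" for r and b :: 'k
    by (simp add: scaleR_conv_of_real kc_props kc_of_real)
  show "\<exists>K. \<forall>x::'k. norm (kc x) \<le> norm x * K" by (intro exI[of _ 1]) (simp add: kc_props)
qed (rule kc_props)

context measure_sequence
begin

lemma continuous_scalar_bounded:
  fixes f :: "'p \<Rightarrow> 'k::real_or_complex" assumes "continuous_map T euclidean f"
  obtains c where "c > 0" "\<forall>x\<in>K. norm (f x) \<le> c"
proof -
  have "continuous_map T euclideanreal (\<lambda>x. norm (f x))" using assms by (rule continuous_map_norm)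
  from continuous_bounded[OF this] show ?thesis using that by auto
qed

text \<open>The maps \<open>Re (kc a)\<close> and \<open>Im (kc a)\<close> are bounded and
  real-linear in a, which reduces the claim to real integrands.\<close>

lemma scalar_integral_limit:
  fixes f :: "'p \<Rightarrow> 'k::real_or_complex"
  assumes f: "continuous_map T euclidean f" and L: "\<And>n. (\<integral>x. f x \<partial>D n) = L"
  shows "(\<integral>x. f x \<partial>M) = L"
proof -
  obtain c where c: "c > 0" "\<forall>x\<in>K. norm (f x) \<le> c" using continuous_scalar_bounded[OF f] .
  have iM: "integrable M f"
    by (rule finite_measure.integrable_const_bound[OF finite_M, of _ c])
      (use c continuous_measurable[OF f] in \<open>auto simp: space_M intro!: AE_I2\<close>)
  have iD: "integrable (D n) f" for n
    by (rule finite_measure.integrable_const_bound[OF finite_D, of _ c])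
      (use c measurable_D[of f] in \<open>auto simp: space_D intro!: AE_I2\<close>)
  have "h (\<integral>x. f x \<partial>M) = h L" if h: "bounded_linear h" for h :: "'k \<Rightarrow> real"
  proof -
    have "continuous_map T euclideanreal (h \<circ> f)"
      using h by (intro continuous_map_compose[OF f])
        (simp add: continuous_map_iff_continuous2 linear_continuous_on)
    moreover have "(\<integral>x. (h \<circ> f) x \<partial>D n) = h L" for n
      using integral_bounded_linear[OF h iD[of n]] L[of n] by simp
    ultimately have "(\<integral>x. (h \<circ> f) x \<partial>M) = h L" by (rule integral_limit(2))
    then show ?thesis using integral_bounded_linear[OF h iM] by simp
  qed
  from this[of "\<lambda>x. Re (kc x)"] this[of "\<lambda>x. Im (kc x)"]
  have "kc (\<integral>x. f x \<partial>M) = kc L"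
    using bounded_linear_compose[OF bounded_linear_Re bounded_linear_kc[where 'k='k]]
      bounded_linear_compose[OF bounded_linear_Im bounded_linear_kc[where 'k='k]]
    by (simp add: complex_eq_iff)
  then show ?thesis by (simp add: kc_inj)
qed

end

section \<open>Positive measures as scalar measures\<close>

locale regular_measure =
  fixes T :: "'p topology" and M :: "'p measure"
  assumes sets_M: "sets M = borel_sets T" and space_M: "space M = topspace T"
    and finite_M: "finite_measure M"
    and outer_regular: "\<And>E. E \<in> borel_sets T \<Longrightarrow>
      emeasure M E = (INF U\<in>{U. openin T U \<and> E \<subseteq> U}. emeasure M U)"
    and inner_regular: "\<And>E. E \<in> borel_sets T \<Longrightarrow>
      emeasure M E = (SUP C\<in>{C. compactin T C \<and> C \<subseteq> E}. emeasure M C)"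
    and compact_borel: "\<And>C. compactin T C \<Longrightarrow> C \<in> borel_sets T"
begin

definition scalar_measure :: "'p set \<Rightarrow> 'k::real_or_complex" where
  "scalar_measure E = of_real (measure M E)"

text \<open>For a positive measure, countable additivity gives every countable partition of E the
  same sum.\<close>

lemma total_variation_scalar_measure:
  assumes E: "E \<in> borel_sets T"
  shows "total_variation T (scalar_measure :: 'p set \<Rightarrow> 'k::real_or_complex) E = emeasure M E"
proof -
  interpret finite_measure M by (rule finite_M)
  let ?P = "{A :: nat \<Rightarrow> 'p set. range A \<subseteq> borel_sets T \<and> disjoint_family A \<and> (\<Union>i. A i) = E}"
  have eq: "(\<Sum>i. ennreal (norm (scalar_measure (A i) :: 'k))) = emeasure M E" if "A \<in> ?P" for A
  proof -
    have "(\<Sum>i. ennreal (norm (scalar_measure (A i) :: 'k))) = (\<Sum>i. emeasure M (A i))"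
      by (simp add: scalar_measure_def emeasure_eq_measure)
    also have "\<dots> = emeasure M E" using that suminf_emeasure[of A M] by (simp add: sets_M)
    finally show ?thesis .
  qed
  have "(\<lambda>i::nat. if i = 0 then E else {}) \<in> ?P"
  proof -
    have "{} \<in> borel_sets T" unfolding borel_sets_def by (rule sigma_sets.Empty)
    then show ?thesis using E by (auto simp: disjoint_family_on_def)
  qed
  then have "?P \<noteq> {}" by blast
  moreover have "total_variation T (scalar_measure :: 'p set \<Rightarrow> 'k) E = (SUP A\<in>?P. emeasure M E)"
    unfolding total_variation_def by (rule SUP_cong) (simp_all only: eq)
  ultimately show ?thesis by simp
qed

lemma variation_measure_scalar_measure:
  "variation_measure T (scalar_measure :: 'p set \<Rightarrow> 'k::real_or_complex) = M"
proof -
  have "variation_measure T (scalar_measure :: 'p set \<Rightarrow> 'k) = measure_of (space M) (sets M) (emeasure M)"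
    unfolding variation_measure_def sets_M[symmetric] space_M[symmetric]
    using total_variation_scalar_measure[where 'k='k]
    by (intro measure_of_eq sets.space_closed) (simp add: sets.sigma_sets_eq[of M, unfolded sets_M] sets_M)
  then show ?thesis by (simp add: measure_of_of_measure)
qed

lemma scalar_borel_scalar_measure:
  "scalar_borel_measure T (scalar_measure :: 'p set \<Rightarrow> 'k::real_or_complex)"
  unfolding scalar_borel_measure_def
proof (intro conjI allI impI)
  interpret finite_measure M by (rule finite_M)
  fix A :: "nat \<Rightarrow> 'p set" assume A: "range A \<subseteq> borel_sets T \<and> disjoint_family A"
  have "(\<lambda>i. measure M (A i)) sums measure M (\<Union>i. A i)"
    using A by (intro finite_measure_UNION) (auto simp: sets_M)
  then show "(\<lambda>i. scalar_measure (A i) :: 'k) sums scalar_measure (\<Union>i. A i)"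
    unfolding scalar_measure_def by (rule sums_of_real)
qed (simp add: scalar_measure_def)

lemma regular_scalar_measure:
  "regular_borel_measure T (scalar_measure :: 'p set \<Rightarrow> 'k::real_or_complex)"
  unfolding regular_borel_measure_def
proof (intro conjI ballI scalar_borel_scalar_measure)
  fix E assume E: "E \<in> borel_sets T"
  have o: "openin T U \<Longrightarrow> U \<in> borel_sets T" for U unfolding borel_sets_def by auto
  show "total_variation T (scalar_measure :: 'p set \<Rightarrow> 'k) E =
     (INF U\<in>{U. openin T U \<and> E \<subseteq> U}. total_variation T (scalar_measure :: 'p set \<Rightarrow> 'k) U)"
    unfolding total_variation_scalar_measure[OF E] outer_regular[OF E]
    by (rule INF_cong) (auto simp: total_variation_scalar_measure o)
  show "total_variation T (scalar_measure :: 'p set \<Rightarrow> 'k) E =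
     (SUP C\<in>{C. compactin T C \<and> C \<subseteq> E}. total_variation T (scalar_measure :: 'p set \<Rightarrow> 'k) C)"
    unfolding total_variation_scalar_measure[OF E] inner_regular[OF E]
    by (rule SUP_cong) (auto simp: total_variation_scalar_measure compact_borel)
qed

text \<open>\<open>variation_density\<close> is an arbitrary choice, but the constant 1 is a density
  too, and densities are unique almost everywhere.\<close>

lemma scalar_integral_scalar_measure:
  fixes f :: "'p \<Rightarrow> 'k::real_or_complex"
  assumes f: "f \<in> borel_measurable M"
  shows "scalar_integral T scalar_measure f = (\<integral>x. f x \<partial>M)"
proof -
  interpret finite_measure M by (rule finite_M)
  let ?P = "\<lambda>h::'p \<Rightarrow> 'k. integrable M h \<and> (\<forall>p. norm (h p) = 1) \<and>
        (\<forall>E \<in> borel_sets T. scalar_measure E = set_lebesgue_integral M E h)"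
  have one: "set_lebesgue_integral M E (\<lambda>_. 1::'k) = scalar_measure E" if "E \<in> borel_sets T" for E
  proof -
    have "E \<in> sets M" using that by (simp add: sets_M)
    then have "E \<inter> space M = E" using sets.sets_into_space by auto
    then show ?thesis unfolding set_lebesgue_integral_def scalar_measure_def
      using \<open>E \<in> sets M\<close>
      by (subst integral_scaleR_left) (simp_all add: scaleR_conv_of_real emeasure_finite less_top[symmetric])
  qed
  define h where "h = variation_density T (scalar_measure :: 'p set \<Rightarrow> 'k)"
  have "?P (\<lambda>_. 1)" using one by simp
  then have "\<exists>h. ?P h" by (rule exI[of ?P "\<lambda>_. 1"])
  from someI_ex[OF this] have h: "?P h"
    unfolding h_def variation_density_def variation_measure_scalar_measure .
  have "AE x in M. h x = 1"
    by (rule density_unique_banach) (use h one in \<open>auto simp: sets_M\<close>)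
  then have "(\<integral>x. f x * h x \<partial>M) = (\<integral>x. f x \<partial>M)"
    using f h by (intro integral_cong_AE) (auto dest: borel_measurable_integrable)
  then show ?thesis
    unfolding scalar_integral_def variation_measure_scalar_measure h_def .
qed

end

lemma (in measure_sequence) regular: "regular_measure T M"
  by (rule regular_measure.intro[OF sets_M space_M finite_M outer_regular inner_regular])
    (auto intro: borel_closed compactin_imp_closedin[OF Hausdorff])

section \<open>Nuclear traces and the approximation property\<close>

text \<open>The weights are \<open>1 / sqrt (r i)\<close> with r the tails of the series. A term is
  a difference of consecutive tails, so the weighted term is dominated by
  \<open>2 * (sqrt (r i) - sqrt (r (Suc i)))\<close>, which telescopes.\<close>

lemma summable_weights:
  fixes b :: "nat \<Rightarrow> real"
  assumes b: "summable b" "\<And>i. b i \<ge> 0"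
  obtains w where "\<forall>i. w i > 0" "(\<lambda>i. 1 / w i) \<longlonglongrightarrow> 0" "summable (\<lambda>i. b i * w i)"
proof
  \<comment> \<open>The added geometric series keeps all tails positive, also when \<open>b\<close>
    is eventually zero.\<close>
  define b' where "b' = (\<lambda>i. b i + (1/2)^i)"
  have sb: "summable b'" unfolding b'_def by (intro summable_add b) (simp add: summable_geometric)
  have b'0: "b' i > 0" for i using b(2)[of i] by (simp add: b'_def add_nonneg_pos)
  define r where "r = (\<lambda>i. \<Sum>n. b' (n + i))"
  have sr: "summable (\<lambda>n. b' (n + i))" for i using sb by (simp add: summable_iff_shift)
  have rSuc: "r i = b' i + r (Suc i)" for i
    using suminf_split_head[OF sr[of i]] by (simp add: r_def)
  have r0: "r i > 0" for i unfolding r_def using sr b'0 by (intro suminf_pos) auto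
  have rlim: "(\<lambda>i. sqrt (r i)) \<longlonglongrightarrow> 0"
    using tendsto_real_sqrt[OF suminf_exist_split2[OF sb]] by (simp add: r_def)
  define w where "w = (\<lambda>i. 1 / sqrt (r i))"
  show "\<forall>i. w i > 0" using r0 by (simp add: w_def)
  show "(\<lambda>i. 1 / w i) \<longlonglongrightarrow> 0" using rlim by (simp add: w_def)
  show "summable (\<lambda>i. b i * w i)"
  proof (rule summable_comparison_test')
    have "summable (\<lambda>n. sqrt (r (Suc n)) - sqrt (r n))" using rlim by (rule telescope_summable)
    then have "summable (\<lambda>n. (-2) * (sqrt (r (Suc n)) - sqrt (r n)))" by (rule summable_mult)
    then show "summable (\<lambda>n. 2 * (sqrt (r n) - sqrt (r (Suc n))))" by (simp add: algebra_simps)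
    fix i :: nat assume "i \<ge> 0"
    have le: "sqrt (r (Suc i)) \<le> sqrt (r i)" using rSuc[of i] b'0[of i] by simp
    have "b' i = sqrt (r i) * sqrt (r i) - sqrt (r (Suc i)) * sqrt (r (Suc i))"
      using rSuc[of i] r0[of i] r0[of "Suc i"] by simp
    also have "\<dots> = (sqrt (r i) - sqrt (r (Suc i))) * (sqrt (r i) + sqrt (r (Suc i)))"
      by (simp add: algebra_simps)
    also have "\<dots> \<le> (sqrt (r i) - sqrt (r (Suc i))) * (2 * sqrt (r i))"
      using le by (intro mult_left_mono) auto
    also have "\<dots> = (2 * (sqrt (r i) - sqrt (r (Suc i)))) * sqrt (r i)" by simp
    finally have "b' i * w i \<le> 2 * (sqrt (r i) - sqrt (r (Suc i)))"
      using r0[of i] unfolding w_def by (simp only: times_divide_eq_right mult_1_right pos_divide_le_eq real_sqrt_gt_zero)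
    moreover have "b i * w i \<le> b' i * w i" using r0[of i] by (intro mult_right_mono) (auto simp: b'_def w_def)
    ultimately show "norm (b i * w i) \<le> 2 * (sqrt (r i) - sqrt (r (Suc i)))"
      using b(2)[of i] r0[of i] by (simp add: w_def)
  qed
qed

section \<open>Nuclear representations of the zero operator\<close>

context normed_vspace
begin

text \<open>Supplies the compact sets on which the approximation property is applied: a
  neighbourhood of zero absorbs all but finitely many points.\<close>

lemma compact_null_sequence:
  assumes \<kappa>: "\<And>i. \<kappa> i \<in> vcarrier X" and lim: "(\<lambda>i::nat. vnorm X (\<kappa> i)) \<longlonglongrightarrow> 0"
  shows "compactin (norm_topology X) (insert (vzero X) (range \<kappa>))"
  unfolding compactin_def
proof (intro conjI allI impI)
  show "insert (vzero X) (range \<kappa>) \<subseteq> topspace (norm_topology X)" using \<kappa> zero_closed by auto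
  fix \<U> assume \<U>: "Ball \<U> (openin (norm_topology X)) \<and> insert (vzero X) (range \<kappa>) \<subseteq> \<Union>\<U>"
  then obtain U where U: "U \<in> \<U>" "vzero X \<in> U" by auto
  obtain r where r: "r > 0" "\<forall>y\<in>vcarrier X. vnorm X (vdiff (vzero X) y) < r \<longrightarrow> y \<in> U"
    using \<U> U unfolding openin_norm by blast
  have "\<forall>\<^sub>F i in sequentially. vnorm X (\<kappa> i) < r" using lim r(1) by (rule order_tendstoD)
  then obtain k where k: "\<And>i. i \<ge> k \<Longrightarrow> vnorm X (\<kappa> i) < r" by (auto simp: eventually_sequentially)
  have inU: "\<kappa> i \<in> U" if "i \<ge> k" for i
    using r(2) k[OF that] \<kappa>[of i] by (simp add: zero_add scale_closed norm_minus)
  have "\<exists>V\<in>\<U>. \<kappa> i \<in> V" for i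
  proof -
    have "\<kappa> i \<in> \<Union>\<U>" using \<U> by blast
    then show ?thesis by blast
  qed
  then obtain V where V: "\<And>i. V i \<in> \<U>" "\<And>i. \<kappa> i \<in> V i" by metis
  show "\<exists>\<F>. finite \<F> \<and> \<F> \<subseteq> \<U> \<and> insert (vzero X) (range \<kappa>) \<subseteq> \<Union>\<F>"
  proof (intro exI[of _ "insert U (V ` {..<k})"] conjI)
    show "insert (vzero X) (range \<kappa>) \<subseteq> \<Union> (insert U (V ` {..<k}))"
    proof
      fix x assume "x \<in> insert (vzero X) (range \<kappa>)"
      then consider "x = vzero X" | i where "x = \<kappa> i" by auto
      then show "x \<in> \<Union> (insert U (V ` {..<k}))"
      proof cases
        case 1 then show ?thesis using U by simp
      next
        case (2 i) then show ?thesis using inU[of i] V(2)[of i] by (cases "i \<ge> k") auto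
      qed
    qed
  qed (use U V in auto)
qed

text \<open>The full series vanishes at every t, so a partial sum equals minus the tail there and
  has dual norm at most \<open>R n\<close>. This norm convergence passes through every c in the
  bidual, whereas \<open>zero\<close> speaks only of the canonical ones.\<close>

lemma nuclear_functional_zero:
  assumes \<phi>: "\<And>i::nat. \<phi> i \<in> vcarrier (dual X)"
    and a: "\<And>i. norm (g i) \<le> a i" "summable (\<lambda>i. a i * vnorm (dual X) (\<phi> i))"
    and zero: "\<And>t. t \<in> vcarrier X \<Longrightarrow> (\<lambda>i. g i * \<phi> i t) sums 0"
    and c: "c \<in> vcarrier (bidual X)"
  shows "(\<lambda>i. g i * c (\<phi> i)) sums 0"
proof -
  interpret d: normed_vspace "dual X" by (rule normed_dual)
  define R where "R = (\<lambda>n. \<Sum>i. a (i + n) * vnorm (dual X) (\<phi> (i + n)))"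
  have R: "R \<longlonglongrightarrow> 0" unfolding R_def using suminf_exist_split2[OF a(2)] by simp
  define p where "p = (\<lambda>n. linear_combination (dual X) g \<phi> n)"
  have p: "p n \<in> vcarrier (dual X)" for n unfolding p_def using \<phi> by (rule d.lc_closed)
  have pt: "p n t = (\<Sum>i<n. g i * \<phi> i t)" if "t \<in> vcarrier X" for n t
  proof -
    have "canonical X t (p n) = (\<Sum>i<n. g i * canonical X t (\<phi> i))"
      unfolding p_def by (rule d.lc_functional[OF d.dual_lf[OF canonical_bidual(1)[OF that]] \<phi>])
    then show ?thesis by (simp add: canonical_apply p \<phi>)
  qed
  have "vnorm (dual X) (p n) \<le> R n" for n
  proof (rule dual_norm_le)
    fix t assume t: "t \<in> unit_ball X"
    then have tc: "t \<in> vcarrier X" by (simp add: unit_ball_def)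
    have le: "norm (g i * \<phi> i t) \<le> a i * vnorm (dual X) (\<phi> i)" for i
      unfolding norm_mult using a(1)[of i] dual_unit_bound[OF \<phi>[of i] t]
      by (intro mult_mono) (auto intro: order_trans[OF norm_ge_zero])
    have sm: "summable (\<lambda>i. g i * \<phi> i t)" using zero[OF tc] by (rule sums_summable)
    have s': "summable (\<lambda>i. a (i + n) * vnorm (dual X) (\<phi> (i + n)))"
      using a(2) by (subst summable_iff_shift)
    have "(\<Sum>i<n. g i * \<phi> i t) = - (\<Sum>i. g (i + n) * \<phi> (i + n) t)"
      using suminf_split_initial_segment[OF sm, of n] sums_unique[OF zero[OF tc]] by (simp add: add_eq_0_iff)
    then have "norm (p n t) = norm (\<Sum>i. g (i + n) * \<phi> (i + n) t)" by (simp add: pt[OF tc])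
    also have "\<dots> \<le> R n" unfolding R_def by (rule norm_suminf_le[OF le s'])
    finally show "norm (p n t) \<le> R n" .
  qed
  then have "norm (c (p n)) \<le> vnorm (bidual X) c * R n" for n
    using d.dual_bound[OF c p[of n]] mult_left_mono[OF _ d.dual_norm_nonneg[OF c]] order_trans by blast
  moreover have "c (p n) = (\<Sum>i<n. g i * c (\<phi> i))" for n
    unfolding p_def by (rule d.lc_functional[OF d.dual_lf[OF c] \<phi>])
  ultimately have le: "norm (\<Sum>i<n. g i * c (\<phi> i)) \<le> vnorm (bidual X) c * R n" for n by metis
  have "(\<lambda>n. vnorm (bidual X) c * R n) \<longlonglongrightarrow> 0" using tendsto_mult_left[OF R, of "vnorm (bidual X) c"] by simp
  then have "(\<lambda>n. \<Sum>i<n. g i * c (\<phi> i)) \<longlonglongrightarrow> 0"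
    by (rule Lim_null_comparison[rotated]) (simp add: le)
  then show ?thesis by (simp add: sums_def)
qed

text \<open>Each term becomes a finite sum over k of
  \<open>\<gamma> i (e k) * c k (T (\<phi> i))\<close>. For fixed k,
  \<open>nuclear_functional_zero\<close> applies with the scalars \<open>\<gamma> i (e k)\<close>
  and the bounded functional \<open>c k\<close> composed with T.\<close>

lemma nuclear_finite_rank_zero:
  assumes \<phi>: "\<And>i::nat. \<phi> i \<in> vcarrier (dual X)"
    and lin: "\<And>i. linear_functional (dual X) (\<gamma> i)"
    and a: "\<And>i \<psi>. \<psi> \<in> vcarrier (dual X) \<Longrightarrow> norm (\<gamma> i \<psi>) \<le> a i * vnorm (dual X) \<psi>"
      "summable (\<lambda>i. a i * vnorm (dual X) (\<phi> i))"
    and zero: "\<And>\<psi> t. \<psi> \<in> vcarrier (dual X) \<Longrightarrow> t \<in> vcarrier X \<Longrightarrow> (\<lambda>i. \<gamma> i \<psi> * \<phi> i t) sums 0"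
    and T: "linear_between (dual X) (dual X) T"
      "continuous_map (norm_topology (dual X)) (norm_topology (dual X)) T" "finite_rank (dual X) T"
  shows "(\<lambda>i. \<gamma> i (T (\<phi> i))) sums 0"
proof -
  interpret d: normed_vspace "dual X" by (rule normed_dual)
  obtain n b where b': "\<forall>i<n. b i \<in> vcarrier (dual X)"
    and Tb': "\<forall>x\<in>vcarrier (dual X). \<exists>c. T x = linear_combination (dual X) c b n"
    using T(3) unfolding finite_rank_def by (elim exE conjE)
  have b: "b i \<in> vcarrier (dual X)" if "i < n" for i using b' that by blast
  have Tb: "\<exists>c. T x = linear_combination (dual X) c b n" if "x \<in> vcarrier (dual X)" for x
    using Tb' that by blast
  \<comment> \<open>The coefficients in \<open>finite_rank\<close> depend on the vector without any
    linearity; interpolating the spanning vectors replaces them by continuous functionals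
    \<open>c k\<close>.\<close>
  have "\<exists>m c e. (\<forall>k<m. c k \<in> vcarrier (bidual X) \<and> e k \<in> vcarrier (dual X)) \<and>
    (\<forall>i<n. b i = linear_combination (dual X) (\<lambda>k. c k (b i)) e m)"
    by (rule d.finite_interpolation) (rule b)
  then obtain m c e where ce': "\<forall>k<m. c k \<in> vcarrier (bidual X) \<and> e k \<in> vcarrier (dual X)"
    and bce': "\<forall>i<n. b i = linear_combination (dual X) (\<lambda>k. c k (b i)) e m"
    by (elim exE conjE)
  have ce: "c k \<in> vcarrier (bidual X)" "e k \<in> vcarrier (dual X)" if "k < m" for k using ce' that by auto
  have bce: "b i = linear_combination (dual X) (\<lambda>k. c k (b i)) e m" if "i < n" for i using bce' that by blast
  have \<gamma>T: "\<gamma> i (T (\<phi> i)) = (\<Sum>k<m. \<gamma> i (e k) * c k (T (\<phi> i)))" for i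
  proof -
    obtain f where f: "T (\<phi> i) = linear_combination (dual X) f b n" using Tb[OF \<phi>] by blast
    have "\<gamma> i (T (\<phi> i)) = (\<Sum>j<n. f j * \<gamma> i (b j))" unfolding f by (rule d.lc_functional[OF lin b])
    also have "\<dots> = (\<Sum>j<n. f j * (\<Sum>k<m. c k (b j) * \<gamma> i (e k)))"
    proof (rule sum.cong)
      fix j assume "j \<in> {..<n}"
      then have j: "j < n" by simp
      have "\<gamma> i (b j) = \<gamma> i (linear_combination (dual X) (\<lambda>k. c k (b j)) e m)" using bce[OF j] by simp
      also have "\<dots> = (\<Sum>k<m. c k (b j) * \<gamma> i (e k))" by (rule d.lc_functional[OF lin ce(2)])
      finally show "f j * \<gamma> i (b j) = f j * (\<Sum>k<m. c k (b j) * \<gamma> i (e k))" by simp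
    qed simp
    also have "\<dots> = (\<Sum>k<m. \<Sum>j<n. f j * (c k (b j) * \<gamma> i (e k)))"
      unfolding sum_distrib_left by (rule sum.swap)
    also have "\<dots> = (\<Sum>k<m. \<gamma> i (e k) * (\<Sum>j<n. f j * c k (b j)))"
      by (simp add: sum_distrib_left mult_ac)
    also have "\<dots> = (\<Sum>k<m. \<gamma> i (e k) * c k (T (\<phi> i)))"
      unfolding f by (rule sum.cong) (auto simp: d.lc_functional[OF d.dual_lf[OF ce(1)] b])
    finally show ?thesis .
  qed
  have "(\<lambda>i. \<gamma> i (e k) * c k (T (\<phi> i))) sums 0" if k: "k < m" for k
  proof -
    have Tc: "T x \<in> vcarrier (dual X)" if "x \<in> vcarrier (dual X)" for x
      using T(1) that by (auto simp: linear_between_def)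
    have lf: "linear_functional (dual X) (\<lambda>x. c k (T x))"
      using T(1) ce(1)[OF k] Tc by (auto simp: linear_functional_def linear_between_def d.dual_add d.dual_scale)
    have "continuous_map (norm_topology (dual X)) (norm_topology scalars) (c k)"
      using ce(1)[OF k] unfolding dual_def[of "dual X"] by (simp add: function_space_def)
    from continuous_map_compose[OF T(2) this]
    obtain C where C: "\<And>x. x \<in> vcarrier (dual X) \<Longrightarrow> norm (c k (T x)) \<le> C * vnorm (dual X) x"
      using d.continuous_functional_iff[OF lf] by (auto simp: comp_def)
    define c' where "c' = (\<lambda>x\<in>vcarrier (dual X). c k (T x))"
    have c': "c' \<in> vcarrier (bidual X)"
      by (rule d.dualI[of _ C]) (use C lf in \<open>auto simp: c'_def linear_functional_def d.add_closed d.scale_closed\<close>)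
    have a': "summable (\<lambda>i. (a i * vnorm (dual X) (e k)) * vnorm (dual X) (\<phi> i))"
      using summable_mult[OF a(2), of "vnorm (dual X) (e k)"] by (simp add: mult_ac)
    have "(\<lambda>i. \<gamma> i (e k) * c' (\<phi> i)) sums 0"
      by (rule nuclear_functional_zero[OF \<phi> _ a' _ c']) (use a(1) zero ce(2)[OF k] in auto)
    then show ?thesis using \<phi> by (simp add: c'_def)
  qed
  then have "(\<lambda>i. \<Sum>k<m. \<gamma> i (e k) * c k (T (\<phi> i))) sums (\<Sum>k<m. 0)" by (intro sums_sum) auto
  then show ?thesis by (simp add: \<gamma>T)
qed

text \<open>The trace of a nuclear operator is well defined on a dual space with the approximation
  property: a nuclear representation of the zero operator has trace 0.\<close>

lemma nuclear_trace_zero: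
  assumes AP: "approximation_property (dual X)"
    and \<phi>: "\<And>i::nat. \<phi> i \<in> vcarrier (dual X)"
    and lin: "\<And>i. linear_functional (dual X) (\<gamma> i)"
    and a0: "\<And>i. a i \<ge> 0"
    and a: "\<And>i \<psi>. \<psi> \<in> vcarrier (dual X) \<Longrightarrow> norm (\<gamma> i \<psi>) \<le> a i * vnorm (dual X) \<psi>"
      "summable (\<lambda>i. a i * vnorm (dual X) (\<phi> i))"
    and zero: "\<And>\<psi> t. \<psi> \<in> vcarrier (dual X) \<Longrightarrow> t \<in> vcarrier X \<Longrightarrow> (\<lambda>i. \<gamma> i \<psi> * \<phi> i t) sums 0"
  shows "(\<lambda>i. \<gamma> i (\<phi> i)) sums 0"
proof -
  interpret d: normed_vspace "dual X" by (rule normed_dual)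
  let ?n = "\<lambda>i. vnorm (dual X) (\<phi> i)"
  have n0: "?n i \<ge> 0" for i using d.norm_nonneg[OF \<phi>] .
  have an0: "a i * ?n i \<ge> 0" for i using a0 n0 by simp
  obtain w where w': "\<forall>i. w i > 0" "(\<lambda>i. 1 / w i) \<longlonglongrightarrow> 0" "summable (\<lambda>i. (a i * ?n i) * w i)"
    using summable_weights[OF a(2) an0] .
  note w = w'(1)[rule_format] w'(2,3)
  \<comment> \<open>These normalised vectors tend to zero because w tends to infinity; a vanishing
    \<open>\<phi> i\<close> gives zero. Approximating them within e changes the i-th trace term by
    at most e times \<open>(a i * ?n i) * w i\<close>, which is still summable.\<close>
  define \<kappa> where "\<kappa> = (\<lambda>i. vscale (dual X) (of_real (1 / (w i * ?n i))) (\<phi> i))"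
  have \<kappa>: "\<kappa> i \<in> vcarrier (dual X)" for i unfolding \<kappa>_def by (rule d.scale_closed[OF \<phi>])
  have \<phi>\<kappa>: "\<phi> i = vscale (dual X) (of_real (w i * ?n i)) (\<kappa> i)" for i
  proof (cases "?n i = 0")
    case True
    then have "\<phi> i = vzero (dual X)" using d.norm_eq_zero[OF \<phi>] by simp
    then show ?thesis unfolding \<kappa>_def by (simp only: d.scale_vzero)
  next
    case False
    then have "w i * ?n i \<noteq> 0" using w(1)[of i] by simp
    then show ?thesis unfolding \<kappa>_def
      by (simp add: d.scale_scale[OF \<phi>] d.scale_one[OF \<phi>] del: of_real_mult of_real_divide flip: of_real_mult)
  qed
  have \<kappa>_le: "vnorm (dual X) (\<kappa> i) \<le> 1 / w i" for i
    using n0[of i] w(1)[of i] unfolding \<kappa>_def d.norm_scale[OF \<phi>] norm_of_real by simp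
  have "(\<lambda>i. vnorm (dual X) (\<kappa> i)) \<longlonglongrightarrow> 0"
    by (rule Lim_null_comparison[OF always_eventually w(2)]) (use \<kappa>_le in \<open>auto simp: d.norm_nonneg[OF \<kappa>]\<close>)
  then have comp: "compactin (norm_topology (dual X)) (insert (vzero (dual X)) (range \<kappa>))"
    by (rule d.compact_null_sequence[OF \<kappa>])
  have le: "norm (\<gamma> i (\<phi> i)) \<le> a i * ?n i" for i by (rule a(1)[OF \<phi>])
  have sm: "summable (\<lambda>i. \<gamma> i (\<phi> i))" by (rule summable_comparison_test'[OF a(2)]) (rule le)
  define C where "C = (\<Sum>i. (a i * ?n i) * w i)"
  have C0: "C \<ge> 0" unfolding C_def using w(1) a0 n0 by (intro suminf_nonneg w(3)) (simp add: less_imp_le)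
  have small: "norm (\<Sum>i. \<gamma> i (\<phi> i)) \<le> e * C" if e: "e > 0" for e
  proof -
    have "\<exists>T. linear_between (dual X) (dual X) T \<and>
      continuous_map (norm_topology (dual X)) (norm_topology (dual X)) T \<and> finite_rank (dual X) T \<and>
      (\<forall>x\<in>insert (vzero (dual X)) (range \<kappa>). vdist (dual X) (T x) x \<le> e)"
      by (rule AP[unfolded approximation_property_def, THEN spec, THEN spec, THEN mp]) (intro conjI comp e)
    then obtain T where T: "linear_between (dual X) (dual X) T"
      "continuous_map (norm_topology (dual X)) (norm_topology (dual X)) T" "finite_rank (dual X) T"
      and T4: "\<forall>x\<in>insert (vzero (dual X)) (range \<kappa>). vdist (dual X) (T x) x \<le> e"
      by (elim exE conjE)
    have Tc: "T x \<in> vcarrier (dual X)" if "x \<in> vcarrier (dual X)" for x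
      using T(1) that by (auto simp: linear_between_def)
    have s0: "(\<lambda>i. \<gamma> i (T (\<phi> i))) sums 0"
      by (rule nuclear_finite_rank_zero[OF \<phi> lin a zero T])
    have term_le: "norm (\<gamma> i (\<phi> i) - \<gamma> i (T (\<phi> i))) \<le> e * ((a i * ?n i) * w i)" for i
    proof -
      have eq: "d.vdiff (T (\<phi> i)) (\<phi> i) = vscale (dual X) (of_real (w i * ?n i)) (d.vdiff (T (\<kappa> i)) (\<kappa> i))"
      proof -
        have "T (\<phi> i) = vscale (dual X) (of_real (w i * ?n i)) (T (\<kappa> i))"
          using T(1) \<kappa>[of i] \<phi>\<kappa>[of i] unfolding linear_between_def by metis
        moreover have "vscale (dual X) (-1) (\<phi> i) = vscale (dual X) (of_real (w i * ?n i)) (vscale (dual X) (-1) (\<kappa> i))"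
          by (subst \<phi>\<kappa>) (simp add: d.scale_scale[OF \<kappa>])
        ultimately show ?thesis by (simp add: d.scale_add_right Tc \<kappa> d.scale_closed)
      qed
      have "vnorm (dual X) (d.vdiff (T (\<kappa> i)) (\<kappa> i)) \<le> e"
        using bspec[OF T4, of "\<kappa> i"] \<kappa> Tc by (simp add: vdist_def)
      then have "vnorm (dual X) (d.vdiff (T (\<phi> i)) (\<phi> i)) \<le> (w i * ?n i) * e"
        unfolding eq d.norm_scale[OF d.diff_closed[OF Tc[OF \<kappa>] \<kappa>]] norm_of_real
        using w(1)[of i] n0[of i] by (simp add: mult_left_mono)
      then have "a i * vnorm (dual X) (d.vdiff (T (\<phi> i)) (\<phi> i)) \<le> a i * ((w i * ?n i) * e)"
        using a0 by (rule mult_left_mono)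
      moreover have "norm (\<gamma> i (d.vdiff (T (\<phi> i)) (\<phi> i))) \<le> a i * vnorm (dual X) (d.vdiff (T (\<phi> i)) (\<phi> i))"
        by (rule a(1)[OF d.diff_closed[OF Tc[OF \<phi>] \<phi>]])
      ultimately show ?thesis
        unfolding d.lf_diff[OF lin Tc[OF \<phi>] \<phi>] by (simp add: norm_minus_commute mult_ac)
    qed
    have "(\<Sum>i. \<gamma> i (\<phi> i)) = (\<Sum>i. \<gamma> i (\<phi> i) - \<gamma> i (T (\<phi> i)))"
      using suminf_diff[OF sm sums_summable[OF s0]] sums_unique[OF s0] by simp
    also have "norm \<dots> \<le> (\<Sum>i. e * ((a i * ?n i) * w i))"
      by (rule norm_suminf_le[OF term_le summable_mult[OF w(3)]])
    also have "\<dots> = e * C" unfolding C_def by (rule suminf_mult[OF w(3)])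
    finally show ?thesis .
  qed
  have "norm (\<Sum>i. \<gamma> i (\<phi> i)) \<le> 0"
  proof (rule field_le_epsilon)
    fix e :: real assume e: "e > 0"
    \<comment> \<open>\<open>C + 1\<close> instead of \<open>C\<close>, as \<open>C\<close> may be
      zero.\<close>
    have "norm (\<Sum>i. \<gamma> i (\<phi> i)) \<le> (e / (C + 1)) * C" using e C0 by (intro small) auto
    also have "\<dots> \<le> e" using e C0 by (simp add: field_simps)
    finally show "norm (\<Sum>i. \<gamma> i (\<phi> i)) \<le> 0 + e" by simp
  qed
  then show ?thesis using summable_sums[OF sm] by simp
qed

end

section \<open>Weakly measurable functions into a separable dual\<close>

lemma sums_integral_bounded:
  fixes f :: "nat \<Rightarrow> 'p \<Rightarrow> 'k::{banach, second_countable_topology}"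
  assumes M: "finite_measure M" and f: "\<And>i. f i \<in> borel_measurable M"
    and B: "\<And>p n. p \<in> space M \<Longrightarrow> (\<Sum>i<n. norm (f i p)) \<le> B"
    and F: "\<And>p. p \<in> space M \<Longrightarrow> (\<lambda>i. f i p) sums F p"
  shows "F \<in> borel_measurable M" "(\<lambda>i. \<integral>p. f i p \<partial>M) sums (\<integral>p. F p \<partial>M)"
proof -
  interpret finite_measure M by (rule M)
  have fi: "integrable M (f i)" for i
  proof (rule integrable_const_bound[of _ B])
    show "AE x in M. norm (f i x) \<le> B"
    proof (rule AE_I2)
      fix p assume p: "p \<in> space M"
      have "norm (f i p) \<le> (\<Sum>j<Suc i. norm (f j p))" by (simp add: sum_nonneg)
      then show "norm (f i p) \<le> B" using B[OF p, of "Suc i"] by linarith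
    qed
  qed (rule f)
  have s: "(\<lambda>p. \<Sum>i<n. f i p) \<in> borel_measurable M" for n using f by measurable
  show Fm: "F \<in> borel_measurable M"
    by (rule borel_measurable_LIMSEQ_metric[OF s]) (use F in \<open>auto simp: sums_def\<close>)
  have "(\<lambda>n. \<integral>p. (\<Sum>i<n. f i p) \<partial>M) \<longlonglongrightarrow> (\<integral>p. F p \<partial>M)"
  proof (rule integral_dominated_convergence[where w = "\<lambda>_. B"])
    show "AE x in M. (\<lambda>n. \<Sum>i<n. f i x) \<longlonglongrightarrow> F x" using F by (intro AE_I2) (auto simp: sums_def)
    show "AE x in M. norm (\<Sum>i<n. f i x) \<le> B" for n
    proof (rule AE_I2)
      fix p assume "p \<in> space M"
      then show "norm (\<Sum>i<n. f i p) \<le> B" using B[of p n] norm_sum[of "\<lambda>i. f i p" "{..<n}"] by linarith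
    qed
  qed (use Fm s in auto)
  then show "(\<lambda>i. \<integral>p. f i p \<partial>M) sums (\<integral>p. F p \<partial>M)"
    by (simp add: sums_def integral_sum fi)
qed

context normed_vspace
begin

lemma ex_dense_sequence:
  assumes "separable_space (norm_topology X)"
  shows "\<exists>\<delta> :: nat \<Rightarrow> 'a. (\<forall>l. \<delta> l \<in> vcarrier X) \<and> (\<forall>x\<in>vcarrier X. \<forall>r>0. \<exists>l. vnorm X (vdiff x (\<delta> l)) < r)"
proof -
  obtain C where C: "countable C" "C \<subseteq> vcarrier X" "norm_topology X closure_of C = vcarrier X"
    using assms unfolding separable_space_def topspace_norm by blast
  have dense: "\<exists>y\<in>C. vnorm X (vdiff x y) < r" if "x \<in> vcarrier X" "r > 0" for x r
    using that C(3) closure_of_norm[OF C(2), of x] by simp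
  have "C \<noteq> {}" using dense[OF zero_closed, of 1] by auto
  then have range: "range (from_nat_into C) = C" using C(1) by (rule range_from_nat_into)
  show ?thesis
  proof (intro exI[of _ "from_nat_into C"] conjI allI ballI impI)
    show "from_nat_into C l \<in> vcarrier X" for l using range C(2) by blast
    fix x and r :: real assume "x \<in> vcarrier X" "r > 0"
    from dense[OF this] show "\<exists>l. vnorm X (vdiff x (from_nat_into C l)) < r"
      using range by (metis rangeE)
  qed
qed

lemma norm_diff_le:
  assumes "x \<in> vcarrier X" "y \<in> vcarrier X"
  shows "vnorm X x \<le> vnorm X (vdiff x y) + vnorm X y"
  using norm_triangle[OF diff_closed[OF assms] assms(2)] by (simp add: diff_add[OF assms])

lemma norm_diff_commute:
  assumes "x \<in> vcarrier X" "y \<in> vcarrier X"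
  shows "vnorm X (vdiff x y) = vnorm X (vdiff y x)"
  by (subst diff_swap[OF assms]) (rule norm_minus[OF diff_closed[OF assms(2,1)]])

lemma dual_diff_apply:
  assumes "x \<in> vcarrier X"
  shows "vadd (dual X) f (vscale (dual X) (-1) g) x = f x - g x"
  using assms by (simp add: dual_ops)

text \<open>Reduces a bound on the dual norm to countably many evaluations, so that it becomes a
  measurable condition for weak* measurable functions. The vector \<open>t (l, m)\<close> attains
  the norm of the dense functional \<open>\<delta> l\<close> up to \<open>1 / Suc m\<close>.\<close>

lemma ex_norming_sequence:
  assumes sep: "separable_space (norm_topology (dual X))"
  shows "\<exists>\<tau> :: nat \<Rightarrow> 'a. (\<forall>i. \<tau> i \<in> unit_ball X) \<and>
    (\<forall>\<psi>\<in>vcarrier (dual X). \<forall>r. vnorm (dual X) \<psi> \<le> r \<longleftrightarrow> (\<forall>i. norm (\<psi> (\<tau> i)) \<le> r))"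
proof -
  interpret d: normed_vspace "dual X" by (rule normed_dual)
  obtain \<delta> :: "nat \<Rightarrow> 'a \<Rightarrow> 'k" where \<delta>: "\<forall>l. \<delta> l \<in> vcarrier (dual X)"
    "\<forall>\<psi>\<in>vcarrier (dual X). \<forall>r>0. \<exists>l. vnorm (dual X) (d.vdiff \<psi> (\<delta> l)) < r"
    using d.ex_dense_sequence[OF sep] by (elim exE conjE)
  have "\<exists>t\<in>unit_ball X. vnorm (dual X) (\<delta> l) - 1 / Suc m \<le> norm (\<delta> l t)" for l m
  proof (rule ccontr)
    assume "\<not> ?thesis"
    then have "vnorm (dual X) (\<delta> l) \<le> vnorm (dual X) (\<delta> l) - 1 / Suc m"
      by (intro dual_norm_le) (auto simp: not_le intro: less_imp_le)
    then show False by simp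
  qed
  then have "\<forall>p. \<exists>t. t \<in> unit_ball X \<and> vnorm (dual X) (\<delta> (fst p)) - 1 / Suc (snd p) \<le> norm (\<delta> (fst p) t)"
    by blast
  from choice[OF this] obtain t where t': "\<forall>p. t p \<in> unit_ball X \<and>
    vnorm (dual X) (\<delta> (fst p)) - 1 / Suc (snd p) \<le> norm (\<delta> (fst p) (t p))" by (elim exE)
  have t: "t p \<in> unit_ball X" "vnorm (dual X) (\<delta> (fst p)) - 1 / Suc (snd p) \<le> norm (\<delta> (fst p) (t p))" for p
    using t' by blast+
  show ?thesis
  proof (intro exI[of _ "\<lambda>i. t (prod_decode i)"] conjI allI ballI)
    show "t (prod_decode i) \<in> unit_ball X" for i by (rule t)
    fix \<psi> r assume \<psi>: "\<psi> \<in> vcarrier (dual X)"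
    show "vnorm (dual X) \<psi> \<le> r \<longleftrightarrow> (\<forall>i. norm (\<psi> (t (prod_decode i))) \<le> r)"
    proof
      assume "vnorm (dual X) \<psi> \<le> r"
      then show "\<forall>i. norm (\<psi> (t (prod_decode i))) \<le> r"
        using dual_unit_bound[OF \<psi> t(1)] order_trans by blast
    next
      assume r: "\<forall>i. norm (\<psi> (t (prod_decode i))) \<le> r"
      have r': "norm (\<psi> (t (l, m))) \<le> r" for l m using spec[OF r, of "prod_encode (l, m)"] by simp
      show "vnorm (dual X) \<psi> \<le> r"
      proof (rule field_le_epsilon)
        fix e :: real assume e: "e > 0"
        obtain l where l: "vnorm (dual X) (d.vdiff \<psi> (\<delta> l)) < e / 3" using \<delta>(2) \<psi> e by (meson zero_less_divide_iff zero_less_numeral)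
        obtain m where m: "1 / Suc m < e / 3" using e nat_approx_posE[of "e/3"] by (auto simp: divide_simps)
        have \<delta>l: "\<delta> l \<in> vcarrier (dual X)" using \<delta>(1) by blast
        have tc: "t (l, m) \<in> vcarrier X" using t(1)[of "(l, m)"] by (simp add: unit_ball_def)
        have "norm (\<delta> l (t (l, m)) - \<psi> (t (l, m))) \<le> vnorm (dual X) (d.vdiff (\<delta> l) \<psi>)"
          using dual_unit_bound[OF d.diff_closed[OF \<delta>l \<psi>] t(1)[of "(l, m)"]]
          unfolding dual_diff_apply[OF tc] .
        then have "norm (\<delta> l (t (l, m))) \<le> norm (\<psi> (t (l, m))) + e / 3"
          using l d.norm_diff_commute[OF \<delta>l \<psi>] norm_triangle_ineq2[of "\<delta> l (t (l, m))" "\<psi> (t (l, m))"] by linarith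
        moreover have "vnorm (dual X) \<psi> \<le> vnorm (dual X) (d.vdiff \<psi> (\<delta> l)) + vnorm (dual X) (\<delta> l)"
          by (rule d.norm_diff_le[OF \<psi> \<delta>l])
        ultimately show "vnorm (dual X) \<psi> \<le> r + e"
          using l m t(2)[of "(l, m)"] r'[of l m] by simp
      qed
    qed
  qed
qed

text \<open>Telescoping through the first elements of a dense sequence at distance at most \<open>2\<^sup>-\<^sup>m\<close>
  writes every functional as an absolutely convergent series whose terms are picked by countably
  many weak* measurable conditions.\<close>

lemma countable_decomposition:
  assumes sep: "separable_space (norm_topology (dual X))"
  shows "\<exists>(\<phi> :: nat \<Rightarrow> 'a \<Rightarrow> 'k) S. (\<forall>i. \<phi> i \<in> vcarrier (dual X)) \<and>
    (\<forall>\<psi>\<in>vcarrier (dual X). \<forall>\<zeta>\<in>vcarrier (bidual X). (\<lambda>i. if \<psi> \<in> S i then \<zeta> (\<phi> i) else 0) sums \<zeta> \<psi>) \<and>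
    (\<forall>\<psi>\<in>vcarrier (dual X). \<forall>n. (\<Sum>i<n. if \<psi> \<in> S i then vnorm (dual X) (\<phi> i) else 0) \<le> vnorm (dual X) \<psi> + 4) \<and>
    (\<forall>(M :: 'p measure) \<Phi>. (\<forall>p\<in>space M. \<Phi> p \<in> vcarrier (dual X)) \<and>
        (\<forall>t\<in>vcarrier X. (\<lambda>p. \<Phi> p t) \<in> borel_measurable M) \<longrightarrow>
        (\<forall>i. Measurable.pred M (\<lambda>p. \<Phi> p \<in> S i)))"
proof -
  interpret d: normed_vspace "dual X" by (rule normed_dual)
  let ?Z = "vcarrier (dual X)"
  obtain \<delta> :: "nat \<Rightarrow> 'a \<Rightarrow> 'k" where \<delta>: "\<forall>l. \<delta> l \<in> ?Z"
    and dense: "\<forall>\<psi>\<in>?Z. \<forall>r>0. \<exists>l. vnorm (dual X) (d.vdiff \<psi> (\<delta> l)) < r"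
    using d.ex_dense_sequence[OF sep] by (elim exE conjE)
  obtain \<tau> :: "nat \<Rightarrow> 'a" where \<tau>: "\<forall>i. \<tau> i \<in> unit_ball X"
    and \<tau>n: "\<forall>\<psi>\<in>?Z. \<forall>r. vnorm (dual X) \<psi> \<le> r \<longleftrightarrow> (\<forall>i. norm (\<psi> (\<tau> i)) \<le> r)"
    using ex_norming_sequence[OF sep] by (elim exE conjE)
  have \<delta>Z: "\<delta> l \<in> ?Z" for l using \<delta> by blast
  have \<tau>X: "\<tau> i \<in> vcarrier X" for i using \<tau> by (simp add: unit_ball_def)
  \<comment> \<open>The least index is a choice with countably many values, determined by countably
    many conditions on the values at the \<open>\<tau> i\<close>; this keeps it measurable.\<close>
  define L where "L = (\<lambda>m \<psi>. LEAST l. \<forall>i. norm (\<psi> (\<tau> i) - \<delta> l (\<tau> i)) \<le> (1/2)^m)"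
  have close_iff: "(\<forall>i. norm (\<psi> (\<tau> i) - \<delta> l (\<tau> i)) \<le> r) \<longleftrightarrow> vnorm (dual X) (d.vdiff \<psi> (\<delta> l)) \<le> r"
    if "\<psi> \<in> ?Z" for \<psi> l r
    using bspec[OF \<tau>n d.diff_closed[OF that \<delta>Z[of l]]] by (simp add: dual_diff_apply[OF \<tau>X])
  have L: "vnorm (dual X) (d.vdiff \<psi> (\<delta> (L m \<psi>))) \<le> (1/2)^m" if \<psi>: "\<psi> \<in> ?Z" for \<psi> m
  proof -
    have "\<exists>l. vnorm (dual X) (d.vdiff \<psi> (\<delta> l)) < (1/2)^m" using dense \<psi> by simp
    then have "\<exists>l. vnorm (dual X) (d.vdiff \<psi> (\<delta> l)) \<le> (1/2)^m" using less_imp_le by blast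
    from LeastI_ex[OF this] show ?thesis unfolding L_def close_iff[OF \<psi>] .
  qed
  \<comment> \<open>An index codes a stage m and two dense functionals. Stage 0 stands for the first
    approximant, later stages for the difference of consecutive ones.\<close>
  define \<phi> where "\<phi> = (\<lambda>i. case prod_decode i of (m, j) \<Rightarrow> case prod_decode j of (l, l') \<Rightarrow>
     if m = 0 then \<delta> l else d.vdiff (\<delta> l) (\<delta> l'))"
  \<comment> \<open>The stage is part of the code, so no code is used twice for the same \<psi>. At
    stage 0 the entry \<open>L (m - 1)\<close> is a dummy.\<close>
  define idx where "idx = (\<lambda>\<psi> m. prod_encode (m, prod_encode (L m \<psi>, L (m - 1) \<psi>)))"
  define S where "S = (\<lambda>i. {\<psi>. i \<in> range (idx \<psi>)})"
  have \<phi>Z: "\<phi> i \<in> ?Z" for i by (auto simp: \<phi>_def \<delta>Z d.diff_closed split: prod.split)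
  have inj: "inj (idx \<psi>)" for \<psi> by (auto simp: inj_def idx_def)
  have \<phi>idx: "\<phi> (idx \<psi> m) = (if m = 0 then \<delta> (L 0 \<psi>) else d.vdiff (\<delta> (L m \<psi>)) (\<delta> (L (m - 1) \<psi>)))" for \<psi> m
    by (auto simp: \<phi>_def idx_def)
  have norm_\<phi>idx: "vnorm (dual X) (\<phi> (idx \<psi> (Suc m))) \<le> 3 * (1/2)^Suc m" if \<psi>: "\<psi> \<in> ?Z" for \<psi> m
  proof -
    have "d.vdiff (\<delta> (L (Suc m) \<psi>)) (\<delta> (L m \<psi>)) =
        vadd (dual X) (d.vdiff (\<delta> (L (Suc m) \<psi>)) \<psi>) (d.vdiff \<psi> (\<delta> (L m \<psi>)))"
      by (rule d.diff_triangle[symmetric]) (use \<psi> \<delta>Z in auto)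
    then have "vnorm (dual X) (\<phi> (idx \<psi> (Suc m))) \<le>
       vnorm (dual X) (d.vdiff (\<delta> (L (Suc m) \<psi>)) \<psi>) + vnorm (dual X) (d.vdiff \<psi> (\<delta> (L m \<psi>)))"
      unfolding \<phi>idx using d.norm_triangle[OF d.diff_closed[OF \<delta>Z \<psi>] d.diff_closed[OF \<psi> \<delta>Z]] by simp
    then show ?thesis using L[OF \<psi>, of "Suc m"] L[OF \<psi>, of m] d.norm_diff_commute[OF \<delta>Z[of "L (Suc m) \<psi>"] \<psi>] by simp
  qed
  have norm_\<phi>idx0: "vnorm (dual X) (\<phi> (idx \<psi> 0)) \<le> vnorm (dual X) \<psi> + 1" if \<psi>: "\<psi> \<in> ?Z" for \<psi>
    using d.norm_diff_le[OF \<delta>Z \<psi>, of "L 0 \<psi>"] L[OF \<psi>, of 0] d.norm_diff_commute[OF \<delta>Z[of "L 0 \<psi>"] \<psi>] by (simp add: \<phi>idx)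
  \<comment> \<open>Consecutive approximants differ by at most \<open>(1/2)^Suc m + (1/2)^m\<close>.
    These bounds add up to 3, and the first approximant exceeds the norm of \<psi> by at most 1:
    hence the 4 in the bound.\<close>
  have s3: "(\<lambda>m. 3 * (1/2)^Suc m :: real) sums 3" using sums_mult[OF power_half_series, of 3] by simp
  have sn: "summable (\<lambda>m. vnorm (dual X) (\<phi> (idx \<psi> m)))"
    "(\<Sum>m. vnorm (dual X) (\<phi> (idx \<psi> m))) \<le> vnorm (dual X) \<psi> + 4" if \<psi>: "\<psi> \<in> ?Z" for \<psi>
  proof -
    have s: "summable (\<lambda>m. vnorm (dual X) (\<phi> (idx \<psi> (Suc m))))"
      by (rule summable_comparison_test'[OF sums_summable[OF s3]]) (use norm_\<phi>idx[OF \<psi>] d.norm_nonneg[OF \<phi>Z] in auto)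
    then show s': "summable (\<lambda>m. vnorm (dual X) (\<phi> (idx \<psi> m)))" by (rule summable_Suc_iff[THEN iffD1])
    have "(\<Sum>m. vnorm (dual X) (\<phi> (idx \<psi> (Suc m)))) \<le> (\<Sum>m. 3 * (1/2)^Suc m)"
      by (rule suminf_le[OF norm_\<phi>idx[OF \<psi>] s sums_summable[OF s3]])
    then show "(\<Sum>m. vnorm (dual X) (\<phi> (idx \<psi> m))) \<le> vnorm (dual X) \<psi> + 4"
      using suminf_split_head[OF s'] norm_\<phi>idx0[OF \<psi>] sums_unique[OF s3] by simp
  qed
  have transfer: "((\<lambda>i. if \<psi> \<in> S i then h (\<phi> i) else 0) has_sum s) UNIV"
    if "summable (\<lambda>m. norm (h (\<phi> (idx \<psi> m))))" "(\<lambda>m. h (\<phi> (idx \<psi> m))) sums s"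
    for \<psi> s and h :: "('a \<Rightarrow> 'k) \<Rightarrow> 'c::banach"
  proof -
    have "((\<lambda>m. h (\<phi> (idx \<psi> m))) has_sum s) UNIV" using that by (rule norm_summable_imp_has_sum)
    then have "((\<lambda>i. h (\<phi> i)) has_sum s) (range (idx \<psi>))"
      using has_sum_reindex[OF inj[of \<psi>], of "\<lambda>i. h (\<phi> i)" s] by (simp add: comp_def)
    then show ?thesis by (rule has_sum_cong_neutral[THEN iffD1, rotated -1]) (auto simp: S_def)
  qed
  have repr: "(\<lambda>i. if \<psi> \<in> S i then \<zeta> (\<phi> i) else 0) sums \<zeta> \<psi>" if \<psi>: "\<psi> \<in> ?Z" and \<zeta>: "\<zeta> \<in> vcarrier (bidual X)" for \<psi> \<zeta>
  proof (rule has_sum_imp_sums, rule transfer)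
    have "summable (\<lambda>m. vnorm (bidual X) \<zeta> * vnorm (dual X) (\<phi> (idx \<psi> m)))" by (rule summable_mult[OF sn(1)[OF \<psi>]])
    then show "summable (\<lambda>m. norm (\<zeta> (\<phi> (idx \<psi> m))))"
      by (rule summable_comparison_test') (use d.dual_bound[OF \<zeta> \<phi>Z] in auto)
    have partial: "(\<Sum>m<Suc n. \<zeta> (\<phi> (idx \<psi> m))) = \<zeta> (\<delta> (L n \<psi>))" for n
      by (induction n) (simp_all add: \<phi>idx d.lf_diff[OF d.dual_lf[OF \<zeta>]] \<delta>Z)
    have "(\<lambda>n. \<zeta> (\<delta> (L n \<psi>))) \<longlonglongrightarrow> \<zeta> \<psi>"
    proof (rule Lim_transform)
      have "(\<lambda>n. vnorm (bidual X) \<zeta> * (1/2)^n) \<longlonglongrightarrow> 0" by (intro tendsto_mult_right_zero LIMSEQ_power_zero) simp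
      then show "(\<lambda>n. \<zeta> (\<delta> (L n \<psi>)) - \<zeta> \<psi>) \<longlonglongrightarrow> 0"
      proof (rule Lim_null_comparison[rotated], intro always_eventually allI)
        fix n
        have "norm (\<zeta> (d.vdiff (\<delta> (L n \<psi>)) \<psi>)) \<le> vnorm (bidual X) \<zeta> * vnorm (dual X) (d.vdiff (\<delta> (L n \<psi>)) \<psi>)"
          by (rule d.dual_bound[OF \<zeta> d.diff_closed[OF \<delta>Z \<psi>]])
        also have "\<dots> \<le> vnorm (bidual X) \<zeta> * (1/2)^n"
          using L[OF \<psi>, of n] d.norm_diff_commute[OF \<delta>Z[of "L n \<psi>"] \<psi>] d.dual_norm_nonneg[OF \<zeta>]
          by (intro mult_left_mono) auto
        finally show "norm (\<zeta> (\<delta> (L n \<psi>)) - \<zeta> \<psi>) \<le> vnorm (bidual X) \<zeta> * (1/2)^n"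
          by (simp add: d.lf_diff[OF d.dual_lf[OF \<zeta>]] \<delta>Z \<psi>)
      qed
    qed simp
    then show "(\<lambda>m. \<zeta> (\<phi> (idx \<psi> m))) sums \<zeta> \<psi>"
      unfolding sums_def partial[symmetric] by (rule LIMSEQ_imp_Suc)
  qed
  have bound: "(\<Sum>i<n. if \<psi> \<in> S i then vnorm (dual X) (\<phi> i) else 0) \<le> vnorm (dual X) \<psi> + 4" if \<psi>: "\<psi> \<in> ?Z" for \<psi> n
  proof -
    have "((\<lambda>i. if \<psi> \<in> S i then vnorm (dual X) (\<phi> i) else 0) has_sum (\<Sum>m. vnorm (dual X) (\<phi> (idx \<psi> m)))) UNIV"
      by (rule transfer) (use sn(1)[OF \<psi>] d.norm_nonneg[OF \<phi>Z] in \<open>simp_all add: summable_sums\<close>)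
    then have s: "(\<lambda>i. if \<psi> \<in> S i then vnorm (dual X) (\<phi> i) else 0) sums (\<Sum>m. vnorm (dual X) (\<phi> (idx \<psi> m)))"
      by (rule has_sum_imp_sums)
    have "(\<Sum>i<n. if \<psi> \<in> S i then vnorm (dual X) (\<phi> i) else 0) \<le> (\<Sum>i. if \<psi> \<in> S i then vnorm (dual X) (\<phi> i) else 0)"
      by (rule sum_le_suminf[OF sums_summable[OF s]]) (auto simp: d.norm_nonneg[OF \<phi>Z])
    then show ?thesis using sums_unique[OF s] sn(2)[OF \<psi>] by simp
  qed
  have meas: "Measurable.pred M (\<lambda>p. \<Phi> p \<in> S i)"
    if \<Phi>: "\<forall>t\<in>vcarrier X. (\<lambda>p. \<Phi> p t) \<in> borel_measurable M" for M :: "'p measure" and \<Phi> i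
  proof -
    have [measurable]: "(\<lambda>p. \<Phi> p (\<tau> j)) \<in> borel_measurable M" for j using \<Phi> \<tau>X by blast
    have [measurable]: "(\<lambda>p. L m (\<Phi> p)) \<in> measurable M (count_space UNIV)" for m
      unfolding L_def by measurable
    have "(\<lambda>p. \<Phi> p \<in> S i) = (\<lambda>p. \<exists>m. i = prod_encode (m, prod_encode (L m (\<Phi> p), L (m - 1) (\<Phi> p))))"
      by (auto simp: S_def idx_def fun_eq_iff)
    then show ?thesis by simp measurable
  qed
  show ?thesis
    by (intro exI[of _ \<phi>] exI[of _ S] conjI allI ballI impI) (use \<phi>Z repr bound meas in blast)+
qed

text \<open>Integrating the expansion of \<open>\<Phi>\<close> term by term gives a nuclear trace:
  \<open>\<gamma> i\<close> integrates \<open>\<xi>\<close> over the set where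
  \<open>\<Phi> p \<in> S i\<close>, and the operator sends \<psi> to the functional whose value at
  t is the integral of \<open>\<xi> p \<psi> * \<Phi> p t\<close>. The expansion is passed as an
  argument so that two measures can share the same \<open>\<phi>\<close>.\<close>

lemma nuclear_integral_representation:
  fixes M :: "'p measure" and \<phi> :: "nat \<Rightarrow> 'a \<Rightarrow> 'k" and \<xi> :: "'p \<Rightarrow> ('a \<Rightarrow> 'k) \<Rightarrow> 'k"
  assumes M: "finite_measure M"
    and \<Phi>: "\<forall>p\<in>space M. \<Phi> p \<in> vcarrier (dual X) \<and> vnorm (dual X) (\<Phi> p) \<le> C"
    and \<xi>: "\<forall>p\<in>space M. \<xi> p \<in> vcarrier (bidual X) \<and> vnorm (bidual X) (\<xi> p) \<le> C'"
    and \<xi>m: "\<forall>\<psi>\<in>vcarrier (dual X). (\<lambda>p. \<xi> p \<psi>) \<in> borel_measurable M"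
    and C: "0 \<le> C'"
    and \<phi>: "\<forall>i. \<phi> i \<in> vcarrier (dual X)"
    and repr: "\<forall>\<psi>\<in>vcarrier (dual X). \<forall>\<zeta>\<in>vcarrier (bidual X).
      (\<lambda>i. if \<psi> \<in> S i then \<zeta> (\<phi> i) else 0) sums \<zeta> \<psi>"
    and bound: "\<forall>\<psi>\<in>vcarrier (dual X). \<forall>n.
      (\<Sum>i<n. if \<psi> \<in> S i then vnorm (dual X) (\<phi> i) else 0) \<le> vnorm (dual X) \<psi> + 4"
    and meas: "\<forall>i. Measurable.pred M (\<lambda>p. \<Phi> p \<in> S i)"
  shows "(\<lambda>p. \<xi> p (\<Phi> p)) \<in> borel_measurable M"
    and "\<exists>\<gamma> a. (\<forall>i. linear_functional (dual X) (\<gamma> i)) \<and> (\<forall>i. 0 \<le> a i) \<and>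
      (\<forall>i. \<forall>\<psi>\<in>vcarrier (dual X). norm (\<gamma> i \<psi>) \<le> a i * vnorm (dual X) \<psi>) \<and>
      summable (\<lambda>i. a i * vnorm (dual X) (\<phi> i)) \<and>
      (\<forall>\<psi>\<in>vcarrier (dual X). \<forall>t\<in>vcarrier X. (\<lambda>i. \<gamma> i \<psi> * \<phi> i t) sums (\<integral>p. \<xi> p \<psi> * \<Phi> p t \<partial>M)) \<and>
      (\<lambda>i. \<gamma> i (\<phi> i)) sums (\<integral>p. \<xi> p (\<Phi> p) \<partial>M)"
proof -
  interpret d: normed_vspace "dual X" by (rule normed_dual)
  interpret finite_measure M by (rule M)
  let ?Z = "vcarrier (dual X)"
  have \<phi>Z: "\<phi> i \<in> ?Z" for i using \<phi> by blast
  have [measurable]: "Measurable.pred M (\<lambda>p. \<Phi> p \<in> S i)" for i using meas by blast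
  define f where "f = (\<lambda>i \<psi> p. if \<Phi> p \<in> S i then \<xi> p \<psi> else 0)"
  have fm: "f i \<psi> \<in> borel_measurable M" if "\<psi> \<in> ?Z" for i \<psi>
  proof -
    have [measurable]: "(\<lambda>p. \<xi> p \<psi>) \<in> borel_measurable M" using \<xi>m that by blast
    show ?thesis unfolding f_def by measurable
  qed
  have \<xi>le: "norm (\<xi> p \<psi>) \<le> C' * vnorm (dual X) \<psi>" if p: "p \<in> space M" and \<psi>: "\<psi> \<in> ?Z" for p \<psi>
    using d.dual_bound[of "\<xi> p" \<psi>] bspec[OF \<xi> p] \<psi> mult_right_mono[of "vnorm (bidual X) (\<xi> p)" C', OF _ d.norm_nonneg[OF \<psi>]]
    by linarith
  have fle: "norm (f i \<psi> p) \<le> (if \<Phi> p \<in> S i then C' * vnorm (dual X) \<psi> else 0)" if "p \<in> space M" "\<psi> \<in> ?Z" for i p \<psi>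
    using \<xi>le[OF that] by (simp add: f_def)
  have fi: "integrable M (f i \<psi>)" if \<psi>: "\<psi> \<in> ?Z" for i \<psi>
  proof (rule integrable_const_bound[of _ "C' * vnorm (dual X) \<psi>"])
    show "AE x in M. norm (f i \<psi> x) \<le> C' * vnorm (dual X) \<psi>"
    proof (rule AE_I2)
      fix p assume "p \<in> space M"
      from fle[OF this \<psi>, of i] show "norm (f i \<psi> p) \<le> C' * vnorm (dual X) \<psi>"
        using C d.norm_nonneg[OF \<psi>] by (auto split: if_splits)
    qed
  qed (rule fm[OF \<psi>])
  define A where "A = (\<lambda>i. {p\<in>space M. \<Phi> p \<in> S i})"
  have As: "A i \<in> sets M" for i unfolding A_def by measurable
  have intA: "integrable M (\<lambda>p. if \<Phi> p \<in> S i then c else 0)"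
    "(\<integral>p. (if \<Phi> p \<in> S i then c else 0) \<partial>M) = measure M (A i) * c" for i and c :: real
  proof -
    have e: "(if \<Phi> p \<in> S i then c else 0) = indicator (A i) p * c" if "p \<in> space M" for p
      using that by (auto simp: A_def indicator_def)
    have "integrable M (\<lambda>p. indicator (A i) p * c)" using As by (simp add: emeasure_finite less_top[symmetric])
    moreover have "integrable M (\<lambda>p. if \<Phi> p \<in> S i then c else 0) = integrable M (\<lambda>p. indicator (A i) p * c)"
      by (rule Bochner_Integration.integrable_cong) (simp_all only: e)
    ultimately show "integrable M (\<lambda>p. if \<Phi> p \<in> S i then c else 0)" by simp
    have "(\<integral>p. (if \<Phi> p \<in> S i then c else 0) \<partial>M) = (\<integral>p. indicator (A i) p * c \<partial>M)"
      by (rule Bochner_Integration.integral_cong[OF refl e])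
    also have "\<dots> = measure M (A i) * c" using As sets.sets_into_space[OF As[of i]] by (simp add: Int_absorb2)
    finally show "(\<integral>p. (if \<Phi> p \<in> S i then c else 0) \<partial>M) = measure M (A i) * c" .
  qed
  define \<gamma> where "\<gamma> = (\<lambda>i \<psi>. \<integral>p. f i \<psi> p \<partial>M)"
  define a where "a = (\<lambda>i. C' * measure M (A i))"
  have lin: "linear_functional (dual X) (\<gamma> i)" for i
    unfolding linear_functional_def
  proof (intro conjI ballI allI)
    fix \<psi> \<psi>' assume Z: "\<psi> \<in> ?Z" "\<psi>' \<in> ?Z"
    have "\<gamma> i (vadd (dual X) \<psi> \<psi>') = (\<integral>p. f i \<psi> p + f i \<psi>' p \<partial>M)"
      unfolding \<gamma>_def
      by (rule Bochner_Integration.integral_cong) (use \<xi> d.dual_add Z in \<open>auto simp: f_def\<close>)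
    then show "\<gamma> i (vadd (dual X) \<psi> \<psi>') = \<gamma> i \<psi> + \<gamma> i \<psi>'" unfolding \<gamma>_def by (simp add: fi Z)
  next
    fix c \<psi> assume Z: "\<psi> \<in> ?Z"
    have "\<gamma> i (vscale (dual X) c \<psi>) = (\<integral>p. c * f i \<psi> p \<partial>M)"
      unfolding \<gamma>_def
      by (rule Bochner_Integration.integral_cong) (use \<xi> d.dual_scale Z in \<open>auto simp: f_def\<close>)
    then show "\<gamma> i (vscale (dual X) c \<psi>) = c * \<gamma> i \<psi>" unfolding \<gamma>_def by simp
  qed
  have a0: "0 \<le> a i" for i using C by (simp add: a_def)
  have \<gamma>le: "norm (\<gamma> i \<psi>) \<le> a i * vnorm (dual X) \<psi>" if \<psi>: "\<psi> \<in> ?Z" for i \<psi>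
  proof -
    have "norm (\<gamma> i \<psi>) \<le> (\<integral>p. norm (f i \<psi> p) \<partial>M)" unfolding \<gamma>_def by (rule integral_norm_bound)
    also have "\<dots> \<le> (\<integral>p. (if \<Phi> p \<in> S i then C' * vnorm (dual X) \<psi> else 0) \<partial>M)"
      by (rule integral_mono[OF integrable_norm[OF fi[OF \<psi>]] intA(1)]) (rule fle[OF _ \<psi>])
    also have "\<dots> = a i * vnorm (dual X) \<psi>" unfolding intA a_def by simp
    finally show ?thesis .
  qed
  have bd: "(\<Sum>i<n. if \<Phi> p \<in> S i then vnorm (dual X) (\<phi> i) else 0) \<le> C + 4" if "p \<in> space M" for p n
  proof -
    have P: "\<Phi> p \<in> ?Z" "vnorm (dual X) (\<Phi> p) \<le> C" using \<Phi> that by blast+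
    have "(\<Sum>i<n. if \<Phi> p \<in> S i then vnorm (dual X) (\<phi> i) else 0) \<le> vnorm (dual X) (\<Phi> p) + 4"
      using bound P(1) by blast
    then show ?thesis using P(2) by linarith
  qed
  have C4: "C + 4 \<ge> 0" if "p \<in> space M" for p using bd[OF that, of 0] by simp
  \<comment> \<open>Integrating the pointwise bound \<open>C + 4\<close> of the expansion bounds all
    partial sums.\<close>
  have sm: "summable (\<lambda>i. a i * vnorm (dual X) (\<phi> i))"
  proof (rule summableI_nonneg_bounded)
    show "0 \<le> a i * vnorm (dual X) (\<phi> i)" for i using a0 d.norm_nonneg[OF \<phi>Z] by simp
    fix n
    have "(\<Sum>i<n. measure M (A i) * vnorm (dual X) (\<phi> i)) =
      (\<integral>p. (\<Sum>i<n. if \<Phi> p \<in> S i then vnorm (dual X) (\<phi> i) else 0) \<partial>M)"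
      by (simp add: intA integral_sum)
    also have "\<dots> \<le> (\<integral>p. C + 4 \<partial>M)" by (intro integral_mono bd) (auto intro!: Bochner_Integration.integrable_sum intA(1))
    finally have "(\<Sum>i<n. measure M (A i) * vnorm (dual X) (\<phi> i)) \<le> (\<integral>p. C + 4 \<partial>M)" .
    then have "C' * (\<Sum>i<n. measure M (A i) * vnorm (dual X) (\<phi> i)) \<le> C' * (\<integral>p. C + 4 \<partial>M)"
      using C by (rule mult_left_mono)
    then show "(\<Sum>i<n. a i * vnorm (dual X) (\<phi> i)) \<le> C' * (\<integral>p. C + 4 \<partial>M)"
      by (simp only: a_def sum_distrib_left mult.assoc)
  qed
  have s1: "(\<lambda>i. \<gamma> i \<psi> * \<phi> i t) sums (\<integral>p. \<xi> p \<psi> * \<Phi> p t \<partial>M)" if \<psi>: "\<psi> \<in> ?Z" and t: "t \<in> vcarrier X" for \<psi> t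
  proof -
    have "(\<lambda>i. \<integral>p. f i \<psi> p * \<phi> i t \<partial>M) sums (\<integral>p. \<xi> p \<psi> * \<Phi> p t \<partial>M)"
    proof (rule sums_integral_bounded(2)[OF M])
      show "(\<lambda>p. f i \<psi> p * \<phi> i t) \<in> borel_measurable M" for i using fm[OF \<psi>, of i] by measurable
      fix p assume p: "p \<in> space M"
      have "(\<lambda>i. if \<Phi> p \<in> S i then canonical X t (\<phi> i) else 0) sums canonical X t (\<Phi> p)"
        using repr bspec[OF \<Phi> p] canonical_bidual(1)[OF t] by blast
      then have "(\<lambda>i. \<xi> p \<psi> * (if \<Phi> p \<in> S i then canonical X t (\<phi> i) else 0)) sums (\<xi> p \<psi> * canonical X t (\<Phi> p))"
        by (rule sums_mult)
      moreover have "\<xi> p \<psi> * (if \<Phi> p \<in> S i then canonical X t (\<phi> i) else 0) = f i \<psi> p * \<phi> i t" for i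
        by (simp add: f_def canonical_apply[OF \<phi>Z])
      ultimately show "(\<lambda>i. f i \<psi> p * \<phi> i t) sums (\<xi> p \<psi> * \<Phi> p t)" using bspec[OF \<Phi> p] by (simp add: canonical_apply)
      fix n
      have "(\<Sum>i<n. norm (f i \<psi> p * \<phi> i t)) \<le>
         (\<Sum>i<n. (C' * vnorm (dual X) \<psi> * vnorm X t) * (if \<Phi> p \<in> S i then vnorm (dual X) (\<phi> i) else 0))"
      proof (rule sum_mono)
        fix i
        have "norm (\<xi> p \<psi>) * norm (\<phi> i t) \<le> (C' * vnorm (dual X) \<psi>) * (vnorm (dual X) (\<phi> i) * vnorm X t)"
          by (intro mult_mono \<xi>le[OF p \<psi>] dual_bound[OF \<phi>Z t]) (auto simp: C d.norm_nonneg[OF \<psi>])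
        then show "norm (f i \<psi> p * \<phi> i t) \<le>
          (C' * vnorm (dual X) \<psi> * vnorm X t) * (if \<Phi> p \<in> S i then vnorm (dual X) (\<phi> i) else 0)"
          by (simp add: f_def norm_mult mult_ac)
      qed
      also have "\<dots> \<le> (C' * vnorm (dual X) \<psi> * vnorm X t) * (C + 4)"
        unfolding sum_distrib_left[symmetric]
        by (intro mult_left_mono bd[OF p] mult_nonneg_nonneg C d.norm_nonneg[OF \<psi>] norm_nonneg[OF t])
      finally show "(\<Sum>i<n. norm (f i \<psi> p * \<phi> i t)) \<le> (C' * vnorm (dual X) \<psi> * vnorm X t) * (C + 4)" .
    qed
    then show ?thesis unfolding \<gamma>_def by simp
  qed
  have s2: "(\<lambda>p. \<xi> p (\<Phi> p)) \<in> borel_measurable M" "(\<lambda>i. \<gamma> i (\<phi> i)) sums (\<integral>p. \<xi> p (\<Phi> p) \<partial>M)"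
  proof -
    have B: "(\<Sum>i<n. norm (f i (\<phi> i) p)) \<le> C' * (C + 4)" if p: "p \<in> space M" for p n
    proof -
      have "(\<Sum>i<n. norm (f i (\<phi> i) p)) \<le> (\<Sum>i<n. C' * (if \<Phi> p \<in> S i then vnorm (dual X) (\<phi> i) else 0))"
        by (rule sum_mono) (use fle[OF p \<phi>Z] in \<open>auto simp: if_distrib cong: if_cong\<close>)
      also have "\<dots> \<le> C' * (C + 4)"
        unfolding sum_distrib_left[symmetric] by (intro mult_left_mono bd[OF p] C)
      finally show ?thesis .
    qed
    have F: "(\<lambda>i. f i (\<phi> i) p) sums \<xi> p (\<Phi> p)" if p: "p \<in> space M" for p
      unfolding f_def using repr bspec[OF \<Phi> p] bspec[OF \<xi> p] by blast
    show "(\<lambda>p. \<xi> p (\<Phi> p)) \<in> borel_measurable M" by (rule sums_integral_bounded(1)[OF M fm[OF \<phi>Z] B F])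
    show "(\<lambda>i. \<gamma> i (\<phi> i)) sums (\<integral>p. \<xi> p (\<Phi> p) \<partial>M)"
      unfolding \<gamma>_def by (rule sums_integral_bounded(2)[OF M fm[OF \<phi>Z] B F])
  qed
  show "(\<lambda>p. \<xi> p (\<Phi> p)) \<in> borel_measurable M" by (rule s2(1))
  show "\<exists>\<gamma> a. (\<forall>i. linear_functional (dual X) (\<gamma> i)) \<and> (\<forall>i. 0 \<le> a i) \<and>
      (\<forall>i. \<forall>\<psi>\<in>vcarrier (dual X). norm (\<gamma> i \<psi>) \<le> a i * vnorm (dual X) \<psi>) \<and>
      summable (\<lambda>i. a i * vnorm (dual X) (\<phi> i)) \<and>
      (\<forall>\<psi>\<in>vcarrier (dual X). \<forall>t\<in>vcarrier X. (\<lambda>i. \<gamma> i \<psi> * \<phi> i t) sums (\<integral>p. \<xi> p \<psi> * \<Phi> p t \<partial>M)) \<and>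
      (\<lambda>i. \<gamma> i (\<phi> i)) sums (\<integral>p. \<xi> p (\<Phi> p) \<partial>M)"
    by (intro exI[of _ \<gamma>] exI[of _ a] conjI allI ballI lin a0 \<gamma>le sm s1 s2(2))
qed

text \<open>Both sides are traces along the same vectors \<open>\<phi> i\<close>. By
  \<open>eq\<close> the difference of their coefficient functionals represents the zero operator, so
  \<open>nuclear_trace_zero\<close> applies.\<close>

lemma trace_integral_eq:
  fixes M1 M2 :: "'p measure"
  assumes sep: "separable_space (norm_topology (dual X))" and AP: "approximation_property (dual X)"
    and M: "finite_measure M1" "finite_measure M2" and C: "0 \<le> C'"
    and \<Phi>1: "\<forall>p\<in>space M1. \<Phi> p \<in> vcarrier (dual X) \<and> vnorm (dual X) (\<Phi> p) \<le> C"
    and \<xi>1: "\<forall>p\<in>space M1. \<xi> p \<in> vcarrier (bidual X) \<and> vnorm (bidual X) (\<xi> p) \<le> C'"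
    and m1: "\<forall>\<psi>\<in>vcarrier (dual X). (\<lambda>p. \<xi> p \<psi>) \<in> borel_measurable M1"
      "\<forall>t\<in>vcarrier X. (\<lambda>p. \<Phi> p t) \<in> borel_measurable M1"
    and \<Phi>2: "\<forall>p\<in>space M2. \<Phi> p \<in> vcarrier (dual X) \<and> vnorm (dual X) (\<Phi> p) \<le> C"
    and \<xi>2: "\<forall>p\<in>space M2. \<xi> p \<in> vcarrier (bidual X) \<and> vnorm (bidual X) (\<xi> p) \<le> C'"
    and m2: "\<forall>\<psi>\<in>vcarrier (dual X). (\<lambda>p. \<xi> p \<psi>) \<in> borel_measurable M2"
      "\<forall>t\<in>vcarrier X. (\<lambda>p. \<Phi> p t) \<in> borel_measurable M2"
    and eq: "\<forall>\<psi>\<in>vcarrier (dual X). \<forall>t\<in>vcarrier X.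
      (\<integral>p. \<xi> p \<psi> * \<Phi> p t \<partial>M1) = (\<integral>p. \<xi> p \<psi> * \<Phi> p t \<partial>M2)"
  shows "(\<lambda>p. \<xi> p (\<Phi> p)) \<in> borel_measurable M1"
    and "(\<integral>p. \<xi> p (\<Phi> p) \<partial>M1) = (\<integral>p. \<xi> p (\<Phi> p) \<partial>M2)"
proof -
  interpret d: normed_vspace "dual X" by (rule normed_dual)
  let ?Z = "vcarrier (dual X)"
  obtain \<phi> :: "nat \<Rightarrow> 'a \<Rightarrow> 'k" and S where \<phi>: "\<forall>i. \<phi> i \<in> ?Z"
    and repr: "\<forall>\<psi>\<in>?Z. \<forall>\<zeta>\<in>vcarrier (bidual X). (\<lambda>i. if \<psi> \<in> S i then \<zeta> (\<phi> i) else 0) sums \<zeta> \<psi>"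
    and bound: "\<forall>\<psi>\<in>?Z. \<forall>n. (\<Sum>i<n. if \<psi> \<in> S i then vnorm (dual X) (\<phi> i) else 0) \<le> vnorm (dual X) \<psi> + 4"
    and meas: "\<forall>(M :: 'p measure) \<Phi>. (\<forall>p\<in>space M. \<Phi> p \<in> ?Z) \<and>
        (\<forall>t\<in>vcarrier X. (\<lambda>p. \<Phi> p t) \<in> borel_measurable M) \<longrightarrow>
        (\<forall>i. Measurable.pred M (\<lambda>p. \<Phi> p \<in> S i))"
    using countable_decomposition[OF sep, where 'p='p] by (elim exE conjE)
  have meas1: "\<forall>i. Measurable.pred M1 (\<lambda>p. \<Phi> p \<in> S i)"
    by (rule meas[THEN spec, THEN spec, THEN mp]) (use \<Phi>1 m1(2) in blast)
  have meas2: "\<forall>i. Measurable.pred M2 (\<lambda>p. \<Phi> p \<in> S i)"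
    by (rule meas[THEN spec, THEN spec, THEN mp]) (use \<Phi>2 m2(2) in blast)
  note r1 = nuclear_integral_representation[OF M(1) \<Phi>1 \<xi>1 m1(1) C \<phi> repr bound meas1]
  note r2 = nuclear_integral_representation[OF M(2) \<Phi>2 \<xi>2 m2(1) C \<phi> repr bound meas2]
  show "(\<lambda>p. \<xi> p (\<Phi> p)) \<in> borel_measurable M1" by (rule r1(1))
  obtain \<gamma> a where g: "\<forall>i. linear_functional (dual X) (\<gamma> i)" "\<forall>i. 0 \<le> a i"
    "\<forall>i. \<forall>\<psi>\<in>?Z. norm (\<gamma> i \<psi>) \<le> a i * vnorm (dual X) \<psi>"
    "summable (\<lambda>i. a i * vnorm (dual X) (\<phi> i))"
    "\<forall>\<psi>\<in>?Z. \<forall>t\<in>vcarrier X. (\<lambda>i. \<gamma> i \<psi> * \<phi> i t) sums (\<integral>p. \<xi> p \<psi> * \<Phi> p t \<partial>M1)"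
    "(\<lambda>i. \<gamma> i (\<phi> i)) sums (\<integral>p. \<xi> p (\<Phi> p) \<partial>M1)"
    using r1(2) by (elim exE conjE)
  obtain \<gamma>' a' where g': "\<forall>i. linear_functional (dual X) (\<gamma>' i)" "\<forall>i. 0 \<le> a' i"
    "\<forall>i. \<forall>\<psi>\<in>?Z. norm (\<gamma>' i \<psi>) \<le> a' i * vnorm (dual X) \<psi>"
    "summable (\<lambda>i. a' i * vnorm (dual X) (\<phi> i))"
    "\<forall>\<psi>\<in>?Z. \<forall>t\<in>vcarrier X. (\<lambda>i. \<gamma>' i \<psi> * \<phi> i t) sums (\<integral>p. \<xi> p \<psi> * \<Phi> p t \<partial>M2)"
    "(\<lambda>i. \<gamma>' i (\<phi> i)) sums (\<integral>p. \<xi> p (\<Phi> p) \<partial>M2)"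
    using r2(2) by (elim exE conjE)
  have "(\<lambda>i. \<gamma> i (\<phi> i) - \<gamma>' i (\<phi> i)) sums 0"
  proof (rule nuclear_trace_zero[OF AP, where a = "\<lambda>i. a i + a' i" and \<phi> = \<phi>
        and \<gamma> = "\<lambda>i \<psi>. \<gamma> i \<psi> - \<gamma>' i \<psi>"])
    show "\<phi> i \<in> ?Z" for i using \<phi> by blast
    show "linear_functional (dual X) (\<lambda>\<psi>. \<gamma> i \<psi> - \<gamma>' i \<psi>)" for i
      using g(1) g'(1) unfolding linear_functional_def by (simp add: algebra_simps)
    show "0 \<le> a i + a' i" for i using g(2) g'(2) by simp
    show "summable (\<lambda>i. (a i + a' i) * vnorm (dual X) (\<phi> i))"
      using summable_add[OF g(4) g'(4)] by (simp add: distrib_right)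
    fix i \<psi> assume \<psi>: "\<psi> \<in> ?Z"
    have "norm (\<gamma> i \<psi> - \<gamma>' i \<psi>) \<le> norm (\<gamma> i \<psi>) + norm (\<gamma>' i \<psi>)" by (rule norm_triangle_ineq4)
    moreover have "norm (\<gamma> i \<psi>) \<le> a i * vnorm (dual X) \<psi>" "norm (\<gamma>' i \<psi>) \<le> a' i * vnorm (dual X) \<psi>"
      using g(3) g'(3) \<psi> by blast+
    ultimately show "norm (\<gamma> i \<psi> - \<gamma>' i \<psi>) \<le> (a i + a' i) * vnorm (dual X) \<psi>" by (simp add: distrib_right)
  next
    fix \<psi> t assume "\<psi> \<in> ?Z" "t \<in> vcarrier X"
    then have "(\<lambda>i. \<gamma> i \<psi> * \<phi> i t - \<gamma>' i \<psi> * \<phi> i t) sums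
       ((\<integral>p. \<xi> p \<psi> * \<Phi> p t \<partial>M1) - (\<integral>p. \<xi> p \<psi> * \<Phi> p t \<partial>M2))"
      using g(5) g'(5) by (intro sums_diff) auto
    then show "(\<lambda>i. (\<gamma> i \<psi> - \<gamma>' i \<psi>) * \<phi> i t) sums 0"
      using eq \<open>\<psi> \<in> ?Z\<close> \<open>t \<in> vcarrier X\<close> by (simp add: left_diff_distrib)
  qed
  from sums_unique2[OF this sums_diff[OF g(6) g'(6)]]
  show "(\<integral>p. \<xi> p (\<Phi> p) \<partial>M1) = (\<integral>p. \<xi> p (\<Phi> p) \<partial>M2)" by simp
qed

end

section \<open>Completions and projective tensor products\<close>

text \<open>The weights b dominate h up to a constant, so the double series converges absolutely and
  may be flattened along \<open>prod_decode\<close>. This merges a sequence of representations into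
  a single one.\<close>

lemma double_series:
  fixes h :: "nat \<Rightarrow> nat \<Rightarrow> 'c::banach" and b :: "nat \<Rightarrow> nat \<Rightarrow> real"
  assumes b0: "\<And>n i. 0 \<le> b n i" and b: "\<And>n. (b n) sums B n" and B: "summable B"
  shows "(\<lambda>k. b (fst (prod_decode k)) (snd (prod_decode k))) sums suminf B"
    and "(\<And>n i. norm (h n i) \<le> K * b n i) \<Longrightarrow> (\<And>n. (h n) sums g n) \<Longrightarrow> g sums s \<Longrightarrow>
      (\<lambda>k. h (fst (prod_decode k)) (snd (prod_decode k))) sums s"
proof -
  have reindex: "(\<lambda>k. f (fst (prod_decode k)) (snd (prod_decode k))) sums t"
    if "((\<lambda>(n, i). f n i) has_sum t) (UNIV \<times> UNIV)" for f :: "nat \<Rightarrow> nat \<Rightarrow> 'd::banach" and t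
  proof -
    have "((\<lambda>k. (\<lambda>(n, i). f n i) (prod_decode k)) has_sum t) UNIV"
      using has_sum_reindex_bij_betw[OF bij_prod_decode, of "\<lambda>(n, i). f n i" t] that by simp
    from has_sum_imp_sums[OF this] show ?thesis by (simp add: case_prod_unfold)
  qed
  have B0: "0 \<le> B n" for n using sums_le[OF _ sums_zero b] b0 by blast
  have bs: "((\<lambda>i. b n i) has_sum B n) UNIV" for n
    using b b0 by (intro norm_summable_imp_has_sum) (auto dest: sums_summable)
  have Bs: "(B has_sum suminf B) UNIV"
    using B B0 by (intro norm_summable_imp_has_sum) auto
  have bsum: "(\<lambda>(n, i). b n i) summable_on (UNIV \<times> UNIV)"
    by (rule summable_on_SigmaI[where g = B]) (use bs Bs b0 in \<open>auto intro: has_sum_imp_summable\<close>)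
  have "((\<lambda>(n, i). b n i) has_sum suminf B) (UNIV \<times> UNIV)"
    by (rule has_sum_SigmaI[where g = B]) (use bs Bs bsum in auto)
  then show "(\<lambda>k. b (fst (prod_decode k)) (snd (prod_decode k))) sums suminf B" by (rule reindex)
  assume le: "\<And>n i. norm (h n i) \<le> K * b n i" and h: "\<And>n. (h n) sums g n" and g: "g sums s"
  have hs: "((\<lambda>i. h n i) has_sum g n) UNIV" for n
  proof (rule norm_summable_imp_has_sum[OF _ h])
    show "summable (\<lambda>i. norm (h n i))"
      by (rule summable_comparison_test'[OF summable_mult[OF sums_summable[OF b[of n]], of K]]) (use le in auto)
  qed
  have "(\<lambda>x. K * (\<lambda>(n, i). b n i) x) summable_on (UNIV \<times> UNIV)" using bsum by (rule summable_on_cmult_right)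
  then have "(\<lambda>x. norm ((\<lambda>(n, i). h n i) x)) summable_on (UNIV \<times> UNIV)"
    by (rule summable_on_comparison_test) (use le in \<open>auto simp: case_prod_unfold\<close>)
  then have "(\<lambda>(n, i). h n i) summable_on (UNIV \<times> UNIV)" by (rule abs_summable_summable)
  then obtain t where t: "((\<lambda>(n, i). h n i) has_sum t) (UNIV \<times> UNIV)" unfolding summable_on_def by (elim exE)
  have "(g has_sum t) UNIV" by (rule has_sum_SigmaD[OF t]) (use hs in auto)
  then have "g sums t" by (rule has_sum_imp_sums)
  from sums_unique2[OF this g] have "t = s" .
  then show "(\<lambda>k. h (fst (prod_decode k)) (snd (prod_decode k))) sums s" using reindex[OF t] by simp
qed

context normed_vspace
begin

lemma completion_simps:
  "vadd (completion X) = vadd (bidual X)" "vzero (completion X) = vzero (bidual X)"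
  "vscale (completion X) = vscale (bidual X)" "vnorm (completion X) = vnorm (bidual X)"
  by (simp_all add: completion_def)

lemma completion_iff:
  "u \<in> vcarrier (completion X) \<longleftrightarrow> u \<in> vcarrier (bidual X) \<and>
     (\<forall>r>0. \<exists>x\<in>vcarrier X. vnorm (bidual X) (vadd (bidual X) u (vscale (bidual X) (-1) (canonical X x))) < r)"
proof -
  interpret b: normed_vspace "bidual X" by (intro normed_vspace.normed_dual normed_dual)
  have "canonical X ` vcarrier X \<subseteq> vcarrier (bidual X)" using canonical_bidual(1) by blast
  from b.closure_of_norm[OF this, of u] show ?thesis by (simp add: completion_def)
qed

lemma canonical_completion: assumes "x \<in> vcarrier X" shows "canonical X x \<in> vcarrier (completion X)"
proof -
  interpret b: normed_vspace "bidual X" by (intro normed_vspace.normed_dual normed_dual)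
  show ?thesis unfolding completion_iff using assms canonical_bidual(1)[OF assms]
    by (auto intro!: bexI[of _ x] simp: b.add_minus b.norm_vzero)
qed

lemma normed_completion: "normed_vspace (completion X)"
proof -
  interpret b: normed_vspace "bidual X" by (intro normed_vspace.normed_dual normed_dual)
  note can = canonical_bidual(1)
  have bi: "x \<in> vcarrier (completion X) \<Longrightarrow> x \<in> vcarrier (bidual X)" for x by (simp add: completion_iff)
  have "normed_vspace ((bidual X)\<lparr>vcarrier := vcarrier (completion X)\<rparr>)"
  proof (rule b.normed_vspace_subspace)
    show "vcarrier (completion X) \<subseteq> vcarrier (bidual X)" using bi by blast
    have "canonical X (vzero X) = vscale (bidual X) 0 (canonical X (vzero X))"
      using canonical_scale[OF zero_closed, of 0] by (simp add: scale_vzero)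
    then show "vzero (bidual X) \<in> vcarrier (completion X)"
      using canonical_completion[OF zero_closed] b.scale_zero[OF can[OF zero_closed]] by simp
    show "vadd (bidual X) u v \<in> vcarrier (completion X)"
      if u: "u \<in> vcarrier (completion X)" and v: "v \<in> vcarrier (completion X)" for u v
      unfolding completion_iff
    proof (intro conjI allI impI)
      show "vadd (bidual X) u v \<in> vcarrier (bidual X)" using bi[OF u] bi[OF v] by (rule b.add_closed)
      fix r :: real assume "r > 0"
      then have r: "r / 2 > 0" by simp
      obtain x y where x: "x \<in> vcarrier X" "vnorm (bidual X) (b.vdiff u (canonical X x)) < r / 2"
        and y: "y \<in> vcarrier X" "vnorm (bidual X) (b.vdiff v (canonical X y)) < r / 2"
        using u v r unfolding completion_iff by blast
      have "b.vdiff (vadd (bidual X) u v) (canonical X (vadd X x y)) =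
        vadd (bidual X) (b.vdiff u (canonical X x)) (b.vdiff v (canonical X y))"
        using bi[OF u] bi[OF v] can[OF x(1)] can[OF y(1)]
        by (simp add: canonical_add x y b.scale_add_right b.scale_closed b.add_swap)
      then have "vnorm (bidual X) (b.vdiff (vadd (bidual X) u v) (canonical X (vadd X x y))) < r"
        using b.norm_triangle[OF b.diff_closed[OF bi[OF u] can[OF x(1)]] b.diff_closed[OF bi[OF v] can[OF y(1)]]] x(2) y(2)
        by simp
      then show "\<exists>z\<in>vcarrier X. vnorm (bidual X) (b.vdiff (vadd (bidual X) u v) (canonical X z)) < r"
        using add_closed[OF x(1) y(1)] by blast
    qed
    show "vscale (bidual X) c u \<in> vcarrier (completion X)" if u: "u \<in> vcarrier (completion X)" for c u
      unfolding completion_iff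
    proof (intro conjI allI impI)
      show "vscale (bidual X) c u \<in> vcarrier (bidual X)" using bi[OF u] by (rule b.scale_closed)
      fix r :: real assume r: "r > 0"
      then have "r / (norm c + 1) > 0" by (simp add: add_nonneg_pos)
      then obtain x where x: "x \<in> vcarrier X" "vnorm (bidual X) (b.vdiff u (canonical X x)) < r / (norm c + 1)"
        using u unfolding completion_iff by blast
      have e: "b.vdiff (vscale (bidual X) c u) (canonical X (vscale X c x)) = vscale (bidual X) c (b.vdiff u (canonical X x))"
        using bi[OF u] can[OF x(1)]
        by (simp add: canonical_scale x b.scale_add_right b.scale_closed b.scale_scale)
      have "vnorm (bidual X) (b.vdiff (vscale (bidual X) c u) (canonical X (vscale X c x))) \<le> norm c * (r / (norm c + 1))"
        unfolding e b.norm_scale[OF b.diff_closed[OF bi[OF u] can[OF x(1)]]] using x(2) by (intro mult_left_mono) auto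
      also have "\<dots> < r"
      proof -
        have "norm c * r < r * (norm c + 1)" using r by (simp add: algebra_simps)
        moreover have "norm c + 1 > 0" by (simp add: add_nonneg_pos)
        ultimately show ?thesis by (simp only: times_divide_eq_right pos_divide_less_eq)
      qed
      finally show "\<exists>z\<in>vcarrier X. vnorm (bidual X) (b.vdiff (vscale (bidual X) c u) (canonical X z)) < r"
        using scale_closed[OF x(1)] by blast
    qed
  qed
  moreover have "(bidual X)\<lparr>vcarrier := vcarrier (completion X)\<rparr> = completion X" by (simp add: completion_def)
  ultimately show ?thesis by simp
qed

text \<open>Elements of the completion lie in the bidual, so the extension of f by continuity is
  just evaluation at f.\<close>

lemma dual_completion_eval:
  assumes f: "f \<in> vcarrier (dual X)"
  shows "(\<lambda>u\<in>vcarrier (completion X). u f) \<in> vcarrier (dual (completion X))"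
proof -
  interpret c: normed_vspace "completion X" by (rule normed_completion)
  interpret d: normed_vspace "dual X" by (rule normed_dual)
  show ?thesis
  proof (rule c.dualI[of _ "vnorm (dual X) f"])
    fix u assume u: "u \<in> vcarrier (completion X)"
    then have ub: "u \<in> vcarrier (bidual X)" by (simp add: completion_iff)
    show "norm ((\<lambda>u\<in>vcarrier (completion X). u f) u) \<le> vnorm (dual X) f * vnorm (completion X) u"
      using d.dual_bound[OF ub f] u by (simp add: completion_simps mult.commute)
  qed (use f c.add_closed c.scale_closed in \<open>auto simp: linear_functional_def completion_simps d.dual_ops\<close>)
qed

lemma completion_functional_limit:
  assumes \<phi>: "\<phi> \<in> vcarrier (dual (completion X))" and u: "u \<in> vcarrier (completion X)"
    and x: "\<And>n. x n \<in> vcarrier X"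
    and lim: "(\<lambda>n. vnorm (bidual X) (vadd (bidual X) u (vscale (bidual X) (-1) (canonical X (x n))))) \<longlonglongrightarrow> 0"
  shows "(\<lambda>n. \<phi> (canonical X (x n))) \<longlonglongrightarrow> \<phi> u"
proof -
  interpret c: normed_vspace "completion X" by (rule normed_completion)
  have "(\<lambda>n. \<phi> u - \<phi> (canonical X (x n))) \<longlonglongrightarrow> 0"
  proof (rule Lim_null_comparison[OF always_eventually])
    show "(\<lambda>n. vnorm (dual (completion X)) \<phi> * vnorm (bidual X) (vadd (bidual X) u (vscale (bidual X) (-1) (canonical X (x n))))) \<longlonglongrightarrow> 0"
      using lim by (rule tendsto_mult_right_zero)
    show "\<forall>n. norm (\<phi> u - \<phi> (canonical X (x n))) \<le> vnorm (dual (completion X)) \<phi> *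
       vnorm (bidual X) (vadd (bidual X) u (vscale (bidual X) (-1) (canonical X (x n))))"
    proof
      fix n
      show "norm (\<phi> u - \<phi> (canonical X (x n))) \<le> vnorm (dual (completion X)) \<phi> *
       vnorm (bidual X) (vadd (bidual X) u (vscale (bidual X) (-1) (canonical X (x n))))"
        using c.dual_bound[OF \<phi> c.diff_closed[OF u canonical_completion[OF x[of n]]]]
          c.lf_diff[OF c.dual_lf[OF \<phi>] u canonical_completion[OF x[of n]]]
        by (simp add: completion_simps)
    qed
  qed
  then have "(\<lambda>n. \<phi> u - (\<phi> u - \<phi> (canonical X (x n)))) \<longlonglongrightarrow> \<phi> u - 0" by (intro tendsto_diff tendsto_const)
  then show ?thesis by simp
qed

end

text \<open>Common setting of both tensor products: tuples P, forms F, product of norms w. The tuple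
  \<open>p0\<close> pads finite sums and \<open>scale\<close> absorbs coefficients. Since tensors
  act on all forms while the norm sees only bounded ones, \<open>separating\<close> is what makes
  the norm definite.\<close>

locale tensor_data =
  fixes P :: "'p set" and F :: "('p \<Rightarrow> 'k::real_or_complex) set" and w :: "'p \<Rightarrow> real" and p0 :: 'p
  assumes null: "p0 \<in> P" "w p0 = 0" "\<And>A. A \<in> F \<Longrightarrow> A p0 = 0"
    and w_nonneg: "\<And>p. p \<in> P \<Longrightarrow> 0 \<le> w p"
    and scale: "\<And>c p. p \<in> P \<Longrightarrow> \<exists>q\<in>P. w q = norm c * w p \<and> (\<forall>A\<in>F. A q = c * A p)"
    and separating: "\<And>(n::nat) p A. (\<forall>i<n. p i \<in> P) \<Longrightarrow>
      (\<forall>A\<in>F. (\<exists>C. \<forall>q\<in>P. norm (A q) \<le> C * w q) \<longrightarrow> (\<Sum>i<n. A (p i)) = 0) \<Longrightarrow> A \<in> F \<Longrightarrow> (\<Sum>i<n. A (p i)) = 0"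
begin

abbreviation "W \<equiv> alg_tensor P F w"

abbreviation elem :: "'p \<Rightarrow> ('p \<Rightarrow> 'k) \<Rightarrow> 'k" where "elem \<equiv> elementary_tensor F"

lemma represents_iff: "represents P F n p v \<longleftrightarrow> (\<forall>i<n. p i \<in> P) \<and> v = (\<lambda>A\<in>F. \<Sum>i<n. A (p i))"
  unfolding represents_def elementary_tensor_def by (auto simp: fun_eq_iff restrict_def)

lemma W_simps:
  "vcarrier W = {v. \<exists>n p. represents P F n p v}" "vadd W u v = (\<lambda>A\<in>F. u A + v A)"
  "vzero W = (\<lambda>A\<in>F. 0)" "vscale W c v = (\<lambda>A\<in>F. c * v A)"
  "vnorm W v = Inf {\<Sum>i<n. w (p i) | n p. represents P F n p v}"
  by (simp_all add: alg_tensor_def function_space_def)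

lemma represents_add:
  assumes "represents P F n p u" "represents P F m q v"
  shows "represents P F (n + m) (\<lambda>i. if i < n then p i else q (i - n)) (vadd W u v)"
    and "(\<Sum>i<n+m. w (if i < n then p i else q (i - n))) = (\<Sum>i<n. w (p i)) + (\<Sum>i<m. w (q i))"
proof -
  have s: "(\<Sum>i<n+m. f (if i < n then p i else q (i - n))) = (\<Sum>i<n. f (p i)) + (\<Sum>i<m. f (q i))"
    for f :: "'p \<Rightarrow> 'c::comm_monoid_add"
    by (induction m) (auto simp: add.assoc)
  show "represents P F (n + m) (\<lambda>i. if i < n then p i else q (i - n)) (vadd W u v)"
    using assms unfolding represents_iff by (auto simp: W_simps s fun_eq_iff restrict_def)
  show "(\<Sum>i<n+m. w (if i < n then p i else q (i - n))) = (\<Sum>i<n. w (p i)) + (\<Sum>i<m. w (q i))" by (rule s)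
qed

lemma represents_scale:
  assumes "represents P F n p v"
  shows "\<exists>q. represents P F n q (vscale W c v) \<and> (\<Sum>i<n. w (q i)) = norm c * (\<Sum>i<n. w (p i))"
proof -
  have "\<forall>i. \<exists>q. i < n \<longrightarrow> q \<in> P \<and> w q = norm c * w (p i) \<and> (\<forall>A\<in>F. A q = c * A (p i))"
    using scale assms unfolding represents_iff by blast
  from choice[OF this] obtain q where q: "\<forall>i<n. q i \<in> P \<and> w (q i) = norm c * w (p i) \<and> (\<forall>A\<in>F. A (q i) = c * A (p i))"
    by blast
  then show ?thesis
    using assms unfolding represents_iff
    by (intro exI[of _ q]) (auto simp: W_simps fun_eq_iff restrict_def sum_distrib_left)
qed

lemma W_bdd: "bdd_below {\<Sum>i<n. w (p i) | n p. represents P F n p v}"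
proof (rule bdd_belowI[of _ 0])
  fix x assume "x \<in> {\<Sum>i<n. w (p i) | n p. represents P F n p v}"
  then obtain n p where "x = (\<Sum>i<n. w (p i))" "represents P F n p v" by blast
  then show "0 \<le> x" unfolding represents_iff by (auto intro!: sum_nonneg w_nonneg)
qed

lemma W_norm_le: "represents P F n p v \<Longrightarrow> vnorm W v \<le> (\<Sum>i<n. w (p i))"
  unfolding W_simps by (rule cInf_lower[OF _ W_bdd]) blast

lemma W_norm_greatest:
  "v \<in> vcarrier W \<Longrightarrow> (\<And>n p. represents P F n p v \<Longrightarrow> c \<le> (\<Sum>i<n. w (p i))) \<Longrightarrow> c \<le> vnorm W v"
  unfolding W_simps(5) by (rule cInf_greatest) (auto simp: W_simps(1))

lemma W_norm_less:
  assumes v: "v \<in> vcarrier W" and c: "vnorm W v < c"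
  shows "\<exists>n p. represents P F n p v \<and> (\<Sum>i<n. w (p i)) < c"
proof (rule ccontr)
  assume n: "\<not> ?thesis"
  have "c \<le> vnorm W v" by (rule W_norm_greatest[OF v]) (use n not_less in blast)
  then show False using c by simp
qed

lemma bounded_form_le:
  assumes A: "A \<in> F" "\<forall>q\<in>P. norm (A q) \<le> C * w q" and C: "0 \<le> C" and v: "v \<in> vcarrier W"
  shows "norm (v A) \<le> C * vnorm W v"
proof -
  have le: "norm (v A) \<le> C * (\<Sum>i<n. w (p i))" if "represents P F n p v" for n p
  proof -
    have "v A = (\<Sum>i<n. A (p i))" using that A(1) unfolding represents_iff by simp
    then have "norm (v A) \<le> (\<Sum>i<n. norm (A (p i)))" by (simp add: norm_sum)
    also have "\<dots> \<le> (\<Sum>i<n. C * w (p i))" using that A(2) unfolding represents_iff by (intro sum_mono) auto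
    finally show ?thesis by (simp add: sum_distrib_left)
  qed
  show ?thesis
  proof (cases "C = 0")
    case True
    obtain n p where "represents P F n p v" using v by (auto simp: W_simps)
    from le[OF this] show ?thesis using True by simp
  next
    case False
    then have "norm (v A) / C \<le> vnorm W v"
      using le C by (intro W_norm_greatest[OF v]) (simp add: pos_divide_le_eq mult.commute)
    then show ?thesis using False C by (simp add: pos_divide_le_eq mult.commute)
  qed
qed

lemma normed_W: "normed_vspace W"
proof
  note F = fun_eq_iff restrict_def
  have rep0: "represents P F 0 (\<lambda>_. p0) (vzero W)" by (simp add: represents_iff W_simps)
  show "vzero W \<in> vcarrier W" using rep0 by (auto simp: W_simps(1))
  show ac: "vadd W x y \<in> vcarrier W" if "x \<in> vcarrier W" "y \<in> vcarrier W" for x y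
    using that represents_add(1) unfolding W_simps(1) by blast
  show sc: "vscale W c x \<in> vcarrier W" if "x \<in> vcarrier W" for c x
    using that represents_scale unfolding W_simps(1) by blast
  show "vadd W (vadd W x y) z = vadd W x (vadd W y z)" "vadd W x y = vadd W y x"
    "vscale W c (vadd W x y) = vadd W (vscale W c x) (vscale W c y)"
    "vscale W (c + d) x = vadd W (vscale W c x) (vscale W d x)"
    "vscale W c (vscale W d x) = vscale W (c * d) x" for x y z c d
    by (auto simp: W_simps F algebra_simps)
  fix x assume x: "x \<in> vcarrier W"
  then have xe: "A \<notin> F \<Longrightarrow> x A = undefined" for A by (auto simp: W_simps represents_iff)
  show "vadd W x (vzero W) = x" "vscale W 1 x = x" using xe by (auto simp: W_simps F)
  show "vadd W x (vscale W (- 1) x) = vzero W" by (auto simp: W_simps F)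
  show nn: "0 \<le> vnorm W x"
    by (rule W_norm_greatest[OF x]) (auto simp: represents_iff intro!: sum_nonneg w_nonneg)
  have le: "vnorm W (vscale W c x) \<le> norm c * vnorm W x" if x: "x \<in> vcarrier W" for c x
  proof (cases "c = 0")
    case True
    then have "vscale W c x = vzero W" by (simp add: W_simps)
    then show ?thesis using W_norm_le[OF rep0] True by simp
  next
    case False
    have "vnorm W (vscale W c x) / norm c \<le> vnorm W x"
    proof (rule W_norm_greatest[OF x])
      fix n p assume "represents P F n p x"
      then obtain q where "represents P F n q (vscale W c x)" "(\<Sum>i<n. w (q i)) = norm c * (\<Sum>i<n. w (p i))"
        using represents_scale by blast
      then show "vnorm W (vscale W c x) / norm c \<le> (\<Sum>i<n. w (p i))"
        using W_norm_le[of n q] False by (simp add: pos_divide_le_eq mult.commute)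
    qed
    then show ?thesis using False by (simp add: pos_divide_le_eq mult.commute)
  qed
  show "vnorm W (vscale W c x) = norm c * vnorm W x" for c
  proof (cases "c = 0")
    case True
    have "0 \<le> vnorm W (vscale W c x)"
      by (rule W_norm_greatest[OF sc[OF x]]) (auto simp: represents_iff intro!: sum_nonneg w_nonneg)
    then show ?thesis using le[OF x, of c] True by simp
  next
    case False
    have "vscale W (inverse c) (vscale W c x) = x" using False xe by (auto simp: W_simps F)
    then have "vnorm W x \<le> norm (inverse c) * vnorm W (vscale W c x)" using le[OF sc[OF x, of c], of "inverse c"] by simp
    from mult_left_mono[OF this, of "norm c"] have "norm c * vnorm W x \<le> vnorm W (vscale W c x)"
      using False by (simp add: norm_inverse mult.assoc[symmetric])
    then show ?thesis using le[OF x, of c] by simp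
  qed
  show "(vnorm W x = 0) = (x = vzero W)"
  proof
    assume "x = vzero W"
    then show "vnorm W x = 0" using W_norm_le[OF rep0] nn by simp
  next
    \<comment> \<open>A tensor of norm zero is annihilated by every bounded form, and
      \<open>separating\<close> extends this to all forms.\<close>
    assume z: "vnorm W x = 0"
    obtain n p where rep: "represents P F n p x" using x by (auto simp: W_simps)
    have "(\<Sum>i<n. A (p i)) = 0" if A: "A \<in> F" for A
    proof (rule separating)
      show "\<forall>i<n. p i \<in> P" using rep by (simp add: represents_iff)
      show "\<forall>A\<in>F. (\<exists>C. \<forall>q\<in>P. norm (A q) \<le> C * w q) \<longrightarrow> (\<Sum>i<n. A (p i)) = 0"
      proof (intro ballI impI)
        fix A assume A: "A \<in> F" "\<exists>C. \<forall>q\<in>P. norm (A q) \<le> C * w q"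
        then obtain C where C: "\<forall>q\<in>P. norm (A q) \<le> C * w q" by blast
        have "\<forall>q\<in>P. norm (A q) \<le> max C 0 * w q"
          using C w_nonneg mult_right_mono[OF max.cobounded1[of C 0]] order_trans by blast
        from bounded_form_le[OF A(1) this _ x] have "x A = 0" using z by simp
        then show "(\<Sum>i<n. A (p i)) = 0" using rep A(1) by (simp add: represents_iff)
      qed
    qed fact
    then show "x = vzero W" using rep unfolding represents_iff W_simps by (auto simp: F)
  qed
  show "vnorm W (vadd W x y) \<le> vnorm W x + vnorm W y" if y: "y \<in> vcarrier W" for y
  proof -
    have "vnorm W (vadd W x y) - (\<Sum>i<m. w (q i)) \<le> vnorm W x" if q: "represents P F m q y" for m q
    proof (rule W_norm_greatest[OF x])
      fix n p assume "represents P F n p x"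
      from W_norm_le[OF represents_add(1)[OF this q]] represents_add(2)[OF this q]
      show "vnorm W (vadd W x y) - (\<Sum>i<m. w (q i)) \<le> (\<Sum>i<n. w (p i))" by simp
    qed
    then have "vnorm W (vadd W x y) - vnorm W x \<le> vnorm W y"
      by (intro W_norm_greatest[OF y]) (simp add: algebra_simps)
    then show ?thesis by simp
  qed
qed

sublocale W: normed_vspace W by (rule normed_W)

lemma rep_elem: "p \<in> P \<Longrightarrow> represents P F 1 (\<lambda>_. p) (elem p)"
  by (auto simp: represents_iff elementary_tensor_def)

lemma elem_W: "p \<in> P \<Longrightarrow> elem p \<in> vcarrier W" and elem_norm: "p \<in> P \<Longrightarrow> vnorm W (elem p) \<le> w p"
  using rep_elem[of p] W_norm_le[OF rep_elem[of p]] by (auto simp: W_simps(1))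

lemma functional_representation:
  assumes f: "linear_functional W f" and r: "represents P F n p v"
  shows "f v = (\<Sum>i<n. f (elem (p i)))"
  using r
proof (induction n arbitrary: v)
  case 0
  then have "v = vzero W" by (simp add: represents_iff W_simps)
  then show ?case using W.lf_zero[OF f] by simp
next
  case (Suc n)
  define v' where "v' = (\<lambda>A\<in>F. \<Sum>i<n. A (p i))"
  have r': "represents P F n p v'" using Suc.prems by (simp add: represents_iff v'_def)
  have pn: "p n \<in> P" using Suc.prems by (simp add: represents_iff)
  have "v = vadd W v' (elem (p n))"
    using Suc.prems by (auto simp: represents_iff W_simps v'_def elementary_tensor_def fun_eq_iff restrict_def)
  moreover have "v' \<in> vcarrier W" using r' by (auto simp: W_simps(1))
  ultimately have "f v = f v' + f (elem (p n))" using f elem_W[OF pn] by (simp add: linear_functional_def)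
  then show ?case using Suc.IH[OF r'] by simp
qed

lemma form_functional:
  assumes A: "A \<in> F" "\<forall>q\<in>P. norm (A q) \<le> C * w q" "0 \<le> C"
  shows "(\<lambda>v\<in>vcarrier W. v A) \<in> vcarrier (dual W)" "vnorm (dual W) (\<lambda>v\<in>vcarrier W. v A) \<le> C"
proof -
  have b: "norm ((\<lambda>v\<in>vcarrier W. v A) v) \<le> C * vnorm W v" if "v \<in> vcarrier W" for v
    using bounded_form_le[OF A that] that by simp
  show "(\<lambda>v\<in>vcarrier W. v A) \<in> vcarrier (dual W)"
    by (rule W.dualI[OF restrict_extensional _ b]) (use A(1) W.add_closed W.scale_closed in \<open>auto simp: linear_functional_def W_simps(2,4)\<close>)
  show "vnorm (dual W) (\<lambda>v\<in>vcarrier W. v A) \<le> C" by (rule W.dual_norm_le'[OF A(3) b])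
qed

text \<open>Approximate u by tensors \<open>v n\<close> at distance below \<open>\<delta> n\<close>,
  represent \<open>v 0\<close> and the successive differences almost optimally, and concatenate
  these finite sums.\<close>

lemma completion_series:
  assumes u: "u \<in> vcarrier (completion W)" and \<epsilon>: "0 < \<epsilon>"
  shows "\<exists>q. (\<forall>i. q i \<in> P) \<and> summable (\<lambda>i. w (q i)) \<and> (\<Sum>i. w (q i)) < vnorm (completion W) u + \<epsilon> \<and>
    (\<forall>\<phi>\<in>vcarrier (dual (completion W)). (\<lambda>i. \<phi> (canonical W (elem (q i)))) sums \<phi> u)"
proof -
  interpret b: normed_vspace "bidual W" by (intro normed_vspace.normed_dual normed_W)
  interpret c: normed_vspace "completion W" by (rule W.normed_completion)
  have ub: "u \<in> vcarrier (bidual W)" using u by (simp add: W.completion_iff)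
  \<comment> \<open>Stage 0 costs less than the norm of u plus \<open>2 * \<delta> 0\<close>, and
    stage \<open>Suc n\<close> less than \<open>2 * \<delta> (Suc n) + \<delta> n\<close>, which is
    \<open>\<epsilon> / 4 * (1/2)^n\<close>. The excess is thus below
    \<open>\<epsilon> / 4 + \<epsilon> / 2\<close>.\<close>
  define \<delta> where "\<delta> = (\<lambda>n. \<epsilon> / 8 * (1/2)^n)"
  have \<delta>0: "\<delta> n > 0" for n using \<epsilon> by (simp add: \<delta>_def)
  have "\<forall>n. \<exists>x. x \<in> vcarrier W \<and> vnorm (bidual W) (b.vdiff u (canonical W x)) < \<delta> n"
    using u \<delta>0 unfolding W.completion_iff by blast
  from choice[OF this] obtain v where v': "\<forall>n. v n \<in> vcarrier W \<and> vnorm (bidual W) (b.vdiff u (canonical W (v n))) < \<delta> n"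
    by (elim exE)
  have vW: "v n \<in> vcarrier W" and vu: "vnorm (bidual W) (b.vdiff u (canonical W (v n))) < \<delta> n" for n using v' by blast+
  have cb: "canonical W (v n) \<in> vcarrier (bidual W)" for n by (rule W.canonical_bidual(1)[OF vW])
  define z where "z = (\<lambda>n. if n = 0 then v 0 else W.vdiff (v n) (v (n - 1)))"
  have zW: "z n \<in> vcarrier W" for n by (simp add: z_def vW W.diff_closed)
  have nz0: "vnorm W (z 0) < vnorm (completion W) u + \<delta> 0"
  proof -
    have "vnorm W (v 0) = vnorm (bidual W) (canonical W (v 0))" using W.canonical_isometric[OF vW] by simp
    also have "\<dots> \<le> vnorm (bidual W) (b.vdiff (canonical W (v 0)) u) + vnorm (bidual W) u" by (rule b.norm_diff_le[OF cb ub])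
    also have "vnorm (bidual W) (b.vdiff (canonical W (v 0)) u) = vnorm (bidual W) (b.vdiff u (canonical W (v 0)))"
      by (rule b.norm_diff_commute[OF cb ub])
    finally show ?thesis using vu[of 0] by (simp add: z_def W.completion_simps)
  qed
  have nzS: "vnorm W (z (Suc n)) < \<delta> (Suc n) + \<delta> n" for n
  proof -
    have "vnorm W (z (Suc n)) = vnorm (bidual W) (canonical W (z (Suc n)))" using W.canonical_isometric[OF zW] by simp
    also have "canonical W (z (Suc n)) = b.vdiff (canonical W (v (Suc n))) (canonical W (v n))"
      by (simp add: z_def W.canonical_add W.canonical_scale vW W.scale_closed)
    also have "\<dots> = vadd (bidual W) (b.vdiff (canonical W (v (Suc n))) u) (b.vdiff u (canonical W (v n)))"
      by (rule b.diff_triangle[symmetric, OF cb ub cb])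
    also have "vnorm (bidual W) \<dots> \<le> vnorm (bidual W) (b.vdiff (canonical W (v (Suc n))) u) + vnorm (bidual W) (b.vdiff u (canonical W (v n)))"
      by (rule b.norm_triangle[OF b.diff_closed[OF cb ub] b.diff_closed[OF ub cb]])
    finally show ?thesis using vu[of n] vu[of "Suc n"] b.norm_diff_commute[OF cb ub, of "Suc n"] by linarith
  qed
  have "\<forall>n. \<exists>r. represents P F (fst r) (snd r) (z n) \<and> (\<Sum>i<fst r. w (snd r i)) < vnorm W (z n) + \<delta> n"
  proof
    fix n
    have "vnorm W (z n) < vnorm W (z n) + \<delta> n" using \<delta>0 by simp
    from W_norm_less[OF zW this] show "\<exists>r. represents P F (fst r) (snd r) (z n) \<and> (\<Sum>i<fst r. w (snd r i)) < vnorm W (z n) + \<delta> n"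
      by simp
  qed
  from choice[OF this] obtain r where r': "\<forall>n. represents P F (fst (r n)) (snd (r n)) (z n) \<and>
     (\<Sum>i<fst (r n). w (snd (r n) i)) < vnorm W (z n) + \<delta> n" by (elim exE)
  define N where "N = (\<lambda>n. fst (r n))"
  define rr where "rr = (\<lambda>n. snd (r n))"
  have r: "represents P F (N n) (rr n) (z n)" and rw: "(\<Sum>i<N n. w (rr n i)) < vnorm W (z n) + \<delta> n" for n
    using r' by (auto simp: N_def rr_def)
  \<comment> \<open>Padding with the weightless \<open>p0\<close> turns each finite representation
    into a sequence, as \<open>double_series\<close> expects.\<close>
  define q where "q = (\<lambda>n i. if i < N n then rr n i else p0)"
  have qP: "q n i \<in> P" for n i using r[of n] null(1) by (auto simp: q_def represents_iff)
  define B where "B = (\<lambda>n. \<Sum>i<N n. w (rr n i))"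
  have wq: "(\<lambda>i. w (q n i)) sums B n" for n
  proof -
    have "(\<lambda>i. w (q n i)) sums (\<Sum>i<N n. w (q n i))" by (rule sums_finite) (auto simp: q_def null)
    then show ?thesis by (simp add: B_def q_def)
  qed
  have B0: "0 \<le> B n" for n unfolding B_def using r[of n] by (auto simp: represents_iff intro!: sum_nonneg w_nonneg)
  have BS: "B (Suc n) \<le> \<epsilon> / 4 * (1/2)^n" for n
    using rw[of "Suc n"] nzS[of n] by (simp add: B_def \<delta>_def)
  have gs: "(\<lambda>n. \<epsilon> / 4 * (1/2)^n) sums (\<epsilon> / 2)" using sums_mult[OF geometric_sums[of "1/2 :: real"], of "\<epsilon> / 4"] by simp
  have sBS: "summable (\<lambda>n. B (Suc n))"
    by (rule summable_comparison_test'[OF sums_summable[OF gs]]) (use BS B0 in auto)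
  then have sB: "summable B" by (rule summable_Suc_iff[THEN iffD1])
  have "suminf (\<lambda>n. B (Suc n)) \<le> \<epsilon> / 2"
    using suminf_le[OF BS sBS sums_summable[OF gs]] sums_unique[OF gs] by simp
  then have tot: "suminf B < vnorm (completion W) u + \<epsilon>"
    using suminf_split_head[OF sB] rw[of 0] nz0 \<epsilon> by (simp add: B_def \<delta>_def)
  define qq where "qq = (\<lambda>k. q (fst (prod_decode k)) (snd (prod_decode k)))"
  have ws: "(\<lambda>k. w (qq k)) sums suminf B"
    unfolding qq_def by (rule double_series(1)[where b = "\<lambda>n i. w (q n i)"]) (auto intro: w_nonneg qP wq sB)
  have "(\<lambda>k. \<phi> (canonical W (elem (qq k)))) sums \<phi> u" if \<phi>: "\<phi> \<in> vcarrier (dual (completion W))" for \<phi>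
    unfolding qq_def
  proof (rule double_series(2)[where b = "\<lambda>n i. w (q n i)" and h = "\<lambda>n i. \<phi> (canonical W (elem (q n i)))"
        and K = "vnorm (dual (completion W)) \<phi>" and g = "\<lambda>n. \<phi> (canonical W (z n))" and B = B])
    show "0 \<le> w (q n i)" for n i by (rule w_nonneg[OF qP])
    show "(\<lambda>i. w (q n i)) sums B n" for n by (rule wq)
    show "summable B" by (rule sB)
    show "norm (\<phi> (canonical W (elem (q n i)))) \<le> vnorm (dual (completion W)) \<phi> * w (q n i)" for n i
    proof -
      have "vnorm (completion W) (canonical W (elem (q n i))) \<le> w (q n i)"
        using W.canonical_isometric[OF elem_W[OF qP]] elem_norm[OF qP] by (simp add: W.completion_simps)
      from mult_left_mono[OF this c.dual_norm_nonneg[OF \<phi>]]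
      show ?thesis using c.dual_bound[OF \<phi> W.canonical_completion[OF elem_W[OF qP[of n i]]]] by linarith
    qed
    have lf: "linear_functional W (\<lambda>x. \<phi> (canonical W x))"
      using c.dual_add[OF \<phi>] c.dual_scale[OF \<phi>]
      by (simp add: linear_functional_def W.canonical_add W.canonical_scale W.canonical_completion W.completion_simps)
    show "(\<lambda>i. \<phi> (canonical W (elem (q n i)))) sums \<phi> (canonical W (z n))" for n
    proof -
      have p0z: "\<phi> (canonical W (elem p0)) = 0"
      proof -
        have "elem p0 = vzero W" using null(3) by (auto simp: elementary_tensor_def W_simps fun_eq_iff restrict_def)
        then show ?thesis using W.lf_zero[OF lf] by simp
      qed
      have "(\<lambda>i. \<phi> (canonical W (elem (q n i)))) sums (\<Sum>i<N n. \<phi> (canonical W (elem (q n i))))"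
        by (rule sums_finite) (auto simp: q_def p0z)
      then show ?thesis using functional_representation[OF lf r[of n]] by (simp add: q_def)
    qed
    have part: "(\<Sum>n<Suc m. \<phi> (canonical W (z n))) = \<phi> (canonical W (v m))" for m
      by (induction m) (simp_all add: z_def W.lf_diff[OF lf] vW)
    have "(\<lambda>m. \<phi> (canonical W (v m))) \<longlonglongrightarrow> \<phi> u"
    proof (rule W.completion_functional_limit[OF \<phi> u vW], rule Lim_null_comparison[OF always_eventually])
      show "\<delta> \<longlonglongrightarrow> 0" unfolding \<delta>_def by (intro tendsto_mult_right_zero LIMSEQ_power_zero) simp
      show "\<forall>n. norm (vnorm (bidual W) (b.vdiff u (canonical W (v n)))) \<le> \<delta> n"
        using vu b.norm_nonneg[OF b.diff_closed[OF ub cb]] by (simp add: less_imp_le)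
    qed
    then show "(\<lambda>n. \<phi> (canonical W (z n))) sums \<phi> u" unfolding sums_def part[symmetric] by (rule LIMSEQ_imp_Suc)
  qed
  moreover have "qq k \<in> P" for k by (simp add: qq_def qP)
  ultimately show ?thesis using sums_summable[OF ws] sums_unique[OF ws] tot by (intro exI[of _ qq]) simp
qed

end

section \<open>Separation of tensors by bounded forms\<close>

context normed_vspace
begin

text \<open>The \<open>c k\<close> are continuous while f may be any linear functional; in this way
  arbitrary forms on finitely many tuples are reduced to bounded ones.\<close>

lemma finite_interpolation_functional:
  fixes x :: "nat \<Rightarrow> 'a"
  assumes x: "\<forall>i<n. x i \<in> vcarrier X"
  shows "\<exists>m c e. (\<forall>k<m. c k \<in> vcarrier (dual X) \<and> e k \<in> vcarrier X) \<and>
    (\<forall>f. linear_functional X f \<longrightarrow> (\<forall>i<n. f (x i) = (\<Sum>k<(m::nat). c k (x i) * f (e k))))"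
proof -
  have "\<exists>m c e. (\<forall>k<m. c k \<in> vcarrier (dual X) \<and> e k \<in> vcarrier X) \<and>
    (\<forall>i<n. x i = linear_combination X (\<lambda>k. c k (x i)) e m)"
    by (rule finite_interpolation) (use x in blast)
  then obtain m c e where ce: "\<forall>k<m. c k \<in> vcarrier (dual X) \<and> e k \<in> vcarrier X"
    and xe: "\<forall>i<n. x i = linear_combination X (\<lambda>k. c k (x i)) e m" by (elim exE conjE)
  have "f (x i) = (\<Sum>k<m. c k (x i) * f (e k))" if f: "linear_functional X f" and i: "i < n" for f i
  proof -
    have "f (x i) = f (linear_combination X (\<lambda>k. c k (x i)) e m)" using xe i by auto
    also have "\<dots> = (\<Sum>k<m. c k (x i) * f (e k))" using ce by (intro lc_functional[OF f]) auto
    finally show ?thesis .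
  qed
  then show ?thesis using ce by blast
qed

end

lemma bilinear_form_iff:
  "bilinear_form S Y B \<longleftrightarrow> B \<in> extensional (vcarrier S \<times> vcarrier Y) \<and>
     (\<forall>y\<in>vcarrier Y. linear_functional S (\<lambda>s. B (s, y))) \<and> (\<forall>s\<in>vcarrier S. linear_functional Y (\<lambda>y. B (s, y)))"
  by (simp add: bilinear_form_def linear_between_scalars)

text \<open>The substance is \<open>separating\<close>. Interpolation in both arguments writes the
  sum of the \<open>B (p i)\<close> as a combination of the values \<open>B (e k, f j)\<close>; its
  coefficients are sums of the bounded forms given by \<open>c k\<close> times \<open>d j\<close>,
  and so vanish.\<close>

lemma pair_tensor_data:
  assumes "normed_vspace S" "normed_vspace Y"
  shows "tensor_data (vcarrier S \<times> vcarrier Y) {B. bilinear_form S Y B}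
     (\<lambda>(s, y). vnorm S s * vnorm Y y) (vzero S, vzero Y)"
proof
  interpret S: normed_vspace S by fact
  interpret Y: normed_vspace Y by fact
  show "(vzero S, vzero Y) \<in> vcarrier S \<times> vcarrier Y" by (simp add: S.zero_closed Y.zero_closed)
  show "(case (vzero S, vzero Y) of (s, y) \<Rightarrow> vnorm S s * vnorm Y y) = 0" by (simp add: S.norm_vzero)
  show "A (vzero S, vzero Y) = 0" if "A \<in> {B. bilinear_form S Y B}" for A
    using that S.lf_zero[of "\<lambda>s. A (s, vzero Y)"] Y.zero_closed by (simp add: bilinear_form_iff)
  show "0 \<le> (case p of (s, y) \<Rightarrow> vnorm S s * vnorm Y y)" if "p \<in> vcarrier S \<times> vcarrier Y" for p
    using that S.norm_nonneg Y.norm_nonneg by auto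
  show "\<exists>q\<in>vcarrier S \<times> vcarrier Y. (case q of (s, y) \<Rightarrow> vnorm S s * vnorm Y y) = norm c * (case p of (s, y) \<Rightarrow> vnorm S s * vnorm Y y) \<and>
     (\<forall>A\<in>{B. bilinear_form S Y B}. A q = c * A p)" if p: "p \<in> vcarrier S \<times> vcarrier Y" for c p
    using p by (intro bexI[of _ "(vscale S c (fst p), snd p)"])
      (auto simp: S.norm_scale S.scale_closed bilinear_form_iff linear_functional_def)
  fix n :: nat and p B
  assume p: "\<forall>i<n. p i \<in> vcarrier S \<times> vcarrier Y"
    and zero: "\<forall>A\<in>{B. bilinear_form S Y B}. (\<exists>C. \<forall>q\<in>vcarrier S \<times> vcarrier Y. norm (A q) \<le> C * (case q of (s, y) \<Rightarrow> vnorm S s * vnorm Y y)) \<longrightarrow>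
       (\<Sum>i<n. A (p i)) = 0" and B: "B \<in> {B. bilinear_form S Y B}"
  have pS: "fst (p i) \<in> vcarrier S" and pY: "snd (p i) \<in> vcarrier Y" if "i < n" for i using p that by (auto simp: mem_Times_iff)
  have pS': "\<forall>i<n. fst (p i) \<in> vcarrier S" and pY': "\<forall>i<n. snd (p i) \<in> vcarrier Y" using pS pY by blast+
  obtain m c e where ce: "\<forall>k<m. c k \<in> vcarrier (dual S) \<and> e k \<in> vcarrier S"
    and xe: "\<forall>f. linear_functional S f \<longrightarrow> (\<forall>i<n. f (fst (p i)) = (\<Sum>k<(m::nat). c k (fst (p i)) * f (e k)))"
    using S.finite_interpolation_functional[OF pS'] by (elim exE conjE)
  obtain l d f where df: "\<forall>k<l. d k \<in> vcarrier (dual Y) \<and> f k \<in> vcarrier Y"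
    and yf: "\<forall>g. linear_functional Y g \<longrightarrow> (\<forall>i<n. g (snd (p i)) = (\<Sum>k<(l::nat). d k (snd (p i)) * g (f k)))"
    using Y.finite_interpolation_functional[OF pY'] by (elim exE conjE)
  have Bi: "B (p i) = (\<Sum>k<m. \<Sum>j<l. B (e k, f j) * (c k (fst (p i)) * d j (snd (p i))))" if i: "i < n" for i
  proof -
    have "B (p i) = B (fst (p i), snd (p i))" by simp
    also have "\<dots> = (\<Sum>k<m. c k (fst (p i)) * B (e k, snd (p i)))"
      by (rule xe[rule_format, of "\<lambda>s. B (s, snd (p i))"]) (use B pY[OF i] i in \<open>auto simp: bilinear_form_iff\<close>)
    also have "\<dots> = (\<Sum>k<m. c k (fst (p i)) * (\<Sum>j<l. d j (snd (p i)) * B (e k, f j)))"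
    proof (rule sum.cong[OF refl])
      fix k assume "k \<in> {..<m}"
      then have "linear_functional Y (\<lambda>y. B (e k, y))" using B ce by (auto simp: bilinear_form_iff)
      from yf[rule_format, OF this i]
      show "c k (fst (p i)) * B (e k, snd (p i)) = c k (fst (p i)) * (\<Sum>j<l. d j (snd (p i)) * B (e k, f j))" by simp
    qed
    finally show ?thesis by (simp add: sum_distrib_left mult_ac)
  qed
  have cd: "(\<Sum>i<n. c k (fst (p i)) * d j (snd (p i))) = 0" if "k < m" "j < l" for k j
  proof -
    have c: "c k \<in> vcarrier (dual S)" and d: "d j \<in> vcarrier (dual Y)" using ce df that by blast+
    define A where "A = (\<lambda>q\<in>vcarrier S \<times> vcarrier Y. c k (fst q) * d j (snd q))"
    have "bilinear_form S Y A"
      by (auto simp: bilinear_form_iff A_def linear_functional_def S.add_closed S.scale_closed Y.add_closed Y.scale_closed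
          S.dual_add[OF c] S.dual_scale[OF c] Y.dual_add[OF d] Y.dual_scale[OF d] algebra_simps)
    moreover have "norm (A q) \<le> (vnorm (dual S) (c k) * vnorm (dual Y) (d j)) * (case q of (s, y) \<Rightarrow> vnorm S s * vnorm Y y)"
      if "q \<in> vcarrier S \<times> vcarrier Y" for q
    proof -
      obtain s y where q: "q = (s, y)" "s \<in> vcarrier S" "y \<in> vcarrier Y" using \<open>q \<in> _\<close> by auto
      have "norm (c k s) * norm (d j y) \<le> (vnorm (dual S) (c k) * vnorm S s) * (vnorm (dual Y) (d j) * vnorm Y y)"
        by (intro mult_mono S.dual_bound[OF c q(2)] Y.dual_bound[OF d q(3)] mult_nonneg_nonneg S.dual_norm_nonneg[OF c] S.norm_nonneg[OF q(2)]) auto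
      then show ?thesis using q by (simp add: A_def norm_mult mult_ac)
    qed
    ultimately have "(\<Sum>i<n. A (p i)) = 0" using zero by blast
    moreover have "(\<Sum>i<n. A (p i)) = (\<Sum>i<n. c k (fst (p i)) * d j (snd (p i)))" using p by (intro sum.cong) (auto simp: A_def)
    ultimately show ?thesis by simp
  qed
  have "(\<Sum>i<n. B (p i)) = (\<Sum>i<n. \<Sum>k<m. \<Sum>j<l. B (e k, f j) * (c k (fst (p i)) * d j (snd (p i))))" using Bi by simp
  also have "\<dots> = (\<Sum>k<m. \<Sum>i<n. \<Sum>j<l. B (e k, f j) * (c k (fst (p i)) * d j (snd (p i))))" by (rule sum.swap)
  also have "\<dots> = (\<Sum>k<m. \<Sum>j<l. \<Sum>i<n. B (e k, f j) * (c k (fst (p i)) * d j (snd (p i))))" by (intro sum.cong refl sum.swap)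
  also have "\<dots> = 0" by (simp add: sum_distrib_left[symmetric] cd)
  finally show "(\<Sum>i<n. B (p i)) = 0" .
qed

lemma multilinear_scalars_iff:
  "multilinear I X scalars A \<longleftrightarrow> A \<in> extensional (\<Pi>\<^sub>E j\<in>I. vcarrier (X j)) \<and>
     (\<forall>x \<in> (\<Pi>\<^sub>E j\<in>I. vcarrier (X j)). \<forall>j\<in>I. linear_functional (X j) (\<lambda>t. A (x(j := t))))"
  by (simp add: multilinear_def linear_between_scalars)

lemma PiE_update: "x \<in> (\<Pi>\<^sub>E j\<in>I. vcarrier (X j)) \<Longrightarrow> i \<in> I \<Longrightarrow> t \<in> vcarrier (X i) \<Longrightarrow>
    x(i := t) \<in> (\<Pi>\<^sub>E j\<in>I. vcarrier (X j))"
  by (auto simp: PiE_iff extensional_def)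

lemma prod_multilinear:
  assumes X: "\<forall>j\<in>I. normed_vspace (X j)" and I: "finite I"
    and \<phi>: "\<forall>j\<in>I. \<phi> j \<in> vcarrier (dual (X j))"
  shows "multilinear I X scalars (\<lambda>x\<in>(\<Pi>\<^sub>E j\<in>I. vcarrier (X j)). \<Prod>j\<in>I. \<phi> j (x j))"
    and "\<And>x. x \<in> (\<Pi>\<^sub>E j\<in>I. vcarrier (X j)) \<Longrightarrow>
      norm (\<Prod>j\<in>I. \<phi> j (x j)) \<le> (\<Prod>j\<in>I. vnorm (dual (X j)) (\<phi> j)) * (\<Prod>j\<in>I. vnorm (X j) (x j))"
proof -
  show "multilinear I X scalars (\<lambda>x\<in>(\<Pi>\<^sub>E j\<in>I. vcarrier (X j)). \<Prod>j\<in>I. \<phi> j (x j))"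
    unfolding multilinear_scalars_iff
  proof (intro conjI ballI)
    fix x i assume x: "x \<in> (\<Pi>\<^sub>E j\<in>I. vcarrier (X j))" and i: "i \<in> I"
    interpret normed_vspace "X i" by (rule bspec[OF X i])
    have e: "(\<lambda>x\<in>(\<Pi>\<^sub>E j\<in>I. vcarrier (X j)). \<Prod>j\<in>I. \<phi> j (x j)) (x(i := t)) = \<phi> i t * (\<Prod>j\<in>I - {i}. \<phi> j (x j))"
      if "t \<in> vcarrier (X i)" for t
      using PiE_update[of x I X, OF x i that] I i by (simp add: prod.remove)
    show "linear_functional (X i) (\<lambda>t. (\<lambda>x\<in>(\<Pi>\<^sub>E j\<in>I. vcarrier (X j)). \<Prod>j\<in>I. \<phi> j (x j)) (x(i := t)))"
      unfolding linear_functional_def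
    proof (intro conjI ballI allI)
      fix s t c assume s: "s \<in> vcarrier (X i)" and t: "t \<in> vcarrier (X i)"
      show "(\<lambda>x\<in>(\<Pi>\<^sub>E j\<in>I. vcarrier (X j)). \<Prod>j\<in>I. \<phi> j (x j)) (x(i := vadd (X i) s t)) =
        (\<lambda>x\<in>(\<Pi>\<^sub>E j\<in>I. vcarrier (X j)). \<Prod>j\<in>I. \<phi> j (x j)) (x(i := s)) +
        (\<lambda>x\<in>(\<Pi>\<^sub>E j\<in>I. vcarrier (X j)). \<Prod>j\<in>I. \<phi> j (x j)) (x(i := t))"
        unfolding e[OF s] e[OF t] e[OF add_closed[OF s t]] dual_add[OF bspec[OF \<phi> i] s t] by (rule distrib_right)
    next
      fix t c assume t: "t \<in> vcarrier (X i)"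
      show "(\<lambda>x\<in>(\<Pi>\<^sub>E j\<in>I. vcarrier (X j)). \<Prod>j\<in>I. \<phi> j (x j)) (x(i := vscale (X i) c t)) =
        c * (\<lambda>x\<in>(\<Pi>\<^sub>E j\<in>I. vcarrier (X j)). \<Prod>j\<in>I. \<phi> j (x j)) (x(i := t))"
        unfolding e[OF t] e[OF scale_closed[OF t]] dual_scale[OF bspec[OF \<phi> i] t] by (rule mult.assoc)
    qed
  qed simp
  fix x assume x: "x \<in> (\<Pi>\<^sub>E j\<in>I. vcarrier (X j))"
  have "norm (\<Prod>j\<in>I. \<phi> j (x j)) = (\<Prod>j\<in>I. norm (\<phi> j (x j)))" by (rule prod_norm[symmetric])
  also have "\<dots> \<le> (\<Prod>j\<in>I. vnorm (dual (X j)) (\<phi> j) * vnorm (X j) (x j))"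
    using normed_vspace.dual_bound[OF bspec[OF X] bspec[OF \<phi>]] x by (intro prod_mono) auto
  finally show "norm (\<Prod>j\<in>I. \<phi> j (x j)) \<le> (\<Prod>j\<in>I. vnorm (dual (X j)) (\<phi> j)) * (\<Prod>j\<in>I. vnorm (X j) (x j))"
    by (simp add: prod.distrib)
qed

text \<open>Scalars are absorbed in coordinate 0, which exists because \<open>1 \<le> N\<close>. The
  substance is again \<open>separating\<close>, now by interpolating one coordinate after
  another.\<close>

lemma family_tensor_data:
  fixes X :: "nat \<Rightarrow> ('k::real_or_complex, 'a) nspace"
  assumes N: "1 \<le> N" and X: "\<And>j. j < N \<Longrightarrow> normed_vspace (X j)"
  shows "tensor_data (\<Pi>\<^sub>E j\<in>{..<N}. vcarrier (X j)) {A. multilinear {..<N} X scalars A}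
     (\<lambda>x. \<Prod>j\<in>{..<N}. vnorm (X j) (x j)) (\<lambda>j\<in>{..<N}. vzero (X j))"
proof
  let ?P = "\<Pi>\<^sub>E j\<in>{..<N}. vcarrier (X j)" and ?w = "\<lambda>x. \<Prod>j\<in>{..<N}. vnorm (X j) (x j)"
  interpret X0: normed_vspace "X 0" using X N by auto
  have N0: "0 \<in> {..<N}" using N by auto
  show p0: "(\<lambda>j\<in>{..<N}. vzero (X j)) \<in> ?P" using normed_vspace.zero_closed[OF X] by auto
  show "?w (\<lambda>j\<in>{..<N}. vzero (X j)) = 0" using N0 by (intro prod_zero) (auto simp: X0.norm_vzero intro!: bexI[of _ 0])
  show "A (\<lambda>j\<in>{..<N}. vzero (X j)) = 0" if "A \<in> {A. multilinear {..<N} X scalars A}" for A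
  proof -
    have "linear_functional (X 0) (\<lambda>t. A ((\<lambda>j\<in>{..<N}. vzero (X j))(0 := t)))"
      using that p0 N0 unfolding multilinear_scalars_iff by blast
    from X0.lf_zero[OF this] show ?thesis using N0 by (simp add: fun_upd_idem)
  qed
  show "0 \<le> ?w p" if "p \<in> ?P" for p
    using that normed_vspace.norm_nonneg[OF X] by (intro prod_nonneg) auto
  show "\<exists>q\<in>?P. ?w q = norm c * ?w p \<and> (\<forall>A\<in>{A. multilinear {..<N} X scalars A}. A q = c * A p)" if p: "p \<in> ?P" for c p
  proof -
    have p0': "p 0 \<in> vcarrier (X 0)" using p N0 by auto
    let ?q = "p(0 := vscale (X 0) c (p 0))"
    have "?q \<in> ?P" by (rule PiE_update[of p "{..<N}" X, OF p N0 X0.scale_closed[OF p0']])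
    moreover have "?w ?q = norm c * ?w p"
      using N0 by (simp add: prod.remove[of "{..<N}" 0] X0.norm_scale[OF p0'])
    moreover have "A ?q = c * A p" if "multilinear {..<N} X scalars A" for A
    proof -
      have "linear_functional (X 0) (\<lambda>t. A (p(0 := t)))" using that p N0 unfolding multilinear_scalars_iff by blast
      then have "A (p(0 := vscale (X 0) c (p 0))) = c * A (p(0 := p 0))" using p0' unfolding linear_functional_def by blast
      then show ?thesis by simp
    qed
    ultimately show ?thesis by blast
  qed
  fix n :: nat and p A
  assume p: "\<forall>i<n. p i \<in> ?P"
    and zero: "\<forall>A\<in>{A. multilinear {..<N} X scalars A}. (\<exists>C. \<forall>q\<in>?P. norm (A q) \<le> C * ?w q) \<longrightarrow> (\<Sum>i<n. A (p i)) = 0"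
    and "A \<in> {A. multilinear {..<N} X scalars A}"
  then have A: "multilinear {..<N} X scalars A" by simp
  let ?mix = "\<lambda>m z x. \<lambda>j\<in>{..<N}. if j < m then z j else x j"
  have pj: "p i j \<in> vcarrier (X j)" if "i < n" "j < N" for i j using p that by auto
  \<comment> \<open>The last m arguments of A come from \<open>p i\<close>; the first
    \<open>N - m\<close> are frozen at z and compensated by continuous functionals of
    \<open>p i\<close>. At m = 0 a bounded product form is summed, at m = N the form A
    itself.\<close>
  have claim: "\<forall>\<phi> z. (\<forall>j<N. \<phi> j \<in> vcarrier (dual (X j))) \<and> z \<in> ?P \<longrightarrow>
     (\<Sum>i<n. (\<Prod>j<N-m. \<phi> j (p i j)) * A (?mix (N-m) z (p i))) = 0" if "m \<le> N" for m
    using that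
  proof (induction m)
    case 0
    show ?case
    proof (intro allI impI, elim conjE)
      fix \<phi> z assume \<phi>: "\<forall>j<N. \<phi> j \<in> vcarrier (dual (X j))" and z: "z \<in> ?P"
      have \<phi>': "\<forall>j\<in>{..<N}. \<phi> j \<in> vcarrier (dual (X j))" using \<phi> by auto
      have X': "\<forall>j\<in>{..<N}. normed_vspace (X j)" using X by auto
      note pm = prod_multilinear[OF X' finite_lessThan \<phi>']
      let ?g = "\<lambda>x\<in>?P. \<Prod>j\<in>{..<N}. \<phi> j (x j)"
      have "(\<Sum>i<n. ?g (p i)) = 0"
      proof (rule zero[rule_format])
        show "?g \<in> {A. multilinear {..<N} X scalars A}" by (rule CollectI) (rule pm(1))
        show "\<exists>C. \<forall>q\<in>?P. norm (?g q) \<le> C * ?w q"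
        proof (intro exI ballI)
          fix q assume q: "q \<in> ?P"
          show "norm (?g q) \<le> (\<Prod>j\<in>{..<N}. vnorm (dual (X j)) (\<phi> j)) * ?w q"
            unfolding restrict_apply'[OF q] by (rule pm(2)[OF q])
        qed
      qed
      then have "(\<Sum>i<n. \<Prod>j<N. \<phi> j (p i j)) = 0" using p by simp
      moreover have "A (?mix N z x) = A z" for x
        using z by (intro arg_cong[of _ _ A]) (auto simp: fun_eq_iff PiE_iff extensional_def)
      ultimately show "(\<Sum>i<n. (\<Prod>j<N-0. \<phi> j (p i j)) * A (?mix (N-0) z (p i))) = 0"
        by (simp add: sum_distrib_right[symmetric] del: restrict_apply)
    qed
  next
    case (Suc m)
    define k where "k = N - Suc m"
    have k: "k < N" "N - m = Suc k" using Suc.prems by (auto simp: k_def)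
    interpret Xk: normed_vspace "X k" by (rule X[OF k(1)])
    show ?case
      unfolding k_def[symmetric]
    proof (intro allI impI, elim conjE)
      fix \<phi> z assume \<phi>: "\<forall>j<N. \<phi> j \<in> vcarrier (dual (X j))" and z: "z \<in> ?P"
      have pk: "\<forall>i<n. p i k \<in> vcarrier (X k)" using pj k(1) by blast
      obtain m' c e where ce: "\<forall>l<m'. c l \<in> vcarrier (dual (X k)) \<and> e l \<in> vcarrier (X k)"
        and xe: "\<forall>f. linear_functional (X k) f \<longrightarrow> (\<forall>i<n. f (p i k) = (\<Sum>l<(m'::nat). c l (p i k) * f (e l)))"
        using Xk.finite_interpolation_functional[OF pk] by (elim exE conjE)
      have Ai: "A (?mix k z (p i)) = (\<Sum>l<m'. c l (p i k) * A (?mix (Suc k) (z(k := e l)) (p i)))" if i: "i < n" for i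
      proof -
        have zj: "z j \<in> vcarrier (X j)" if "j < N" for j using z that by auto
        have mP: "?mix k z (p i) \<in> ?P" by (rule restrict_PiE_iff[THEN iffD2]) (use zj pj[OF i] in simp)
        have lf: "linear_functional (X k) (\<lambda>t. A ((?mix k z (p i))(k := t)))"
          using A mP k(1) unfolding multilinear_scalars_iff by blast
        have "A (?mix k z (p i)) = A ((?mix k z (p i))(k := p i k))"
          using k(1) by (intro arg_cong[of _ _ A]) (auto simp: fun_eq_iff)
        also have "\<dots> = (\<Sum>l<m'. c l (p i k) * A ((?mix k z (p i))(k := e l)))" by (rule xe[rule_format, OF lf i])
        also have "\<dots> = (\<Sum>l<m'. c l (p i k) * A (?mix (Suc k) (z(k := e l)) (p i)))"
          using k(1) by (intro sum.cong refl arg_cong2[of _ _ _ _ "(*)"] arg_cong[of _ _ A]) (auto simp: fun_eq_iff)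
        finally show ?thesis .
      qed
      have "(\<Sum>i<n. (\<Prod>j<k. \<phi> j (p i j)) * A (?mix k z (p i))) =
         (\<Sum>i<n. \<Sum>l<m'. (\<Prod>j<Suc k. (\<phi>(k := c l)) j (p i j)) * A (?mix (Suc k) (z(k := e l)) (p i)))"
      proof (rule sum.cong[OF refl])
        fix i assume "i \<in> {..<n}"
        then have i: "i < n" by simp
        have pr: "(\<Prod>j<Suc k. (\<phi>(k := c l)) j (p i j)) = (\<Prod>j<k. \<phi> j (p i j)) * c l (p i k)" for l
          by (simp add: prod.lessThan_Suc)
        show "(\<Prod>j<k. \<phi> j (p i j)) * A (?mix k z (p i)) =
           (\<Sum>l<m'. (\<Prod>j<Suc k. (\<phi>(k := c l)) j (p i j)) * A (?mix (Suc k) (z(k := e l)) (p i)))"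
          unfolding Ai[OF i] pr by (simp add: sum_distrib_left mult.assoc del: restrict_apply)
      qed
      also have "\<dots> = (\<Sum>l<m'. \<Sum>i<n. (\<Prod>j<Suc k. (\<phi>(k := c l)) j (p i j)) * A (?mix (Suc k) (z(k := e l)) (p i)))"
        by (rule sum.swap)
      also have "\<dots> = 0"
      proof (rule sum.neutral, rule ballI)
        fix l assume "l \<in> {..<m'}"
        then have "\<forall>j<N. (\<phi>(k := c l)) j \<in> vcarrier (dual (X j))" "z(k := e l) \<in> ?P"
          using ce \<phi> k(1) PiE_update[of z "{..<N}" X k "e l"] z by auto
        then show "(\<Sum>i<n. (\<Prod>j<Suc k. (\<phi>(k := c l)) j (p i j)) * A (?mix (Suc k) (z(k := e l)) (p i))) = 0"
          using Suc.IH Suc.prems unfolding k(2) by (meson Suc_leD)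
      qed
      finally show "(\<Sum>i<n. (\<Prod>j<k. \<phi> j (p i j)) * A (?mix k z (p i))) = 0" .
    qed
  qed
  have "\<forall>j<N. vzero (dual (X j)) \<in> vcarrier (dual (X j))"
    using normed_vspace.zero_closed[OF normed_vspace.normed_dual[OF X]] by auto
  then have "(\<forall>j<N. vzero (dual (X j)) \<in> vcarrier (dual (X j))) \<and> (\<lambda>j\<in>{..<N}. vzero (X j)) \<in> ?P" using p0 by (rule conjI)
  note claim[OF order_refl, THEN spec[of _ "\<lambda>j. vzero (dual (X j))"], THEN spec[of _ "\<lambda>j\<in>{..<N}. vzero (X j)"], THEN mp, OF this]
  then have "(\<Sum>i<n. A (?mix 0 (\<lambda>j\<in>{..<N}. vzero (X j)) (p i))) = 0"
    unfolding diff_self_eq_0 lessThan_0 prod.empty mult_1 .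
  moreover have "A (?mix 0 (\<lambda>j\<in>{..<N}. vzero (X j)) (p i)) = A (p i)" if "i < n" for i
    using p that by (intro arg_cong[of _ _ A]) (auto simp: fun_eq_iff PiE_iff extensional_def)
  ultimately show "(\<Sum>i<n. A (p i)) = 0" by simp
qed

section \<open>The completed tensor product with Y and its duality\<close>

locale tensor_spaces =
  fixes N :: nat and X :: "nat \<Rightarrow> ('k::real_or_complex, 'a) nspace" and Y :: "('k, 'b) nspace"
  assumes N: "1 \<le> N" and X: "\<And>j. j < N \<Longrightarrow> normed_vspace (X j)" and Y: "normed_vspace Y"
begin

abbreviation "Pi_X \<equiv> \<Pi>\<^sub>E j\<in>{..<N}. vcarrier (X j)"
abbreviation "wX \<equiv> \<lambda>x. \<Prod>j\<in>{..<N}. vnorm (X j) (x j)"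
abbreviation "S \<equiv> proj_tensor_family {..<N} X"
abbreviation "SY \<equiv> proj_tensor_pair S Y"
abbreviation "tX \<equiv> tensor_family {..<N} X"
abbreviation "tY \<equiv> tensor_pair S Y"

sublocale f: tensor_data Pi_X "{A. multilinear {..<N} X scalars A}" wX "\<lambda>j\<in>{..<N}. vzero (X j)"
  by (rule family_tensor_data[OF N X])

lemma S_eq: "S = completion f.W"
  by (simp add: proj_tensor_family_def alg_tensor_family_def)

lemma tX_eq: "tX x = canonical f.W (f.elem x)"
  by (simp add: tensor_family_def alg_tensor_family_def)

sublocale S: normed_vspace S
  unfolding S_eq by (rule f.W.normed_completion)

sublocale Y: normed_vspace Y by (rule Y)

sublocale p: tensor_data "vcarrier S \<times> vcarrier Y" "{B. bilinear_form S Y B}"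
   "\<lambda>(s, y). vnorm S s * vnorm Y y" "(vzero S, vzero Y)"
  by (rule pair_tensor_data[OF S.normed_vspace_axioms Y])

lemma SY_eq: "SY = completion p.W"
  by (simp add: proj_tensor_pair_def alg_tensor_pair_def)

lemma tY_eq: "tY s y = canonical p.W (p.elem (s, y))"
  by (simp add: tensor_pair_def alg_tensor_pair_def)

sublocale SY: normed_vspace SY
  unfolding SY_eq by (rule p.W.normed_completion)

lemma tX_closed: "x \<in> Pi_X \<Longrightarrow> tX x \<in> vcarrier S"
  unfolding S_eq tX_eq by (intro f.W.canonical_completion f.elem_W)

lemma tX_norm: "x \<in> Pi_X \<Longrightarrow> vnorm S (tX x) \<le> wX x"
  unfolding S_eq tX_eq f.W.completion_simps using f.W.canonical_isometric[OF f.elem_W] f.elem_norm by simp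

lemma tY_closed: "s \<in> vcarrier S \<Longrightarrow> y \<in> vcarrier Y \<Longrightarrow> tY s y \<in> vcarrier SY"
  unfolding SY_eq tY_eq by (intro p.W.canonical_completion p.elem_W) auto

lemma tY_norm: "s \<in> vcarrier S \<Longrightarrow> y \<in> vcarrier Y \<Longrightarrow> vnorm SY (tY s y) \<le> vnorm S s * vnorm Y y"
  unfolding SY_eq tY_eq p.W.completion_simps
  using p.W.canonical_isometric[OF p.elem_W] p.elem_norm[of "(s, y)"] by simp

lemma elem_pair_linear:
  assumes s: "s \<in> vcarrier S" "s' \<in> vcarrier S" and y: "y \<in> vcarrier Y"
  shows "p.elem (vadd S s s', y) = vadd p.W (p.elem (s, y)) (p.elem (s', y))"
    and "p.elem (vscale S c s, y) = vscale p.W c (p.elem (s, y))"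
  using s y unfolding elementary_tensor_def p.W_simps
  by (auto simp: fun_eq_iff restrict_def bilinear_form_iff linear_functional_def)

text \<open>With y fixed, an expansion of an element of \<open>S\<close> can be carried through a
  functional on the outer product; \<open>tensor_series\<close> relies on this.\<close>

lemma tY_functional:
  assumes \<phi>: "\<phi> \<in> vcarrier (dual SY)" and y: "y \<in> vcarrier Y"
  shows "(\<lambda>s\<in>vcarrier S. \<phi> (tY s y)) \<in> vcarrier (dual S)"
proof (rule S.dualI[OF restrict_extensional, of _ "vnorm (dual SY) \<phi> * vnorm Y y"])
  have e: "p.elem (s, y) \<in> vcarrier p.W" if "s \<in> vcarrier S" for s using that y by (intro p.elem_W) auto
  have add: "\<phi> (tY (vadd S s s') y) = \<phi> (tY s y) + \<phi> (tY s' y)" if s: "s \<in> vcarrier S" "s' \<in> vcarrier S" for s s'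
  proof -
    have "tY (vadd S s s') y = vadd SY (tY s y) (tY s' y)"
      unfolding tY_eq elem_pair_linear(1)[OF s y] p.W.canonical_add[OF e[OF s(1)] e[OF s(2)]]
      by (simp add: SY_eq p.W.completion_simps)
    then show ?thesis using SY.dual_add[OF \<phi> tY_closed[OF s(1) y] tY_closed[OF s(2) y]] by simp
  qed
  have scale: "\<phi> (tY (vscale S c s) y) = c * \<phi> (tY s y)" if s: "s \<in> vcarrier S" for s c
  proof -
    have "tY (vscale S c s) y = vscale SY c (tY s y)"
      unfolding tY_eq elem_pair_linear(2)[OF s s y] p.W.canonical_scale[OF e[OF s]]
      by (simp add: SY_eq p.W.completion_simps)
    then show ?thesis using SY.dual_scale[OF \<phi> tY_closed[OF s y]] by simp
  qed
  show "linear_functional S (\<lambda>s\<in>vcarrier S. \<phi> (tY s y))"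
    using add scale S.add_closed S.scale_closed by (simp add: linear_functional_def)
  fix s assume s: "s \<in> vcarrier S"
  have "norm (\<phi> (tY s y)) \<le> vnorm (dual SY) \<phi> * vnorm SY (tY s y)" by (rule SY.dual_bound[OF \<phi> tY_closed[OF s y]])
  also have "\<dots> \<le> vnorm (dual SY) \<phi> * (vnorm S s * vnorm Y y)"
    by (rule mult_left_mono[OF tY_norm[OF s y] SY.dual_norm_nonneg[OF \<phi>]])
  finally show "norm ((\<lambda>s\<in>vcarrier S. \<phi> (tY s y)) s) \<le> vnorm (dual SY) \<phi> * vnorm Y y * vnorm S s"
    using s by (simp add: mult_ac)
qed

text \<open>The pair representation has left factors in a completion, so each of them is expanded
  once more, with a tolerance adapted to the norm of its right factor, and the double series is
  flattened.\<close>

lemma tensor_series: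
  assumes u: "u \<in> vcarrier SY" and \<epsilon>: "0 < \<epsilon>"
  shows "\<exists>x y. (\<forall>i. x i \<in> Pi_X \<and> y i \<in> vcarrier Y) \<and> summable (\<lambda>i. wX (x i) * vnorm Y (y i)) \<and>
    (\<Sum>i. wX (x i) * vnorm Y (y i)) < vnorm SY u + \<epsilon> \<and>
    (\<forall>\<phi>\<in>vcarrier (dual SY). (\<lambda>i. \<phi> (tY (tX (x i)) (y i))) sums \<phi> u)"
proof -
  have "0 < \<epsilon> / 2" using \<epsilon> by simp
  from p.completion_series[OF u[unfolded SY_eq] this] obtain q where
    q: "\<forall>i. q i \<in> vcarrier S \<times> vcarrier Y" "summable (\<lambda>i. case q i of (s, y) \<Rightarrow> vnorm S s * vnorm Y y)"
    "(\<Sum>i. case q i of (s, y) \<Rightarrow> vnorm S s * vnorm Y y) < vnorm SY u + \<epsilon> / 2"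
    "\<forall>\<phi>\<in>vcarrier (dual SY). (\<lambda>i. \<phi> (canonical p.W (p.elem (q i)))) sums \<phi> u"
    unfolding SY_eq[symmetric] by (elim exE conjE)
  define s where "s = (\<lambda>k. fst (q k))"
  define y where "y = (\<lambda>k. snd (q k))"
  have qk: "q k = (s k, y k)" for k by (simp add: s_def y_def)
  have sS: "s k \<in> vcarrier S" and yY: "y k \<in> vcarrier Y" for k using q(1)[rule_format, of k] by (auto simp: s_def y_def)
  define c where "c = (\<lambda>k. vnorm S (s k) * vnorm Y (y k))"
  have c: "summable c" "suminf c < vnorm SY u + \<epsilon> / 2" using q(2,3) by (simp_all add: c_def qk)
  \<comment> \<open>The error in expanding \<open>s k\<close> is multiplied by the norm of
    \<open>y k\<close>. Dividing by 1 plus that norm keeps the product below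
    \<open>\<epsilon> / 4 * (1/2)^k\<close>, in total \<open>\<epsilon> / 2\<close>, without a
    division by zero.\<close>
  define \<eta> where "\<eta> = (\<lambda>k. \<epsilon> / 4 * (1/2)^k / (1 + vnorm Y (y k)))"
  have ny: "0 \<le> vnorm Y (y k)" for k by (rule Y.norm_nonneg[OF yY])
  have \<eta>0: "0 < \<eta> k" for k using \<epsilon> ny[of k] by (simp add: \<eta>_def)
  have \<eta>y: "\<eta> k * vnorm Y (y k) \<le> \<epsilon> / 4 * (1/2)^k" for k
  proof -
    have "vnorm Y (y k) / (1 + vnorm Y (y k)) \<le> 1" using ny[of k] by simp
    from mult_left_mono[OF this, of "\<epsilon> / 4 * (1/2)^k"] show ?thesis using \<epsilon> by (simp add: \<eta>_def)
  qed
  have "\<forall>k. \<exists>x. (\<forall>i. x i \<in> Pi_X) \<and> summable (\<lambda>i. wX (x i)) \<and> (\<Sum>i. wX (x i)) < vnorm S (s k) + \<eta> k \<and>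
    (\<forall>\<phi>\<in>vcarrier (dual S). (\<lambda>i. \<phi> (tX (x i))) sums \<phi> (s k))"
    unfolding S_eq tX_eq by (rule allI, rule f.completion_series) (use sS \<eta>0 in \<open>simp_all add: S_eq\<close>)
  from choice[OF this] obtain x where x: "\<forall>k. (\<forall>i. x k i \<in> Pi_X) \<and> summable (\<lambda>i. wX (x k i)) \<and>
    (\<Sum>i. wX (x k i)) < vnorm S (s k) + \<eta> k \<and> (\<forall>\<phi>\<in>vcarrier (dual S). (\<lambda>i. \<phi> (tX (x k i))) sums \<phi> (s k))" by (elim exE)
  have xP: "x k i \<in> Pi_X" and xs: "summable (\<lambda>i. wX (x k i))" and xle: "(\<Sum>i. wX (x k i)) < vnorm S (s k) + \<eta> k"
    for k i using x by blast+
  have x\<phi>: "(\<lambda>i. \<phi> (tX (x k i))) sums \<phi> (s k)" if "\<phi> \<in> vcarrier (dual S)" for \<phi> k using x that by blast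
  define b where "b = (\<lambda>k i. wX (x k i) * vnorm Y (y k))"
  define B where "B = (\<lambda>k. (\<Sum>i. wX (x k i)) * vnorm Y (y k))"
  have b0: "0 \<le> b k i" for k i unfolding b_def using f.w_nonneg[OF xP] ny by simp
  have bs: "(\<lambda>i. b k i) sums B k" for k unfolding b_def B_def by (rule sums_mult2[OF summable_sums[OF xs]])
  have B0: "0 \<le> B k" for k unfolding B_def using suminf_nonneg[OF xs] f.w_nonneg[OF xP] ny by simp
  have Bc: "B k \<le> c k + \<epsilon> / 4 * (1/2)^k" for k
  proof -
    have "B k \<le> (vnorm S (s k) + \<eta> k) * vnorm Y (y k)"
      unfolding B_def using xle[of k] ny[of k] by (intro mult_right_mono) auto
    then show ?thesis using \<eta>y[of k] by (simp add: c_def distrib_right)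
  qed
  have gs: "(\<lambda>n. \<epsilon> / 4 * (1/2)^n) sums (\<epsilon> / 2)" using sums_mult[OF geometric_sums[of "1/2 :: real"], of "\<epsilon> / 4"] by simp
  have cs: "summable (\<lambda>k. c k + \<epsilon> / 4 * (1/2)^k)" by (rule summable_add[OF c(1) sums_summable[OF gs]])
  have sB: "summable B" by (rule summable_comparison_test'[OF cs]) (use Bc B0 in auto)
  have "suminf B \<le> (\<Sum>k. c k + \<epsilon> / 4 * (1/2)^k)" by (rule suminf_le[OF Bc sB cs])
  also have "\<dots> = suminf c + \<epsilon> / 2" using suminf_add[OF c(1) sums_summable[OF gs]] sums_unique[OF gs] by simp
  finally have tot: "suminf B < vnorm SY u + \<epsilon>" using c(2) by simp
  define xx where "xx = (\<lambda>n. x (fst (prod_decode n)) (snd (prod_decode n)))"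
  define yy where "yy = (\<lambda>n. y (fst (prod_decode n)))"
  have ws: "(\<lambda>n. wX (xx n) * vnorm Y (yy n)) sums suminf B"
    using double_series(1)[of b B, OF b0 bs sB] by (simp add: b_def xx_def yy_def)
  have "(\<lambda>n. \<phi> (tY (tX (xx n)) (yy n))) sums \<phi> u" if \<phi>: "\<phi> \<in> vcarrier (dual SY)" for \<phi>
    unfolding xx_def yy_def
  proof (rule double_series(2)[where b = b and B = B and h = "\<lambda>k i. \<phi> (tY (tX (x k i)) (y k))"
        and K = "vnorm (dual SY) \<phi>" and g = "\<lambda>k. \<phi> (tY (s k) (y k))", OF b0 bs sB])
    show "norm (\<phi> (tY (tX (x k i)) (y k))) \<le> vnorm (dual SY) \<phi> * b k i" for k i
    proof -
      have "vnorm SY (tY (tX (x k i)) (y k)) \<le> vnorm S (tX (x k i)) * vnorm Y (y k)" by (rule tY_norm[OF tX_closed[OF xP] yY])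
      also have "\<dots> \<le> b k i" unfolding b_def by (rule mult_right_mono[OF tX_norm[OF xP] ny])
      finally have "vnorm (dual SY) \<phi> * vnorm SY (tY (tX (x k i)) (y k)) \<le> vnorm (dual SY) \<phi> * b k i"
        using SY.dual_norm_nonneg[OF \<phi>] by (rule mult_left_mono)
      then show ?thesis using SY.dual_bound[OF \<phi> tY_closed[OF tX_closed[OF xP[of k i]] yY[of k]]] by linarith
    qed
    show "(\<lambda>i. \<phi> (tY (tX (x k i)) (y k))) sums \<phi> (tY (s k) (y k))" for k
      using x\<phi>[OF tY_functional[OF \<phi> yY[of k]], of k] by (simp add: tX_closed[OF xP] sS)
    show "(\<lambda>k. \<phi> (tY (s k) (y k))) sums \<phi> u"
      using bspec[OF q(4) \<phi>] by (simp add: qk tY_eq)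
  qed
  then show ?thesis using xP yY ws sums_summable[OF ws] sums_unique[OF ws] tot
    by (intro exI[of _ xx] exI[of _ yy]) (auto simp: xx_def yy_def)
qed

text \<open>For each y the form in x gives an element \<open>g y\<close> of the dual of the
  algebraic product. Elements of \<open>S\<close> lie in its bidual and can be applied to
  \<open>g y\<close>; the result is a bounded bilinear form \<open>B\<close>, and the functional is
  evaluation at \<open>B\<close>.\<close>

lemma tensor_functional:
  assumes \<Psi>X: "\<forall>y\<in>vcarrier Y. multilinear {..<N} X scalars (\<lambda>x\<in>Pi_X. \<Psi> x y)"
    and \<Psi>Y: "\<forall>x\<in>Pi_X. linear_functional Y (\<Psi> x)"
    and C: "0 \<le> C" "\<forall>x\<in>Pi_X. \<forall>y\<in>vcarrier Y. norm (\<Psi> x y) \<le> C * wX x * vnorm Y y"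
  shows "\<exists>\<phi>\<in>vcarrier (dual SY). \<forall>x\<in>Pi_X. \<forall>y\<in>vcarrier Y. \<phi> (tY (tX x) y) = \<Psi> x y"
proof -
  define A where "A = (\<lambda>y. \<lambda>x\<in>Pi_X. \<Psi> x y)"
  define g where "g = (\<lambda>y. \<lambda>v\<in>vcarrier f.W. v (A y))"
  have AF: "A y \<in> {A. multilinear {..<N} X scalars A}" if "y \<in> vcarrier Y" for y using \<Psi>X that by (simp add: A_def)
  have Ab: "\<forall>q\<in>Pi_X. norm (A y q) \<le> (C * vnorm Y y) * wX q" if "y \<in> vcarrier Y" for y
    using C(2) that by (simp add: A_def mult_ac)
  have Cy: "0 \<le> C * vnorm Y y" if "y \<in> vcarrier Y" for y using C(1) Y.norm_nonneg[OF that] by simp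
  have gd: "g y \<in> vcarrier (dual f.W)" "vnorm (dual f.W) (g y) \<le> C * vnorm Y y" if y: "y \<in> vcarrier Y" for y
    unfolding g_def by (rule f.form_functional[OF AF[OF y] Ab[OF y] Cy[OF y]])+
  interpret fd: normed_vspace "dual f.W" by (rule f.W.normed_dual)
  have sb: "s \<in> vcarrier (bidual f.W)" if "s \<in> vcarrier S" for s using that by (simp add: S_eq f.W.completion_iff)
  \<comment> \<open>An algebraic tensor acts on forms as a finite sum of evaluations, so linearity
    of \<open>\<Psi> x\<close> in y carries over to \<open>g\<close>.\<close>
  have g_add: "g (vadd Y y y') = vadd (dual f.W) (g y) (g y')" if y: "y \<in> vcarrier Y" "y' \<in> vcarrier Y" for y y'
  proof (rule f.W.dual_eqI[OF gd(1)[OF Y.add_closed[OF y]] fd.add_closed[OF gd(1)[OF y(1)] gd(1)[OF y(2)]]])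
    fix v assume v: "v \<in> vcarrier f.W"
    then obtain n q where r: "\<forall>i<(n::nat). q i \<in> Pi_X" "v = (\<lambda>A\<in>{A. multilinear {..<N} X scalars A}. \<Sum>i<n. A (q i))"
      unfolding f.W_simps(1) f.represents_iff by blast
    have vA: "v (A z) = (\<Sum>i<n. \<Psi> (q i) z)" if "z \<in> vcarrier Y" for z
    proof -
      have "v (A z) = (\<Sum>i<n. A z (q i))" unfolding r(2) restrict_apply'[OF AF[OF that]] ..
      then show ?thesis using r(1) by (simp add: A_def)
    qed
    show "g (vadd Y y y') v = vadd (dual f.W) (g y) (g y') v"
      using v r(1) \<Psi>Y y by (simp add: g_def f.W.dual_ops vA Y.add_closed linear_functional_def sum.distrib)
  qed
  have g_scale: "g (vscale Y c y) = vscale (dual f.W) c (g y)" if y: "y \<in> vcarrier Y" for y c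
  proof (rule f.W.dual_eqI[OF gd(1)[OF Y.scale_closed[OF y]] fd.scale_closed[OF gd(1)[OF y]]])
    fix v assume v: "v \<in> vcarrier f.W"
    then obtain n q where r: "\<forall>i<(n::nat). q i \<in> Pi_X" "v = (\<lambda>A\<in>{A. multilinear {..<N} X scalars A}. \<Sum>i<n. A (q i))"
      unfolding f.W_simps(1) f.represents_iff by blast
    have vA: "v (A z) = (\<Sum>i<n. \<Psi> (q i) z)" if "z \<in> vcarrier Y" for z
    proof -
      have "v (A z) = (\<Sum>i<n. A z (q i))" unfolding r(2) restrict_apply'[OF AF[OF that]] ..
      then show ?thesis using r(1) by (simp add: A_def)
    qed
    show "g (vscale Y c y) v = vscale (dual f.W) c (g y) v"
      using v r(1) \<Psi>Y y by (simp add: g_def f.W.dual_ops vA Y.scale_closed linear_functional_def sum_distrib_left)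
  qed
  define B where "B = (\<lambda>p\<in>vcarrier S \<times> vcarrier Y. (fst p) (g (snd p)))"
  have Bs: "B (s, y) = s (g y)" if "s \<in> vcarrier S" "y \<in> vcarrier Y" for s y using that by (simp add: B_def)
  have Sops: "vadd S = vadd (bidual f.W)" "vscale S = vscale (bidual f.W)" "vnorm S = vnorm (bidual f.W)"
    by (simp_all add: S_eq f.W.completion_simps)
  have "bilinear_form S Y B"
    unfolding bilinear_form_iff
  proof (intro conjI ballI)
    show "B \<in> extensional (vcarrier S \<times> vcarrier Y)" by (simp add: B_def)
    fix y assume y: "y \<in> vcarrier Y"
    show "linear_functional S (\<lambda>s. B (s, y))"
      unfolding linear_functional_def using y gd(1)[OF y]
      by (simp add: Bs S.add_closed S.scale_closed) (simp add: Sops fd.dual_ops)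
  next
    fix s assume s: "s \<in> vcarrier S"
    show "linear_functional Y (\<lambda>y. B (s, y))"
      unfolding linear_functional_def
      using s by (simp add: Bs Y.add_closed Y.scale_closed g_add g_scale fd.dual_add[OF sb[OF s]] fd.dual_scale[OF sb[OF s]] gd(1))
  qed
  then have BF: "B \<in> {B. bilinear_form S Y B}" by simp
  have Bb: "\<forall>q\<in>vcarrier S \<times> vcarrier Y. norm (B q) \<le> C * (case q of (s, y) \<Rightarrow> vnorm S s * vnorm Y y)"
  proof
    fix q assume "q \<in> vcarrier S \<times> vcarrier Y"
    then obtain s y where q: "q = (s, y)" "s \<in> vcarrier S" "y \<in> vcarrier Y" by auto
    have "norm (s (g y)) \<le> vnorm S s * vnorm (dual f.W) (g y)" unfolding Sops(3) by (rule fd.dual_bound[OF sb[OF q(2)] gd(1)[OF q(3)]])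
    also have "\<dots> \<le> vnorm S s * (C * vnorm Y y)" by (rule mult_left_mono[OF gd(2)[OF q(3)] S.norm_nonneg[OF q(2)]])
    finally show "norm (B q) \<le> C * (case q of (s, y) \<Rightarrow> vnorm S s * vnorm Y y)" using q by (simp add: Bs mult_ac)
  qed
  note h = p.form_functional(1)[OF BF Bb C(1)]
  define \<phi> where "\<phi> = (\<lambda>u\<in>vcarrier SY. u (\<lambda>v\<in>vcarrier p.W. v B))"
  have "\<phi> \<in> vcarrier (dual SY)" unfolding \<phi>_def SY_eq by (rule p.W.dual_completion_eval[OF h])
  moreover have "\<phi> (tY (tX x) y) = \<Psi> x y" if x: "x \<in> Pi_X" and y: "y \<in> vcarrier Y" for x y
  proof -
    have "\<phi> (tY (tX x) y) = (tY (tX x) y) (\<lambda>v\<in>vcarrier p.W. v B)"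
      unfolding \<phi>_def by (rule restrict_apply'[OF tY_closed[OF tX_closed[OF x] y]])
    also have "\<dots> = (\<lambda>v\<in>vcarrier p.W. v B) (p.elem (tX x, y))" unfolding tY_eq by (rule p.W.canonical_apply[OF h])
    also have "\<dots> = p.elem (tX x, y) B" by (rule restrict_apply', rule p.elem_W) (use tX_closed[OF x] y in auto)
    also have "\<dots> = B (tX x, y)" unfolding elementary_tensor_def by (rule restrict_apply'[OF BF])
    also have "\<dots> = (canonical f.W (f.elem x)) (g y)" using Bs[OF tX_closed[OF x] y] by (simp add: tX_eq)
    also have "\<dots> = g y (f.elem x)" by (rule f.W.canonical_apply[OF gd(1)[OF y]])
    also have "\<dots> = f.elem x (A y)" unfolding g_def by (rule restrict_apply'[OF f.elem_W[OF x]])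
    also have "\<dots> = A y x" unfolding elementary_tensor_def by (rule restrict_apply'[OF AF[OF y]])
    also have "\<dots> = \<Psi> x y" unfolding A_def by (rule restrict_apply'[OF x])
    finally show ?thesis .
  qed
  ultimately show ?thesis by blast
qed

text \<open>The description in \<open>duality\<close> is unique because \<open>tensor_series\<close>
  expands every element into elementary tensors, where its values are prescribed.\<close>

lemma duality_sums:
  assumes \<Psi>X: "\<forall>y\<in>vcarrier Y. multilinear {..<N} X scalars (\<lambda>x\<in>Pi_X. \<Psi> x y)"
    and \<Psi>Y: "\<forall>x\<in>Pi_X. linear_functional Y (\<Psi> x)"
    and C: "0 \<le> C" "\<forall>x\<in>Pi_X. \<forall>y\<in>vcarrier Y. norm (\<Psi> x y) \<le> C * wX x * vnorm Y y"
    and xy: "\<forall>i. x i \<in> Pi_X \<and> y i \<in> vcarrier Y"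
    and sums: "\<forall>\<phi>\<in>vcarrier (dual SY). (\<lambda>i. \<phi> (tY (tX (x i)) (y i))) sums \<phi> u"
  shows "(\<lambda>i. \<Psi> (x i) (y i)) sums duality N X Y u \<Psi>"
proof -
  obtain \<phi> where \<phi>: "\<phi> \<in> vcarrier (dual SY)" "\<forall>x\<in>Pi_X. \<forall>y\<in>vcarrier Y. \<phi> (tY (tX x) y) = \<Psi> x y"
    using tensor_functional[OF \<Psi>X \<Psi>Y C] by (elim bexE)
  have "(THE \<phi>. \<phi> \<in> vcarrier (dual SY) \<and> (\<forall>x \<in> Pi_X. \<forall>y \<in> vcarrier Y. \<phi> (tY (tX x) y) = \<Psi> x y)) = \<phi>"
  proof (rule the_equality)
    fix \<phi>' assume \<phi>': "\<phi>' \<in> vcarrier (dual SY) \<and> (\<forall>x \<in> Pi_X. \<forall>y \<in> vcarrier Y. \<phi>' (tY (tX x) y) = \<Psi> x y)"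
    show "\<phi>' = \<phi>"
    proof (rule SY.dual_eqI)
      fix v assume v: "v \<in> vcarrier SY"
      obtain a b where ab: "\<forall>i. a i \<in> Pi_X \<and> b i \<in> vcarrier Y"
        "\<forall>\<phi>\<in>vcarrier (dual SY). (\<lambda>i. \<phi> (tY (tX (a i)) (b i))) sums \<phi> v"
        using tensor_series[OF v zero_less_one] by (elim exE conjE)
      have "\<phi>' (tY (tX (a i)) (b i)) = \<phi> (tY (tX (a i)) (b i))" for i using ab(1) \<phi> \<phi>' by simp
      then show "\<phi>' v = \<phi> v" using bspec[OF ab(2) \<phi>(1)] bspec[OF ab(2), of \<phi>'] \<phi>' sums_unique2 by auto
    qed (use \<phi> \<phi>' in auto)
  qed (use \<phi> in auto)
  then have "duality N X Y u \<Psi> = \<phi> u" unfolding duality_def by simp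
  moreover have "\<phi> (tY (tX (x i)) (y i)) = \<Psi> (x i) (y i)" for i using xy \<phi>(2) by simp
  ultimately show ?thesis using bspec[OF sums \<phi>(1)] by simp
qed

end

section \<open>The Arens extension\<close>

lemma iterated_limit_unique:
  assumes T: "Hausdorff_space T" and F: "\<forall>j\<in>set js. F j \<noteq> bot"
    and "iterated_limit T F f js x l" "iterated_limit T F f js x l'"
  shows "l = l'"
  using assms(2-)
proof (induction js arbitrary: x l l')
  case Nil then show ?case by simp
next
  case (Cons j js)
  obtain g where g: "\<forall>\<^sub>F t in F j. iterated_limit T F f js (x(j := t)) (g t)" "limitin T g l (F j)"
    using Cons.prems(2) by auto
  obtain g' where g': "\<forall>\<^sub>F t in F j. iterated_limit T F f js (x(j := t)) (g' t)" "limitin T g' l' (F j)"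
    using Cons.prems(3) by auto
  have "\<forall>\<^sub>F t in F j. g t = g' t"
    using g(1) g'(1) by eventually_elim (use Cons.IH Cons.prems(1) in auto)
  then have "limitin T g' l (F j)" using limitin_transform_eventually[OF _ g(2)] by blast
  then show ?case using limitin_Hausdorff_unique[OF _ g'(2)] T Cons.prems(1) by auto
qed

lemma multilinear_scale:
  fixes X :: "nat \<Rightarrow> ('k::real_or_complex, 'a) nspace"
  assumes X: "\<And>j. j < N \<Longrightarrow> normed_vspace (X j)" and A: "multilinear {..<N} X scalars A"
    and x: "x \<in> (\<Pi>\<^sub>E j\<in>{..<N}. vcarrier (X j))"
  shows "A (\<lambda>j\<in>{..<N}. vscale (X j) (c j) (x j)) = (\<Prod>j<N. c j) * A x"
proof -
  let ?x = "\<lambda>m. \<lambda>j\<in>{..<N}. if j < m then vscale (X j) (c j) (x j) else x j"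
  have xj: "x j \<in> vcarrier (X j)" if "j < N" for j using x that by auto
  have xm: "?x m \<in> (\<Pi>\<^sub>E j\<in>{..<N}. vcarrier (X j))" for m
    by (rule restrict_PiE_iff[THEN iffD2]) (use xj normed_vspace.scale_closed[OF X] in simp)
  have "A (?x m) = (\<Prod>j<m. c j) * A x" if "m \<le> N" for m
    using that
  proof (induction m)
    case 0
    have "?x 0 = x" using x by (auto simp: fun_eq_iff PiE_iff extensional_def)
    then show ?case by simp
  next
    case (Suc m)
    have m: "m < N" using Suc.prems by simp
    have "linear_functional (X m) (\<lambda>t. A ((?x m)(m := t)))"
      using A xm m unfolding multilinear_scalars_iff by blast
    then have "A ((?x m)(m := vscale (X m) (c m) (x m))) = c m * A ((?x m)(m := x m))"
      using xj[OF m] unfolding linear_functional_def by blast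
    moreover have "(?x m)(m := vscale (X m) (c m) (x m)) = ?x (Suc m)" "(?x m)(m := x m) = ?x m"
      using m by (auto simp: fun_eq_iff)
    ultimately show ?case using Suc by (simp add: mult_ac del: restrict_apply)
  qed
  from this[of N] show ?thesis by (simp cong: restrict_cong)
qed

context tensor_spaces
begin

sublocale Y': normed_vspace "dual Y" by (rule Y.normed_dual)

sublocale Y'': normed_vspace "bidual Y" by (rule Y'.normed_dual)

definition normalize :: "(nat \<Rightarrow> 'a) \<Rightarrow> nat \<Rightarrow> 'a" where
  "normalize x = (\<lambda>j\<in>{..<N}. vscale (X j) (of_real (inverse (vnorm (X j) (x j)))) (x j))"

lemma normalize:
  assumes x: "x \<in> Pi_X"
  shows "j < N \<Longrightarrow> normalize x j \<in> unit_ball (X j)" "normalize x \<in> Pi_X"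
    "(\<lambda>j\<in>{..<N}. vscale (X j) (of_real (vnorm (X j) (x j))) (normalize x j)) = x"
proof -
  have xj: "x j \<in> vcarrier (X j)" if "j < N" for j using x that by auto
  show "j < N \<Longrightarrow> normalize x j \<in> unit_ball (X j)"
    using normed_vspace.unit_normalize(1)[OF X xj] by (simp add: normalize_def)
  show "normalize x \<in> Pi_X"
    unfolding normalize_def by (rule restrict_PiE_iff[THEN iffD2]) (use xj normed_vspace.scale_closed[OF X] in simp)
  show "(\<lambda>j\<in>{..<N}. vscale (X j) (of_real (vnorm (X j) (x j))) (normalize x j)) = x"
  proof
    fix j
    show "(\<lambda>j\<in>{..<N}. vscale (X j) (of_real (vnorm (X j) (x j))) (normalize x j)) j = x j"
    proof (cases "j < N")
      case True
      then show ?thesis using normed_vspace.unit_normalize(2)[OF X[OF True] xj[OF True]] by (simp add: normalize_def del: of_real_inverse)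
    next
      case False
      then show ?thesis using x by (auto simp: PiE_iff extensional_def)
    qed
  qed
qed

lemma multilinear_normalize:
  assumes A: "multilinear {..<N} X scalars A" and x: "x \<in> Pi_X"
  shows "A x = of_real (wX x) * A (normalize x)"
  using multilinear_scale[OF X A normalize(2)[OF x], of "\<lambda>j. of_real (vnorm (X j) (x j))"]
  unfolding normalize(3)[OF x] by simp

end

section \<open>Extension of a multilinear map to the biduals\<close>

locale tensor_map = tensor_spaces N X Y
  for N :: nat and X :: "nat \<Rightarrow> ('k::real_or_complex, 'a) nspace" and Y :: "('k, 'b) nspace" +
  fixes \<Psi> :: "(nat \<Rightarrow> 'a) \<Rightarrow> 'b \<Rightarrow> 'k"
  assumes \<Psi>: "\<Psi> \<in> continuous_multilinear_maps {..<N} X (dual Y)"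
begin

lemma \<Psi>_linear:
  assumes "x \<in> Pi_X" "j < N"
  shows "linear_between (X j) (dual Y) (\<lambda>t. \<Psi> (x(j := t)))"
  using \<Psi> assms by (simp add: continuous_multilinear_maps_def multilinear_def)

lemma \<Psi>_dual: "x \<in> Pi_X \<Longrightarrow> \<Psi> x \<in> vcarrier (dual Y)"
proof -
  assume x: "x \<in> Pi_X"
  have "x 0 \<in> vcarrier (X 0)" by (rule PiE_mem[OF x]) (use N in simp)
  moreover have "linear_between (X 0) (dual Y) (\<lambda>t. \<Psi> (x(0 := t)))" by (rule \<Psi>_linear[OF x]) (use N in simp)
  ultimately have "\<Psi> (x(0 := x 0)) \<in> vcarrier (dual Y)" unfolding linear_between_def by blast
  then show ?thesis by simp
qed

lemma \<Psi>_multilinear: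
  assumes w: "w \<in> vcarrier (bidual Y)"
  shows "multilinear {..<N} X scalars (\<lambda>x\<in>Pi_X. w (\<Psi> x))"
  unfolding multilinear_scalars_iff
proof (intro conjI ballI)
  fix x j assume x: "x \<in> Pi_X" and "j \<in> {..<N}"
  then have j: "j < N" by simp
  interpret Xj: normed_vspace "X j" by (rule X[OF j])
  have P: "x(j := t) \<in> Pi_X" if "t \<in> vcarrier (X j)" for t using PiE_update[of x "{..<N}" X j t] x j that by simp
  have lb: "\<Psi> (x(j := t)) \<in> vcarrier (dual Y)" "\<Psi> (x(j := vadd (X j) s t)) = vadd (dual Y) (\<Psi> (x(j := s))) (\<Psi> (x(j := t)))"
     "\<Psi> (x(j := vscale (X j) c t)) = vscale (dual Y) c (\<Psi> (x(j := t)))"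
    if "s \<in> vcarrier (X j)" "t \<in> vcarrier (X j)" for s t c
    using \<Psi>_linear[OF x j] that unfolding linear_between_def by auto
  show "linear_functional (X j) (\<lambda>t. (\<lambda>x\<in>Pi_X. w (\<Psi> x)) (x(j := t)))"
    unfolding linear_functional_def
  proof (intro conjI ballI allI)
    fix s t c assume s: "s \<in> vcarrier (X j)" and t: "t \<in> vcarrier (X j)"
    show "(\<lambda>x\<in>Pi_X. w (\<Psi> x)) (x(j := vadd (X j) s t)) = (\<lambda>x\<in>Pi_X. w (\<Psi> x)) (x(j := s)) + (\<lambda>x\<in>Pi_X. w (\<Psi> x)) (x(j := t))"
      unfolding restrict_apply'[OF P[OF Xj.add_closed[OF s t]]] restrict_apply'[OF P[OF s]] restrict_apply'[OF P[OF t]] lb(2)[OF s t]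
      by (rule Y'.dual_add[OF w lb(1)[OF s s] lb(1)[OF t t]])
  next
    fix t c assume t: "t \<in> vcarrier (X j)"
    show "(\<lambda>x\<in>Pi_X. w (\<Psi> x)) (x(j := vscale (X j) c t)) = c * (\<lambda>x\<in>Pi_X. w (\<Psi> x)) (x(j := t))"
      unfolding restrict_apply'[OF P[OF Xj.scale_closed[OF t]]] restrict_apply'[OF P[OF t]] lb(3)[OF t t]
      by (rule Y'.dual_scale[OF w lb(1)[OF t t]])
  qed
qed simp

lemma \<Psi>_y_multilinear:
  assumes y: "y \<in> vcarrier Y"
  shows "multilinear {..<N} X scalars (\<lambda>x\<in>Pi_X. \<Psi> x y)"
proof -
  have "(\<lambda>x\<in>Pi_X. canonical Y y (\<Psi> x)) = (\<lambda>x\<in>Pi_X. \<Psi> x y)"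
    by (rule restrict_ext) (simp add: Y.canonical_apply \<Psi>_dual)
  then show ?thesis using \<Psi>_multilinear[OF Y.canonical_bidual(1)[OF y]] by simp
qed

text \<open>Continuity at zero gives a box with radii \<open>r j\<close> on which the norm of
  \<open>\<Psi>\<close> is below 1, and multilinearity rescales tuples of unit vectors into this
  box.\<close>

lemma ex_bound: "\<exists>C\<ge>0. \<forall>x\<in>Pi_X. vnorm (dual Y) (\<Psi> x) \<le> C * wX x"
proof -
  let ?p0 = "\<lambda>j\<in>{..<N}. vzero (X j)"
  let ?U = "{f \<in> vcarrier (dual Y). vnorm (dual Y) f < 1}"
  let ?P = "product_topology (\<lambda>j. norm_topology (X j)) {..<N}"
  have "openin (norm_topology (dual Y)) ?U"
    unfolding Y'.openin_norm
  proof (intro conjI ballI)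
    fix f assume f: "f \<in> ?U"
    show "\<exists>r>0. \<forall>g\<in>vcarrier (dual Y). vnorm (dual Y) (Y'.vdiff f g) < r \<longrightarrow> g \<in> ?U"
    proof (intro exI[of _ "1 - vnorm (dual Y) f"] conjI ballI impI)
      fix g assume g: "g \<in> vcarrier (dual Y)" "vnorm (dual Y) (Y'.vdiff f g) < 1 - vnorm (dual Y) f"
      have "vnorm (dual Y) g \<le> vnorm (dual Y) (Y'.vdiff g f) + vnorm (dual Y) f" using f g by (intro Y'.norm_diff_le) auto
      then show "g \<in> ?U" using g f Y'.norm_diff_commute[of f g] by simp
    qed (use f in auto)
  qed auto
  moreover have "continuous_map ?P (norm_topology (dual Y)) \<Psi>" using \<Psi> by (simp add: continuous_multilinear_maps_def)
  ultimately have op: "openin ?P {x \<in> topspace ?P. \<Psi> x \<in> ?U}" by (rule openin_continuous_map_preimage[rotated])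
  have top: "topspace ?P = Pi_X" using normed_vspace.topspace_norm[OF X] by (auto simp: topspace_product_topology intro!: PiE_cong)
  have p0U: "?p0 \<in> {x \<in> topspace ?P. \<Psi> x \<in> ?U}"
  proof -
    have p0: "?p0 \<in> Pi_X" by (rule f.null(1))
    have "\<Psi> ?p0 y = 0" if "y \<in> vcarrier Y" for y
      using f.null(3)[of "\<lambda>x\<in>Pi_X. \<Psi> x y"] \<Psi>_y_multilinear[OF that] p0 by simp
    then have "vnorm (dual Y) (\<Psi> ?p0) \<le> 0" by (intro Y.dual_norm_le) (auto simp: unit_ball_def)
    then show ?thesis using p0 \<Psi>_dual top by simp
  qed
  obtain U where U: "\<forall>j\<in>{..<N}. openin (norm_topology (X j)) (U j)" "?p0 \<in> Pi\<^sub>E {..<N} U"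
    "Pi\<^sub>E {..<N} U \<subseteq> {x \<in> topspace ?P. \<Psi> x \<in> ?U}"
    using bspec[OF iffD1[OF openin_product_topology_alt op] p0U] by (elim exE conjE)
  have "\<forall>j. \<exists>r. j < N \<longrightarrow> r > 0 \<and> (\<forall>t\<in>vcarrier (X j). vnorm (X j) t < r \<longrightarrow> t \<in> U j)"
  proof
    fix j
    show "\<exists>r. j < N \<longrightarrow> r > 0 \<and> (\<forall>t\<in>vcarrier (X j). vnorm (X j) t < r \<longrightarrow> t \<in> U j)"
    proof (cases "j < N")
      case True
      interpret Xj: normed_vspace "X j" by (rule X[OF True])
      have z: "vzero (X j) \<in> U j" using U(2) True by (auto dest: PiE_mem)
      have "openin (norm_topology (X j)) (U j)" using U(1) True by simp
      then obtain r where r: "r > 0" "\<forall>t\<in>vcarrier (X j). vnorm (X j) (Xj.vdiff (vzero (X j)) t) < r \<longrightarrow> t \<in> U j"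
        using z unfolding Xj.openin_norm by blast
      have "t \<in> U j" if "t \<in> vcarrier (X j)" "vnorm (X j) t < r" for t
        using r(2) that by (simp add: Xj.zero_add Xj.scale_closed Xj.norm_minus)
      then show ?thesis using r(1) by blast
    qed simp
  qed
  from choice[OF this] obtain r where r: "\<forall>j. j < N \<longrightarrow> r j > 0 \<and> (\<forall>t\<in>vcarrier (X j). vnorm (X j) t < r j \<longrightarrow> t \<in> U j)" by (elim exE)
  \<comment> \<open>Half the radius, so that scaled unit vectors satisfy the strict inequality.
    Scaling back produces the constant, the product of the \<open>1 / \<rho> j\<close>.\<close>
  define \<rho> where "\<rho> = (\<lambda>j. r j / 2)"
  have small: "vnorm (dual Y) (\<Psi> x) < 1" if x: "\<forall>j<N. x j \<in> vcarrier (X j) \<and> vnorm (X j) (x j) < r j" "x \<in> extensional {..<N}" for x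
  proof -
    have "x \<in> Pi\<^sub>E {..<N} U" using x r by (auto simp: PiE_iff)
    then show ?thesis using U(3) by auto
  qed
  define C where "C = (\<Prod>j<N. 1 / \<rho> j)"
  have C0: "C \<ge> 0" unfolding C_def \<rho>_def using r by (intro prod_nonneg) (auto simp: less_imp_le)
  have unit: "norm (\<Psi> x y) \<le> C" if x: "x \<in> Pi_X" "\<forall>j<N. x j \<in> unit_ball (X j)" and y: "y \<in> unit_ball Y" for x y
  proof -
    have yc: "y \<in> vcarrier Y" using y by (simp add: unit_ball_def)
    let ?x = "\<lambda>j\<in>{..<N}. vscale (X j) (of_real (\<rho> j)) (x j)"
    have xj: "x j \<in> vcarrier (X j)" "vnorm (X j) (x j) \<le> 1" if "j < N" for j using x(2) that by (auto simp: unit_ball_def)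
    have x'j: "vscale (X j) (of_real (\<rho> j)) (x j) \<in> vcarrier (X j) \<and> vnorm (X j) (vscale (X j) (of_real (\<rho> j)) (x j)) < r j" if j: "j < N" for j
    proof -
      have "vnorm (X j) (vscale (X j) (of_real (\<rho> j)) (x j)) = \<bar>\<rho> j\<bar> * vnorm (X j) (x j)"
        unfolding normed_vspace.norm_scale[OF X[OF j] xj(1)[OF j]] norm_of_real ..
      also have "\<dots> \<le> \<bar>\<rho> j\<bar> * 1" using xj(2)[OF j] by (intro mult_left_mono) auto
      finally show ?thesis using r j normed_vspace.scale_closed[OF X[OF j] xj(1)[OF j]] by (auto simp: \<rho>_def)
    qed
    have x'P: "?x \<in> Pi_X" by (rule restrict_PiE_iff[THEN iffD2]) (use x'j in simp)
    have "(\<lambda>x\<in>Pi_X. \<Psi> x y) ?x = (\<Prod>j<N. of_real (\<rho> j)) * (\<lambda>x\<in>Pi_X. \<Psi> x y) x"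
      by (rule multilinear_scale[OF X \<Psi>_y_multilinear[OF yc] x(1)])
    then have e: "\<Psi> ?x y = (\<Prod>j<N. of_real (\<rho> j)) * \<Psi> x y" unfolding restrict_apply'[OF x(1)] restrict_apply'[OF x'P] .
    have "vnorm (dual Y) (\<Psi> ?x) < 1" by (rule small) (use x'j in simp_all)
    then have "norm (\<Psi> ?x y) \<le> 1" using Y.dual_unit_bound[OF \<Psi>_dual[OF x'P] y] by linarith
    moreover have pos: "(\<Prod>j<N. \<rho> j) > 0" using r by (intro prod_pos) (auto simp: \<rho>_def)
    moreover have "norm (\<Psi> ?x y) = (\<Prod>j<N. \<rho> j) * norm (\<Psi> x y)"
      unfolding e norm_mult of_real_prod[symmetric] norm_of_real using pos by (simp only: abs_of_pos)
    ultimately show ?thesis by (simp add: C_def prod_dividef field_simps)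
  qed
  show ?thesis
  proof (intro exI[of _ C] conjI ballI C0)
    fix x assume x: "x \<in> Pi_X"
    have w0: "wX x \<ge> 0" by (rule f.w_nonneg[OF x])
    show "vnorm (dual Y) (\<Psi> x) \<le> C * wX x"
    proof (rule Y.dual_norm_le)
      fix y assume y: "y \<in> unit_ball Y"
      then have yc: "y \<in> vcarrier Y" by (simp add: unit_ball_def)
      have "(\<lambda>x\<in>Pi_X. \<Psi> x y) x = of_real (wX x) * (\<lambda>x\<in>Pi_X. \<Psi> x y) (normalize x)"
        by (rule multilinear_normalize[OF \<Psi>_y_multilinear[OF yc] x])
      then have "\<Psi> x y = of_real (wX x) * \<Psi> (normalize x) y" unfolding restrict_apply'[OF x] restrict_apply'[OF normalize(2)[OF x]] .
      then have "norm (\<Psi> x y) = wX x * norm (\<Psi> (normalize x) y)" using w0 by (simp add: norm_mult del: of_real_prod)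
      also have "\<dots> \<le> wX x * C" using unit[OF normalize(2)[OF x] _ y] normalize(1)[OF x] w0 by (intro mult_left_mono) auto
      finally show "norm (\<Psi> x y) \<le> C * wX x" by (simp add: mult.commute)
    qed
  qed
qed

definition C :: real where "C = (SOME C. C \<ge> 0 \<and> (\<forall>x\<in>Pi_X. vnorm (dual Y) (\<Psi> x) \<le> C * wX x))"

lemma C: "C \<ge> 0" "x \<in> Pi_X \<Longrightarrow> vnorm (dual Y) (\<Psi> x) \<le> C * wX x"
  using someI_ex[OF ex_bound] unfolding C_def[symmetric] by blast+

text \<open>\<open>V m z w x\<close> is the form with its last \<open>m\<close> arguments already extended to the biduals and
  evaluated at \<open>z\<close>, and its value at \<open>w\<close>.\<close>

primrec V :: "nat \<Rightarrow> (nat \<Rightarrow> ('a \<Rightarrow> 'k) \<Rightarrow> 'k) \<Rightarrow> (('b \<Rightarrow> 'k) \<Rightarrow> 'k) \<Rightarrow> (nat \<Rightarrow> 'a) \<Rightarrow> 'k" where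
  "V 0 z w x = w (\<Psi> x)"
| "V (Suc m) z w x = z (N - Suc m) (\<lambda>t\<in>vcarrier (X (N - Suc m)). V m z w (x(N - Suc m := t)))"

abbreviation "Pi_lt k \<equiv> \<Pi>\<^sub>E j\<in>{..<k}. vcarrier (X j)"

lemma Pi_lt_update: "x \<in> Pi_lt k \<Longrightarrow> t \<in> vcarrier (X k) \<Longrightarrow> x(k := t) \<in> Pi_lt (Suc k)"
  by (auto simp: PiE_iff extensional_def less_Suc_eq)

lemma prod_norm_nonneg:
  assumes x: "x \<in> Pi_lt k" and k: "k \<le> N" shows "0 \<le> (\<Prod>j<k. vnorm (X j) (x j))"
proof (rule prod_nonneg)
  fix j assume "j \<in> {..<k}"
  then show "0 \<le> vnorm (X j) (x j)"
    using normed_vspace.norm_nonneg[OF X[of j] PiE_mem[OF x, of j]] k by simp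
qed

text \<open>The claims need one joint induction: the next value of \<open>V\<close> applies
  \<open>z k\<close> to the section in the k-th argument, which must be linear and bounded.
  Linearity in w makes the result an element of the third dual of \<open>Y\<close>.\<close>

lemma V_props:
  assumes z: "\<forall>j<N. z j \<in> unit_ball (bidual (X j))" and m: "m \<le> N"
  shows "(\<forall>w\<in>vcarrier (bidual Y). \<forall>x\<in>Pi_lt (N - m).
      norm (V m z w x) \<le> (C * vnorm (bidual Y) w) * (\<Prod>j<N-m. vnorm (X j) (x j))) \<and>
    (\<forall>w\<in>vcarrier (bidual Y). \<forall>x\<in>Pi_lt (N - m). \<forall>j<N-m. linear_functional (X j) (\<lambda>t. V m z w (x(j := t)))) \<and>
    (\<forall>x\<in>Pi_lt (N - m). linear_functional (bidual Y) (\<lambda>w. V m z w x))"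
  using m
proof (induction m)
  case 0
  have 1: "norm (w (\<Psi> x)) \<le> (C * vnorm (bidual Y) w) * wX x" if w: "w \<in> vcarrier (bidual Y)" and x: "x \<in> Pi_X" for w x
  proof -
    have "norm (w (\<Psi> x)) \<le> vnorm (bidual Y) w * vnorm (dual Y) (\<Psi> x)" by (rule Y'.dual_bound[OF w \<Psi>_dual[OF x]])
    also have "\<dots> \<le> vnorm (bidual Y) w * (C * wX x)" by (rule mult_left_mono[OF C(2)[OF x] Y'.dual_norm_nonneg[OF w]])
    finally show ?thesis by (simp add: mult_ac)
  qed
  have 2: "linear_functional (X j) (\<lambda>t. w (\<Psi> (x(j := t))))" if w: "w \<in> vcarrier (bidual Y)" and x: "x \<in> Pi_X" and j: "j < N" for w x j
  proof -
    interpret Xj: normed_vspace "X j" by (rule X[OF j])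
    have P: "x(j := t) \<in> Pi_X" if "t \<in> vcarrier (X j)" for t using PiE_update[of x "{..<N}" X j t] x j that by simp
    have "linear_functional (X j) (\<lambda>t. (\<lambda>x\<in>Pi_X. w (\<Psi> x)) (x(j := t)))"
      using \<Psi>_multilinear[OF w] x j unfolding multilinear_scalars_iff by blast
    then show ?thesis unfolding linear_functional_def
      using P Xj.add_closed Xj.scale_closed by simp
  qed
  have 3: "linear_functional (bidual Y) (\<lambda>w. w (\<Psi> x))" if "x \<in> Pi_X" for x
    using \<Psi>_dual[OF that] by (simp add: linear_functional_def Y'.dual_ops)
  show ?case unfolding V.simps diff_zero using 1 2 3 by blast
next
  case (Suc m)
  define k where "k = N - Suc m"
  have k: "k < N" "N - m = Suc k" using Suc.prems by (auto simp: k_def)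
  have "m \<le> N" using Suc.prems by simp
  note IH = Suc.IH[OF this, unfolded k(2)]
  interpret Xk: normed_vspace "X k" by (rule X[OF k(1)])
  interpret Xk': normed_vspace "dual (X k)" by (rule Xk.normed_dual)
  have zk: "z k \<in> vcarrier (bidual (X k))" "vnorm (bidual (X k)) (z k) \<le> 1" using z k(1) by (auto simp: unit_ball_def)
  let ?\<Phi> = "\<lambda>w x. \<lambda>t\<in>vcarrier (X k). V m z w (x(k := t))"
  let ?B = "\<lambda>w x. (C * vnorm (bidual Y) w) * (\<Prod>j<k. vnorm (X j) (x j))"
  have B0: "0 \<le> ?B w x" if w: "w \<in> vcarrier (bidual Y)" and x: "x \<in> Pi_lt k" for w x
    using C(1) Y'.dual_norm_nonneg[OF w] prod_norm_nonneg[OF x less_imp_le[OF k(1)]]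
    by (intro mult_nonneg_nonneg)
  have \<Phi>b: "norm (?\<Phi> w x t) \<le> ?B w x * vnorm (X k) t"
    if w: "w \<in> vcarrier (bidual Y)" and x: "x \<in> Pi_lt k" and t: "t \<in> vcarrier (X k)" for w x t
  proof -
    have "norm (V m z w (x(k := t))) \<le> (C * vnorm (bidual Y) w) * (\<Prod>j<Suc k. vnorm (X j) ((x(k := t)) j))"
      using IH w Pi_lt_update[OF x t] by blast
    also have "(\<Prod>j<Suc k. vnorm (X j) ((x(k := t)) j)) = (\<Prod>j<k. vnorm (X j) (x j)) * vnorm (X k) t"
      by (simp add: prod.lessThan_Suc)
    finally show ?thesis unfolding restrict_apply'[OF t] by (simp only: mult_ac)
  qed
  have \<Phi>: "?\<Phi> w x \<in> vcarrier (dual (X k))"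
    if w: "w \<in> vcarrier (bidual Y)" and x: "x \<in> Pi_lt k" for w x
  proof (rule Xk.dualI[OF restrict_extensional _ \<Phi>b[OF w x]])
    have "linear_functional (X k) (\<lambda>t. V m z w ((x(k := vzero (X k)))(k := t)))"
      using IH w Pi_lt_update[OF x Xk.zero_closed] by blast
    then show "linear_functional (X k) (?\<Phi> w x)"
      unfolding linear_functional_def by (simp add: Xk.add_closed Xk.scale_closed)
  qed
  have 1: "norm (V (Suc m) z w x) \<le> ?B w x" if w: "w \<in> vcarrier (bidual Y)" and x: "x \<in> Pi_lt k" for w x
  proof -
    have "norm (z k (?\<Phi> w x)) \<le> vnorm (bidual (X k)) (z k) * vnorm (dual (X k)) (?\<Phi> w x)" by (rule Xk'.dual_bound[OF zk(1) \<Phi>[OF w x]])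
    also have "\<dots> \<le> 1 * ?B w x"
      by (intro mult_mono zk(2) Xk.dual_norm_le'[OF B0[OF w x] \<Phi>b[OF w x]] Xk.dual_norm_nonneg[OF \<Phi>[OF w x]]) auto
    finally show ?thesis by (simp add: k_def)
  qed
  have 2: "linear_functional (X j) (\<lambda>t. V (Suc m) z w (x(j := t)))" if w: "w \<in> vcarrier (bidual Y)" and x: "x \<in> Pi_lt k" and j: "j < k" for w x j
  proof -
    have jN: "j < N" using j k(1) by simp
    interpret Xj: normed_vspace "X j" by (rule X[OF jN])
    have P: "x(j := t) \<in> Pi_lt k" if "t \<in> vcarrier (X j)" for t using PiE_update[of x "{..<k}" X j t] x j that by simp
    have lin: "linear_functional (X j) (\<lambda>t. V m z w (x(j := t, k := s)))" if s: "s \<in> vcarrier (X k)" for s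
    proof -
      have "linear_functional (X j) (\<lambda>t. V m z w ((x(k := s))(j := t)))" using IH w Pi_lt_update[OF x s] j by (meson less_SucI)
      moreover have "(x(k := s))(j := t) = x(j := t, k := s)" for t using j by (simp add: fun_upd_twist)
      ultimately show ?thesis by simp
    qed
    have add: "?\<Phi> w (x(j := vadd (X j) a b)) = vadd (dual (X k)) (?\<Phi> w (x(j := a))) (?\<Phi> w (x(j := b)))"
      if "a \<in> vcarrier (X j)" "b \<in> vcarrier (X j)" for a b
      unfolding Xk.dual_ops using lin that by (intro restrict_ext) (simp add: linear_functional_def)
    have scale: "?\<Phi> w (x(j := vscale (X j) c a)) = vscale (dual (X k)) c (?\<Phi> w (x(j := a)))"
      if "a \<in> vcarrier (X j)" for a c
      unfolding Xk.dual_ops using lin that by (intro restrict_ext) (simp add: linear_functional_def)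
    show ?thesis
      unfolding linear_functional_def V.simps k_def[symmetric]
      by (intro conjI ballI allI) (simp_all only: add scale Xk'.dual_add[OF zk(1) \<Phi>[OF w P] \<Phi>[OF w P]] Xk'.dual_scale[OF zk(1) \<Phi>[OF w P]])
  qed
  have 3: "linear_functional (bidual Y) (\<lambda>w. V (Suc m) z w x)" if x: "x \<in> Pi_lt k" for x
  proof -
    have lin: "linear_functional (bidual Y) (\<lambda>w. V m z w (x(k := s)))" if s: "s \<in> vcarrier (X k)" for s
      using IH Pi_lt_update[OF x s] by blast
    have add: "?\<Phi> (vadd (bidual Y) a b) x = vadd (dual (X k)) (?\<Phi> a x) (?\<Phi> b x)"
      if "a \<in> vcarrier (bidual Y)" "b \<in> vcarrier (bidual Y)" for a b
      unfolding Xk.dual_ops using lin that by (intro restrict_ext) (simp add: linear_functional_def)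
    have scale: "?\<Phi> (vscale (bidual Y) c a) x = vscale (dual (X k)) c (?\<Phi> a x)"
      if "a \<in> vcarrier (bidual Y)" for a c
      unfolding Xk.dual_ops using lin that by (intro restrict_ext) (simp add: linear_functional_def)
    show ?thesis
      unfolding linear_functional_def V.simps k_def[symmetric]
      by (intro conjI ballI allI) (simp_all only: add scale Xk'.dual_add[OF zk(1) \<Phi>[OF _ x] \<Phi>[OF _ x]] Xk'.dual_scale[OF zk(1) \<Phi>[OF _ x]])
  qed
  show ?case unfolding k_def[symmetric] using 1 2 3 by blast
qed

lemma V_bound:
  assumes "\<forall>j<N. z j \<in> unit_ball (bidual (X j))" "m \<le> N" "w \<in> vcarrier (bidual Y)" "x \<in> Pi_lt (N - m)"
  shows "norm (V m z w x) \<le> (C * vnorm (bidual Y) w) * (\<Prod>j<N-m. vnorm (X j) (x j))"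
  using V_props[OF assms(1,2)] assms(3,4) by blast

lemma V_dual:
  assumes z: "\<forall>j<N. z j \<in> unit_ball (bidual (X j))" and m: "m < N" and w: "w \<in> vcarrier (bidual Y)"
    and x: "x \<in> Pi_lt (N - Suc m)"
  shows "(\<lambda>t\<in>vcarrier (X (N - Suc m)). V m z w (x(N - Suc m := t))) \<in> vcarrier (dual (X (N - Suc m)))" (is "?\<Phi> \<in> _")
    and "vnorm (dual (X (N - Suc m))) (\<lambda>t\<in>vcarrier (X (N - Suc m)). V m z w (x(N - Suc m := t))) \<le>
      (C * vnorm (bidual Y) w) * (\<Prod>j<N - Suc m. vnorm (X j) (x j))"
proof -
  define k where "k = N - Suc m"
  have k: "k < N" "N - m = Suc k" using m by (auto simp: k_def)
  interpret Xk: normed_vspace "X k" by (rule X[OF k(1)])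
  have xk: "x \<in> Pi_lt k" using x by (simp add: k_def)
  let ?B = "(C * vnorm (bidual Y) w) * (\<Prod>j<k. vnorm (X j) (x j))"
  have B0: "0 \<le> ?B"
    using C(1) Y'.dual_norm_nonneg[OF w] prod_norm_nonneg[OF xk less_imp_le[OF k(1)]]
    by (intro mult_nonneg_nonneg)
  have b: "norm ((\<lambda>t\<in>vcarrier (X k). V m z w (x(k := t))) t) \<le> ?B * vnorm (X k) t" if t: "t \<in> vcarrier (X k)" for t
  proof -
    have "norm (V m z w (x(k := t))) \<le> (C * vnorm (bidual Y) w) * (\<Prod>j<Suc k. vnorm (X j) ((x(k := t)) j))"
      using V_bound[OF z less_imp_le[OF m] w, of "x(k := t)"] Pi_lt_update[OF xk t] unfolding k(2) by blast
    also have "(\<Prod>j<Suc k. vnorm (X j) ((x(k := t)) j)) = (\<Prod>j<k. vnorm (X j) (x j)) * vnorm (X k) t"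
      by (simp add: prod.lessThan_Suc)
    finally show ?thesis unfolding restrict_apply'[OF t] by (simp only: mult_ac)
  qed
  have "linear_functional (X k) (\<lambda>t. V m z w ((x(k := vzero (X k)))(k := t)))"
    using V_props[OF z less_imp_le[OF m]] w Pi_lt_update[OF xk Xk.zero_closed] unfolding k(2) by blast
  then have lf: "linear_functional (X k) (\<lambda>t\<in>vcarrier (X k). V m z w (x(k := t)))"
    unfolding linear_functional_def by (simp add: Xk.add_closed Xk.scale_closed)
  show "?\<Phi> \<in> vcarrier (dual (X (N - Suc m)))"
    unfolding k_def[symmetric] by (rule Xk.dualI[OF restrict_extensional lf b])
  show "vnorm (dual (X (N - Suc m))) ?\<Phi> \<le> (C * vnorm (bidual Y) w) * (\<Prod>j<N - Suc m. vnorm (X j) (x j))"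
    unfolding k_def[symmetric] by (rule Xk.dual_norm_le'[OF B0 b])
qed

lemma V_functional:
  assumes z: "\<forall>j<N. z j \<in> unit_ball (bidual (X j))" and m: "m \<le> N" and x: "x \<in> Pi_lt (N - m)"
  shows "(\<lambda>w\<in>vcarrier (bidual Y). V m z w x) \<in> vcarrier (dual (bidual Y))"
proof (rule Y''.dualI[OF restrict_extensional, of _ "C * (\<Prod>j<N-m. vnorm (X j) (x j))"])
  have "linear_functional (bidual Y) (\<lambda>w. V m z w x)" using V_props[OF z m] x by blast
  then show "linear_functional (bidual Y) (\<lambda>w\<in>vcarrier (bidual Y). V m z w x)"
    unfolding linear_functional_def by (simp add: Y''.add_closed Y''.scale_closed)
  fix w assume w: "w \<in> vcarrier (bidual Y)"
  show "norm ((\<lambda>w\<in>vcarrier (bidual Y). V m z w x) w) \<le> C * (\<Prod>j<N-m. vnorm (X j) (x j)) * vnorm (bidual Y) w"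
    using V_bound[OF z m w x] w by (simp add: mult_ac)
qed

text \<open>The innermost limit is over the last coordinate, where \<open>V\<close> starts. At
  coordinate k the net tends weak* to \<open>z k\<close>; evaluating on the section, an element of
  the dual of \<open>X k\<close>, gives the limit at each w.\<close>

lemma V_iterated_limit:
  assumes z: "\<forall>j<N. z j \<in> unit_ball (bidual (X j))" and F: "\<forall>j<N. bounded_net_to (X j) (F j) (z j)"
    and m: "m \<le> N" and x: "x \<in> Pi_lt (N - m)"
  shows "iterated_limit (weak_star (bidual Y)) F (\<lambda>x. canonical (dual Y) (\<Psi> x)) [N - m..<N] x
    (\<lambda>w\<in>vcarrier (bidual Y). V m z w x)"
  using m x
proof (induction m arbitrary: x)
  case 0
  then show ?case by (simp add: canonical_def)
next
  case (Suc m)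
  define k where "k = N - Suc m"
  have k: "k < N" "N - m = Suc k" using Suc.prems by (auto simp: k_def)
  have m: "m < N" using Suc.prems by simp
  interpret Xk: normed_vspace "X k" by (rule X[OF k(1)])
  interpret Xk': normed_vspace "dual (X k)" by (rule Xk.normed_dual)
  have xk: "x \<in> Pi_lt k" using Suc.prems by (simp add: k_def)
  have IH: "iterated_limit (weak_star (bidual Y)) F (\<lambda>x. canonical (dual Y) (\<Psi> x)) [Suc k..<N] (x(k := t))
    (\<lambda>w\<in>vcarrier (bidual Y). V m z w (x(k := t)))" if "t \<in> vcarrier (X k)" for t
  proof -
    have "x(k := t) \<in> Pi_lt (N - m)" unfolding k(2) by (rule Pi_lt_update[OF xk that])
    from Suc.IH[OF less_imp_le[OF m] this] show ?thesis unfolding k(2) .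
  qed
  let ?g = "\<lambda>t. \<lambda>w\<in>vcarrier (bidual Y). V m z w (x(k := t))"
  obtain r where ev: "\<forall>\<^sub>F t in F k. t \<in> vcarrier (X k) \<and> vnorm (X k) t \<le> r"
    and lim: "limitin (weak_star (dual (X k))) (canonical (X k)) (z k) (F k)"
    using F k(1) unfolding bounded_net_to_def by blast
  have ev': "\<forall>\<^sub>F t in F k. t \<in> vcarrier (X k)" using ev by (rule eventually_mono) simp
  have L: "limitin (weak_star (bidual Y)) ?g (\<lambda>w\<in>vcarrier (bidual Y). V (Suc m) z w x) (F k)"
    unfolding Y''.limitin_weak_star
  proof (intro conjI ballI)
    show "(\<lambda>w\<in>vcarrier (bidual Y). V (Suc m) z w x) \<in> vcarrier (dual (bidual Y))"
      by (rule V_functional[OF z Suc.prems])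
    show "\<forall>\<^sub>F t in F k. ?g t \<in> vcarrier (dual (bidual Y))"
      using ev'
    proof (rule eventually_mono)
      fix t assume "t \<in> vcarrier (X k)"
      then show "?g t \<in> vcarrier (dual (bidual Y))"
        using V_functional[OF z less_imp_le[OF m], of "x(k := t)"] Pi_lt_update[OF xk] unfolding k(2) by blast
    qed
    fix w assume w: "w \<in> vcarrier (bidual Y)"
    let ?\<Phi> = "\<lambda>t\<in>vcarrier (X k). V m z w (x(k := t))"
    have \<Phi>: "?\<Phi> \<in> vcarrier (dual (X k))" using V_dual(1)[OF z m w] xk unfolding k_def[symmetric] by blast
    have "((\<lambda>t. canonical (X k) t ?\<Phi>) \<longlongrightarrow> z k ?\<Phi>) (F k)"
      using lim \<Phi> unfolding Xk'.limitin_weak_star by blast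
    then have "((\<lambda>t. ?g t w) \<longlongrightarrow> z k ?\<Phi>) (F k)"
      by (rule Lim_transform_eventually) (use ev' in \<open>rule eventually_mono\<close>, use \<Phi> w in \<open>simp add: Xk.canonical_apply\<close>)
    then show "((\<lambda>t. ?g t w) \<longlongrightarrow> (\<lambda>w\<in>vcarrier (bidual Y). V (Suc m) z w x) w) (F k)"
      using w by (simp add: k_def)
  qed
  have E: "\<forall>\<^sub>F t in F k. iterated_limit (weak_star (bidual Y)) F (\<lambda>x. canonical (dual Y) (\<Psi> x)) [Suc k..<N] (x(k := t)) (?g t)"
    using ev' by (rule eventually_mono) (rule IH)
  have U: "[N - Suc m..<N] = k # [Suc k..<N]" using k(1) by (simp add: k_def upt_conv_Cons)
  show ?case unfolding U iterated_limit.simps by (rule exI[of _ ?g], rule conjI[OF E L])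
qed

text \<open>Goldstine's theorem provides a net for every \<open>z j\<close>; without one the
  condition in \<open>arens\<close> would be vacuous and determine nothing. Uniqueness is then that
  of limits in a Hausdorff topology.\<close>

lemma arens_eq:
  assumes z: "\<forall>j<N. z j \<in> unit_ball (bidual (X j))" and w: "w \<in> unit_ball (bidual Y)"
  shows "arens N X Y \<Psi> z w = V N z w (\<lambda>_. undefined)"
proof -
  let ?l = "\<lambda>w\<in>vcarrier (bidual Y). V N z w (\<lambda>_. undefined)"
  let ?L = "\<lambda>F l. iterated_limit (weak_star (bidual Y)) F (\<lambda>x. canonical (dual Y) (\<Psi> x)) [0..<N] (\<lambda>_. undefined) l"
  \<comment> \<open>All arguments have been extended, so the tuple of remaining ones is the empty
    tuple.\<close>
  have u: "(\<lambda>_. undefined) \<in> Pi_lt (N - N)" by simp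
  have ex: "?L F ?l" if "\<forall>j<N. bounded_net_to (X j) (F j) (z j)" for F
    using V_iterated_limit[OF z that order_refl u] by simp
  have "(THE l. \<forall>F. (\<forall>j<N. bounded_net_to (X j) (F j) (z j)) \<longrightarrow> ?L F l) = ?l"
  proof (rule the_equality)
    show "\<forall>F. (\<forall>j<N. bounded_net_to (X j) (F j) (z j)) \<longrightarrow> ?L F ?l" using ex by blast
    fix l assume l: "\<forall>F. (\<forall>j<N. bounded_net_to (X j) (F j) (z j)) \<longrightarrow> ?L F l"
    have "\<forall>j. \<exists>F. j < N \<longrightarrow> bounded_net_to (X j) F (z j)" using normed_vspace.goldstine[OF X] z by blast
    from choice[OF this] obtain F where F: "\<forall>j<N. bounded_net_to (X j) (F j) (z j)" by blast
    have "?L F l" using l F by blast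
    moreover have "?L F ?l" by (rule ex[OF F])
    moreover have "\<forall>j\<in>set [0..<N]. F j \<noteq> bot" using F by (auto simp: bounded_net_to_def)
    ultimately show "l = ?l" using iterated_limit_unique[OF Y''.Hausdorff_weak_star] by blast
  qed
  then show ?thesis using w unfolding arens_def by (simp add: unit_ball_def)
qed

text \<open>A canonical point merely evaluates the section, so \<open>V\<close> returns
  \<open>\<Psi>\<close> there. These are the only points charged by the discrete measures.\<close>

lemma V_canonical:
  assumes s: "s \<in> Pi_X" "\<forall>j<N. s j \<in> unit_ball (X j)" and y: "y \<in> vcarrier Y"
    and m: "m \<le> N" and x: "x \<in> Pi_lt (N - m)"
  shows "V m (\<lambda>j\<in>{..<N}. canonical (X j) (s j)) (canonical Y y) x = \<Psi> (\<lambda>j\<in>{..<N}. if j < N - m then x j else s j) y"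
  using m x
proof (induction m arbitrary: x)
  case 0
  then have x: "x \<in> Pi_X" by simp
  have "(\<lambda>j\<in>{..<N}. if j < N - 0 then x j else s j) = x" using x by (auto simp: fun_eq_iff PiE_iff extensional_def)
  then show ?case using \<Psi>_dual[OF x] by (simp add: Y.canonical_apply)
next
  case (Suc m)
  define k where "k = N - Suc m"
  have k: "k < N" "N - m = Suc k" using Suc.prems by (auto simp: k_def)
  have m: "m < N" using Suc.prems by simp
  interpret Xk: normed_vspace "X k" by (rule X[OF k(1)])
  have xk: "x \<in> Pi_lt k" using Suc.prems by (simp add: k_def)
  let ?z = "\<lambda>j\<in>{..<N}. canonical (X j) (s j)"
  have z: "\<forall>j<N. ?z j \<in> unit_ball (bidual (X j))" using s(2) normed_vspace.canonical_unit_ball[OF X] by simp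
  have \<Phi>: "(\<lambda>t\<in>vcarrier (X k). V m ?z (canonical Y y) (x(k := t))) \<in> vcarrier (dual (X k))"
    using V_dual(1)[OF z m Y.canonical_bidual(1)[OF y]] xk unfolding k_def[symmetric] by blast
  have sk: "s k \<in> vcarrier (X k)" using s(1) k(1) by auto
  have "V (Suc m) ?z (canonical Y y) x = canonical (X k) (s k) (\<lambda>t\<in>vcarrier (X k). V m ?z (canonical Y y) (x(k := t)))"
    unfolding V.simps k_def[symmetric] using k(1) by (simp del: restrict_apply add: restrict_apply'[of k "{..<N}"])
  also have "\<dots> = V m ?z (canonical Y y) (x(k := s k))" unfolding Xk.canonical_apply[OF \<Phi>] by (rule restrict_apply'[OF sk])
  also have "\<dots> = \<Psi> (\<lambda>j\<in>{..<N}. if j < Suc k then (x(k := s k)) j else s j) y"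
  proof -
    have "x(k := s k) \<in> Pi_lt (N - m)" unfolding k(2) by (rule Pi_lt_update[OF xk sk])
    from Suc.IH[OF less_imp_le[OF m] this] show ?thesis unfolding k(2) .
  qed
  also have "(\<lambda>j\<in>{..<N}. if j < Suc k then (x(k := s k)) j else s j) = (\<lambda>j\<in>{..<N}. if j < k then x j else s j)"
    by (auto simp: fun_eq_iff less_Suc_eq)
  finally show ?case by (simp add: k_def)
qed

end

section \<open>Discrete measures and the representing measure\<close>

text \<open>Point masses \<open>a i\<close> at \<open>pt i\<close>; taking an image measure adds up
  the masses of coinciding points.\<close>

definition discrete_measure :: "'p set \<Rightarrow> (nat \<Rightarrow> real) \<Rightarrow> (nat \<Rightarrow> 'p) \<Rightarrow> 'p measure" where
  "discrete_measure K a pt = distr (density (count_space UNIV) (\<lambda>i. ennreal (a i))) (count_space K) pt"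

lemma discrete_measure:
  assumes a: "\<And>i. 0 \<le> a i" "summable a" and pt: "\<And>i. pt i \<in> K"
  shows "sets (discrete_measure K a pt) = Pow K" "finite_measure (discrete_measure K a pt)"
    "measure (discrete_measure K a pt) K = suminf a"
    "\<And>f :: 'p \<Rightarrow> 'k::{banach, second_countable_topology}. summable (\<lambda>i. norm (a i *\<^sub>R f (pt i))) \<Longrightarrow>
       (\<lambda>i. a i *\<^sub>R f (pt i)) sums (\<integral>p. f p \<partial>discrete_measure K a pt)"
proof -
  let ?d = "density (count_space UNIV) (\<lambda>i::nat. ennreal (a i))"
  have m: "pt \<in> measurable ?d (count_space K)" using pt by (auto simp: measurable_def)
  show "sets (discrete_measure K a pt) = Pow K" by (simp add: discrete_measure_def)
  have "emeasure (discrete_measure K a pt) K = emeasure ?d (pt -` K \<inter> space ?d)"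
    unfolding discrete_measure_def by (rule emeasure_distr[OF m]) simp
  also have "pt -` K \<inter> space ?d = UNIV" using pt by auto
  also have "emeasure ?d UNIV = (\<integral>\<^sup>+ i. ennreal (a i) \<partial>count_space UNIV)" by (simp add: emeasure_density)
  also have "\<dots> = (\<Sum>i. ennreal (a i))" by (rule nn_integral_count_space_nat)
  also have "\<dots> = ennreal (suminf a)" by (rule suminf_ennreal2[OF a])
  finally have e: "emeasure (discrete_measure K a pt) K = ennreal (suminf a)" .
  show "finite_measure (discrete_measure K a pt)"
    by (rule finite_measureI) (simp add: e discrete_measure_def[THEN arg_cong[of _ _ space]])
  show "measure (discrete_measure K a pt) K = suminf a"
    by (simp add: measure_def e suminf_nonneg[OF a(2,1)])
  fix f :: "'p \<Rightarrow> 'k" assume s: "summable (\<lambda>i. norm (a i *\<^sub>R f (pt i)))"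
  have "(\<integral>p. f p \<partial>discrete_measure K a pt) = (\<integral>i. f (pt i) \<partial>?d)"
    unfolding discrete_measure_def by (rule integral_distr[OF m]) simp
  also have "\<dots> = (\<integral>i. a i *\<^sub>R f (pt i) \<partial>count_space UNIV)" by (rule integral_density) (auto simp: a)
  finally show "(\<lambda>i. a i *\<^sub>R f (pt i)) sums (\<integral>p. f p \<partial>discrete_measure K a pt)"
    using sums_integral_count_space_nat[of "\<lambda>i. a i *\<^sub>R f (pt i)"] s by (simp add: integrable_count_space_nat_iff)
qed

section \<open>Discrete measures representing a tensor\<close>

context tensor_spaces
begin

abbreviation "balls \<equiv> bidual_balls N X Y"

lemma topspace_balls: "topspace balls = (\<Pi>\<^sub>E j\<in>{..<N}. unit_ball (bidual (X j))) \<times> unit_ball (bidual Y)"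
proof -
  have "topspace (product_topology (\<lambda>j. bidual_ball (X j)) {..<N}) = (\<Pi>\<^sub>E j\<in>{..<N}. unit_ball (bidual (X j)))"
    unfolding topspace_product_topology by (rule PiE_cong) (simp add: normed_vspace.topspace_bidual_ball[OF X])
  then show ?thesis by (simp add: bidual_balls_def Y.topspace_bidual_ball)
qed

lemma compact_balls: "compact_space balls"
  unfolding bidual_balls_def compact_space_prod_topology compact_space_product_topology
  using normed_vspace.compact_bidual_ball[OF X] Y.compact_bidual_ball by simp

lemma Hausdorff_balls: "Hausdorff_space balls"
  unfolding bidual_balls_def Hausdorff_space_prod_topology Hausdorff_space_product_topology
  using normed_vspace.Hausdorff_bidual_ball[OF X] Y.Hausdorff_bidual_ball by simp

lemma continuous_fst_eval:
  assumes j: "j < N" and \<phi>: "\<phi> \<in> vcarrier (dual (X j))"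
  shows "continuous_map balls euclidean (\<lambda>p. fst p j \<phi>)"
proof -
  have "continuous_map (product_topology (\<lambda>j. bidual_ball (X j)) {..<N}) (bidual_ball (X j)) (\<lambda>z. z j)"
    by (rule continuous_map_product_projection) (use j in simp)
  from continuous_map_compose[OF continuous_map_compose[OF continuous_map_fst this]
      normed_vspace.continuous_bidual_eval[OF X[OF j] \<phi>]]
  show ?thesis by (simp add: bidual_balls_def comp_def)
qed

lemma continuous_snd_eval:
  assumes "\<psi> \<in> vcarrier (dual Y)"
  shows "continuous_map balls euclidean (\<lambda>p. snd p \<psi>)"
  using continuous_map_compose[OF continuous_map_snd Y.continuous_bidual_eval[OF assms]]
  by (simp add: bidual_balls_def comp_def)

text \<open>The norms divided out in \<open>point\<close> reappear as this mass, so that the atoms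
  lie in the unit balls.\<close>

definition weight :: "(nat \<Rightarrow> 'a) \<Rightarrow> 'b \<Rightarrow> real" where "weight x y = wX x * vnorm Y y"

definition point :: "(nat \<Rightarrow> 'a) \<Rightarrow> 'b \<Rightarrow> (nat \<Rightarrow> ('a \<Rightarrow> 'k) \<Rightarrow> 'k) \<times> (('b \<Rightarrow> 'k) \<Rightarrow> 'k)" where
  "point x y = ((\<lambda>j\<in>{..<N}. canonical (X j) (normalize x j)),
     canonical Y (vscale Y (of_real (inverse (vnorm Y y))) y))"

lemma point_balls:
  assumes x: "x \<in> Pi_X" and y: "y \<in> vcarrier Y"
  shows "point x y \<in> topspace balls"
proof -
  have "(\<lambda>j\<in>{..<N}. canonical (X j) (normalize x j)) \<in> (\<Pi>\<^sub>E j\<in>{..<N}. unit_ball (bidual (X j)))"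
    by (rule restrict_PiE_iff[THEN iffD2])
      (use normalize(1)[OF x] normed_vspace.canonical_unit_ball[OF X] in simp)
  moreover have "canonical Y (vscale Y (of_real (inverse (vnorm Y y))) y) \<in> unit_ball (bidual Y)"
    by (rule Y.canonical_unit_ball[OF Y.unit_normalize(1)[OF y]])
  ultimately show ?thesis unfolding topspace_balls point_def by (rule SigmaI)
qed

definition represents_tensor where
  "represents_tensor u x y \<longleftrightarrow> (\<forall>i::nat. x i \<in> Pi_X \<and> y i \<in> vcarrier Y) \<and> summable (\<lambda>i. weight (x i) (y i)) \<and>
    (\<forall>\<phi>\<in>vcarrier (dual SY). (\<lambda>i. \<phi> (tY (tX (x i)) (y i))) sums \<phi> u)"

definition tensor_measure where
  "tensor_measure x y = discrete_measure (topspace balls) (\<lambda>i. weight (x i) (y i)) (\<lambda>i. point (x i) (y i))"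

lemma tensor_measure:
  assumes r: "represents_tensor u x y"
  shows "sets (tensor_measure x y) = Pow (topspace balls)" "finite_measure (tensor_measure x y)"
    "measure (tensor_measure x y) (topspace balls) = (\<Sum>i. weight (x i) (y i))"
proof -
  have xy: "x i \<in> Pi_X" "y i \<in> vcarrier Y" for i using r by (auto simp: represents_tensor_def)
  have s: "summable (\<lambda>i. weight (x i) (y i))" using r by (simp add: represents_tensor_def)
  have a0: "0 \<le> weight (x i) (y i)" for i
    unfolding weight_def by (rule mult_nonneg_nonneg[OF f.w_nonneg[OF xy(1)] Y.norm_nonneg[OF xy(2)]])
  show "sets (tensor_measure x y) = Pow (topspace balls)" "finite_measure (tensor_measure x y)"
    "measure (tensor_measure x y) (topspace balls) = (\<Sum>i. weight (x i) (y i))"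
    unfolding tensor_measure_def
    by (rule discrete_measure, (rule a0 s point_balls xy)+)+
qed

text \<open>Only the values of G at the atoms matter, so this serves both the finite-type forms and
  the Arens extension.\<close>

lemma tensor_measure_duality:
  assumes r: "represents_tensor u x y"
    and \<Psi>X: "\<forall>y\<in>vcarrier Y. multilinear {..<N} X scalars (\<lambda>x\<in>Pi_X. \<Psi> x y)"
    and \<Psi>Y: "\<forall>x\<in>Pi_X. linear_functional Y (\<Psi> x)"
    and C: "0 \<le> C" "\<forall>x\<in>Pi_X. \<forall>y\<in>vcarrier Y. norm (\<Psi> x y) \<le> C * wX x * vnorm Y y"
    and G: "\<And>x y. x \<in> Pi_X \<Longrightarrow> y \<in> vcarrier Y \<Longrightarrow>
      G (point x y) = \<Psi> (normalize x) (vscale Y (of_real (inverse (vnorm Y y))) y)"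
  shows "(\<integral>p. G p \<partial>tensor_measure x y) = duality N X Y u \<Psi>"
proof -
  have xy: "x i \<in> Pi_X" "y i \<in> vcarrier Y" for i using r by (auto simp: represents_tensor_def)
  have s: "summable (\<lambda>i. weight (x i) (y i))" using r by (simp add: represents_tensor_def)
  have a0: "0 \<le> weight (x i) (y i)" for i
    unfolding weight_def by (rule mult_nonneg_nonneg[OF f.w_nonneg[OF xy(1)] Y.norm_nonneg[OF xy(2)]])
  have e: "weight (x i) (y i) *\<^sub>R G (point (x i) (y i)) = \<Psi> (x i) (y i)" for i
  proof -
    let ?y = "vscale Y (of_real (inverse (vnorm Y (y i)))) (y i)"
    have y': "?y \<in> vcarrier Y" by (rule Y.scale_closed[OF xy(2)])
    have "linear_functional Y (\<Psi> (normalize (x i)))" using \<Psi>Y normalize(2)[OF xy(1)] by blast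
    then have "\<Psi> (normalize (x i)) (vscale Y (of_real (vnorm Y (y i))) ?y) = of_real (vnorm Y (y i)) * \<Psi> (normalize (x i)) ?y"
      using y' unfolding linear_functional_def by blast
    then have 1: "\<Psi> (normalize (x i)) (y i) = of_real (vnorm Y (y i)) * \<Psi> (normalize (x i)) ?y"
      unfolding Y.unit_normalize(2)[OF xy(2)] .
    have "multilinear {..<N} X scalars (\<lambda>x\<in>Pi_X. \<Psi> x (y i))" using \<Psi>X xy(2) by blast
    from multilinear_normalize[OF this xy(1)]
    have "\<Psi> (x i) (y i) = of_real (wX (x i)) * \<Psi> (normalize (x i)) (y i)"
      unfolding restrict_apply'[OF xy(1)] restrict_apply'[OF normalize(2)[OF xy(1)]] .
    then show ?thesis unfolding G[OF xy] 1 by (simp add: weight_def scaleR_conv_of_real mult.assoc)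
  qed
  have "summable (\<lambda>i. norm (weight (x i) (y i) *\<^sub>R G (point (x i) (y i))))"
    unfolding e
  proof (rule summable_comparison_test'[OF summable_mult[OF s, of C]])
    show "norm (norm (\<Psi> (x i) (y i))) \<le> C * weight (x i) (y i)" for i
      using C(2) xy[of i] by (simp add: weight_def mult.assoc)
  qed
  from discrete_measure(4)[where a = "\<lambda>i. weight (x i) (y i)" and pt = "\<lambda>i. point (x i) (y i)", OF a0 s point_balls[OF xy] this]
  have "(\<lambda>i. \<Psi> (x i) (y i)) sums (\<integral>p. G p \<partial>tensor_measure x y)" unfolding e tensor_measure_def .
  moreover have "(\<lambda>i. \<Psi> (x i) (y i)) sums duality N X Y u \<Psi>"
    by (rule duality_sums[OF \<Psi>X \<Psi>Y C]) (use r in \<open>simp_all add: represents_tensor_def\<close>)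
  ultimately show ?thesis by (rule sums_unique2)
qed

text \<open>The right-hand side depends on u but not on its representation, so these integrals are
  constant along any sequence of representations.\<close>

lemma tensor_measure_finite_type:
  assumes r: "represents_tensor u x y"
    and \<phi>: "\<forall>j\<in>{..<N}. \<phi> j \<in> vcarrier (dual (X j))" and \<psi>: "\<psi> \<in> vcarrier (dual Y)"
  shows "(\<integral>p. (\<Prod>j<N. fst p j (\<phi> j)) * snd p \<psi> \<partial>tensor_measure x y) =
    duality N X Y u (\<lambda>x y. (\<Prod>j<N. \<phi> j (x j)) * \<psi> y)"
proof (rule tensor_measure_duality[OF r])
  have X': "\<forall>j\<in>{..<N}. normed_vspace (X j)" using X by simp
  note pm = prod_multilinear[OF X' finite_lessThan \<phi>]
  show "\<forall>y\<in>vcarrier Y. multilinear {..<N} X scalars (\<lambda>x\<in>Pi_X. (\<Prod>j<N. \<phi> j (x j)) * \<psi> y)"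
    unfolding multilinear_scalars_iff
  proof (intro ballI conjI)
    fix y x j assume y: "y \<in> vcarrier Y" and x: "x \<in> Pi_X" and j: "j \<in> {..<N}"
    interpret Xj: normed_vspace "X j" using X j by simp
    have P: "x(j := t) \<in> Pi_X" if "t \<in> vcarrier (X j)" for t by (rule PiE_update[of x "{..<N}" X j t, OF x j that])
    have "linear_functional (X j) (\<lambda>t. (\<lambda>x\<in>Pi_X. \<Prod>j<N. \<phi> j (x j)) (x(j := t)))"
      using pm(1) x j unfolding multilinear_scalars_iff by blast
    moreover have "(\<lambda>x\<in>Pi_X. (\<Prod>j<N. \<phi> j (x j)) * \<psi> y) (x(j := t)) = (\<lambda>x\<in>Pi_X. \<Prod>j<N. \<phi> j (x j)) (x(j := t)) * \<psi> y"
      if "t \<in> vcarrier (X j)" for t unfolding restrict_apply'[OF P[OF that]] ..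
    ultimately show "linear_functional (X j) (\<lambda>t. (\<lambda>x\<in>Pi_X. (\<Prod>j<N. \<phi> j (x j)) * \<psi> y) (x(j := t)))"
      unfolding linear_functional_def
      by (simp only: Ball_def Xj.add_closed Xj.scale_closed distrib_right mult.assoc simp_thms cong: imp_cong)
  qed simp
  show "\<forall>x\<in>Pi_X. linear_functional Y (\<lambda>y. (\<Prod>j<N. \<phi> j (x j)) * \<psi> y)"
    by (simp add: linear_functional_def Y.dual_add[OF \<psi>] Y.dual_scale[OF \<psi>] algebra_simps)
  show "0 \<le> (\<Prod>j<N. vnorm (dual (X j)) (\<phi> j)) * vnorm (dual Y) \<psi>"
    using normed_vspace.dual_norm_nonneg[OF X] \<phi> by (intro mult_nonneg_nonneg prod_nonneg Y.dual_norm_nonneg[OF \<psi>]) simp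
  show "\<forall>x\<in>Pi_X. \<forall>y\<in>vcarrier Y. norm ((\<Prod>j<N. \<phi> j (x j)) * \<psi> y) \<le>
     (\<Prod>j<N. vnorm (dual (X j)) (\<phi> j)) * vnorm (dual Y) \<psi> * wX x * vnorm Y y"
  proof (intro ballI)
    fix x y assume x: "x \<in> Pi_X" and y: "y \<in> vcarrier Y"
    have "norm (\<Prod>j<N. \<phi> j (x j)) * norm (\<psi> y) \<le>
      ((\<Prod>j<N. vnorm (dual (X j)) (\<phi> j)) * wX x) * (vnorm (dual Y) \<psi> * vnorm Y y)"
      by (rule mult_mono[OF pm(2)[OF x] Y.dual_bound[OF \<psi> y] order_trans[OF norm_ge_zero pm(2)[OF x]]]) simp
    then show "norm ((\<Prod>j<N. \<phi> j (x j)) * \<psi> y) \<le>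
     (\<Prod>j<N. vnorm (dual (X j)) (\<phi> j)) * vnorm (dual Y) \<psi> * wX x * vnorm Y y"
      unfolding norm_mult by (simp only: mult_ac)
  qed
  fix x y assume x: "x \<in> Pi_X" and y: "y \<in> vcarrier Y"
  have "(\<Prod>j<N. fst (point x y) j (\<phi> j)) = (\<Prod>j<N. \<phi> j (normalize x j))"
    using normed_vspace.canonical_apply[OF X] \<phi> by (intro prod.cong) (simp_all add: point_def)
  then show "(\<Prod>j<N. fst (point x y) j (\<phi> j)) * snd (point x y) \<psi> =
    (\<Prod>j<N. \<phi> j (normalize x j)) * \<psi> (vscale Y (of_real (inverse (vnorm Y y))) y)"
    by (simp add: point_def Y.canonical_apply[OF \<psi>])
qed

text \<open>What the limit measure and the discrete measures have in common: one is defined on the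
  Borel sets and the others on the power set, but the weak* evaluations are measurable for all of
  them.\<close>

definition ball_measure where
  "ball_measure M \<longleftrightarrow> finite_measure M \<and> space M = topspace balls \<and>
     (\<forall>j<N. \<forall>\<phi>\<in>vcarrier (dual (X j)). (\<lambda>p. fst p j \<phi>) \<in> borel_measurable M) \<and>
     (\<forall>\<psi>\<in>vcarrier (dual Y). (\<lambda>p. snd p \<psi>) \<in> borel_measurable M)"

lemma ball_space:
  assumes "ball_measure M" "p \<in> space M"
  shows "\<forall>j<N. fst p j \<in> unit_ball (bidual (X j))" "snd p \<in> vcarrier (bidual Y)" "vnorm (bidual Y) (snd p) \<le> 1"
proof -
  have "p \<in> (\<Pi>\<^sub>E j\<in>{..<N}. unit_ball (bidual (X j))) \<times> unit_ball (bidual Y)"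
    using assms by (simp add: ball_measure_def topspace_balls)
  then have "fst p \<in> (\<Pi>\<^sub>E j\<in>{..<N}. unit_ball (bidual (X j))) \<and> snd p \<in> unit_ball (bidual Y)"
    by (simp only: mem_Times_iff)
  note p = conjunct1[OF this] conjunct2[OF this]
  show "\<forall>j<N. fst p j \<in> unit_ball (bidual (X j))"
    by (intro allI impI, rule PiE_mem[OF p(1)]) simp
  show "snd p \<in> vcarrier (bidual Y)" "vnorm (bidual Y) (snd p) \<le> 1" using p(2) by (simp_all add: unit_ball_def)
qed

end

section \<open>Comparison of integrals, one coordinate at a time\<close>

context tensor_map
begin

lemma V_section:
  assumes M: "ball_measure M" and m: "m < N" and x: "x \<in> Pi_lt (N - Suc m)"
  shows "\<forall>p\<in>space M. (\<lambda>t\<in>vcarrier (X (N - Suc m)). V m (fst p) (snd p) (x(N - Suc m := t))) \<in> vcarrier (dual (X (N - Suc m))) \<and>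
    vnorm (dual (X (N - Suc m))) (\<lambda>t\<in>vcarrier (X (N - Suc m)). V m (fst p) (snd p) (x(N - Suc m := t))) \<le>
      C * (\<Prod>j<N - Suc m. vnorm (X j) (x j))"
proof
  fix p assume p: "p \<in> space M"
  note b = ball_space[OF M p]
  have "C * vnorm (bidual Y) (snd p) \<le> C * 1" by (rule mult_left_mono[OF b(3) C(1)])
  then have "(C * vnorm (bidual Y) (snd p)) * (\<Prod>j<N - Suc m. vnorm (X j) (x j)) \<le> C * (\<Prod>j<N - Suc m. vnorm (X j) (x j))"
    using prod_norm_nonneg[OF x] by (intro mult_right_mono) auto
  then show "(\<lambda>t\<in>vcarrier (X (N - Suc m)). V m (fst p) (snd p) (x(N - Suc m := t))) \<in> vcarrier (dual (X (N - Suc m))) \<and>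
    vnorm (dual (X (N - Suc m))) (\<lambda>t\<in>vcarrier (X (N - Suc m)). V m (fst p) (snd p) (x(N - Suc m := t))) \<le>
      C * (\<Prod>j<N - Suc m. vnorm (X j) (x j))"
    using V_dual[OF b(1) m b(2) x] by linarith
qed

text \<open>The new integrand pairs a weak* measurable point of the bidual with a weak* measurable
  section, and measurability of such a pairing is not immediate. It comes from the countable
  expansion in \<open>trace_integral_eq\<close>, used with both measures equal to M.\<close>

lemma V_measurable:
  assumes sep: "\<And>j. j < N \<Longrightarrow> separable_space (norm_topology (dual (X j)))"
    and AP: "\<And>j. j < N \<Longrightarrow> approximation_property (dual (X j))"
    and M: "ball_measure M" and m: "m \<le> N" and x: "x \<in> Pi_lt (N - m)"
  shows "(\<lambda>p. V m (fst p) (snd p) x) \<in> borel_measurable M"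
  using m x
proof (induction m arbitrary: x)
  case 0
  then show ?case using M \<Psi>_dual unfolding ball_measure_def V.simps by simp
next
  case (Suc m)
  define k where "k = N - Suc m"
  have k: "k < N" "N - m = Suc k" using Suc.prems by (auto simp: k_def)
  have m: "m < N" using Suc.prems by simp
  interpret Xk: normed_vspace "X k" by (rule X[OF k(1)])
  have xk: "x \<in> Pi_lt k" using Suc.prems by (simp add: k_def)
  note sec = V_section[OF M m, of x, folded k_def, OF xk]
  have fin: "finite_measure M" using M by (simp add: ball_measure_def)
  have zk: "\<forall>p\<in>space M. fst p k \<in> vcarrier (bidual (X k)) \<and> vnorm (bidual (X k)) (fst p k) \<le> 1"
    using ball_space(1)[OF M] k(1) by (simp add: unit_ball_def)
  have zm: "\<forall>\<psi>\<in>vcarrier (dual (X k)). (\<lambda>p. fst p k \<psi>) \<in> borel_measurable M" using M k(1) unfolding ball_measure_def by blast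
  have Vm: "\<forall>t\<in>vcarrier (X k). (\<lambda>p. (\<lambda>t\<in>vcarrier (X k). V m (fst p) (snd p) (x(k := t))) t) \<in> borel_measurable M"
  proof
    fix t assume t: "t \<in> vcarrier (X k)"
    have "x(k := t) \<in> Pi_lt (N - m)" unfolding k(2) by (rule Pi_lt_update[OF xk t])
    from Suc.IH[OF less_imp_le[OF m] this]
    show "(\<lambda>p. (\<lambda>t\<in>vcarrier (X k). V m (fst p) (snd p) (x(k := t))) t) \<in> borel_measurable M"
      unfolding restrict_apply'[OF t] .
  qed
  have "(\<lambda>p. fst p k (\<lambda>t\<in>vcarrier (X k). V m (fst p) (snd p) (x(k := t)))) \<in> borel_measurable M"
    by (rule Xk.trace_integral_eq(1)[OF sep[OF k(1)] AP[OF k(1)] fin fin zero_le_one sec zk zm Vm sec zk zm Vm]) simp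
  then show ?case unfolding V.simps k_def[symmetric] .
qed

text \<open>Each step trades one functional \<open>\<phi> k\<close> for an extended coordinate. The
  tuple x and the remaining functionals stay arbitrary in the induction, because the trace argument
  varies both.\<close>

lemma V_integral_eq:
  assumes sep: "\<And>j. j < N \<Longrightarrow> separable_space (norm_topology (dual (X j)))"
    and AP: "\<And>j. j < N \<Longrightarrow> approximation_property (dual (X j))"
    and M: "ball_measure M1" "ball_measure M2"
    and eq: "\<forall>\<phi> \<psi>. (\<forall>j\<in>{..<N}. \<phi> j \<in> vcarrier (dual (X j))) \<and> \<psi> \<in> vcarrier (dual Y) \<longrightarrow>
      (\<integral>p. (\<Prod>j<N. fst p j (\<phi> j)) * snd p \<psi> \<partial>M1) = (\<integral>p. (\<Prod>j<N. fst p j (\<phi> j)) * snd p \<psi> \<partial>M2)"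
    and m: "m \<le> N" and x: "x \<in> Pi_lt (N - m)" and \<phi>: "\<forall>j<N-m. \<phi> j \<in> vcarrier (dual (X j))"
  shows "(\<integral>p. (\<Prod>j<N-m. fst p j (\<phi> j)) * V m (fst p) (snd p) x \<partial>M1) =
    (\<integral>p. (\<Prod>j<N-m. fst p j (\<phi> j)) * V m (fst p) (snd p) x \<partial>M2)"
  using m x \<phi>
proof (induction m arbitrary: x \<phi>)
  case 0
  then show ?case using eq \<Psi>_dual unfolding V.simps diff_zero by (simp only: Ball_def lessThan_iff simp_thms)
next
  case (Suc m)
  define k where "k = N - Suc m"
  have k: "k < N" "N - m = Suc k" using Suc.prems by (auto simp: k_def)
  have m: "m < N" using Suc.prems by simp
  interpret Xk: normed_vspace "X k" by (rule X[OF k(1)])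
  interpret Xk': normed_vspace "dual (X k)" by (rule Xk.normed_dual)
  have xk: "x \<in> Pi_lt k" using Suc.prems by (simp add: k_def)
  have \<phi>: "\<forall>j<k. \<phi> j \<in> vcarrier (dual (X j))" using Suc.prems(3) by (simp add: k_def)
  define \<Phi> where "\<Phi> = (\<lambda>p :: (nat \<Rightarrow> ('a \<Rightarrow> 'k) \<Rightarrow> 'k) \<times> (('b \<Rightarrow> 'k) \<Rightarrow> 'k). \<lambda>t\<in>vcarrier (X k). V m (fst p) (snd p) (x(k := t)))"
  \<comment> \<open>The factors with index below k are absorbed into the bidual element, so that the
    integrand becomes the pairing \<open>\<xi> p (\<Phi> p)\<close>.\<close>
  define \<xi> where "\<xi> = (\<lambda>p :: (nat \<Rightarrow> ('a \<Rightarrow> 'k) \<Rightarrow> 'k) \<times> (('b \<Rightarrow> 'k) \<Rightarrow> 'k). \<lambda>\<psi>\<in>vcarrier (dual (X k)). (\<Prod>j<k. fst p j (\<phi> j)) * fst p k \<psi>)"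
  define C' where "C' = (\<Prod>j<k. vnorm (dual (X j)) (\<phi> j))"
  have C'0: "0 \<le> C'" unfolding C'_def
    using normed_vspace.dual_norm_nonneg[OF X] \<phi> k(1) by (intro prod_nonneg) simp
  have \<Phi>1: "\<forall>p\<in>space M. \<Phi> p \<in> vcarrier (dual (X k)) \<and> vnorm (dual (X k)) (\<Phi> p) \<le> C * (\<Prod>j<k. vnorm (X j) (x j))"
    if "ball_measure M" for M
    unfolding \<Phi>_def by (rule V_section[OF that m, of x, folded k_def, OF xk])
  have Vm: "\<forall>t\<in>vcarrier (X k). (\<lambda>p. \<Phi> p t) \<in> borel_measurable M" if M: "ball_measure M" for M
  proof
    fix t assume t: "t \<in> vcarrier (X k)"
    have "x(k := t) \<in> Pi_lt (N - m)" unfolding k(2) by (rule Pi_lt_update[OF xk t])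
    from V_measurable[OF sep AP M less_imp_le[OF m] this]
    show "(\<lambda>p. \<Phi> p t) \<in> borel_measurable M" unfolding \<Phi>_def restrict_apply'[OF t] .
  qed
  have Qb: "norm (\<Prod>j<k. fst p j (\<phi> j)) \<le> C'" if M: "ball_measure M" and p: "p \<in> space M" for p M
  proof -
    have "norm (\<Prod>j<k. fst p j (\<phi> j)) = (\<Prod>j<k. norm (fst p j (\<phi> j)))" by (rule prod_norm[symmetric])
    also have "\<dots> \<le> C'"
      unfolding C'_def
    proof (intro prod_mono conjI norm_ge_zero)
      fix j assume "j \<in> {..<k}"
      then have j: "j < k" "j < N" using k(1) by auto
      interpret Xj: normed_vspace "X j" by (rule X[OF j(2)])
      interpret Xj': normed_vspace "dual (X j)" by (rule Xj.normed_dual)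
      have \<phi>j: "\<phi> j \<in> vcarrier (dual (X j))" using \<phi> j(1) by blast
      have "fst p j \<in> unit_ball (bidual (X j))" using ball_space(1)[OF M p] j(2) by blast
      then have "norm (fst p j (\<phi> j)) \<le> vnorm (dual (X j)) (\<phi> j)" unfolding Xj'.unit_ball_dual_iff using \<phi>j by blast
      then show "norm (fst p j (\<phi> j)) \<le> vnorm (dual (X j)) (\<phi> j)" .
    qed
    finally show ?thesis .
  qed
  have \<xi>1: "\<forall>p\<in>space M. \<xi> p \<in> vcarrier (bidual (X k)) \<and> vnorm (bidual (X k)) (\<xi> p) \<le> C'" if M: "ball_measure M" for M
  proof
    fix p assume p: "p \<in> space M"
    have zk: "fst p k \<in> unit_ball (bidual (X k))" using ball_space(1)[OF M p] k(1) by blast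
    then have zkd: "fst p k \<in> vcarrier (bidual (X k))" by (simp add: unit_ball_def)
    have b: "norm (\<xi> p \<psi>) \<le> C' * vnorm (dual (X k)) \<psi>" if \<psi>: "\<psi> \<in> vcarrier (dual (X k))" for \<psi>
    proof -
      have "norm (fst p k \<psi>) \<le> vnorm (dual (X k)) \<psi>" using zk \<psi> unfolding Xk'.unit_ball_dual_iff by blast
      from mult_mono[OF Qb[OF M p] this C'0 norm_ge_zero]
      show ?thesis unfolding \<xi>_def restrict_apply'[OF \<psi>] norm_mult .
    qed
    have lf: "linear_functional (dual (X k)) (\<xi> p)"
      unfolding linear_functional_def \<xi>_def
      by (simp add: Xk'.add_closed Xk'.scale_closed Xk'.dual_add[OF zkd] Xk'.dual_scale[OF zkd] distrib_left mult.left_commute)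
    have "\<xi> p \<in> extensional (vcarrier (dual (X k)))" unfolding \<xi>_def by (rule restrict_extensional)
    from Xk'.dualI[OF this lf b] show "\<xi> p \<in> vcarrier (bidual (X k)) \<and> vnorm (bidual (X k)) (\<xi> p) \<le> C'"
      using Xk'.dual_norm_le'[OF C'0 b] by blast
  qed
  have \<xi>m: "\<forall>\<psi>\<in>vcarrier (dual (X k)). (\<lambda>p. \<xi> p \<psi>) \<in> borel_measurable M" if M: "ball_measure M" for M
  proof
    fix \<psi> assume \<psi>: "\<psi> \<in> vcarrier (dual (X k))"
    have "(\<lambda>p. fst p k \<psi>) \<in> borel_measurable M" using M k(1) \<psi> unfolding ball_measure_def by blast
    moreover have "(\<lambda>p. \<Prod>j<k. fst p j (\<phi> j)) \<in> borel_measurable M"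
      by (rule borel_measurable_prod) (use M \<phi> k(1) in \<open>simp add: ball_measure_def\<close>)
    ultimately show "(\<lambda>p. \<xi> p \<psi>) \<in> borel_measurable M" unfolding \<xi>_def restrict_apply'[OF \<psi>] by (intro borel_measurable_times)
  qed
  have fin: "finite_measure M1" "finite_measure M2" using M by (simp_all add: ball_measure_def)
  \<comment> \<open>This is the induction hypothesis with \<psi> as k-th functional and t as k-th
    argument.\<close>
  have eq': "\<forall>\<psi>\<in>vcarrier (dual (X k)). \<forall>t\<in>vcarrier (X k).
      (\<integral>p. \<xi> p \<psi> * \<Phi> p t \<partial>M1) = (\<integral>p. \<xi> p \<psi> * \<Phi> p t \<partial>M2)"
  proof (intro ballI)
    fix \<psi> t assume \<psi>: "\<psi> \<in> vcarrier (dual (X k))" and t: "t \<in> vcarrier (X k)"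
    have "x(k := t) \<in> Pi_lt (N - m)" unfolding k(2) by (rule Pi_lt_update[OF xk t])
    moreover have "\<forall>j<N-m. (\<phi>(k := \<psi>)) j \<in> vcarrier (dual (X j))" using \<phi> \<psi> unfolding k(2) by (simp add: less_Suc_eq)
    ultimately have "(\<integral>p. (\<Prod>j<N-m. fst p j ((\<phi>(k := \<psi>)) j)) * V m (fst p) (snd p) (x(k := t)) \<partial>M1) =
      (\<integral>p. (\<Prod>j<N-m. fst p j ((\<phi>(k := \<psi>)) j)) * V m (fst p) (snd p) (x(k := t)) \<partial>M2)"
      by (rule Suc.IH[OF less_imp_le[OF m]])
    moreover have "(\<Prod>j<N-m. fst p j ((\<phi>(k := \<psi>)) j)) = (\<Prod>j<k. fst p j (\<phi> j)) * fst p k \<psi>"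
      for p :: "(nat \<Rightarrow> ('a \<Rightarrow> 'k) \<Rightarrow> 'k) \<times> (('b \<Rightarrow> 'k) \<Rightarrow> 'k)"
      unfolding k(2) by simp
    ultimately show "(\<integral>p. \<xi> p \<psi> * \<Phi> p t \<partial>M1) = (\<integral>p. \<xi> p \<psi> * \<Phi> p t \<partial>M2)"
      unfolding \<xi>_def \<Phi>_def restrict_apply'[OF \<psi>] restrict_apply'[OF t] by (simp only:)
  qed
  have "(\<integral>p. \<xi> p (\<Phi> p) \<partial>M1) = (\<integral>p. \<xi> p (\<Phi> p) \<partial>M2)"
    by (rule Xk.trace_integral_eq(2)[OF sep[OF k(1)] AP[OF k(1)] fin C'0 \<Phi>1[OF M(1)] \<xi>1[OF M(1)] \<xi>m[OF M(1)] Vm[OF M(1)]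
      \<Phi>1[OF M(2)] \<xi>1[OF M(2)] \<xi>m[OF M(2)] Vm[OF M(2)] eq'])
  moreover have "(\<integral>p. \<xi> p (\<Phi> p) \<partial>M) = (\<integral>p. (\<Prod>j<k. fst p j (\<phi> j)) * V (Suc m) (fst p) (snd p) x \<partial>M)"
    if M: "ball_measure M" for M
  proof (rule Bochner_Integration.integral_cong[OF refl])
    fix p assume "p \<in> space M"
    then have "\<Phi> p \<in> vcarrier (dual (X k))" using \<Phi>1[OF M] by blast
    then show "\<xi> p (\<Phi> p) = (\<Prod>j<k. fst p j (\<phi> j)) * V (Suc m) (fst p) (snd p) x"
      unfolding \<xi>_def V.simps k_def[symmetric] by (simp only: restrict_apply') (simp only: \<Phi>_def)
  qed
  ultimately show ?case unfolding k_def[symmetric] using M by simp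
qed

lemma arens_measure:
  assumes sep: "\<And>j. j < N \<Longrightarrow> separable_space (norm_topology (dual (X j)))"
    and AP: "\<And>j. j < N \<Longrightarrow> approximation_property (dual (X j))"
    and M: "ball_measure M" and r: "represents_tensor u x y" and D: "ball_measure (tensor_measure x y)"
    and eq: "\<forall>\<phi> \<psi>. (\<forall>j\<in>{..<N}. \<phi> j \<in> vcarrier (dual (X j))) \<and> \<psi> \<in> vcarrier (dual Y) \<longrightarrow>
      (\<integral>p. (\<Prod>j<N. fst p j (\<phi> j)) * snd p \<psi> \<partial>M) = (\<integral>p. (\<Prod>j<N. fst p j (\<phi> j)) * snd p \<psi> \<partial>tensor_measure x y)"
  shows "integrable M (\<lambda>(z, w). arens N X Y \<Psi> z w)"
    and "(\<integral>p. (case p of (z, w) \<Rightarrow> arens N X Y \<Psi> z w) \<partial>M) = duality N X Y u \<Psi>"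
proof -
  let ?V = "\<lambda>p. V N (fst p) (snd p) (\<lambda>_. undefined)"
  have ux: "(\<lambda>_. undefined) \<in> Pi_lt (N - N)" by simp
  have e: "(case p of (z, w) \<Rightarrow> arens N X Y \<Psi> z w) = ?V p" if p: "p \<in> space M" for p
  proof -
    have "snd p \<in> unit_ball (bidual Y)" using ball_space(2,3)[OF M p] by (simp add: unit_ball_def)
    then show ?thesis using arens_eq[OF ball_space(1)[OF M p]] by (simp add: case_prod_unfold)
  qed
  have meas: "?V \<in> borel_measurable M" by (rule V_measurable[OF sep AP M order_refl ux])
  have fin: "finite_measure M" using M by (simp add: ball_measure_def)
  have "integrable M ?V"
  proof (rule finite_measure.integrable_const_bound[OF fin, of _ C])
    show "AE p in M. norm (?V p) \<le> C"
    proof (rule AE_I2)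
      fix p assume p: "p \<in> space M"
      note b = ball_space[OF M p]
      have "norm (?V p) \<le> (C * vnorm (bidual Y) (snd p)) * (\<Prod>j<N-N. vnorm (X j) undefined)"
        using V_bound[OF b(1) order_refl b(2) ux] .
      then show "norm (?V p) \<le> C" using mult_left_mono[OF b(3) C(1)] by simp
    qed
  qed (rule meas)
  moreover have "integrable M (\<lambda>(z, w). arens N X Y \<Psi> z w) = integrable M ?V"
    by (rule Bochner_Integration.integrable_cong[OF refl e])
  ultimately show "integrable M (\<lambda>(z, w). arens N X Y \<Psi> z w)" by simp
  have "(\<integral>p. (case p of (z, w) \<Rightarrow> arens N X Y \<Psi> z w) \<partial>M) = (\<integral>p. ?V p \<partial>M)"
    by (rule Bochner_Integration.integral_cong[OF refl e])
  \<comment> \<open>With m = N no functional is left and the product is empty.\<close>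
  also have "\<dots> = (\<integral>p. ?V p \<partial>tensor_measure x y)"
    using V_integral_eq[OF sep AP M D eq order_refl ux, of "\<lambda>_. undefined"] by simp
  also have "\<dots> = duality N X Y u \<Psi>"
  proof (rule tensor_measure_duality[OF r _ _ C(1)])
    show "\<forall>y\<in>vcarrier Y. multilinear {..<N} X scalars (\<lambda>x\<in>Pi_X. \<Psi> x y)" using \<Psi>_y_multilinear by blast
    show "\<forall>x\<in>Pi_X. linear_functional Y (\<Psi> x)" using Y.dual_lf[OF \<Psi>_dual] by blast
    show "\<forall>x\<in>Pi_X. \<forall>y\<in>vcarrier Y. norm (\<Psi> x y) \<le> C * wX x * vnorm Y y"
    proof (intro ballI)
      fix x y assume x: "x \<in> Pi_X" and y: "y \<in> vcarrier Y"
      show "norm (\<Psi> x y) \<le> C * wX x * vnorm Y y"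
        using Y.dual_bound[OF \<Psi>_dual[OF x] y] mult_right_mono[OF C(2)[OF x] Y.norm_nonneg[OF y]] by linarith
    qed
    fix x y assume x: "x \<in> Pi_X" and y: "y \<in> vcarrier Y"
    have n: "\<forall>j<N. normalize x j \<in> unit_ball (X j)" using normalize(1)[OF x] by blast
    have "(\<lambda>j\<in>{..<N}. if j < N - N then undefined else normalize x j) = normalize x"
      by (simp add: normalize_def cong: restrict_cong)
    then show "?V (point x y) = \<Psi> (normalize x) (vscale Y (of_real (inverse (vnorm Y y))) y)"
      unfolding point_def fst_conv snd_conv
      using V_canonical[OF normalize(2)[OF x] n Y.scale_closed[OF y] order_refl ux] by simp
  qed
  finally show "(\<integral>p. (case p of (z, w) \<Rightarrow> arens N X Y \<Psi> z w) \<partial>M) = duality N X Y u \<Psi>" .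
qed

end

section \<open>Existence of the representing measure\<close>

lemma continuous_map_scalar_mult:
  fixes f g :: "'p \<Rightarrow> 'k::real_normed_field"
  assumes "continuous_map T euclidean f" "continuous_map T euclidean g"
  shows "continuous_map T euclidean (\<lambda>x. f x * g x)"
  using assms unfolding continuous_map_atin limitin_canonical_iff by (auto intro: tendsto_mult)

lemma continuous_map_scalar_prod:
  fixes f :: "'i \<Rightarrow> 'p \<Rightarrow> 'k::real_normed_field"
  assumes "\<And>i. i \<in> I \<Longrightarrow> continuous_map T euclidean (f i)"
  shows "continuous_map T euclidean (\<lambda>x. \<Prod>i\<in>I. f i x)"
  using assms
  by (induction I rule: infinite_finite_induct) (auto intro: continuous_map_scalar_mult)

theorem lemma3p2:
  fixes X :: "nat \<Rightarrow> ('k::real_or_complex, 'a) nspace"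
    and Y :: "('k, 'b) nspace"
    and N :: nat
  assumes "1 \<le> N"
    and "\<And>j. j < N \<Longrightarrow> banach_vspace (X j)"
    and "\<And>j. j < N \<Longrightarrow> separable_space (norm_topology (dual (X j)))"
    and "\<And>j. j < N \<Longrightarrow> approximation_property (dual (X j))"
    and "banach_vspace Y"
    and "u \<in> vcarrier (proj_tensor_pair (proj_tensor_family {..<N} X) Y)"
  shows "\<exists>\<mu>. regular_borel_measure (bidual_balls N X Y) \<mu> \<and>
    total_variation (bidual_balls N X Y) \<mu> (topspace (bidual_balls N X Y))
      \<le> ennreal (vnorm (proj_tensor_pair (proj_tensor_family {..<N} X) Y) u) \<and>
    (\<forall>\<Psi> \<in> continuous_multilinear_maps {..<N} X (dual Y).
       integrable (variation_measure (bidual_balls N X Y) \<mu>) (\<lambda>(x'', y''). arens N X Y \<Psi> x'' y'') \<and>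
       duality N X Y u \<Psi>
         = scalar_integral (bidual_balls N X Y) \<mu> (\<lambda>(x'', y''). arens N X Y \<Psi> x'' y''))"
proof -
  interpret tensor_spaces N X Y
    by (rule tensor_spaces.intro) (fact assms(1), erule banach_vspace.axioms(1)[OF assms(2)], rule banach_vspace.axioms(1)[OF assms(5)])
  \<comment> \<open>The excess \<open>1 / Suc n\<close> over the norm disappears along the sequence,
    so the limit measure has mass at most the norm itself.\<close>
  have "\<forall>n::nat. \<exists>xy. represents_tensor u (fst xy) (snd xy) \<and>
    (\<Sum>i. weight (fst xy i) (snd xy i)) < vnorm SY u + 1 / Suc n"
  proof
    fix n :: nat
    have "0 < 1 / real (Suc n)" by simp
    from tensor_series[OF assms(6) this] obtain x y where "\<forall>i. x i \<in> Pi_X \<and> y i \<in> vcarrier Y"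
      "summable (\<lambda>i. wX (x i) * vnorm Y (y i))" "(\<Sum>i. wX (x i) * vnorm Y (y i)) < vnorm SY u + 1 / Suc n"
      "\<forall>\<phi>\<in>vcarrier (dual SY). (\<lambda>i. \<phi> (tY (tX (x i)) (y i))) sums \<phi> u" by (elim exE conjE)
    then show "\<exists>xy. represents_tensor u (fst xy) (snd xy) \<and>
      (\<Sum>i. weight (fst xy i) (snd xy i)) < vnorm SY u + 1 / Suc n"
      by (intro exI[of _ "(x, y)"]) (simp add: represents_tensor_def weight_def)
  qed
  from choice[OF this] obtain xy where xy: "\<forall>n. represents_tensor u (fst (xy n)) (snd (xy n)) \<and>
    (\<Sum>i. weight (fst (xy n) i) (snd (xy n) i)) < vnorm SY u + 1 / Suc n" by (elim exE)
  define D where "D = (\<lambda>n. tensor_measure (fst (xy n)) (snd (xy n)))"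
  have r: "represents_tensor u (fst (xy n)) (snd (xy n))" for n using xy by blast
  have D_le: "measure (D n) (topspace balls) \<le> vnorm SY u + 1 / Suc n" for n
    unfolding D_def tensor_measure(3)[OF r] using xy less_imp_le by blast
  \<comment> \<open>The bound \<open>vnorm SY u + 1\<close> only serves compactness; the sharp one
    comes from \<open>measure_M_le\<close>.\<close>
  interpret ms: measure_sequence balls D "vnorm SY u + 1"
  proof (rule measure_sequence.intro[OF compact_balls Hausdorff_balls])
    show "sets (D n) = Pow (topspace balls)" for n unfolding D_def by (rule tensor_measure(1)[OF r])
    show "finite_measure (D n)" for n unfolding D_def by (rule tensor_measure(2)[OF r])
    fix n :: nat
    have "1 / real (Suc n) \<le> 1" by simp
    then show "measure (D n) (topspace balls) \<le> vnorm SY u + 1" using D_le[of n] by linarith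
  qed
  interpret rm: regular_measure balls ms.M by (rule ms.regular)
  let ?\<mu> = "rm.scalar_measure :: _ \<Rightarrow> 'k"
  have "measure ms.M (topspace balls) \<le> vnorm SY u"
  proof (rule ms.measure_M_le)
    fix e :: real assume "e > 0"
    then obtain k where k: "1 / Suc k < e" using nat_approx_posE by metis
    have "measure (D n) (topspace balls) \<le> vnorm SY u + e" if "n \<ge> k" for n
    proof -
      have "1 / Suc n \<le> 1 / Suc k" using that by (intro divide_left_mono) auto
      then show ?thesis using D_le[of n] k by linarith
    qed
    then show "\<exists>k. \<forall>n\<ge>k. measure (D n) (topspace balls) \<le> vnorm SY u + e" by blast
  qed
  then have tv: "total_variation balls ?\<mu> (topspace balls) \<le> ennreal (vnorm SY u)"
    unfolding rm.total_variation_scalar_measure[OF ms.borel_open[OF openin_topspace]]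
    by (simp add: finite_measure.emeasure_eq_measure[OF ms.finite_M] ennreal_leI)
  have bM: "ball_measure ms.M"
    unfolding ball_measure_def using ms.finite_M ms.space_M continuous_fst_eval continuous_snd_eval ms.continuous_measurable by blast
  \<comment> \<open>Any member of the sequence would do for the comparison, since all of them give
    finite-type forms the same integrals.\<close>
  have bD: "ball_measure (D 0)"
    unfolding ball_measure_def using ms.finite_D ms.space_D ms.measurable_D by blast
  have eq: "\<forall>\<phi> \<psi>. (\<forall>j\<in>{..<N}. \<phi> j \<in> vcarrier (dual (X j))) \<and> \<psi> \<in> vcarrier (dual Y) \<longrightarrow>
      (\<integral>p. (\<Prod>j<N. fst p j (\<phi> j)) * snd p \<psi> \<partial>ms.M) = (\<integral>p. (\<Prod>j<N. fst p j (\<phi> j)) * snd p \<psi> \<partial>D 0)"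
  proof (intro allI impI, elim conjE)
    fix \<phi> \<psi> assume \<phi>: "\<forall>j\<in>{..<N}. \<phi> j \<in> vcarrier (dual (X j))" and \<psi>: "\<psi> \<in> vcarrier (dual Y)"
    have c: "continuous_map balls euclidean (\<lambda>p. (\<Prod>j<N. fst p j (\<phi> j)) * snd p \<psi>)"
      by (intro continuous_map_scalar_mult continuous_map_scalar_prod continuous_fst_eval continuous_snd_eval \<psi>) (use \<phi> in auto)
    have d: "(\<integral>p. (\<Prod>j<N. fst p j (\<phi> j)) * snd p \<psi> \<partial>D n) = duality N X Y u (\<lambda>x y. (\<Prod>j<N. \<phi> j (x j)) * \<psi> y)" for n
      unfolding D_def by (rule tensor_measure_finite_type[OF r \<phi> \<psi>])
    show "(\<integral>p. (\<Prod>j<N. fst p j (\<phi> j)) * snd p \<psi> \<partial>ms.M) = (\<integral>p. (\<Prod>j<N. fst p j (\<phi> j)) * snd p \<psi> \<partial>D 0)"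
      unfolding d by (rule ms.scalar_integral_limit[OF c d])
  qed
  show ?thesis
  proof (intro exI[of _ ?\<mu>] conjI ballI)
    show "regular_borel_measure balls ?\<mu>" by (rule rm.regular_scalar_measure)
    show "total_variation balls ?\<mu> (topspace balls) \<le> ennreal (vnorm SY u)" by (rule tv)
    fix \<Psi> assume \<Psi>: "\<Psi> \<in> continuous_multilinear_maps {..<N} X (dual Y)"
    interpret tensor_map N X Y \<Psi>
      by (rule tensor_map.intro[OF tensor_spaces_axioms tensor_map_axioms.intro[OF \<Psi>]])
    have D0: "D 0 = tensor_measure (fst (xy 0)) (snd (xy 0))" by (simp add: D_def)
    note am = arens_measure[OF assms(3,4) bM r bD[unfolded D0] eq[unfolded D0]]
    show "integrable (variation_measure balls ?\<mu>) (\<lambda>(x'', y''). arens N X Y \<Psi> x'' y'')"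
      unfolding rm.variation_measure_scalar_measure by (rule am(1))
    show "duality N X Y u \<Psi> = scalar_integral balls ?\<mu> (\<lambda>(x'', y''). arens N X Y \<Psi> x'' y'')"
      by (rule trans[OF am(2)[symmetric] rm.scalar_integral_scalar_measure[OF borel_measurable_integrable[OF am(1)], symmetric]])
  qed
qed

end
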